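(* Let $n\in\mathbb{N}$, $d\in\mathbb{R}$, $R>0$, $\epsilon>0$, $r_0>0$, $\delta_0>0$, $r>0$, $\delta>0$, and let $p\in S^d(\mathbb{R}^n\times\mathbb{R}^n)$. Assume that $p|_{B(0,r_0)\times\mathbb{R}^n}$ extends holomorphically into $(B(0,r_0)+iB(0,\delta_0))\times W_\epsilon$, where $$W_\epsilon=\{\zeta\in\mathbb{C}^n : |\operatorname{Im}\zeta|<\epsilon|\operatorname{Re}\zeta|\}\cap\{\zeta\in\mathbb{C}^n : |\operatorname{Re}\zeta|>R\},$$ and satisfies $$\sup_{(x,\zeta)\in K\times W_\epsilon}\langle\operatorname{Re}\zeta\rangle^{-d}|p(x,\zeta)|<\infty\quad\text{for any } K\subset\subset B(0,r_0)+iB(0,\delta_0).$$ Let $u\in C_0^\infty(\mathbb{R}^n)$, and suppose that $u|_{B(0,r)}$ extends holomorphically into $B(0,r)+iB(0,\delta)$. Choose $r>r'>0$ and $\delta\ge\delta'>0$ so that $$\frac{\delta'}{r-r'}<\epsilon.$$ Then $\operatorname{Op}(p)u|_{B(0,\min\{r',r_0\})}$ extends holomorphically into $B(0,\min\{r',r_0\})+iB(0,\min\{\delta',\delta_0\})$.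
   Context: $B(x,r)$ is the open Euclidean ball in $\mathbb{R}^n$ with center $x$ and radius $r$. For sets $A,B\subset\mathbb{R}^n$, $A+iB=\{a+ib : a\in A,\ b\in B\}\subset\mathbb{C}^n$. $K\subset\subset\Omega$ means that $K$ is a relatively compact subset of $\Omega$. $\langle\xi\rangle=(1+|\xi|^2)^{1/2}$ for $\xi\in\mathbb{R}^n$. For $d\in\mathbb{R}$, $S^d(\mathbb{R}^n\times\mathbb{R}^n)$ is the set of $p\in C^\infty(\mathbb{R}^n\times\mathbb{R}^n)$ such that for all multi-indices $\alpha,\beta\in\mathbb{N}_0^n$, $\sup_{(x,\xi)\in\mathbb{R}^n\times\mathbb{R}^n}\langle\xi\rangle^{|\alpha|-d}|\partial_x^\beta\partial_\xi^\alpha p(x,\xi)|<\infty$. For $u\in C_0^\infty(\mathbb{R}^n)$ (smooth, compactly supported), $\operatorname{Op}(p)u(x)=(2\pi)^{-n}\int_{\mathbb{R}^n}e^{ix\cdot\xi}p(x,\xi)\mathcal{F}u(\xi)\,d\xi$, where $\mathcal{F}u(\xi)=\int_{\mathbb{R}^n}e^{-iy\cdot\xi}u(y)\,dy$ is the Fourier transform. Real and imaginary parts of vectors in $\mathbb{C}^n$ are taken componentwise, and $|\cdot|$ is the Euclidean norm.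
   Formalization: The extension of p is also required, for every real ξ (including |ξ| ≤ R), to be holomorphic in x on B(0,r_0)+iB(0,δ_0) and jointly continuous in (x,ξ); without this p = a(x)χ(ξ), a nowhere analytic, χ a bump supported in |ξ|<R, is a counterexample. *)

theory Defs
  imports "HOL-Analysis.Analysis"
begin

definition japanese_bracket :: "real ^ 'n \<Rightarrow> real" where
  "japanese_bracket \<xi> = sqrt (1 + (norm \<xi>)\<^sup>2)"

(* The directional derivative; only ever applied to differentiable functions. *)
definition dir_deriv :: "'a::real_normed_vector \<Rightarrow> ('a \<Rightarrow> complex) \<Rightarrow> 'a \<Rightarrow> complex" where
  "dir_deriv v f = (\<lambda>z. frechet_derivative f (at z) v)"

primrec C_k :: "nat \<Rightarrow> ('a::real_normed_vector \<Rightarrow> complex) \<Rightarrow> bool" where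
  "C_k 0 f \<longleftrightarrow> continuous_on UNIV f"
| "C_k (Suc k) f \<longleftrightarrow> (\<forall>z. f differentiable (at z)) \<and> (\<forall>v. C_k k (dir_deriv v f))"

definition smooth :: "('a::real_normed_vector \<Rightarrow> complex) \<Rightarrow> bool" where
  "smooth f \<longleftrightarrow> (\<forall>k. C_k k f)"

definition smooth_compact_support :: "('a::real_normed_vector \<Rightarrow> complex) \<Rightarrow> bool" where
  "smooth_compact_support u \<longleftrightarrow> smooth u \<and> compact (closure {x. u x \<noteq> 0})"

(* A finite index type carries no canonical order, so one enumeration of the coordinates is
   fixed; for smooth functions multi-index derivatives do not depend on it. *)
definition coordinates :: "'n::finite list" where
  "coordinates = (SOME is. distinct is \<and> set is = UNIV)"

(* Product over all i of the (\<alpha> i)-th powers of the derivative in direction e i. *)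
definition multi_deriv ::
  "('n::finite \<Rightarrow> 'a::real_normed_vector) \<Rightarrow> ('n \<Rightarrow> nat) \<Rightarrow> ('a \<Rightarrow> complex) \<Rightarrow> 'a \<Rightarrow> complex" where
  "multi_deriv e \<alpha> f = fold (\<lambda>i. dir_deriv (e i) ^^ \<alpha> i) coordinates f"

definition deriv_x ::
  "('n::finite \<Rightarrow> nat) \<Rightarrow> ((real ^ 'n) \<times> (real ^ 'n) \<Rightarrow> complex) \<Rightarrow>
     (real ^ 'n) \<times> (real ^ 'n) \<Rightarrow> complex" where
  "deriv_x \<beta> = multi_deriv (\<lambda>i. (axis i 1, 0)) \<beta>"

definition deriv_xi ::
  "('n::finite \<Rightarrow> nat) \<Rightarrow> ((real ^ 'n) \<times> (real ^ 'n) \<Rightarrow> complex) \<Rightarrow>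
     (real ^ 'n) \<times> (real ^ 'n) \<Rightarrow> complex" where
  "deriv_xi \<alpha> = multi_deriv (\<lambda>i. (0, axis i 1)) \<alpha>"

definition symbol_class :: "real \<Rightarrow> ((real ^ 'n::finite) \<times> (real ^ 'n) \<Rightarrow> complex) set" where
  "symbol_class d = {p. smooth p \<and>
     (\<forall>\<alpha> \<beta>. bdd_above (range (\<lambda>(x, \<xi>).
        japanese_bracket \<xi> powr (real (\<Sum>i\<in>UNIV. \<alpha> i) - d)
          * norm (deriv_x \<beta> (deriv_xi \<alpha> p) (x, \<xi>)))))}"

definition fourier :: "(real ^ 'n::finite \<Rightarrow> complex) \<Rightarrow> real ^ 'n \<Rightarrow> complex" where
  "fourier u \<xi> = (LINT y|lborel. exp (- \<i> * complex_of_real (y \<bullet> \<xi>)) * u y)"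

definition Op ::
  "((real ^ 'n::finite) \<times> (real ^ 'n) \<Rightarrow> complex) \<Rightarrow>
     (real ^ 'n \<Rightarrow> complex) \<Rightarrow> real ^ 'n \<Rightarrow> complex" where
  "Op p u x = complex_of_real (1 / (2 * pi) ^ CARD('n)) *
     (LINT \<xi>|lborel. exp (\<i> * complex_of_real (x \<bullet> \<xi>)) * p (x, \<xi>) * fourier u \<xi>)"

definition Re_vec :: "complex ^ 'n \<Rightarrow> real ^ 'n" where
  "Re_vec z = (\<chi> i. Re (z $ i))"

definition Im_vec :: "complex ^ 'n \<Rightarrow> real ^ 'n" where
  "Im_vec z = (\<chi> i. Im (z $ i))"

(* The vector a + i b. In particular cvec x 0 is the real vector x seen in complex n-space. *)
definition cvec :: "real ^ 'n \<Rightarrow> real ^ 'n \<Rightarrow> complex ^ 'n" where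
  "cvec a b = (\<chi> i. Complex (a $ i) (b $ i))"

definition tube :: "(real ^ 'n) set \<Rightarrow> (real ^ 'n) set \<Rightarrow> (complex ^ 'n) set" where
  "tube A B = {cvec a b | a b. a \<in> A \<and> b \<in> B}"

definition W :: "real \<Rightarrow> real \<Rightarrow> (complex ^ 'n::finite) set" where
  "W R \<epsilon> = {\<zeta>. norm (Im_vec \<zeta>) < \<epsilon> * norm (Re_vec \<zeta>)} \<inter> {\<zeta>. norm (Re_vec \<zeta>) > R}"

definition relatively_compact_in :: "'a::topological_space set \<Rightarrow> 'a set \<Rightarrow> bool" where
  "relatively_compact_in K \<Omega> \<longleftrightarrow> compact (closure K) \<and> closure K \<subseteq> \<Omega>"

(* Holomorphy in several variables: the derivative exists and is complex linear. Real linearity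
   is part of has_derivative. The complex scalar multiplication is a parameter because product
   types carry no instance of it. Meant for open U. *)
definition holomorphic_wrt ::
  "(complex \<Rightarrow> 'a \<Rightarrow> 'a) \<Rightarrow> ('a::real_normed_vector \<Rightarrow> complex) \<Rightarrow> 'a set \<Rightarrow> bool" where
  "holomorphic_wrt cscale f U \<longleftrightarrow>
     (\<forall>z\<in>U. \<exists>f'. (f has_derivative f') (at z) \<and> (\<forall>c v. f' (cscale c v) = c * f' v))"

definition holo :: "(complex ^ 'n::finite \<Rightarrow> complex) \<Rightarrow> (complex ^ 'n) set \<Rightarrow> bool" where
  "holo f U \<longleftrightarrow> holomorphic_wrt (\<lambda>c z. c *s z) f U"

definition holo2 ::
  "((complex ^ 'n::finite) \<times> (complex ^ 'n) \<Rightarrow> complex) \<Rightarrow>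
     ((complex ^ 'n) \<times> (complex ^ 'n)) set \<Rightarrow> bool" where
  "holo2 f U \<longleftrightarrow> holomorphic_wrt (\<lambda>c (z, \<zeta>). (c *s z, c *s \<zeta>)) f U"

definition extends_holomorphically ::
  "(real ^ 'n::finite \<Rightarrow> complex) \<Rightarrow> (real ^ 'n) set \<Rightarrow> (complex ^ 'n) set \<Rightarrow> bool" where
  "extends_holomorphically f A D \<longleftrightarrow> (\<exists>F. holo F D \<and> (\<forall>x\<in>A. F (cvec x 0) = f x))"

(* "P extends p restricted to A x R^n holomorphically into D x V". Here V need not contain all
   real frequencies (W R \<epsilon> omits those with norm at most R), but the restriction that is extended
   lives over all of them. So P extends p over every real frequency: it is jointly holomorphic
   on D x V, while over the real frequencies it is holomorphic in the space variable and jointly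
   continuous. Over real points of V the last two conditions follow from joint holomorphy. They cannot
   be dropped: for p (x, \<xi>) = a x * c \<xi> with a not real analytic and c a bump function supported
   in a ball of radius R, the zero function is a holomorphic extension over W R \<epsilon>, yet
   Op p u is a times an entire function. *)
definition extends_symbol_holomorphically ::
  "((complex ^ 'n::finite) \<times> (complex ^ 'n) \<Rightarrow> complex) \<Rightarrow>
     ((real ^ 'n) \<times> (real ^ 'n) \<Rightarrow> complex) \<Rightarrow> (real ^ 'n) set \<Rightarrow>
     (complex ^ 'n) set \<Rightarrow> (complex ^ 'n) set \<Rightarrow> bool" where
  "extends_symbol_holomorphically P p A D V \<longleftrightarrow>
     (\<forall>x\<in>A. \<forall>\<xi>. P (cvec x 0, cvec \<xi> 0) = p (x, \<xi>)) \<and>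
     holo2 P (D \<times> V) \<and>
     (\<forall>\<xi>. holo (\<lambda>z. P (z, cvec \<xi> 0)) D) \<and>
     continuous_on (D \<times> range (\<lambda>\<xi>. cvec \<xi> 0)) P"

end

theory Submission
  imports Defs "HOL-Complex_Analysis.Cauchy_Integral_Formula"
begin

text \<open>
  Write \<open>z = x + i\<eta>\<close>, choose \<open>\<kappa>\<close> with \<open>\<delta>' / (r - r') < \<kappa> < \<epsilon>\<close>, and let \<open>\<Gamma>\<close> be the cone of all \<open>w\<close> with
  \<open>|Im w| < \<kappa> |Re w|\<close>. Shifting the frequency to \<open>\<zeta> = \<xi> + i g(\<xi>) \<theta>\<close>, where \<open>g\<close> grows like \<open>\<kappa> |\<xi>|\<close> and vanishes
  at low frequencies and \<open>\<theta>\<close> points roughly in the direction of \<open>Re w\<close>, makes the kernel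
  \<open>k(z, w) = \<integral> exp(i w \<cdot> \<zeta>) P(z, \<zeta>) d\<zeta>\<close> absolutely convergent and holomorphic for \<open>w \<in> \<Gamma>\<close>; it does not
  depend on \<open>\<theta>\<close>. Formally \<open>Op(p)u(z) = \<integral> k(z, z - Y) u(Y) dY\<close>, and the integration over \<open>Y\<close> is moved to
  \<open>Y = y + i c(y) \<eta>\<close>, where \<open>c = 1\<close> on a ball slightly larger than \<open>B(0, r')\<close>, \<open>c = 0\<close> near the boundary of
  \<open>B(0, r)\<close>, and \<open>(1 - c(y)) |\<eta>| < \<kappa> |x - y|\<close> off the diagonal; this is where the hypothesis on
  \<open>\<delta>' / (r - r')\<close> enters.

  The singularity of \<open>k\<close> at \<open>w = 0\<close> is avoided by a cut-off \<open>a\<^sub>0(v)\<close>, polynomial in \<open>v \<cdot> v\<close> inside a small ball,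
  and three pieces are treated separately: \<open>near\<close> is \<open>\<integral> P(z, \<xi>) (\<integral> exp(i v \<cdot> \<xi>) a\<^sub>0(v) U(z - v) dv) d\<xi>\<close>, with an
  inner integral that decays rapidly; \<open>middle\<close> is \<open>\<integral> (1 - a\<^sub>0(v)) a(v) k(z, v) U(z - v) dv\<close> with a second
  cut-off \<open>a\<close>, where \<open>1 - a\<^sub>0\<close> vanishes to high order at the singularity; and \<open>far\<close> is the remaining
  integral over the contour \<open>Y\<close>. The first two are visibly holomorphic in \<open>z\<close>. For the third the
  antiholomorphic derivative of the integrand is a sum of two directional derivatives in \<open>y\<close>, so it integrates to zero;
  the same identity gives the independence of \<open>\<theta>\<close>. At real points the three pieces add up to
  \<open>Op(p)u\<close> by inserting a Gaussian in \<open>\<xi>\<close> and shifting the contour only slightly, so that the Gaussian stays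
  bounded even when \<open>\<epsilon> > 1\<close>.
\<close>

section \<open>Integrals depending on a parameter\<close>

text \<open>Neither factor of the integrand of \<open>Op\<close> can be continued alone: exp(i z .
  \<xi>) grows exponentially off the real points, while the transform of \<open>u\<close> decays
  only faster than every power, since \<open>u\<close> is analytic on a ball only. The missing decay
  must come from contours in the frequency and in the space variable, and each is forced to be real
  somewhere: at low frequencies \<open>P\<close> is holomorphic in \<open>z\<close> alone, and
  outside the ball of radius \<open>r\<close> only \<open>u\<close> at real points is available.
  Hence contours that are graphs over the real space with variable height. No contour is changed by
  differential forms. The height is varied along a parameter, and the derivative of the integral is
  the integral of a divergence, which vanishes by translation invariance of Lebesgue measure. The
  fields that occur contain first derivatives of the height, so the height must be twice
  differentiable; splines suffice and come with explicit slopes. Orders are matched as follows: with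
  J = N + n + 3, the kernel at real \<open>w\<close> is at most of size |w|^(-J) near 0, and 1 minus
  the inner cut-off vanishes there to order 2 J.\<close>

lemma integrable_inverse_power_norm:
  assumes "k \<ge> DIM('a) + 2"
  shows "integrable lborel (\<lambda>x::'a::euclidean_space. 1 / (1 + norm x) ^ k)"
proof -
  let ?D = "DIM('a)"
  let ?V = "unit_ball_vol (real ?D)"
  have "integrable lborel (\<lambda>x::'a. 1 / (1 + norm x) ^ (?D + 2))"
  proof (rule integrableI_bounded)
    \<comment> \<open>Layers: a point whose norm has integer part j lies in the ball of radius j +
      1, of volume a constant times (j + 1)^D. The exponent D + 2 then leaves the summable series of
      1 / (j + 1)^2.\<close>
    have pt: "ennreal (norm (1 / (1 + norm x) ^ (?D + 2))) \<le>
        (\<Sum>j. ennreal (1 / (1 + real j) ^ (?D + 2)) * indicator (ball 0 (real j + 1)) x)" for x :: 'a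
    proof -
      define j where "j = nat \<lfloor>norm x\<rfloor>"
      have j: "real j \<le> norm x" "norm x < real j + 1"
        unfolding j_def using norm_ge_zero[of x] by (simp_all add: of_nat_nat)
      define s where "s = (\<lambda>j. ennreal (1 / (1 + real j) ^ (?D + 2)) * indicator (ball 0 (real j +
          1)) x)"
      have "norm (1 / (1 + norm x) ^ (?D + 2)) \<le> 1 / (1 + real j) ^ (?D + 2)"
        using j by (auto intro!: frac_le power_mono simp del: power_Suc)
      then have "ennreal (norm (1 / (1 + norm x) ^ (?D + 2))) \<le> s j"
        using j by (simp add: s_def ennreal_leI del: power_Suc)
      also have "s j \<le> (\<Sum>j. s j)"
        using sum_le_suminf[of s "{j}"] by auto
      finally show ?thesis by (simp only: s_def)
    qed
    have "(\<integral>\<^sup>+ x. ennreal (norm (1 / (1 + norm (x::'a)) ^ (?D + 2))) \<partial>lborel) \<le>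
        (\<integral>\<^sup>+ x. (\<Sum>j. ennreal (1 / (1 + real j) ^ (?D + 2)) * indicator (ball 0 (real j
            + 1)) (x::'a)) \<partial>lborel)"
      by (intro nn_integral_mono pt)
    also have "\<dots> = (\<Sum>j. \<integral>\<^sup>+ x. ennreal (1 / (1 + real j) ^ (?D + 2)) * indicator
        (ball 0 (real j + 1)) (x::'a) \<partial>lborel)"
      by (intro nn_integral_suminf borel_measurable_times_ennreal borel_measurable_const
          borel_measurable_indicator) auto
    also have "\<dots> = (\<Sum>j. ennreal (?V / (real (Suc j)) ^ 2))"
    proof (rule suminf_cong)
      fix j :: nat
      have "(\<integral>\<^sup>+ x. ennreal (1 / (1 + real j) ^ (?D + 2)) * indicator (ball 0 (real j + 1))
          (x::'a) \<partial>lborel)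
        = ennreal (1 / (1 + real j) ^ (?D + 2)) * emeasure lborel (ball (0::'a) (real j + 1))"
        by (rule nn_integral_cmult_indicator) auto
      also have "\<dots> = ennreal (1 / (1 + real j) ^ (?D + 2) * (?V * (real j + 1) ^ ?D))"
        using emeasure_ball[of "real j + 1" "0::'a"]
          ennreal_mult'[of "1 / (1 + real j) ^ (?D + 2)" "?V * (real j + 1) ^ ?D"]
        by (simp del: power_Suc)
      also have "1 / (1 + real j) ^ (?D + 2) * (?V * (real j + 1) ^ ?D) = ?V / (real (Suc j)) ^ 2"
      proof -
        have "1 / (c * b) * (V * c) = V / b" if "c \<noteq> 0" for b c V :: real using that by simp
        from this[of "(1 + real j) ^ ?D" "(1 + real j) ^ 2" ?V] show ?thesis
          by (simp only: power_add of_nat_Suc add.commute[of "real j" 1]) simp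
      qed
      finally show "(\<integral>\<^sup>+ x. ennreal (1 / (1 + real j) ^ (?D + 2)) * indicator (ball 0 (real
          j + 1)) (x::'a) \<partial>lborel)
         = ennreal (?V / (real (Suc j)) ^ 2)" .
    qed
    also have "\<dots> < \<infinity>"
    proof -
      have "summable (\<lambda>j. ?V * inverse (real (Suc j) ^ 2))"
        using inverse_power_summable[of 2, where 'a=real] by (intro summable_mult, subst summable_Suc_iff)
            auto
      then have "summable (\<lambda>j. ?V / (real (Suc j)) ^ 2)" by (simp add: divide_inverse)
      then show ?thesis
        by (subst suminf_ennreal2) (auto intro!: divide_nonneg_nonneg)
    qed
    finally show "(\<integral>\<^sup>+ x. ennreal (norm (1 / (1 + norm (x::'a)) ^ (?D + 2)))
        \<partial>lborel) < \<infinity>" .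
  qed auto
  then show ?thesis
  proof (rule Bochner_Integration.integrable_bound)
    show "AE x in lborel. norm (1 / (1 + norm (x::'a)) ^ k) \<le> norm (1 / (1 + norm x) ^ (?D + 2))"
      using assms by (auto intro!: AE_I2 frac_le power_increasing zero_less_power add_pos_nonneg simp del:
          power_Suc)
  qed auto
qed

text \<open>By the mean value inequality \<open>h\<close> is a common Lipschitz constant of the
  integrands near \<open>z0\<close>, so dominated convergence with majorant \<open>2 * h\<close>
  applies to the remainder quotient. The derivative is measurable as a limit of difference
  quotients.\<close>

lemma has_derivative_integral:
  fixes f :: "'a::real_normed_vector \<Rightarrow> 'b \<Rightarrow> complex"
  assumes e: "e > 0"
    and int: "\<And>z. z \<in> ball z0 e \<Longrightarrow> integrable M (f z)"
    and der: "\<And>z y. z \<in> ball z0 e \<Longrightarrow> y \<in> space M \<Longrightarrow> ((\<lambda>z.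
        f z y) has_derivative f' z y) (at z)"
    and bd: "\<And>z y v. z \<in> ball z0 e \<Longrightarrow> y \<in> space M \<Longrightarrow> norm (f' z y
        v) \<le> h y * norm v"
    and h: "integrable M h"
  shows "integrable M (\<lambda>y. f' z0 y v)"
    and "((\<lambda>z. \<integral>y. f z y \<partial>M) has_derivative (\<lambda>v. \<integral>y. f' z0 y v
        \<partial>M)) (at z0)"
proof -
  have z0: "z0 \<in> ball z0 e" using e by simp
  have h0: "h y \<ge> 0" if "y \<in> space M" "(v::'a) \<noteq> 0" for y v
  proof -
    have "0 \<le> h y * norm v" using bd[OF z0 that(1), of v] norm_ge_zero order_trans by blast
    then show ?thesis using that(2) by (simp add: zero_le_mult_iff)
  qed
  have lip: "norm (f z y - f z0 y) \<le> h y * norm (z - z0)" if "z \<in> ball z0 e" "y \<in> space M" for z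
      y
  proof (cases "z = z0")
    case False
    have "norm (f z y - f z0 y) \<le> h y * norm (z - z0)"
    proof (rule differentiable_bound[where f'="\<lambda>z. f' z y" and S="ball z0 e"])
      fix x assume x: "x \<in> ball z0 e"
      show "((\<lambda>z. f z y) has_derivative f' x y) (at x within ball z0 e)"
        using der[OF x that(2)] has_derivative_at_withinI by blast
      show "onorm (f' x y) \<le> h y"
        using bd[OF x that(2)] h0[OF that(2), of "z - z0"] False by (intro onorm_bound) auto
    qed (use that z0 in auto)
    then show ?thesis .
  qed auto
  have meas: "(\<lambda>y. f' z0 y v) \<in> borel_measurable M" for v
  proof (rule borel_measurable_LIMSEQ_metric)
    \<comment> \<open>The divisor \<open>norm v + 1\<close> also covers \<open>v = 0\<close>, and a
      last divisor of at least 2 keeps the points \<open>z0 + t n *\<^sub>R v\<close> strictly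
      inside the ball.\<close>
    define t where "t n = e / (norm v + 1) / real (Suc (Suc n))" for n
    have nv: "norm v + 1 > 0" by (auto intro: add_nonneg_pos)
    have tpos: "t n > 0" for n unfolding t_def using e
      by (intro divide_pos_pos) (auto intro: add_nonneg_pos)
    have tin: "z0 + t n *\<^sub>R v \<in> ball z0 e" for n
    proof -
      have "norm (t n *\<^sub>R v) = t n * norm v" using tpos[of n] by simp
      also have "\<dots> = e * (norm v / (norm v + 1)) / real (Suc (Suc n))"
        by (simp add: t_def)
      also have "\<dots> \<le> e * 1 / real (Suc (Suc n))"
        using e by (intro divide_right_mono mult_left_mono) (auto simp: divide_le_eq nv)
      also have "\<dots> < e" using e by (simp add: divide_less_eq)
      finally show ?thesis by (simp add: dist_norm)
    qed
    have tne: "\<forall>n. t n \<in> UNIV - {0}" using tpos by (simp add: less_le)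
    have t0: "t \<longlonglongrightarrow> 0"
    proof -
      have "(\<lambda>n. e / (norm v + 1) / real (Suc n)) \<longlonglongrightarrow> 0"
        by (rule LIMSEQ_Suc[OF lim_const_over_n])
      then show ?thesis unfolding t_def by (rule LIMSEQ_Suc)
    qed
    show "(\<lambda>y. (f (z0 + t n *\<^sub>R v) y - f z0 y) /\<^sub>R t n) \<in> borel_measurable M" for n
      using int[OF tin[of n]] int[OF z0] by measurable
    fix y assume y: "y \<in> space M"
    have "((\<lambda>s. f (z0 + s *\<^sub>R v) y) has_vector_derivative f' z0 y v) (at 0)"
    proof -
      have "((\<lambda>s. z0 + s *\<^sub>R v) has_derivative (\<lambda>s. s *\<^sub>R v)) (at 0)"
        by (auto intro!: derivative_eq_intros)
      from has_derivative_compose[OF this, of "\<lambda>z. f z y" "f' z0 y"] der[OF z0 y]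
      have "((\<lambda>s. f (z0 + s *\<^sub>R v) y) has_derivative (\<lambda>s. f' z0 y (s *\<^sub>R v)))
          (at 0)" by simp
      then show ?thesis unfolding has_vector_derivative_def
        using linear_simps(5)[OF has_derivative_bounded_linear[OF der[OF z0 y]]] by simp
    qed
    then have lim: "((\<lambda>s. norm (f (z0 + s *\<^sub>R v) y - f z0 y - s *\<^sub>R f' z0 y v) / norm s)
        \<longlongrightarrow> 0) (at 0)"
      by (simp add: has_vector_derivative_def has_derivative_iff_norm)
    have "((\<lambda>s. norm ((f (z0 + s *\<^sub>R v) y - f z0 y) /\<^sub>R s - f' z0 y v))
        \<longlongrightarrow> 0) (at (0::real))"
    proof (rule Lim_transform_eventually[OF lim])
      show "\<forall>\<^sub>F s in at 0. norm (f (z0 + s *\<^sub>R v) y - f z0 y - s *\<^sub>R f' z0 y v) /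
          norm s =
          norm ((f (z0 + s *\<^sub>R v) y - f z0 y) /\<^sub>R s - f' z0 y v)"
        unfolding eventually_at_filter
      proof (intro always_eventually allI impI)
        fix s :: real assume "s \<noteq> 0"
        then have "(f (z0 + s *\<^sub>R v) y - f z0 y) /\<^sub>R s - f' z0 y v =
            (f (z0 + s *\<^sub>R v) y - f z0 y - s *\<^sub>R f' z0 y v) /\<^sub>R s"
          by (simp add: scaleR_diff_right)
        then show "norm (f (z0 + s *\<^sub>R v) y - f z0 y - s *\<^sub>R f' z0 y v) / norm s =
            norm ((f (z0 + s *\<^sub>R v) y - f z0 y) /\<^sub>R s - f' z0 y v)"
          by (simp only: norm_scaleR abs_inverse real_norm_def divide_inverse mult.commute[of
              "inverse \<bar>s\<bar>"])
      qed
    qed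
    from LIM_zero_cancel[OF tendsto_norm_zero_cancel[OF this]]
    have "((\<lambda>s. (f (z0 + s *\<^sub>R v) y - f z0 y) /\<^sub>R s) \<longlongrightarrow> f' z0 y v)
        (at (0::real) within UNIV)" .
    from iffD1[OF tendsto_at_iff_sequentially this, THEN spec, THEN mp, OF tne, THEN mp, OF t0]
    show "(\<lambda>n. (f (z0 + t n *\<^sub>R v) y - f z0 y) /\<^sub>R t n) \<longlonglongrightarrow> f' z0
        y v"
      by (simp only: comp_def)
  qed
  have intd: "integrable M (\<lambda>y. f' z0 y v)" for v
  proof (rule Bochner_Integration.integrable_bound[OF integrable_mult_left[OF h, of "norm v"] meas])
    show "AE y in M. norm (f' z0 y v) \<le> norm (h y * norm v)"
      using bd[OF z0] by (intro AE_I2) (auto intro: order_trans[OF _ abs_ge_self])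
  qed
  then show "integrable M (\<lambda>y. f' z0 y v)" .
  show "((\<lambda>z. \<integral>y. f z y \<partial>M) has_derivative (\<lambda>v. \<integral>y. f' z0 y v
      \<partial>M)) (at z0)"
    unfolding has_derivative_iff_norm
  proof (intro conjI)
    show "bounded_linear (\<lambda>v. \<integral>y. f' z0 y v \<partial>M)"
    proof (rule bounded_linear_intro[where K="\<integral>y. h y \<partial>M"])
      fix v w :: 'a and s :: real
      have "(\<integral>y. f' z0 y (v + w) \<partial>M) = (\<integral>y. f' z0 y v + f' z0 y w \<partial>M)"
        by (intro Bochner_Integration.integral_cong refl)
          (use linear_simps(1)[OF has_derivative_bounded_linear[OF der[OF z0]]] in auto)
      then show "(\<integral>y. f' z0 y (v + w) \<partial>M) = (\<integral>y. f' z0 y v \<partial>M) +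
          (\<integral>y. f' z0 y w \<partial>M)"
        using intd by simp
      have "(\<integral>y. f' z0 y (s *\<^sub>R v) \<partial>M) = (\<integral>y. s *\<^sub>R f' z0 y v
          \<partial>M)"
        by (intro Bochner_Integration.integral_cong refl)
          (use linear_simps(5)[OF has_derivative_bounded_linear[OF der[OF z0]]] in auto)
      then show "(\<integral>y. f' z0 y (s *\<^sub>R v) \<partial>M) = s *\<^sub>R (\<integral>y. f' z0 y v
          \<partial>M)" by simp
      have "norm (\<integral>y. f' z0 y v \<partial>M) \<le> (\<integral>y. h y * norm v \<partial>M)"
        using bd[OF z0] h intd by (intro order_trans[OF integral_norm_bound integral_mono]) auto
      then show "norm (\<integral>y. f' z0 y v \<partial>M) \<le> norm v * (\<integral>y. h y \<partial>M)"
        by (simp add: mult.commute)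
    qed
    show "((\<lambda>z. norm ((\<integral>y. f z y \<partial>M) - (\<integral>y. f z0 y \<partial>M) -
        (\<integral>y. f' z0 y (z - z0) \<partial>M)) / norm (z - z0)) \<longlongrightarrow> 0) (at z0)"
      unfolding tendsto_at_iff_sequentially
    proof (intro allI impI, unfold comp_def)
      fix X assume X: "\<forall>i. X i \<in> UNIV - {z0}" and lim: "X \<longlonglongrightarrow> z0"
      define q where "q i y = norm (f (X i) y - f z0 y - f' z0 y (X i - z0)) / norm (X i - z0)" for i y
      have "\<forall>\<^sub>F i in sequentially. X i \<in> ball z0 e"
        using lim z0 by (intro topological_tendstoD) auto
      then obtain N where N: "\<And>i. i \<ge> N \<Longrightarrow> X i \<in> ball z0 e" by (auto simp:
          eventually_sequentially)
      have "(\<lambda>i. \<integral>y. q (i + N) y \<partial>M) \<longlonglongrightarrow> (\<integral>y. 0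
          \<partial>M)"
      proof (rule integral_dominated_convergence[where w="\<lambda>y. 2 * h y"])
        show "(\<lambda>y. q (i + N) y) \<in> borel_measurable M" for i
          unfolding q_def using int[OF N[of "i + N"]] int[OF z0] meas by measurable
        show "integrable M (\<lambda>y. 2 * h y)" using h by simp
        show "AE y in M. (\<lambda>i. q (i + N) y) \<longlonglongrightarrow> 0"
        proof (rule AE_I2)
          fix y assume y: "y \<in> space M"
          have "((\<lambda>z. norm (f z y - f z0 y - f' z0 y (z - z0)) / norm (z - z0))
              \<longlongrightarrow> 0) (at z0)"
            using der[OF z0 y] by (simp add: has_derivative_iff_norm)
          then have "(\<lambda>i. q i y) \<longlonglongrightarrow> 0"
            unfolding tendsto_at_iff_sequentially comp_def q_def using X lim by blast
          then show "(\<lambda>i. q (i + N) y) \<longlonglongrightarrow> 0" by (rule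
              LIMSEQ_ignore_initial_segment)
        qed
        show "AE y in M. norm (q (i + N) y) \<le> 2 * h y" for i
        proof (rule AE_I2)
          fix y assume y: "y \<in> space M"
          have "norm (f (X (i + N)) y - f z0 y - f' z0 y (X (i + N) - z0)) \<le>
              norm (f (X (i + N)) y - f z0 y) + norm (f' z0 y (X (i + N) - z0))"
            by (rule norm_triangle_ineq4)
          also have "\<dots> \<le> h y * norm (X (i + N) - z0) + h y * norm (X (i + N) - z0)"
            using lip[OF N[of "i + N"] y] bd[OF z0 y] by (intro add_mono) auto
          finally show "norm (q (i + N) y) \<le> 2 * h y"
            using X unfolding q_def by (simp add: divide_le_eq)
        qed
      qed auto
      then have q0: "(\<lambda>i. \<integral>y. q (i + N) y \<partial>M) \<longlonglongrightarrow> 0" by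
          simp
      have "(\<lambda>i. norm ((\<integral>y. f (X (i + N)) y \<partial>M) - (\<integral>y. f z0 y
          \<partial>M) - (\<integral>y. f' z0 y (X (i + N) - z0) \<partial>M))
          / norm (X (i + N) - z0)) \<longlonglongrightarrow> 0"
      proof (rule tendsto_sandwich[OF _ _ tendsto_const q0])
        show "\<forall>\<^sub>F i in sequentially. norm ((\<integral>y. f (X (i + N)) y \<partial>M) -
            (\<integral>y. f z0 y \<partial>M) - (\<integral>y. f' z0 y (X (i + N) - z0) \<partial>M))
          / norm (X (i + N) - z0) \<le> (\<integral>y. q (i + N) y \<partial>M)"
        proof (rule always_eventually, rule allI)
          fix i
          let ?z = "X (i + N)"
          have "(\<integral>y. f ?z y \<partial>M) - (\<integral>y. f z0 y \<partial>M) - (\<integral>y. f'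
              z0 y (?z - z0) \<partial>M)
            = (\<integral>y. f ?z y - f z0 y - f' z0 y (?z - z0) \<partial>M)"
            using int[OF N[of "i + N"]] int[OF z0] intd by simp
          also have "norm \<dots> \<le> (\<integral>y. norm (f ?z y - f z0 y - f' z0 y (?z - z0))
              \<partial>M)"
            by (rule integral_norm_bound)
          finally show "norm ((\<integral>y. f ?z y \<partial>M) - (\<integral>y. f z0 y \<partial>M) -
              (\<integral>y. f' z0 y (?z - z0) \<partial>M))
            / norm (?z - z0) \<le> (\<integral>y. q (i + N) y \<partial>M)"
            unfolding q_def by (simp add: divide_right_mono)
        qed
      qed auto
      then show "(\<lambda>i. norm ((\<integral>y. f (X i) y \<partial>M) - (\<integral>y. f z0 y
          \<partial>M) - (\<integral>y. f' z0 y (X i - z0) \<partial>M)) / norm (X i - z0))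
          \<longlonglongrightarrow> 0"
        by (rule LIMSEQ_offset)
    qed
  qed
qed

lemma weight_shift:
  fixes y :: "'a::real_normed_vector"
  assumes "norm v \<le> 1"
  shows "1 / (1 + norm (y + v)) ^ k \<le> 2 ^ k * (1 / (1 + norm y) ^ k)"
proof -
  have "norm y \<le> norm (y + v) + norm v" using norm_triangle_ineq4[of "y + v" v] by simp
  then have "1 + norm y \<le> 2 * (1 + norm (y + v))" using assms norm_ge_zero[of "y + v"]
    by (smt (verit))
  then have "(1 + norm y) ^ k \<le> (2 * (1 + norm (y + v))) ^ k" by (intro power_mono) auto
  then have "(1 + norm y) ^ k \<le> 2 ^ k * (1 + norm (y + v)) ^ k" by (simp only: power_mult_distrib)
  moreover have "(1 + norm y) ^ k > 0" "(1 + norm (y + v)) ^ k > 0"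
    by (auto intro!: zero_less_power add_pos_nonneg)
  ultimately show ?thesis by (simp add: field_simps)
qed

text \<open>The integral of X(y + s v) does not depend on \<open>s\<close>, by translation
  invariance; its derivative at \<open>s = 0\<close> is the integral in question. This is the form
  of Stokes' theorem behind every change of contour, and also the integration by parts behind the
  decay of Fourier transforms.\<close>

lemma integral_directional_derivative:
  fixes X :: "'a::euclidean_space \<Rightarrow> complex"
  assumes der: "\<And>y. (X has_derivative X' y) (at y)"
    and bd: "\<And>y. norm (X y) \<le> C / (1 + norm y) ^ (DIM('a) + 2)"
    and bd': "\<And>y. norm (X' y v) \<le> C / (1 + norm y) ^ (DIM('a) + 2)"
  shows "integrable lborel (\<lambda>y. X' y v)" and "(\<integral>y. X' y v \<partial>lborel) = 0"
proof -
  let ?k = "DIM('a) + 2"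
  have cont: "continuous_on UNIV X"
    by (intro continuous_at_imp_continuous_on ballI has_derivative_continuous[OF der])
  have w: "integrable lborel (\<lambda>y::'a. C * (1 / (1 + norm y) ^ ?k))"
    using integrable_inverse_power_norm[of ?k, where 'a='a] by (intro integrable_mult_right) auto
  have X: "integrable lborel X"
  proof (rule Bochner_Integration.integrable_bound[OF w])
    show "X \<in> borel_measurable lborel" using borel_measurable_continuous_onI[OF cont] by simp
    show "AE y in lborel. norm (X y) \<le> norm (C * (1 / (1 + norm y) ^ ?k))"
    proof (rule AE_I2)
      fix y
      have "norm (X y) \<le> C * (1 / (1 + norm y) ^ ?k)" using bd[of y] by simp
      then show "norm (X y) \<le> norm (C * (1 / (1 + norm y) ^ ?k))"
        unfolding real_norm_def by (rule order_trans[OF _ abs_ge_self])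
    qed
  qed
  \<comment> \<open>Chosen so that all translations by \<open>s *\<^sub>R v\<close> have length at
    most 1, as \<open>weight_shift\<close> requires.\<close>
  define e where "e = 1 / (1 + norm v)"
  have e: "e > 0" unfolding e_def by (auto intro: add_pos_nonneg)

  have small: "norm (s *\<^sub>R v) \<le> 1" if "s \<in> ball 0 e" for s
  proof -
    have "norm (s *\<^sub>R v) \<le> e * norm v" using that by (auto intro!: mult_right_mono)
    also have "\<dots> \<le> 1" unfolding e_def by (simp add: divide_le_eq add_pos_nonneg)
    finally show ?thesis .
  qed
  let ?f = "\<lambda>(s::real) y. X (y + s *\<^sub>R v)" let ?f' =
      "\<lambda>s y r. X' (y + s *\<^sub>R v) (r *\<^sub>R v)"
  let ?h = "\<lambda>y::'a. 2 ^ ?k * (C * (1 / (1 + norm y) ^ ?k))"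
  have w': "integrable lborel ?h" by (rule integrable_mult_right[OF w])
  have C: "C \<ge> 0" using order_trans[OF norm_ge_zero bd[of 0]] by simp
  note linX = linear_simps[OF has_derivative_bounded_linear[OF der]]
  have transl: "(\<integral>y. X (y + s *\<^sub>R v) \<partial>lborel) = (\<integral>y. X y
      \<partial>lborel)" 
    "integrable lborel (\<lambda>y. X (y + s *\<^sub>R v))" for s
  proof -
    have "(\<integral>y. X y \<partial>lborel) = (\<integral>y. X y \<partial>(distr lborel borel ((+) (s
        *\<^sub>R v))))"
      by (subst lborel_distr_plus) simp
    also have "\<dots> = (\<integral>y. X (s *\<^sub>R v + y) \<partial>lborel)"
      using X by (intro integral_distr) auto
    finally show "(\<integral>y. X (y + s *\<^sub>R v) \<partial>lborel) = (\<integral>y. X y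
        \<partial>lborel)" by (simp add: add.commute)
    have "integrable (distr lborel borel ((+) (s *\<^sub>R v))) X"
      by (subst lborel_distr_plus) (rule X)
    then show "integrable lborel (\<lambda>y. X (y + s *\<^sub>R v))"
      using X by (subst (asm) integrable_distr_eq) (auto simp: add.commute)
  qed
  have d: "((\<lambda>s. ?f s y) has_derivative ?f' s y) (at s)" for s y
    by (rule has_derivative_compose[where f="\<lambda>s. y + s *\<^sub>R v"]) (auto intro!:
        derivative_eq_intros der)
  have b: "norm (?f' s y r) \<le> ?h y * norm r" if "s \<in> ball 0 e" for s y r
  proof -
    have "norm (?f' s y r) = norm r * norm (X' (y + s *\<^sub>R v) v)" by (simp add: linX)
    also have "\<dots> \<le> norm r * (C * (1 / (1 + norm (y + s *\<^sub>R v)) ^ ?k))"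
      using bd' by (intro mult_left_mono) (auto simp del: power_Suc)
    also have "\<dots> \<le> norm r * (C * (2 ^ ?k * (1 / (1 + norm y) ^ ?k)))"
      using C weight_shift[OF small[OF that], where k="?k"] by (intro mult_left_mono) (auto simp del:
          power_Suc)
    finally show ?thesis by (simp add: mult_ac)
  qed
  note I = has_derivative_integral[of e 0 lborel ?f ?f' ?h]
  have "integrable lborel (\<lambda>y. ?f' 0 y 1)"
    by (rule I(1)[OF e transl(2) d b w'])
  then show "integrable lborel (\<lambda>y. X' y v)" by simp
  have "((\<lambda>s. \<integral>y. ?f s y \<partial>lborel) has_derivative (\<lambda>r. \<integral>y. ?f' 0
      y r \<partial>lborel)) (at 0)"
    by (rule I(2)[OF e transl(2) d b w'])
  then have "((\<lambda>s::real. \<integral>y. X y \<partial>lborel) has_derivative (\<lambda>r.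
      \<integral>y. ?f' 0 y r \<partial>lborel)) (at 0)"
    by (simp only: transl)
  moreover have "((\<lambda>s::real. \<integral>y. X y \<partial>lborel) has_derivative (\<lambda>r. 0)) (at
      0)" by simp
  ultimately have "(\<lambda>r. \<integral>y. ?f' 0 y r \<partial>lborel) = (\<lambda>r. 0)" by (rule
      has_derivative_unique)
  then have "(\<integral>y. ?f' 0 y 1 \<partial>lborel) = 0" by (rule fun_cong)
  then show "(\<integral>y. X' y v \<partial>lborel) = 0" by simp
qed

section \<open>Holomorphic functions of several variables\<close>

text \<open>Just what is needed to restrict a function to the complex line
  \<open>z0 + cs t v\<close> and to apply one-variable theory there. The abstraction treats complex
  n-space and its square alike.\<close>

definition complex_scaling :: "(complex \<Rightarrow> 'a::real_normed_vector \<Rightarrow> 'a) \<Rightarrow>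
    bool" where
  "complex_scaling cs \<longleftrightarrow>
     (\<forall>v. cs 1 v = v) \<and> (\<forall>v. bounded_linear (\<lambda>c. cs c v)) \<and> (\<forall>c v.
         norm (cs c v) = norm c * norm v)"

lemma norm_vector_smult: "norm (c *s z) = norm c * norm (z :: complex ^ 'n::finite)"
  by (simp add: norm_vec_def L2_set_def norm_mult power_mult_distrib flip: sum_distrib_left)
    (simp add: real_sqrt_mult)

lemma complex_scaling_vec: "complex_scaling (\<lambda>c (z :: complex ^ 'n::finite). c *s z)"
  unfolding complex_scaling_def
proof (intro conjI allI)
  fix v :: "complex ^ 'n"
  show "bounded_linear (\<lambda>c. c *s v)"
  proof (rule bounded_linear_intro[where K="norm v"])
    show "norm (c *s v) \<le> norm c * norm v" for c by (simp add: norm_vector_smult)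
  qed (auto simp: vec_eq_iff algebra_simps)
qed (auto simp: norm_vector_smult)

lemma complex_scaling_prod:
  "complex_scaling (\<lambda>c (z :: complex ^ 'n::finite, w :: complex ^ 'm::finite). (c *s z, c *s w))"
  unfolding complex_scaling_def
proof (intro conjI allI)
  fix v :: "(complex ^ 'n) \<times> (complex ^ 'm)"
  have 1: "bounded_linear (\<lambda>c. c *s fst v)" "bounded_linear (\<lambda>c. c *s snd v)"
    using complex_scaling_vec unfolding complex_scaling_def by auto
  show "bounded_linear (\<lambda>c. case v of (z, w) \<Rightarrow> (c *s z, c *s w))"
    using bounded_linear_Pair[OF 1] by (simp add: case_prod_unfold)
  fix c :: complex
  show "norm (case v of (z, w) \<Rightarrow> (c *s z, c *s w)) = norm c * norm v"
    by (simp add: case_prod_unfold norm_prod_def norm_vector_smult power_mult_distrib real_sqrt_mult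
        flip: distrib_left)
qed auto

lemma holomorphic_wrtD:
  assumes "holomorphic_wrt cs f S" "z \<in> S"
  shows "(f has_derivative frechet_derivative f (at z)) (at z)"
    and "frechet_derivative f (at z) (cs c v) = c * frechet_derivative f (at z) v"
proof -
  obtain f' where f': "(f has_derivative f') (at z)" "\<And>c v. f' (cs c v) = c * f' v"
    using assms unfolding holomorphic_wrt_def by blast
  then have "frechet_derivative f (at z) = f'" using frechet_derivative_at by metis
  with f' show "(f has_derivative frechet_derivative f (at z)) (at z)"
    "frechet_derivative f (at z) (cs c v) = c * frechet_derivative f (at z) v" by auto
qed

lemma holomorphic_wrtI:
  assumes "\<And>z. z \<in> S \<Longrightarrow> (f has_derivative f' z) (at z)"
    "\<And>z c v. z \<in> S \<Longrightarrow> f' z (cs c v) = c * f' z v"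
  shows "holomorphic_wrt cs f S"
  using assms unfolding holomorphic_wrt_def by blast

lemma holomorphic_wrt_subset: "holomorphic_wrt cs f S \<Longrightarrow> T \<subseteq> S \<Longrightarrow>
    holomorphic_wrt cs f T"
  unfolding holomorphic_wrt_def by blast

lemma holomorphic_wrt_continuous_on: "holomorphic_wrt cs f S \<Longrightarrow> continuous_on S f"
  by (intro continuous_at_imp_continuous_on ballI has_derivative_continuous[OF holomorphic_wrtD(1)])

lemma holomorphic_wrt_cong:
  assumes "open S" "\<And>z. z \<in> S \<Longrightarrow> f z = g z" "holomorphic_wrt cs f S"
  shows "holomorphic_wrt cs g S"
proof (rule holomorphic_wrtI)
  fix z assume z: "z \<in> S"
  show "(g has_derivative frechet_derivative f (at z)) (at z)"
    by (rule has_derivative_transform_within_open[OF holomorphic_wrtD(1)[OF assms(3) z] assms(1) z])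
      (use assms(2) in auto)
qed (rule holomorphic_wrtD(2)[OF assms(3)])

lemma holomorphic_wrt_mult:
  assumes "holomorphic_wrt cs f S" "holomorphic_wrt cs g S"
  shows "holomorphic_wrt cs (\<lambda>z. f z * g z) S"
proof (rule holomorphic_wrtI)
  fix z assume z: "z \<in> S"
  show "((\<lambda>z. f z * g z) has_derivative
      (\<lambda>v. f z * frechet_derivative g (at z) v + frechet_derivative f (at z) v * g z)) (at z)"
    by (intro has_derivative_mult holomorphic_wrtD(1)[OF assms(1) z] holomorphic_wrtD(1)[OF assms(2) z])
qed (simp add: holomorphic_wrtD(2)[OF assms(1)] holomorphic_wrtD(2)[OF assms(2)] algebra_simps)

lemma holomorphic_wrt_add:
  assumes "holomorphic_wrt cs f S" "holomorphic_wrt cs g S"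
  shows "holomorphic_wrt cs (\<lambda>z. f z + g z) S"
proof (rule holomorphic_wrtI)
  fix z assume z: "z \<in> S"
  show "((\<lambda>z. f z + g z) has_derivative
      (\<lambda>v. frechet_derivative f (at z) v + frechet_derivative g (at z) v)) (at z)"
    by (intro has_derivative_add holomorphic_wrtD(1)[OF assms(1) z] holomorphic_wrtD(1)[OF assms(2) z])
qed (simp add: holomorphic_wrtD(2)[OF assms(1)] holomorphic_wrtD(2)[OF assms(2)] algebra_simps)

lemma holomorphic_wrt_const: "holomorphic_wrt cs (\<lambda>z. c) S"
  by (rule holomorphic_wrtI[where f'="\<lambda>_ _. 0"]) auto

lemma holomorphic_wrt_compose_field:
  assumes "holomorphic_wrt cs f S" "\<And>z. z \<in> S \<Longrightarrow> (g has_field_derivative g' (f z))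
      (at (f z))"
  shows "holomorphic_wrt cs (\<lambda>z. g (f z)) S"
proof (rule holomorphic_wrtI)
  fix z assume z: "z \<in> S"
  show "((\<lambda>z. g (f z)) has_derivative (\<lambda>v. g' (f z) * frechet_derivative f (at z) v)) (at
      z)"
    using has_derivative_compose[OF holomorphic_wrtD(1)[OF assms(1) z], of g "(*) (g' (f z))"] assms(2)[OF
        z]
    by (simp add: has_field_derivative_def)
qed (simp add: holomorphic_wrtD(2)[OF assms(1)])

lemma holomorphic_wrt_affine:
  assumes hol: "holomorphic_wrt cs f S"
    and der: "\<And>z. z \<in> T \<Longrightarrow> (g has_derivative g') (at z)" and lin:
        "\<And>c v. g' (cs' c v) = cs c (g' v)"
    and im: "\<And>z. z \<in> T \<Longrightarrow> g z \<in> S"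
  shows "holomorphic_wrt cs' (\<lambda>z. f (g z)) T"
proof (rule holomorphic_wrtI)
  fix z assume z: "z \<in> T"
  show "((\<lambda>z. f (g z)) has_derivative (\<lambda>v. frechet_derivative f (at (g z)) (g' v))) (at z)"
    by (rule has_derivative_compose[OF der[OF z] holomorphic_wrtD(1)[OF hol im[OF z]]])
qed (simp add: lin holomorphic_wrtD(2)[OF hol im])

text \<open>Cauchy's inequality for the one-variable function obtained by restriction to the complex
  line through \<open>z0\<close> in direction \<open>v\<close>.\<close>

lemma holomorphic_wrt_derivative_bound:
  assumes cs: "complex_scaling cs" and r: "r > 0"
    and hol: "holomorphic_wrt cs f (ball z0 r)"
    and bd: "\<And>z. z \<in> ball z0 r \<Longrightarrow> norm (f z) \<le> B"
    and der: "(f has_derivative f') (at z0)"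
  shows "norm (f' v) \<le> 2 * B / r * norm v"
proof (cases "v = 0")
  case True
  then show ?thesis using linear_simps(3)[OF has_derivative_bounded_linear[OF der]] by simp
next
  case False
  \<comment> \<open>Half of the radius at which the line leaves the ball, so that the closed disc is
    mapped inside it; this is the origin of the factor 2 in the bound.\<close>
  define s where "s = r / (2 * norm v)"
  have s: "s > 0" using r False by (simp add: s_def)
  define F where "F = (\<lambda>t. f (z0 + cs t v))"
  have bl: "bounded_linear (\<lambda>c. cs c v)" and nm: "\<And>c. norm (cs c v) = norm c * norm v" and one:
      "cs 1 v = v"
    using cs by (auto simp: complex_scaling_def)
  have inb: "z0 + cs t v \<in> ball z0 r" if "t \<in> cball 0 s" for t
  proof -
    have "norm t * norm v \<le> s * norm v" using that by (intro mult_right_mono) auto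
    also have "\<dots> < r" using r False by (simp add: s_def)
    finally show ?thesis by (simp add: dist_norm nm)
  qed
  have dF: "(F has_field_derivative frechet_derivative f (at (z0 + cs t v)) v) (at t)" if
      "t \<in> cball 0 s" for t
  proof -
    have "((\<lambda>t. z0 + cs t v) has_derivative (\<lambda>t. cs t v)) (at t)"
      by (auto intro!: derivative_eq_intros bounded_linear_imp_has_derivative bl)
    from has_derivative_compose[OF this holomorphic_wrtD(1)[OF hol inb[OF that]]]
    have "(F has_derivative (\<lambda>c. c * frechet_derivative f (at (z0 + cs t v)) v)) (at t)"
      by (simp add: F_def holomorphic_wrtD(2)[OF hol inb[OF that]])
    moreover have "(\<lambda>c. c * D) = (*) D" for D :: complex by (rule ext) (rule mult.commute)
    ultimately show ?thesis by (simp only: has_field_derivative_def)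
  qed
  have "cs 0 v = 0" using linear_simps(3)[OF bl] .
  have "norm ((deriv ^^ 1) F 0) \<le> fact 1 * B / s ^ 1"
  proof (rule Cauchy_inequality)
    show "F holomorphic_on ball 0 s"
      unfolding holomorphic_on_def field_differentiable_def
    proof
      fix t assume "t \<in> ball (0::complex) s"
      then have "t \<in> cball 0 s" by auto
      from has_field_derivative_at_within[OF dF[OF this]]
      show "\<exists>D. (F has_field_derivative D) (at t within ball 0 s)" by blast
    qed
    show "continuous_on (cball 0 s) F"
      by (intro continuous_at_imp_continuous_on ballI DERIV_isCont[OF dF])
    show "norm (F x) \<le> B" if "norm (0 - x) = s" for x
      unfolding F_def using that by (intro bd inb) auto
  qed (use s in auto)
  moreover have "deriv F 0 = f' v"
  proof -
    have "deriv F 0 = frechet_derivative f (at (z0 + cs 0 v)) v" using dF[of 0] s by (intro DERIV_imp_deriv)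
        auto
    also have "\<dots> = f' v" using \<open>cs 0 v = 0\<close> frechet_derivative_at[OF der] by simp
    finally show ?thesis .
  qed
  ultimately have "norm (f' v) \<le> B / s" by simp
  also have "B / s = 2 * B / r * norm v" by (simp add: s_def)
  finally show ?thesis .
qed

text \<open>Cauchy's inequality on balls of half the radius turns the local majorant of the
  integrand into a majorant of its derivative, so that differentiation under the integral applies.
  Complex linearity passes through the integral.\<close>

lemma holomorphic_wrt_integral:
  fixes f :: "'a::real_normed_vector \<Rightarrow> 'b \<Rightarrow> complex"
  assumes cs: "complex_scaling cs"
    and meas: "\<And>z. z \<in> S \<Longrightarrow> f z \<in> borel_measurable M"
    and hol: "\<And>y. y \<in> space M \<Longrightarrow> holomorphic_wrt cs (\<lambda>z. f z y) S"
    and dom: "\<And>z0. z0 \<in> S \<Longrightarrow> \<exists>e>0. \<exists>h. ball z0 e \<subseteq> S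
        \<and> integrable M h \<and>
      (\<forall>z\<in>ball z0 e. \<forall>y\<in>space M. norm (f z y) \<le> h y)"
  shows "holomorphic_wrt cs (\<lambda>z. \<integral>y. f z y \<partial>M) S"
  unfolding holomorphic_wrt_def
proof
  fix z0 assume z0: "z0 \<in> S"
  from dom[OF z0] obtain e h where e: "e > 0" and sub: "ball z0 e \<subseteq> S" and h: "integrable M h"
    and bd: "\<And>z y. z \<in> ball z0 e \<Longrightarrow> y \<in> space M \<Longrightarrow> norm (f z y)
        \<le> h y" by blast
  let ?f' = "\<lambda>z y. frechet_derivative (\<lambda>z. f z y) (at z)"
  have sm: "ball z (e/2) \<subseteq> ball z0 e" if "z \<in> ball z0 (e/2)" for z
    using that by (intro subsetI) (auto intro: dist_triangle_half_l simp: dist_commute)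
  have int: "integrable M (f z)" if "z \<in> ball z0 (e/2)" for z
  proof (rule Bochner_Integration.integrable_bound[OF h])
    have z: "z \<in> ball z0 e" using that e by auto
    then show "f z \<in> borel_measurable M" using sub meas by auto
    show "AE y in M. norm (f z y) \<le> norm (h y)"
      using bd[OF z] by (intro AE_I2) (auto intro: order_trans[OF _ abs_ge_self])
  qed
  have der: "((\<lambda>z. f z y) has_derivative ?f' z y) (at z)" if "z \<in> ball z0 (e/2)"
      "y \<in> space M" for z y
  proof (rule holomorphic_wrtD(1)[OF hol[OF that(2)]])
    show "z \<in> S" using that(1) sub e by auto
  qed
  have b: "norm (?f' z y v) \<le> (4 / e * h y) * norm v" if "z \<in> ball z0 (e/2)" "y \<in> space M" for z
      y v
  proof -
    have "norm (?f' z y v) \<le> 2 * h y / (e/2) * norm v"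
      by (rule holomorphic_wrt_derivative_bound[OF cs _ holomorphic_wrt_subset[OF hol[OF that(2)]] bd])
        (use that sm[OF that(1)] sub e der in auto)
    then show ?thesis by simp
  qed
  have h4: "integrable M (\<lambda>y. 4 / e * h y)" by (rule integrable_mult_right[OF h])
  have e2: "e / 2 > 0" using e by simp
  from has_derivative_integral(2)[OF e2 int der b h4]
  have "((\<lambda>z. \<integral>y. f z y \<partial>M) has_derivative (\<lambda>v. \<integral>y. ?f' z0 y v
      \<partial>M)) (at z0)" .
  moreover have "(\<integral>y. ?f' z0 y (cs c v) \<partial>M) = c * (\<integral>y. ?f' z0 y v \<partial>M)"
      for c v
  proof -
    have "(\<integral>y. ?f' z0 y (cs c v) \<partial>M) = (\<integral>y. c * ?f' z0 y v \<partial>M)"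
      by (intro Bochner_Integration.integral_cong refl holomorphic_wrtD(2)[OF hol z0])
    then show ?thesis by simp
  qed
  ultimately show "\<exists>f'. ((\<lambda>z. \<integral>y. f z y \<partial>M) has_derivative f') (at z0)
      \<and> (\<forall>c v. f' (cs c v) = c * f' v)"
    by blast
qed

lemma cvec_Re_Im [simp]: "cvec (Re_vec z) (Im_vec z) = z"
  by (simp add: cvec_def Re_vec_def Im_vec_def vec_eq_iff complex_eq_iff)

lemma Re_vec_cvec [simp]: "Re_vec (cvec a b) = a" and Im_vec_cvec [simp]: "Im_vec (cvec a b) = b"
  by (simp_all add: cvec_def Re_vec_def Im_vec_def vec_eq_iff)

lemma Re_vec_simps [simp]:
  "Re_vec (z + w) = Re_vec z + Re_vec w" "Re_vec (z - w) = Re_vec z - Re_vec w"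
  "Re_vec (r *\<^sub>R z) = r *\<^sub>R Re_vec z" "Re_vec 0 = 0" "Re_vec (- z) = - Re_vec z"
  by (simp_all add: Re_vec_def vec_eq_iff)

lemma Im_vec_simps [simp]:
  "Im_vec (z + w) = Im_vec z + Im_vec w" "Im_vec (z - w) = Im_vec z - Im_vec w"
  "Im_vec (r *\<^sub>R z) = r *\<^sub>R Im_vec z" "Im_vec 0 = 0" "Im_vec (- z) = - Im_vec z"
  by (simp_all add: Im_vec_def vec_eq_iff)

lemma Re_vec_smult [simp]: "Re_vec (c *s z) = Re c *\<^sub>R Re_vec z - Im c *\<^sub>R Im_vec z"
  and Im_vec_smult [simp]: "Im_vec (c *s z) = Re c *\<^sub>R Im_vec z + Im c *\<^sub>R Re_vec z"
  by (simp_all add: Re_vec_def Im_vec_def vec_eq_iff)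

lemma complex_vec_eqI: "Re_vec z = Re_vec w \<Longrightarrow> Im_vec z = Im_vec w \<Longrightarrow> z = w"
  by (metis cvec_Re_Im)

lemma norm_complex_vec: "(norm z)\<^sup>2 = (norm (Re_vec z))\<^sup>2 + (norm (Im_vec (z :: complex ^
    'n::finite)))\<^sup>2"
  by (simp add: norm_vec_def L2_set_def sum_nonneg Re_vec_def Im_vec_def cmod_power2 flip: sum.distrib)

lemma norm_Re_vec_le: "norm (Re_vec z) \<le> norm (z :: complex ^ 'n::finite)"
  and norm_Im_vec_le: "norm (Im_vec z) \<le> norm (z :: complex ^ 'n::finite)"
  by (rule power2_le_imp_le; simp add: norm_complex_vec)+

lemma norm_cvec_real [simp]: "norm (cvec a 0) = norm (a :: real ^ 'n::finite)"
  and norm_cvec_imag [simp]: "norm (cvec 0 a) = norm (a :: real ^ 'n::finite)"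
  using norm_complex_vec[of "cvec a 0"] norm_complex_vec[of "cvec 0 a"] by (simp_all add:
      power2_eq_iff_nonneg)

lemma norm_complex_vec_le: "norm z \<le> norm (Re_vec z) + norm (Im_vec (z :: complex ^ 'n::finite))"
  by (rule power2_le_imp_le) (simp_all add: norm_complex_vec power2_sum)

lemma bounded_linear_Re_vec: "bounded_linear (Re_vec :: complex ^ 'n::finite \<Rightarrow> _)"
  by (rule bounded_linear_intro[where K=1]) (simp_all add: norm_Re_vec_le)

lemma bounded_linear_Im_vec: "bounded_linear (Im_vec :: complex ^ 'n::finite \<Rightarrow> _)"
  by (rule bounded_linear_intro[where K=1]) (simp_all add: norm_Im_vec_le)

lemmas has_derivative_Re_vec [derivative_intros] = bounded_linear.has_derivative[OF bounded_linear_Re_vec]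
lemmas has_derivative_Im_vec [derivative_intros] = bounded_linear.has_derivative[OF bounded_linear_Im_vec]
lemmas continuous_on_Re_vec [continuous_intros] = bounded_linear.continuous_on[OF bounded_linear_Re_vec]
lemmas continuous_on_Im_vec [continuous_intros] = bounded_linear.continuous_on[OF bounded_linear_Im_vec]

lemma cvec_add: "cvec (a + a') (b + b') = cvec a b + cvec a' b'"
  and cvec_diff: "cvec (a - a') (b - b') = cvec a b - cvec a' b'"
  and cvec_scaleR: "cvec (r *\<^sub>R a) (r *\<^sub>R b) = r *\<^sub>R cvec a b"
  and cvec_zero [simp]: "cvec 0 0 = 0"
  by (rule complex_vec_eqI; simp)+

lemma bounded_linear_cvec: "bounded_linear (\<lambda>(a, b). cvec a (b :: real ^ 'n::finite))"
proof (rule bounded_linear_intro[where K=2])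
  fix x :: "(real ^ 'n) \<times> (real ^ 'n)"
  have "norm (cvec (fst x) (snd x)) \<le> norm (fst x) + norm (snd x)"
    using norm_complex_vec_le[of "cvec (fst x) (snd x)"] by simp
  also have "\<dots> \<le> norm x * 2" using norm_fst_le[of "fst x" "snd x"] norm_snd_le[of "snd x" "fst x"]
      by simp
  finally show "norm (case x of (a, b) \<Rightarrow> cvec a b) \<le> norm x * 2" by (simp add:
      case_prod_unfold)
qed (auto simp: case_prod_unfold cvec_add cvec_scaleR)

lemma has_derivative_cvec [derivative_intros]:
  assumes "(f has_derivative f') (at x within S)" "(g has_derivative g') (at x within S)"
  shows "((\<lambda>x. cvec (f x) (g x :: real ^ 'n::finite)) has_derivative (\<lambda>v. cvec (f' v) (g'
      v))) (at x within S)"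
  using bounded_linear.has_derivative[OF bounded_linear_cvec has_derivative_Pair[OF assms]] by simp

lemma continuous_on_cvec [continuous_intros]:
  assumes "continuous_on S f" "continuous_on S g"
  shows "continuous_on S (\<lambda>x. cvec (f x) (g x :: real ^ 'n::finite))"
  using bounded_linear.continuous_on[OF bounded_linear_cvec continuous_on_Pair[OF assms]] by simp

text \<open>The bilinear extension of the real inner product, not the Hermitian one: it has to be
  holomorphic in both arguments.\<close>

definition cdot :: "complex ^ 'n::finite \<Rightarrow> complex ^ 'n \<Rightarrow> complex" where
  "cdot w z = (\<Sum>i\<in>UNIV. w $ i * z $ i)"

lemma Re_cdot: "Re (cdot w z) = Re_vec w \<bullet> Re_vec z - Im_vec w \<bullet> Im_vec z"
  and Im_cdot: "Im (cdot w z) = Re_vec w \<bullet> Im_vec z + Im_vec w \<bullet> Re_vec z"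
  by (simp_all add: cdot_def inner_vec_def Re_vec_def Im_vec_def sum_subtractf sum.distrib)

lemma norm_cdot_le: "norm (cdot w z) \<le> norm w * norm z * 4"
proof -
  have "norm (cdot w z) \<le> \<bar>Re (cdot w z)\<bar> + \<bar>Im (cdot w z)\<bar>" by (rule cmod_le)
  also have "\<dots> \<le> \<bar>Re_vec w \<bullet> Re_vec z\<bar> + \<bar>Im_vec w \<bullet> Im_vec z\<bar>
      + (\<bar>Re_vec w \<bullet> Im_vec z\<bar> + \<bar>Im_vec w \<bullet> Re_vec z\<bar>)"
    unfolding Re_cdot Im_cdot by linarith
  also have "\<dots> \<le> norm w * norm z + norm w * norm z + (norm w * norm z + norm w * norm z)"
    by (intro add_mono order_trans[OF Cauchy_Schwarz_ineq2] mult_mono norm_Re_vec_le norm_Im_vec_le) auto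
  finally show ?thesis by simp
qed

lemma bounded_bilinear_cdot: "bounded_bilinear (cdot :: complex ^ 'n::finite \<Rightarrow> _)"
proof
  show "\<exists>K. \<forall>a b. norm (cdot a b :: complex) \<le> norm (a :: complex ^ 'n) * norm b * K"
    using norm_cdot_le by blast
qed (auto simp: cdot_def algebra_simps sum.distrib scaleR_sum_right)

lemmas has_derivative_cdot [derivative_intros] = bounded_bilinear.FDERIV[OF bounded_bilinear_cdot]
lemmas continuous_on_cdot [continuous_intros] = bounded_bilinear.continuous_on[OF bounded_bilinear_cdot]

lemma cdot_smult_left [simp]: "cdot (c *s w) z = c * cdot w z"
  and cdot_smult_right [simp]: "cdot w (c *s z) = c * cdot w z"
  by (simp_all add: cdot_def sum_distrib_left mult_ac)

lemma mem_tube: "z \<in> tube A B \<longleftrightarrow> Re_vec z \<in> A \<and> Im_vec z \<in> B"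
  unfolding tube_def mem_Collect_eq by (metis Re_vec_cvec Im_vec_cvec cvec_Re_Im)

lemma open_tube:
  fixes A B :: "(real ^ 'n::finite) set"
  assumes "open A" "open B" shows "open (tube A B)"
proof -
  have "tube A B = Re_vec -` A \<inter> Im_vec -` B" by (auto simp: mem_tube)
  moreover have "open (Re_vec -` A :: (complex ^ 'n) set)" "open (Im_vec -` B :: (complex ^ 'n) set)"
    using assms by (auto intro!: open_vimage continuous_intros)
  ultimately show ?thesis by auto
qed

section \<open>Deformation of contours\<close>

text \<open>The growth allowed here fits both the compactly supported cut-offs and a frequency
  height comparable to |\<xi>|. The symmetry of \<open>g2\<close> makes the two second-order terms
  in the variation of a contour cancel.\<close>

definition C2_fun :: "(real ^ 'n::finite \<Rightarrow> real) \<Rightarrow> (real ^ 'n \<Rightarrow> real ^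
    'n \<Rightarrow> real) \<Rightarrow>
    (real ^ 'n \<Rightarrow> real ^ 'n \<Rightarrow> real ^ 'n \<Rightarrow> real) \<Rightarrow> real
        \<Rightarrow> bool" where
  "C2_fun g g1 g2 G \<longleftrightarrow>
     (\<forall>y. (g has_derivative g1 y) (at y)) \<and>
     (\<forall>y v. ((\<lambda>y. g1 y v) has_derivative g2 y v) (at y)) \<and>
     (\<forall>y u v. g2 y u v = g2 y v u) \<and>
     (\<forall>y. \<bar>g y\<bar> \<le> G * (1 + norm y)) \<and>
     (\<forall>y v. \<bar>g1 y v\<bar> \<le> G * norm v) \<and>
     (\<forall>y u v. \<bar>g2 y u v\<bar> \<le> G * norm u * norm v)"

text \<open>A factor that vanishes to first order makes the product differentiable even where the
  other factor is merely bounded. This handles the points at which the holomorphic function on the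
  contour is not known to be differentiable.\<close>

lemma has_derivative_zero_mult_bounded:
  fixes H :: "'a::real_normed_vector \<Rightarrow> real" and Q :: "'a \<Rightarrow> complex"
  assumes H: "(H has_derivative (\<lambda>v. 0)) (at y)" and H0: "H y = 0"
    and Q: "\<And>x. H x \<noteq> 0 \<Longrightarrow> norm (Q x) \<le> B"
  shows "((\<lambda>x. of_real (H x) * Q x) has_derivative (\<lambda>v. 0)) (at y)"
  unfolding has_derivative_iff_norm
proof (intro conjI)
  have l: "((\<lambda>x. B * (norm (H x) / norm (x - y))) \<longlongrightarrow> 0) (at y)"
    using H H0 tendsto_mult_right_zero unfolding has_derivative_iff_norm by fastforce
  show "((\<lambda>x. norm (of_real (H x) * Q x - of_real (H y) * Q y - 0) / norm (x - y))
      \<longlongrightarrow> 0) (at y)"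
  proof (rule tendsto_sandwich[OF _ _ tendsto_const l])
    show "\<forall>\<^sub>F x in at y. norm (of_real (H x) * Q x - of_real (H y) * Q y - 0) / norm (x - y)
        \<le> B * (norm (H x) / norm (x - y))"
    proof (intro always_eventually allI)
      fix x
      have "norm (of_real (H x) * Q x) \<le> B * norm (H x)"
        using Q[of x] by (cases "H x = 0") (auto simp: norm_mult mult.commute intro: mult_right_mono)
      then show "norm (of_real (H x) * Q x - of_real (H y) * Q y - 0) / norm (x - y) \<le> B * (norm (H x) /
          norm (x - y))"
        by (simp add: H0 divide_right_mono)
    qed
  qed auto
qed simp

text \<open>Dictionary: \<open>ge\<close>, \<open>gt\<close> and \<open>Ae\<close>,
  \<open>At\<close> are the derivatives of height and weight in directions \<open>e\<close> and
  \<open>\<theta>\<close>, \<open>s\<close> is the mixed second derivative of the height,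
  \<open>F\<close> the value of the function on the contour, and \<open>p\<close>, \<open>q\<close>
  its complex derivatives along \<open>e\<close> and \<open>\<theta>\<close>. By the chain rule,
  \<open>p + \<i> * ge * q\<close> and \<open>q + \<i> * gt * q\<close> are the derivatives of
  \<open>F\<close>. The terms with \<open>s\<close> and with \<open>q\<close> cancel, and the
  assumptions remove the remaining cross terms.\<close>

lemma contour_variation_algebra:
  fixes a g ge gt Ae At F p q s :: complex
  assumes "Ae * gt = 0" "At * ge = 0"
  shows "a * (\<i> * g * p * (1 + \<i> * gt) + \<i> * ge * F) + \<i> * (Ae * g) * F =
    ((a * ge + Ae * g) * (\<i> * (1 + \<i> * gt)) * F + a * g * (\<i> * (\<i> * s)) * F + a * g * (\<i> * (1
        + \<i> * gt)) * (p + \<i> * ge * q))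
    + ((a * gt + At * g) * ge * F + a * g * s * F + a * g * ge * (q + \<i> * gt * q))"
proof -
  have "\<i> * \<i> = -1" by simp
  with assms show ?thesis by algebra
qed

text \<open>With \<open>F y = f (y + i g(y) \<theta>)\<close>, the integrand is the derivative of \<open>i A
    g (1 + i \<partial>\<^sub>\<theta> g) F\<close> in direction \<open>e\<close>
  plus the derivative of \<open>A g (\<partial>\<^sub>e g) F\<close> in direction
      \<open>\<theta>\<close>.\<close>

lemma integral_contour_variation:
  fixes f :: "complex ^ 'n::finite \<Rightarrow> complex" and A :: "real ^ 'n \<Rightarrow> real" and e ::
      "real ^ 'n"
  assumes g: "C2_fun g g1 g2 G"
    and A: "\<And>y. (A has_derivative A1 y) (at y)" "\<And>y. \<bar>A y\<bar> \<le> 1"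
        "\<And>y v. \<bar>A1 y v\<bar> \<le> G * norm v"
    and orth: "\<And>y u v. A1 y u * g1 y v = 0"
    and f: "\<And>y. y \<in> S \<Longrightarrow> (f has_derivative f' y) (at (cvec y (g y *\<^sub>R
        \<theta>)))"
    and lin: "\<And>y c v. y \<in> S \<Longrightarrow> f' y (c *s v) = c * f' y v"
    and bd: "\<And>y. y \<in> S \<Longrightarrow> norm (f (cvec y (g y *\<^sub>R \<theta>))) \<le> C / (1 +
        norm y) ^ (CARD('n) + 3)"
    and bd': "\<And>y v. y \<in> S \<Longrightarrow> norm (f' y v) \<le> C / (1 + norm y) ^ (CARD('n) + 3) *
        norm v"
    and off: "\<And>y. y \<notin> S \<Longrightarrow> A y * g y = 0"
        "\<And>y v. y \<notin> S \<Longrightarrow> A y * g1 y v + A1 y v * g y = 0"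
  defines "\<Psi> \<equiv> \<lambda>y. of_real (A y) * (\<i> * of_real (g y) * f' y (cvec e 0) * (1 + \<i> *
      of_real (g1 y \<theta>))
        + \<i> * of_real (g1 y e) * f (cvec y (g y *\<^sub>R \<theta>)))
      + \<i> * of_real (A1 y e * g y) * f (cvec y (g y *\<^sub>R \<theta>))"
  shows "integrable lborel \<Psi>" "(\<integral>y. \<Psi> y \<partial>lborel) = 0"
proof -
  have dg: "(g has_derivative g1 y) (at y)" and dg1: "((\<lambda>y. g1 y v) has_derivative g2 y v) (at y)"
    and sym: "g2 y u v = g2 y v u" and bg: "\<bar>g y\<bar> \<le> G * (1 + norm y)"
    and bg1: "\<bar>g1 y v\<bar> \<le> G * norm v" and bg2: "\<bar>g2 y u v\<bar> \<le> G * norm u * norm v"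
        for y u v
    using g unfolding C2_fun_def by blast+
  have "\<bar>g (0::real ^ 'n)\<bar> \<le> G" using bg[of 0] by simp
  then have G: "G \<ge> 0" by linarith
  define F where "F y = f (cvec y (g y *\<^sub>R \<theta>))" for y
  define F' where "F' y v = f' y (cvec v (g1 y v *\<^sub>R \<theta>))" for y v
  \<comment> \<open>Both fields carry the factor \<open>H\<close>. It vanishes to first order off
    \<open>S\<close>, and this is what makes them differentiable at such points.\<close>
  define H where "H y = A y * g y" for y
  define H' where "H' y v = A y * g1 y v + A1 y v * g y" for y v
  define w where "w y = 1 + norm y" for y :: "real ^ 'n"
  have w1: "w y \<ge> 1" for y unfolding w_def by simp
  have w0: "w y > 0" for y using w1[of y] by linarith
  define T where "T y = C / w y ^ (CARD('n) + 3)" for y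
  have bF: "norm (F y) \<le> T y" if "y \<in> S" for y using bd[OF that] by (simp add: F_def T_def w_def)
  have T0: "T y \<ge> 0" if "y \<in> S" for y using bF[OF that] norm_ge_zero order_trans by blast
  have TC: "T y \<le> C" if "y \<in> S" for y
  proof -
    have "w y ^ (CARD('n) + 3) \<ge> 1" using w1 by (rule one_le_power)
    moreover have "C \<ge> 0" using T0[OF that] zero_less_power[OF w0[of y], of "CARD('n) + 3"]
      unfolding T_def by (auto simp: zero_le_divide_iff)
    ultimately show ?thesis unfolding T_def
      by (metis div_by_1 frac_le order_refl zero_less_one)
  qed
  have dH: "(H has_derivative H' y) (at y)" for y
    unfolding H_def H'_def by (rule has_derivative_mult[OF A(1) dg])
  have H_off: "H y = 0" "H' y = (\<lambda>v. 0)" if "y \<notin> S" for y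
    using off(1)[OF that] off(2)[OF that] by (auto simp: H_def H'_def)
  have dF: "(F has_derivative F' y) (at y)" if "y \<in> S" for y
    unfolding F_def F'_def
  proof (rule has_derivative_compose[where g=f and f="\<lambda>y. cvec y (g y *\<^sub>R \<theta>)", OF _
      f[OF that]])
    show "((\<lambda>y. cvec y (g y *\<^sub>R \<theta>)) has_derivative (\<lambda>v. cvec v (g1 y v
        *\<^sub>R \<theta>))) (at y)"
      by (auto intro!: derivative_eq_intros dg)
  qed
  have F'eq: "F' y v = f' y (cvec v 0) + \<i> * of_real (g1 y v) * f' y (cvec \<theta> 0)" if "y \<in> S"
      for y v
  proof -
    have "cvec v (g1 y v *\<^sub>R \<theta>) = cvec v 0 + (\<i> * of_real (g1 y v)) *s cvec \<theta> 0"
      by (rule complex_vec_eqI) simp_all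
    then show ?thesis
      using linear_simps(1)[OF has_derivative_bounded_linear[OF f[OF that]]] lin[OF that] by (simp add:
          F'_def)
  qed
  have bF': "norm (F' y v) \<le> T y * ((1 + G * norm \<theta>) * norm v)" if "y \<in> S" for y v
  proof -
    have "norm (f' y u) \<le> T y * norm u" for u using bd'[OF that] by (simp add: T_def w_def)
    note b = this[of "cvec v (g1 y v *\<^sub>R \<theta>)"]
    have "norm (cvec v (g1 y v *\<^sub>R \<theta>)) \<le> norm v + \<bar>g1 y v\<bar> * norm \<theta>"
      using norm_complex_vec_le[of "cvec v (g1 y v *\<^sub>R \<theta>)"] by simp
    also have "\<dots> \<le> norm v + G * norm v * norm \<theta>" by (intro add_left_mono mult_right_mono
        bg1) auto
    also have "\<dots> = (1 + G * norm \<theta>) * norm v" by (simp add: algebra_simps)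
    finally show ?thesis unfolding F'_def using b T0[OF that] by (meson mult_left_mono order_trans)
  qed
  have bH: "\<bar>H y\<bar> \<le> G * w y" for y
  proof -
    have "\<bar>A y\<bar> * \<bar>g y\<bar> \<le> 1 * (G * w y)" unfolding w_def by (intro mult_mono A(2)
        bg) auto
    then show ?thesis by (simp add: H_def abs_mult)
  qed
  have bH': "\<bar>H' y v\<bar> \<le> (G + G * G) * norm v * w y" for y v
  proof -
    have "\<bar>H' y v\<bar> \<le> \<bar>A y\<bar> * \<bar>g1 y v\<bar> + \<bar>A1 y v\<bar> * \<bar>g
        y\<bar>" unfolding H'_def by (simp flip: abs_mult)
    also have "\<dots> \<le> 1 * (G * norm v) + G * norm v * (G * w y)"
      unfolding w_def using G by (intro add_mono mult_mono A bg1 bg) auto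
    also have "\<dots> \<le> G * norm v * w y + G * norm v * (G * w y)"
      using mult_left_mono[OF w1[of y], of "G * norm v"] G by simp
    finally show ?thesis by (simp add: algebra_simps)
  qed
  have key: "integrable lborel (\<lambda>y. Z' y v) \<and> (\<integral>y. Z' y v \<partial>lborel) = 0"
    if dq: "\<And>y. (q has_derivative q' y) (at y)" and bq: "\<And>y. norm (q y) \<le> K" and bq':
        "\<And>y. norm (q' y v) \<le> K"
      and Z': "\<And>y v. Z' y v = (if y \<in> S then of_real (H' y v) * q y * F y + of_real (H y) * q' y v
          * F y + of_real (H y) * q y * F' y v else 0)"
    for q :: "real ^ 'n \<Rightarrow> complex" and q' Z' v K
  proof -
    define Z where "Z y = of_real (H y) * (q y * F y)" for y
    have K: "K \<ge> 0" using bq[of 0] norm_ge_zero order_trans by blast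
    have inS: "y \<in> S" if "H y \<noteq> 0" for y using H_off(1) that by blast
    have dZ: "(Z has_derivative Z' y) (at y)" for y
    proof (cases "y \<in> S")
      case True
      have "(Z has_derivative (\<lambda>v. of_real (H y) * (q y * F' y v + q' y v * F y) + of_real (H' y v)
          * (q y * F y))) (at y)"
        unfolding Z_def
        by (intro has_derivative_mult has_derivative_of_real dH dq dF[OF True])
      moreover have "(\<lambda>v. of_real (H y) * (q y * F' y v + q' y v * F y) + of_real (H' y v) * (q y *
          F y)) = Z' y"
        using True by (auto simp: Z' fun_eq_iff algebra_simps)
      ultimately show ?thesis by simp
    next
      case False
      have "(Z has_derivative (\<lambda>v. 0)) (at y)"
        unfolding Z_def
      proof (rule has_derivative_zero_mult_bounded)
        show "(H has_derivative (\<lambda>v. 0)) (at y)" using dH[of y] H_off(2)[OF False] by simp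
        show "norm (q x * F x) \<le> K * C" if "H x \<noteq> 0" for x
          unfolding norm_mult using bq[of x] order_trans[OF bF[OF inS[OF that]] TC[OF inS[OF that]]] K
          by (intro mult_mono) auto
      qed (rule H_off(1)[OF False])
      moreover have "Z' y = (\<lambda>v. 0)" using False by (simp add: Z' fun_eq_iff)
      ultimately show ?thesis by simp
    qed
    define N where "N = G * K + (G + G * G) * norm v * K + G * K * ((1 + G * norm \<theta>) * norm v) + G *
        K"
    define B where "B = N * C"
    \<comment> \<open>The height may grow linearly, which costs one power of the weight: n + 3 in
      the hypotheses, n + 2 in the integrable majorant.\<close>
    have Tw: "x * (w y * T y) \<le> (N * C) / (1 + norm y) ^ (CARD('n) + 2)" if "x \<le> N" "y \<in> S" for
        x y
    proof -
      have "w y * T y = C / (1 + norm y) ^ (CARD('n) + 2)"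
        using w0[of y] by (simp add: T_def w_def[symmetric] power_add power3_eq_cube power2_eq_square)
      moreover have "w y * T y \<ge> 0" using T0[OF that(2)] w0[of y] by simp
      ultimately show ?thesis using mult_right_mono[OF that(1), of "w y * T y"] by simp
    qed
    have N0: "N \<ge> 0" unfolding N_def using G K by (intro add_nonneg_nonneg mult_nonneg_nonneg) auto
    have C0: "C \<ge> 0" if "y \<in> S" for y using order_trans[OF T0[OF that] TC[OF that]] .
    have bZ: "norm (Z y) \<le> \<bar>N * C\<bar> / (1 + norm y) ^ (CARD('n) + 2)" for y
    proof (cases "y \<in> S")
      case True
      have "norm (Z y) \<le> (G * w y) * (K * T y)" unfolding Z_def norm_mult norm_of_real
        using G K w0[of y] T0[OF True] by (intro mult_mono bH bq bF True) auto
      also have "\<dots> = G * K * (w y * T y)" by (simp add: mult_ac)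
      also have "\<dots> \<le> (N * C) / (1 + norm y) ^ (CARD('n) + 2)"
        by (rule Tw[OF _ True]) (use G K in \<open>auto simp: N_def intro!: add_nonneg_nonneg
            mult_nonneg_nonneg\<close>)
      finally show ?thesis using N0 C0[OF True] by simp
    next
      case False
      then show ?thesis using H_off(1) by (simp add: Z_def)
    qed
    have bZ': "norm (Z' y v) \<le> \<bar>N * C\<bar> / (1 + norm y) ^ (CARD('n) + 2)" for y
    proof (cases "y \<in> S")
      case True
      have "norm (Z' y v) \<le> norm (of_real (H' y v) * q y * F y) + norm (of_real (H y) * q' y v * F y) +
          norm (of_real (H y) * q y * F' y v)"
        using True by (simp only: Z' if_True) (intro order_trans[OF norm_triangle_ineq] add_right_mono
            norm_triangle_ineq)
      also have "\<dots> \<le> ((G + G * G) * norm v * w y) * K * T y + (G * w y) * K * T y + (G * w y) * K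
          * (T y * ((1 + G * norm \<theta>) * norm v))"
        unfolding norm_mult norm_of_real
        using G K w0[of y] T0[OF True] by (intro add_mono mult_mono bH bH' bq bq' bF bF' True) auto
      also have "\<dots> = ((G + G * G) * norm v * K + G * K + G * K * ((1 + G * norm \<theta>) * norm v)) *
          (w y * T y)"
        by (simp add: algebra_simps)
      also have "\<dots> \<le> (N * C) / (1 + norm y) ^ (CARD('n) + 2)"
        by (rule Tw[OF _ True]) (use G K in \<open>auto simp: N_def\<close>)
      finally show ?thesis using N0 C0[OF True] by simp
    next
      case False
      then show ?thesis by (simp add: Z')
    qed
    have D: "DIM(real ^ 'n) = CARD('n)" by simp
    show ?thesis
      using integral_directional_derivative[of Z Z' "\<bar>N * C\<bar>" v] dZ bZ bZ' unfolding D by blast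
  qed
  define Z1 where "Z1 y v = (if y \<in> S then of_real (H' y v) * (\<i> * (1 + \<i> * of_real (g1 y
      \<theta>))) * F y
      + of_real (H y) * (\<i> * (\<i> * of_real (g2 y \<theta> v))) * F y + of_real (H y) * (\<i> * (1 +
          \<i> * of_real (g1 y \<theta>))) * F' y v else 0)" for y v
  define Z2 where "Z2 y v = (if y \<in> S then of_real (H' y v) * of_real (g1 y e) * F y
      + of_real (H y) * of_real (g2 y e v) * F y + of_real (H y) * of_real (g1 y e) * F' y v else
          0)" for y v
  have 1: "integrable lborel (\<lambda>y. Z1 y e) \<and> (\<integral>y. Z1 y e \<partial>lborel) = 0"
  proof (rule key[where K="1 + G * norm \<theta> + G * norm \<theta> * norm e"])
    fix y
    show "((\<lambda>y. \<i> * (1 + \<i> * of_real (g1 y \<theta>))) has_derivative (\<lambda>v. \<i> *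
        (\<i> * of_real (g2 y \<theta> v)))) (at y)"
      by (auto intro!: derivative_eq_intros dg1)
    have "norm (\<i> * (1 + \<i> * complex_of_real (g1 y \<theta>))) \<le> 1 + \<bar>g1 y \<theta>\<bar>"
      using norm_triangle_ineq[of 1 "\<i> * complex_of_real (g1 y \<theta>)"] by (simp add: norm_mult)
    also have "\<dots> \<le> 1 + G * norm \<theta> + G * norm \<theta> * norm e" using bg1[of y \<theta>] G
      by (simp add: add_increasing2)
    finally show "norm (\<i> * (1 + \<i> * complex_of_real (g1 y \<theta>))) \<le> 1 + G * norm \<theta> + G
        * norm \<theta> * norm e" .
    show "norm (\<i> * (\<i> * complex_of_real (g2 y \<theta> e))) \<le> 1 + G * norm \<theta> + G * norm
        \<theta> * norm e"
      using bg2[of y \<theta> e] G by (simp add: norm_mult add_increasing)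
  qed (rule Z1_def)
  have 2: "integrable lborel (\<lambda>y. Z2 y \<theta>) \<and> (\<integral>y. Z2 y \<theta>
      \<partial>lborel) = 0"
  proof (rule key[where K="G * norm e + G * norm e * norm \<theta>"])
    fix y
    show "((\<lambda>y. complex_of_real (g1 y e)) has_derivative (\<lambda>v. of_real (g2 y e v))) (at y)"
      by (auto intro!: derivative_eq_intros dg1)
    show "norm (complex_of_real (g1 y e)) \<le> G * norm e + G * norm e * norm \<theta>"
      using bg1[of y e] G by (simp add: add_increasing2)
    show "norm (complex_of_real (g2 y e \<theta>)) \<le> G * norm e + G * norm e * norm \<theta>"
      using bg2[of y e \<theta>] G by (simp add: add_increasing)
  qed (rule Z2_def)
  have eq: "\<Psi> y = Z1 y e + Z2 y \<theta>" for y
  proof (cases "y \<in> S")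
    case True
    have o: "complex_of_real (A1 y e) * complex_of_real (g1 y \<theta>) = 0"
        "complex_of_real (A1 y \<theta>) * complex_of_real (g1 y e) = 0"
      using orth by (simp_all flip: of_real_mult)
    show ?thesis
      unfolding \<Psi>_def Z1_def Z2_def F'eq[OF True] sym[of y e \<theta>] H_def H'_def of_real_add
          of_real_mult if_P[OF True] F_def[symmetric]
      by (rule contour_variation_algebra[OF o])
  next
    case False
    have "A y * g y = 0" "A y * g1 y e + A1 y e * g y = 0" using off[OF False] by auto
    then have o: "complex_of_real (A y) * complex_of_real (g y) = 0"
      "complex_of_real (A y) * complex_of_real (g1 y e) + complex_of_real (A1 y e) * complex_of_real (g y) =
          0"
      by (simp_all flip: of_real_mult of_real_add)
    have "\<Psi> y = (complex_of_real (A y) * complex_of_real (g y)) * (\<i> * f' y (cvec e 0) * (1 + \<i> *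
        of_real (g1 y \<theta>)))
       + (complex_of_real (A y) * complex_of_real (g1 y e) + complex_of_real (A1 y e) * complex_of_real (g
           y)) * (\<i> * f (cvec y (g y *\<^sub>R \<theta>)))"
      by (simp add: \<Psi>_def algebra_simps)
    then show ?thesis unfolding o Z1_def Z2_def using False by simp
  qed
  show "integrable lborel \<Psi>" "(\<integral>y. \<Psi> y \<partial>lborel) = 0"
    unfolding eq using 1 2 by simp_all
qed

text \<open>The factor \<open>1 + \<i> * g1 y \<theta>\<close> is the Jacobian determinant of y -> y
  + i g(y) \<theta>, a rank-one perturbation of the identity. Differentiating in
  \<open>\<theta>\<close> along \<open>e\<close> yields the integrand of
  \<open>integral_contour_variation\<close> with constant weight 1, so the derivative is zero on the
  convex set \<open>\<Theta>\<close>.\<close>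

lemma integral_contour_direction:
  fixes f :: "complex ^ 'n::finite \<Rightarrow> complex"
  assumes g: "C2_fun g g1 g2 G"
    and \<Theta>: "open \<Theta>" "convex \<Theta>" "\<And>\<theta>. \<theta> \<in> \<Theta>
        \<Longrightarrow> norm \<theta> \<le> 2"
    and f: "\<And>\<theta> y. \<theta> \<in> \<Theta> \<Longrightarrow> y \<in> S \<Longrightarrow> (f
        has_derivative f' \<theta> y) (at (cvec y (g y *\<^sub>R \<theta>)))"
    and lin: "\<And>\<theta> y c v. \<theta> \<in> \<Theta> \<Longrightarrow> y \<in> S \<Longrightarrow> f'
        \<theta> y (c *s v) = c * f' \<theta> y v"
    and bd: "\<And>\<theta> y. \<theta> \<in> \<Theta> \<Longrightarrow> norm (f (cvec y (g y *\<^sub>R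
        \<theta>))) \<le> C / (1 + norm y) ^ (CARD('n) + 3)"
    and bd': "\<And>\<theta> y v. \<theta> \<in> \<Theta> \<Longrightarrow> y \<in> S \<Longrightarrow> norm
        (f' \<theta> y v) \<le> C / (1 + norm y) ^ (CARD('n) + 3) * norm v"
    and meas: "\<And>\<theta>. \<theta> \<in> \<Theta> \<Longrightarrow> (\<lambda>y. f (cvec y (g y
        *\<^sub>R \<theta>))) \<in> borel_measurable borel"
    and off: "\<And>y. y \<notin> S \<Longrightarrow> g y = 0"
        "\<And>y v. y \<notin> S \<Longrightarrow> g1 y v = 0"
    and "\<theta>0 \<in> \<Theta>" "\<theta>1 \<in> \<Theta>"
  shows "(\<integral>y. f (cvec y (g y *\<^sub>R \<theta>0)) * (1 + \<i> * of_real (g1 y \<theta>0))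
      \<partial>lborel) =
    (\<integral>y. f (cvec y (g y *\<^sub>R \<theta>1)) * (1 + \<i> * of_real (g1 y \<theta>1))
        \<partial>lborel)"
proof -
  have dg: "(g has_derivative g1 y) (at y)" and dg1: "((\<lambda>y. g1 y v) has_derivative g2 y v) (at y)"
    and bg: "\<bar>g y\<bar> \<le> G * (1 + norm y)" and bg1: "\<bar>g1 y v\<bar> \<le> G * norm v" for y v
    using g unfolding C2_fun_def by blast+
  have "\<bar>g (0::real ^ 'n)\<bar> \<le> G" using bg[of 0] by simp
  then have G: "G \<ge> 0" by linarith
  define \<phi> where "\<phi> \<theta> y = f (cvec y (g y *\<^sub>R \<theta>)) * (1 + \<i> * of_real (g1 y
      \<theta>))" for \<theta> y
  define \<phi>' where "\<phi>' \<theta> y e = (if y \<in> S then \<i> * of_real (g y) * f' \<theta> y (cvec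
      e 0) * (1 + \<i> * of_real (g1 y \<theta>))
        + \<i> * of_real (g1 y e) * f (cvec y (g y *\<^sub>R \<theta>)) else 0)" for \<theta> y e
  define T where "T y = C / (1 + norm y) ^ (CARD('n) + 3)" for y :: "real ^ 'n"
  have C: "C \<ge> 0" using order_trans[OF norm_ge_zero bd[OF \<open>\<theta>0 \<in> \<Theta>\<close>, of
      0]] by simp
  have T0: "T y \<ge> 0" for y using C by (simp add: T_def)
  have J: "norm (1 + \<i> * complex_of_real (g1 y \<theta>)) \<le> 1 + 2 * G" if "\<theta> \<in> \<Theta>"
      for y \<theta>
  proof -
    have "norm (1 + \<i> * complex_of_real (g1 y \<theta>)) \<le> 1 + \<bar>g1 y \<theta>\<bar>"
      using norm_triangle_ineq[of 1 "\<i> * complex_of_real (g1 y \<theta>)"] by (simp add: norm_mult)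
    also have "\<dots> \<le> 1 + G * 2" using bg1[of y \<theta>] mult_left_mono[OF \<Theta>(3)[OF that] G]
        by linarith
    finally show ?thesis by simp
  qed
  define N where "N = G * (1 + 2 * G) + G + (1 + 2 * G)"
  have N: "integrable lborel (\<lambda>y::real^'n. N * C * (1 / (1 + norm y) ^ (CARD('n) + 2)))"
    using integrable_inverse_power_norm[of "CARD('n) + 2", where 'a="real ^ 'n"] by (intro
        integrable_mult_right) simp
  have Tw: "x * ((1 + norm y) * T y) \<le> N * C * (1 / (1 + norm y) ^ (CARD('n) + 2))" if "x \<le> N" for x
      and y :: "real ^ 'n"
  proof -
    have w: "1 + norm y > 0" by (simp add: add_pos_nonneg)
    have "(1 + norm y) * T y = C / (1 + norm y) ^ (CARD('n) + 2)"
      using w by (simp add: T_def power_add power3_eq_cube power2_eq_square)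
    moreover have "(1 + norm y) * T y \<ge> 0" using T0[of y] w by simp
    ultimately show ?thesis using mult_right_mono[OF that, of "(1 + norm y) * T y"] by simp
  qed
  have d\<phi>: "((\<lambda>\<theta>. \<phi> \<theta> y) has_derivative \<phi>' \<theta> y) (at \<theta>)"
      if \<theta>: "\<theta> \<in> \<Theta>" for \<theta> y
  proof (cases "y \<in> S")
    case True
    have lg: "g1 y (u + v) = g1 y u + g1 y v" "g1 y (c *\<^sub>R v) = c * g1 y v" for u v c
      using linear_simps[OF has_derivative_bounded_linear[OF dg]] by auto
    have z: "((\<lambda>\<theta>. f (cvec y (g y *\<^sub>R \<theta>))) has_derivative (\<lambda>e. f'
        \<theta> y (cvec 0 (g y *\<^sub>R e)))) (at \<theta>)"
      by (rule has_derivative_compose[where g=f and f="\<lambda>\<theta>. cvec y (g y *\<^sub>R \<theta>)",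
          OF _ f[OF \<theta> True]])
        (auto intro!: derivative_eq_intros)
    have bl: "((\<lambda>\<theta>. g1 y \<theta>) has_derivative g1 y) (at \<theta>)"
      by (rule bounded_linear_imp_has_derivative[OF has_derivative_bounded_linear[OF dg]])
    have "((\<lambda>\<theta>. \<phi> \<theta> y) has_derivative (\<lambda>e. f (cvec y (g y *\<^sub>R
        \<theta>)) * (\<i> * of_real (g1 y e))
       + f' \<theta> y (cvec 0 (g y *\<^sub>R e)) * (1 + \<i> * of_real (g1 y \<theta>)))) (at \<theta>)"
      unfolding \<phi>_def by (rule has_derivative_mult[OF z]) (auto intro!: derivative_eq_intros bl)
    moreover have "f' \<theta> y (cvec 0 (g y *\<^sub>R e)) = \<i> * of_real (g y) * f' \<theta> y (cvec e
        0)" for e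
    proof -
      have "cvec 0 (g y *\<^sub>R e) = (\<i> * of_real (g y)) *s cvec e 0" by (rule complex_vec_eqI)
          simp_all
      then show ?thesis using lin[OF \<theta> True] by simp
    qed
    ultimately show ?thesis using True by (simp add: \<phi>'_def[abs_def] add.commute mult_ac)
  next
    case False
    then show ?thesis using off[OF False] by (simp add: \<phi>_def \<phi>'_def[abs_def])
  qed
  have b\<phi>: "norm (\<phi> \<theta> y) \<le> N * C * (1 / (1 + norm y) ^ (CARD('n) + 2))" if \<theta>:
      "\<theta> \<in> \<Theta>" for \<theta> y
  proof -
    have "norm (\<phi> \<theta> y) \<le> T y * (1 + 2 * G)"
      unfolding \<phi>_def norm_mult using bd[OF \<theta>, of y] J[OF \<theta>] T0 by (intro mult_mono)
          (auto simp: T_def)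
    also have "\<dots> \<le> (1 + 2 * G) * ((1 + norm y) * T y)"
      using T0[of y] G by (simp add: algebra_simps)
    also have "\<dots> \<le> N * C * (1 / (1 + norm y) ^ (CARD('n) + 2))"
      by (rule Tw) (use G in \<open>auto simp: N_def\<close>)
    finally show ?thesis .
  qed
  have b\<phi>': "norm (\<phi>' \<theta> y e) \<le> N * C * (1 / (1 + norm y) ^ (CARD('n) + 2)) * norm e" if
      \<theta>: "\<theta> \<in> \<Theta>" for \<theta> y e
  proof (cases "y \<in> S")
    case True
    have "norm (\<phi>' \<theta> y e) \<le> norm (\<i> * of_real (g y) * f' \<theta> y (cvec e 0) * (1 +
        \<i> * of_real (g1 y \<theta>)))
        + norm (\<i> * of_real (g1 y e) * f (cvec y (g y *\<^sub>R \<theta>)))"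
      using True by (simp only: \<phi>'_def if_True) (rule norm_triangle_ineq)
    also have "\<dots> \<le> 1 * (G * (1 + norm y)) * (T y * norm e) * (1 + 2 * G) + 1 * (G * norm e) * T y"
      unfolding norm_mult norm_of_real norm_ii
      using G C T0[of y] bd'[OF \<theta> True, of "cvec e 0"] bd[OF \<theta>, of y]
      by (intro add_mono mult_mono bg bg1 J[OF \<theta>])
        (auto simp: T_def intro!: divide_nonneg_nonneg mult_nonneg_nonneg zero_le_power)
    also have "\<dots> \<le> 1 * (G * (1 + norm y)) * (T y * norm e) * (1 + 2 * G) + 1 * (G * norm e) * ((1
        + norm y) * T y)"
      using G T0[of y] by (intro add_left_mono mult_left_mono) (auto simp: algebra_simps)
    also have "\<dots> = ((G * (1 + 2 * G) + G) * ((1 + norm y) * T y)) * norm e" by (simp add: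
        algebra_simps)
    also have "\<dots> \<le> N * C * (1 / (1 + norm y) ^ (CARD('n) + 2)) * norm e"
      by (intro mult_right_mono Tw) (use G in \<open>auto simp: N_def\<close>)
    finally show ?thesis .
  next
    case False
    then show ?thesis using C G by (simp add: \<phi>'_def N_def)
  qed
  have int\<phi>: "integrable lborel (\<phi> \<theta>)" if \<theta>: "\<theta> \<in> \<Theta>" for \<theta>
  proof (rule Bochner_Integration.integrable_bound[OF N])
    have "continuous_on UNIV (\<lambda>y. g1 y \<theta>)"
      by (intro continuous_at_imp_continuous_on ballI has_derivative_continuous[OF dg1])
    then have "(\<lambda>y. g1 y \<theta>) \<in> borel_measurable borel" by (rule
        borel_measurable_continuous_onI)
    then show "\<phi> \<theta> \<in> borel_measurable lborel" unfolding \<phi>_def using meas[OF \<theta>]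
        by measurable
    show "AE y in lborel. norm (\<phi> \<theta> y) \<le> norm (N * C * (1 / (1 + norm y) ^ (CARD('n) + 2)))"
      unfolding real_norm_def by (intro AE_I2 order_trans[OF b\<phi>[OF \<theta>] abs_ge_self])
  qed
  define \<Phi> where "\<Phi> \<theta> = (\<integral>y. \<phi> \<theta> y \<partial>lborel)" for \<theta>
  have d\<Phi>: "(\<Phi> has_derivative (\<lambda>e. 0)) (at \<theta>)" if \<theta>:
      "\<theta> \<in> \<Theta>" for \<theta>
  proof -
    from \<Theta>(1) \<theta> obtain r where r: "r > 0" "ball \<theta> r \<subseteq> \<Theta>" using openE
        by blast
    have "(\<Phi> has_derivative (\<lambda>e. \<integral>y. \<phi>' \<theta> y e \<partial>lborel)) (at
        \<theta>)"
      unfolding \<Phi>_def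
      by (rule has_derivative_integral(2)[OF r(1) int\<phi> d\<phi> b\<phi>' N]) (use r(2) in auto)
    moreover have "(\<integral>y. \<phi>' \<theta> y e \<partial>lborel) = 0" for e
    proof -
      have "\<phi>' \<theta> y e = of_real 1 * (\<i> * of_real (g y) * f' \<theta> y (cvec e 0) * (1 + \<i>
          * of_real (g1 y \<theta>))
          + \<i> * of_real (g1 y e) * f (cvec y (g y *\<^sub>R \<theta>))) + \<i> * of_real (0 * g y) * f
              (cvec y (g y *\<^sub>R \<theta>))" for y
        using off[of y] by (simp add: \<phi>'_def)
      moreover have "(\<integral>y. of_real 1 * (\<i> * of_real (g y) * f' \<theta> y (cvec e 0) * (1 + \<i>
          * of_real (g1 y \<theta>))
          + \<i> * of_real (g1 y e) * f (cvec y (g y *\<^sub>R \<theta>))) + \<i> * of_real (0 * g y) * f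
              (cvec y (g y *\<^sub>R \<theta>)) \<partial>lborel) = 0"
        by (rule integral_contour_variation(2)[where A="\<lambda>_. 1" and ?A1.0="\<lambda>_ _. 0" and S=S
            and C=C, OF g])
          (use f[OF \<theta>] lin[OF \<theta>] bd[OF \<theta>] bd'[OF \<theta>] off G in auto)
      ultimately show ?thesis by simp
    qed
    ultimately show ?thesis by simp
  qed
  have "\<Phi> \<theta>0 = \<Phi> \<theta>1"
  proof -
    have "\<exists>c. \<forall>\<theta>\<in>\<Theta>. \<Phi> \<theta> = c"
      by (rule has_derivative_zero_constant[OF \<Theta>(2)]) (use d\<Phi> has_derivative_at_withinI in
          blast)
    then show ?thesis using \<open>\<theta>0 \<in> \<Theta>\<close> \<open>\<theta>1 \<in> \<Theta>\<close>
        by metis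
  qed
  then show ?thesis by (simp add: \<Phi>_def \<phi>_def)
qed

section \<open>Cut-off functions\<close>

lemma DERIV_pos_part_cube: "((\<lambda>t. (max 0 (t::real)) ^ 3) has_real_derivative 3 * (max 0 t) ^ 2) (at
    t)"
  and DERIV_pos_part_square: "((\<lambda>t. (max 0 (t::real)) ^ 2) has_real_derivative 2 * max 0 t) (at t)"
proof -
  have *: "((\<lambda>t. (max 0 (t::real)) ^ Suc (Suc k)) has_real_derivative real (Suc (Suc k)) * (max 0 t)
      ^ Suc k) (at t)" for k
  proof -
    consider "t < 0" | "t > 0" | "t = 0" by linarith
    then show ?thesis
    proof cases
      case 1
      have "((\<lambda>t. 0::real) has_real_derivative 0) (at t)" by simp
      then have "((\<lambda>t. (max 0 (t::real)) ^ Suc (Suc k)) has_real_derivative 0) (at t)"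
        by (rule has_field_derivative_transform_within_open[where S="{..<0}"]) (use 1 in auto)
      then show ?thesis using 1 by simp
    next
      case 2
      have "((\<lambda>t. t ^ Suc (Suc k)) has_real_derivative real (Suc (Suc k)) * t ^ Suc k) (at t)"
        by (rule derivative_eq_intros refl | simp)+
      then have "((\<lambda>t. (max 0 (t::real)) ^ Suc (Suc k)) has_real_derivative real (Suc (Suc k)) * t ^
          Suc k) (at t)"
        by (rule has_field_derivative_transform_within_open[where S="{0<..}"]) (use 2 in auto)
      then show ?thesis using 2 by simp
    next
      case 3
      have "((\<lambda>h. (max 0 h) ^ Suc (Suc k) / h) \<longlongrightarrow> 0) (at (0::real))"
      proof (rule tendsto_norm_zero_cancel, rule tendsto_sandwich[OF _ _ tendsto_const])
        show "((\<lambda>h. \<bar>h\<bar> ^ Suc k) \<longlongrightarrow> 0) (at (0::real))"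
          by (rule tendsto_eq_intros refl | simp)+
        show "\<forall>\<^sub>F h in at (0::real). norm ((max 0 h) ^ Suc (Suc k) / h) \<le> \<bar>h\<bar> ^
            Suc k"
        proof (intro always_eventually allI)
          fix h :: real
          show "norm ((max 0 h) ^ Suc (Suc k) / h) \<le> \<bar>h\<bar> ^ Suc k"
          proof (cases "h \<le> 0")
            case True
            then have "(max 0 h) ^ Suc (Suc k) / h = 0" by simp
            then show ?thesis using zero_le_power[of "\<bar>h\<bar>" "Suc k"] by (simp only: norm_zero)
          qed (simp add: max_def abs_mult)
        qed
      qed auto
      then show ?thesis using 3 by (simp add: DERIV_def)
    qed
  qed
  show "((\<lambda>t. (max 0 (t::real)) ^ 3) has_real_derivative 3 * (max 0 t) ^ 2) (at t)"
    using *[of 1] by (simp add: numeral_3_eq_3 numeral_2_eq_2)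
  show "((\<lambda>t. (max 0 (t::real)) ^ 2) has_real_derivative 2 * max 0 t) (at t)"
    using *[of 0] by (simp add: numeral_2_eq_2)
qed

text \<open>The step is a difference of two ramps, smoothed by a quadratic B-spline.\<close>

lemma C2_step_real:
  fixes a b \<rho> :: real
  assumes ab: "a < b" and \<rho>: "\<rho> > 1"
  obtains \<phi> \<phi>1 \<phi>2 B where
    "\<And>t. (\<phi> has_real_derivative \<phi>1 t) (at t)"
        "\<And>t. (\<phi>1 has_real_derivative \<phi>2 t) (at t)"
    "\<And>t. t \<le> a \<Longrightarrow> \<phi> t = 0" "\<And>t. t \<ge> b \<Longrightarrow> \<phi> t = 1"
    "\<And>t. t \<le> a \<or> t \<ge> b \<Longrightarrow> \<phi>1 t = 0"
        "\<And>t. t \<le> a \<or> t \<ge> b \<Longrightarrow> \<phi>2 t = 0"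
    "\<And>t. 0 \<le> \<phi> t" "\<And>t. \<phi> t \<le> 1" "\<And>t. t \<ge> a \<Longrightarrow> \<phi> t
        \<le> \<rho> * ((t - a) / (b - a))"
    "\<And>t. \<bar>\<phi>1 t\<bar> \<le> B" "\<And>t. \<bar>\<phi>2 t\<bar> \<le> B"
proof -
  \<comment> \<open>A ramp of length \<open>l\<close> has slope \<open>\<rho> / (b - a)\<close>,
    slightly more than the chord from a to b; the length saved, \<open>2 * h\<close>, is spent on
    smoothing.\<close>
  define l where "l = (b - a) / \<rho>"
  have l: "l > 0" using ab \<rho> by (simp add: l_def)
  have lb: "l < b - a"
    using mult_strict_left_mono[OF \<rho>, of "b - a"] ab \<rho> by (simp add: l_def divide_less_eq)
  define h where "h = (b - a - l) / 2"
  have h: "h > 0" using lb by (simp add: h_def)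
  have bh: "b = a + l + 2 * h" by (simp add: h_def field_simps)
  \<comment> \<open>\<open>P2\<close> is the tent of integral one on [0, 2h], and \<open>P\<close>
    its second antiderivative: a twice differentiable ramp, 0 up to 0 and t - h from 2h on. The step
    is the difference quotient of \<open>P\<close> with spacing \<open>l\<close>; its values lie in
    [0, 1] because \<open>P\<close> is nondecreasing with slope at most 1.\<close>
  define P where "P t = ((max 0 t) ^ 3 - 2 * (max 0 (t - h)) ^ 3 + (max 0 (t - 2 * h)) ^ 3) / (6 *
      h\<^sup>2)" for t
  define P1 where "P1 t = ((max 0 t) ^ 2 - 2 * (max 0 (t - h)) ^ 2 + (max 0 (t - 2 * h)) ^ 2) / (2 *
      h\<^sup>2)" for t
  define P2 where "P2 t = ((max 0 t) - 2 * (max 0 (t - h)) + (max 0 (t - 2 * h))) / h\<^sup>2" for t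
  have c3: "((\<lambda>t. (max 0 (t - c)) ^ 3) has_real_derivative 3 * (max 0 (t - c)) ^ 2) (at t)" for c t
      :: real
    by (rule DERIV_cong[OF DERIV_chain2[OF DERIV_pos_part_cube DERIV_diff[OF DERIV_ident DERIV_const]]])
        simp
  have c2: "((\<lambda>t. (max 0 (t - c)) ^ 2) has_real_derivative 2 * (max 0 (t - c))) (at t)" for c t ::
      real
    by (rule DERIV_cong[OF DERIV_chain2[OF DERIV_pos_part_square DERIV_diff[OF DERIV_ident DERIV_const]]])
        simp
  have dP: "(P has_real_derivative P1 t) (at t)" for t
  proof -
    have "(P has_real_derivative (3 * (max 0 t) ^ 2 - 2 * (3 * (max 0 (t - h)) ^ 2) + 3 * (max 0 (t - 2 *
        h)) ^ 2) / (6 * h\<^sup>2)) (at t)"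
      unfolding P_def by (intro DERIV_cdivide DERIV_add DERIV_diff DERIV_cmult c3 DERIV_pos_part_cube)
    then show ?thesis by (rule DERIV_cong) (use h in \<open>simp add: P1_def field_simps\<close>)
  qed
  have dP1: "(P1 has_real_derivative P2 t) (at t)" for t
  proof -
    have "(P1 has_real_derivative (2 * (max 0 t) - 2 * (2 * (max 0 (t - h))) + 2 * (max 0 (t - 2 * h))) / (2
        * h\<^sup>2)) (at t)"
      unfolding P1_def by (intro DERIV_cdivide DERIV_add DERIV_diff DERIV_cmult c2 DERIV_pos_part_square)
    then show ?thesis by (rule DERIV_cong) (use h in \<open>simp add: P2_def field_simps\<close>)
  qed
  have P2b: "0 \<le> P2 t" "P2 t \<le> 1 / h" for t
  proof -
    have "0 \<le> max 0 t - 2 * max 0 (t - h) + max 0 (t - 2 * h)"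
        "max 0 t - 2 * max 0 (t - h) + max 0 (t - 2 * h) \<le> h"
      using h by (auto simp: max_def)
    then have "0 / h\<^sup>2 \<le> P2 t" "P2 t \<le> h / h\<^sup>2" unfolding P2_def by (intro
        divide_right_mono; simp)+
    then show "0 \<le> P2 t" "P2 t \<le> 1 / h" using h by (simp_all add: power2_eq_square)
  qed
  have P2z: "P2 t = 0" if "t \<le> 0 \<or> t \<ge> 2 * h" for t using that h by (auto simp: P2_def max_def)
  have P1z: "P1 t = 0" if "t \<le> 0" for t using that h by (auto simp: P1_def max_def)
  have P1o: "P1 t = 1" if "t \<ge> 2 * h" for t
    using that h by (auto simp: P1_def max_def field_simps power2_eq_square)
  have Pz: "P t = 0" if "t \<le> 0" for t using that h by (auto simp: P_def max_def)
  have Po: "P t = t - h" if "t \<ge> 2 * h" for t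
  proof -
    have "t ^ 3 - 2 * (t - h) ^ 3 + (t - 2 * h) ^ 3 = (t - h) * (6 * h\<^sup>2)"
      by (simp add: power3_eq_cube power2_eq_square algebra_simps)
    then show ?thesis using that h by (simp add: P_def max_def)
  qed
  have P1mono: "P1 s \<le> P1 t" if "s \<le> t" for s t
    by (rule DERIV_nonneg_imp_nondecreasing[OF that]) (use dP1 P2b in blast)
  have P1b: "0 \<le> P1 t" "P1 t \<le> 1" for t
    using P1mono[of "min 0 t" t] P1z[of "min 0 t"] P1mono[of t "max t (2 * h)"] P1o[of "max t (2 * h)"] by
        auto
  have Pmono: "P s \<le> P t" if "s \<le> t" for s t
    by (rule DERIV_nonneg_imp_nondecreasing[OF that]) (use dP P1b in blast)
  have Plip: "P t - P s \<le> t - s" if "s \<le> t" for s t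
  proof -
    have "s - P s \<le> t - P t"
    proof (rule DERIV_nonneg_imp_nondecreasing[OF that])
      fix x
      show "\<exists>y. ((\<lambda>x. x - P x) has_real_derivative y) (at x) \<and> 0 \<le> y"
        by (intro exI[of _ "1 - P1 x"] conjI DERIV_diff DERIV_ident dP) (use P1b in auto)
    qed
    then show ?thesis by linarith
  qed
  define \<phi> where "\<phi> t = (P (t - a) - P (t - (a + l))) / l" for t
  define \<phi>1 where "\<phi>1 t = (P1 (t - a) - P1 (t - (a + l))) / l" for t
  define \<phi>2 where "\<phi>2 t = (P2 (t - a) - P2 (t - (a + l))) / l" for t
  have sh: "((\<lambda>t. f (t - c)) has_real_derivative f' (t - c)) (at t)"
    if "\<And>t. (f has_real_derivative f' t) (at t)" for f f' :: "real \<Rightarrow> real" and c t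
    by (rule DERIV_cong[OF DERIV_chain2[OF that DERIV_diff[OF DERIV_ident DERIV_const]]]) simp
  show thesis
  proof (rule that[of \<phi> \<phi>1 \<phi>2 "1 / l + 1 / h / l"])
    fix t
    show "(\<phi> has_real_derivative \<phi>1 t) (at t)" unfolding \<phi>_def \<phi>1_def
      by (intro DERIV_cdivide DERIV_diff sh dP)
    show "(\<phi>1 has_real_derivative \<phi>2 t) (at t)" unfolding \<phi>1_def \<phi>2_def
      by (intro DERIV_cdivide DERIV_diff sh dP1)
    show "\<phi> t = 0" if "t \<le> a" using that l by (simp add: \<phi>_def Pz)
    show "\<phi> t = 1" if "t \<ge> b" using that l h by (simp add: \<phi>_def Po bh)
    show "\<phi>1 t = 0" if "t \<le> a \<or> t \<ge> b" using that l h by (auto simp: \<phi>1_def P1z P1o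
        bh)
    show "\<phi>2 t = 0" if "t \<le> a \<or> t \<ge> b" using that l h by (auto simp: \<phi>2_def P2z bh)
    show "0 \<le> \<phi> t" using Pmono[of "t - (a + l)" "t - a"] l by (simp add: \<phi>_def)
    show "\<phi> t \<le> 1" using Plip[of "t - (a + l)" "t - a"] l by (simp add: \<phi>_def)
    show "\<phi> t \<le> \<rho> * ((t - a) / (b - a))" if "t \<ge> a"
    proof -
      have "P (t - a) \<le> t - a" using Plip[of 0 "t - a"] Pz[of 0] that by simp
      moreover have "P (t - (a + l)) \<ge> 0"
        using Pmono[of "min 0 (t - (a + l))" "t - (a + l)"] Pz[of "min 0 (t - (a + l))"] by simp
      ultimately have "\<phi> t \<le> (t - a) / l" using l unfolding \<phi>_def by (intro divide_right_mono)
          auto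
      also have "\<dots> = \<rho> * ((t - a) / (b - a))" using \<rho> ab by (simp add: l_def)
      finally show ?thesis .
    qed
    have "\<bar>P1 (t - a) - P1 (t - (a + l))\<bar> \<le> 1" using P1b[of "t - a"] P1b[of "t - (a + l)"] by
        linarith
    then have "\<bar>\<phi>1 t\<bar> \<le> 1 / l" using l by (simp add: \<phi>1_def abs_divide
        divide_right_mono)
    then show "\<bar>\<phi>1 t\<bar> \<le> 1 / l + 1 / h / l" using h l by (simp add: add_increasing2)
    have "\<bar>P2 (t - a) - P2 (t - (a + l))\<bar> \<le> 1 / h" using P2b[of "t - a"] P2b[of "t - (a + l)"]
        by linarith
    from divide_right_mono[OF this, of l] have "\<bar>\<phi>2 t\<bar> \<le> 1 / h / l" using l unfolding
        \<phi>2_def abs_divide by simp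
    then show "\<bar>\<phi>2 t\<bar> \<le> 1 / l + 1 / h / l" using h l by (simp add: add_increasing)
  qed
qed

text \<open>Profiles are written in t = |y|^2, which is smooth at the origin where the norm is not.
  The bounds then become inequalities in one real variable r = |y|.\<close>

lemma C2_fun_radial:
  fixes \<gamma> \<gamma>1 \<gamma>2 :: "real \<Rightarrow> real"
  assumes d: "\<And>t. t \<ge> 0 \<Longrightarrow> (\<gamma> has_real_derivative \<gamma>1 t) (at t)"
    and d1: "\<And>t. t \<ge> 0 \<Longrightarrow> (\<gamma>1 has_real_derivative \<gamma>2 t) (at t)"
    and b: "\<And>r. r \<ge> 0 \<Longrightarrow> \<bar>\<gamma> (r\<^sup>2)\<bar> \<le> G * (1 + r)"
    and b1: "\<And>r. r \<ge> 0 \<Longrightarrow> \<bar>\<gamma>1 (r\<^sup>2)\<bar> * (2 * r) \<le> G"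
    and b2: "\<And>r. r \<ge> 0 \<Longrightarrow> \<bar>\<gamma>2 (r\<^sup>2)\<bar> * (4 * r\<^sup>2) +
        \<bar>\<gamma>1 (r\<^sup>2)\<bar> * 2 \<le> G"
  shows "C2_fun (\<lambda>y :: real ^ 'n::finite. \<gamma> (y \<bullet> y)) (\<lambda>y v. \<gamma>1 (y
      \<bullet> y) * (2 * (y \<bullet> v)))
    (\<lambda>y v u. \<gamma>2 (y \<bullet> y) * (2 * (y \<bullet> u)) * (2 * (y \<bullet> v)) + \<gamma>1
        (y \<bullet> y) * (2 * (u \<bullet> v))) G"
  unfolding C2_fun_def
proof (intro conjI allI)
  fix y u v :: "real ^ 'n"
  have yy: "y \<bullet> y = (norm y)\<^sup>2" by (simp add: power2_norm_eq_inner)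
  have q: "((\<lambda>y. y \<bullet> y) has_derivative (\<lambda>v. 2 * (y \<bullet> v))) (at y)"
    by (auto intro!: derivative_eq_intros simp: inner_commute)
  show "((\<lambda>y. \<gamma> (y \<bullet> y)) has_derivative (\<lambda>v. \<gamma>1 (y \<bullet> y) * (2 *
      (y \<bullet> v)))) (at y)"
    using has_derivative_compose[OF q, of \<gamma> "(*) (\<gamma>1 (y \<bullet> y))"] d[of "y \<bullet> y"]
        by (simp add: has_field_derivative_def)
  have q1: "((\<lambda>y. \<gamma>1 (y \<bullet> y)) has_derivative (\<lambda>v. \<gamma>2 (y \<bullet> y) *
      (2 * (y \<bullet> v)))) (at y)"
    using has_derivative_compose[OF q, of \<gamma>1 "(*) (\<gamma>2 (y \<bullet> y))"] d1[of
        "y \<bullet> y"] by (simp add: has_field_derivative_def)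
  have "((\<lambda>y. \<gamma>1 (y \<bullet> y) * (2 * (y \<bullet> v))) has_derivative
      (\<lambda>u. \<gamma>1 (y \<bullet> y) * (2 * (u \<bullet> v)) + \<gamma>2 (y \<bullet> y) * (2 * (y
          \<bullet> u)) * (2 * (y \<bullet> v)))) (at y)"
    by (rule has_derivative_mult[OF q1]) (auto intro!: derivative_eq_intros)
  then show "((\<lambda>y. \<gamma>1 (y \<bullet> y) * (2 * (y \<bullet> v))) has_derivative
      (\<lambda>u. \<gamma>2 (y \<bullet> y) * (2 * (y \<bullet> u)) * (2 * (y \<bullet> v)) + \<gamma>1 (y
          \<bullet> y) * (2 * (u \<bullet> v)))) (at y)"
    by (simp add: add.commute)
  show "\<gamma>2 (y \<bullet> y) * (2 * (y \<bullet> v)) * (2 * (y \<bullet> u)) + \<gamma>1 (y \<bullet>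
      y) * (2 * (v \<bullet> u)) =
      \<gamma>2 (y \<bullet> y) * (2 * (y \<bullet> u)) * (2 * (y \<bullet> v)) + \<gamma>1 (y \<bullet> y)
          * (2 * (u \<bullet> v))"
    by (simp add: inner_commute mult_ac)
  show "\<bar>\<gamma> (y \<bullet> y)\<bar> \<le> G * (1 + norm y)" using b[of "norm y"] by (simp add: yy)
  have "\<bar>\<gamma>1 (y \<bullet> y) * (2 * (y \<bullet> v))\<bar> \<le> \<bar>\<gamma>1 ((norm
      y)\<^sup>2)\<bar> * (2 * (norm y * norm v))"
    unfolding abs_mult yy by (intro mult_left_mono) (auto simp: Cauchy_Schwarz_ineq2)
  also have "\<dots> = (\<bar>\<gamma>1 ((norm y)\<^sup>2)\<bar> * (2 * norm y)) * norm v" by simp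
  also have "\<dots> \<le> G * norm v" by (intro mult_right_mono b1) auto
  finally show "\<bar>\<gamma>1 (y \<bullet> y) * (2 * (y \<bullet> v))\<bar> \<le> G * norm v" .
  have "\<bar>\<gamma>2 (y \<bullet> y) * (2 * (y \<bullet> v)) * (2 * (y \<bullet> u)) + \<gamma>1 (y
      \<bullet> y) * (2 * (v \<bullet> u))\<bar> \<le>
      \<bar>\<gamma>2 (y \<bullet> y)\<bar> * (2 * \<bar>y \<bullet> v\<bar>) * (2 * \<bar>y \<bullet>
          u\<bar>) + \<bar>\<gamma>1 (y \<bullet> y)\<bar> * (2 * \<bar>v \<bullet> u\<bar>)"
    using abs_triangle_ineq[of "\<gamma>2 (y \<bullet> y) * (2 * (y \<bullet> v)) * (2 * (y \<bullet> u))"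
        "\<gamma>1 (y \<bullet> y) * (2 * (v \<bullet> u))"]
    by (simp only: abs_mult abs_numeral)
  also have "\<dots> \<le> \<bar>\<gamma>2 (y \<bullet> y)\<bar> * (2 * (norm y * norm v)) * (2 * (norm y *
      norm u)) + \<bar>\<gamma>1 (y \<bullet> y)\<bar> * (2 * (norm v * norm u))"
    by (intro add_mono mult_mono Cauchy_Schwarz_ineq2) auto
  also have "\<dots> = (\<bar>\<gamma>2 ((norm y)\<^sup>2)\<bar> * (4 * (norm y)\<^sup>2) + \<bar>\<gamma>1
      ((norm y)\<^sup>2)\<bar> * 2) * (norm u * norm v)"
    by (simp add: yy algebra_simps power2_eq_square)
  also have "\<dots> \<le> G * (norm u * norm v)" by (intro mult_right_mono b2) auto
  finally show "\<bar>\<gamma>2 (y \<bullet> y) * (2 * (y \<bullet> v)) * (2 * (y \<bullet> u)) + \<gamma>1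
      (y \<bullet> y) * (2 * (v \<bullet> u))\<bar> \<le> G * norm u * norm v"
    by (simp add: mult.assoc)
qed

text \<open>The last conclusion is the quantitative one: the descent costs at most
  \<open>\<rho>\<close> times the slope of the chord, with \<open>\<rho>\<close> as close to 1 as
  desired. The bound passes from |y|^2 to |y| because a convex function lies below its
  chord.\<close>

lemma C2_cutoff:
  fixes a b \<rho> :: real
  assumes a: "0 < a" and ab: "a < b" and \<rho>: "\<rho> > 1"
  obtains g :: "real ^ 'n::finite \<Rightarrow> real" and g1 g2 G where "C2_fun g g1 g2 G"
    "\<And>y. norm y \<le> a \<Longrightarrow> g y = 1" "\<And>y v. norm y \<le> a \<Longrightarrow> g1 y v
        = 0"
    "\<And>y. norm y \<ge> b \<Longrightarrow> g y = 0" "\<And>y v. norm y \<ge> b \<Longrightarrow> g1 y v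
        = 0"
    "\<And>y. 0 \<le> g y" "\<And>y. g y \<le> 1"
    "\<And>y. norm y \<ge> a \<Longrightarrow> 1 - g y \<le> \<rho> * ((norm y - a) / (b - a))"
proof -
  have ab2: "a\<^sup>2 < b\<^sup>2" using a ab by (simp add: power_strict_mono)
  show thesis
  proof (rule C2_step_real[OF ab2 \<rho>])
  fix \<phi> \<phi>1 \<phi>2 B
  assume \<phi>: "\<And>t. (\<phi> has_real_derivative \<phi>1 t) (at t)"
      "\<And>t. (\<phi>1 has_real_derivative \<phi>2 t) (at t)"
    "\<And>t. t \<le> a\<^sup>2 \<Longrightarrow> \<phi> t = 0"
        "\<And>t. t \<ge> b\<^sup>2 \<Longrightarrow> \<phi> t = 1"
    "\<And>t. t \<le> a\<^sup>2 \<or> t \<ge> b\<^sup>2 \<Longrightarrow> \<phi>1 t = 0"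
        "\<And>t. t \<le> a\<^sup>2 \<or> t \<ge> b\<^sup>2 \<Longrightarrow> \<phi>2 t = 0"
    "\<And>t. 0 \<le> \<phi> t" "\<And>t. \<phi> t \<le> 1" "\<And>t. t \<ge> a\<^sup>2 \<Longrightarrow>
        \<phi> t \<le> \<rho> * ((t - a\<^sup>2) / (b\<^sup>2 - a\<^sup>2))"
    "\<And>t. \<bar>\<phi>1 t\<bar> \<le> B" "\<And>t. \<bar>\<phi>2 t\<bar> \<le> B"

  have B: "B \<ge> 0" using \<phi>(10)[of 0] by linarith
  define G where "G = 1 + B * (2 * b) + (B * (4 * b\<^sup>2) + B * 2)"
  have G: "G \<ge> 1" "G \<ge> B * (2 * b)" "G \<ge> B * (4 * b\<^sup>2) + B * 2"
    using B a ab by (auto simp: G_def)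
  have C: "C2_fun (\<lambda>y :: real ^ 'n. 1 - \<phi> (y \<bullet> y)) (\<lambda>y v. - \<phi>1 (y
      \<bullet> y) * (2 * (y \<bullet> v)))
    (\<lambda>y v u. - \<phi>2 (y \<bullet> y) * (2 * (y \<bullet> u)) * (2 * (y \<bullet> v)) + - \<phi>1
        (y \<bullet> y) * (2 * (u \<bullet> v))) G"
  proof (rule C2_fun_radial[where \<gamma>="\<lambda>t. 1 - \<phi> t" and
      ?\<gamma>1.0="\<lambda>t. - \<phi>1 t" and ?\<gamma>2.0="\<lambda>t. - \<phi>2 t"])
    show "((\<lambda>t. 1 - \<phi> t) has_real_derivative - \<phi>1 t) (at t)" for t
      by (rule derivative_eq_intros \<phi>(1) refl | simp)+
    show "((\<lambda>t. - \<phi>1 t) has_real_derivative - \<phi>2 t) (at t)" for t by (rule DERIV_minus[OF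
        \<phi>(2)])
    fix r :: real assume r: "r \<ge> 0"
    have "\<bar>1 - \<phi> (r\<^sup>2)\<bar> \<le> 1" using \<phi>(7)[of "r\<^sup>2"] \<phi>(8)[of
        "r\<^sup>2"] by linarith
    also have "1 \<le> G * (1 + r)" using mult_mono[of 1 G 1 "1 + r"] G(1) r by simp
    finally show "\<bar>1 - \<phi> (r\<^sup>2)\<bar> \<le> G * (1 + r)" .
    show "\<bar>- \<phi>1 (r\<^sup>2)\<bar> * (2 * r) \<le> G"
    proof (cases "r \<ge> b")
      case True
      then have "r\<^sup>2 \<ge> b\<^sup>2" using a ab by (simp add: power_mono)
      then show ?thesis using \<phi>(5) G by simp
    next
      case False
      then have "\<bar>\<phi>1 (r\<^sup>2)\<bar> * (2 * r) \<le> B * (2 * b)" using r B by (intro mult_mono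
          \<phi>(10)) auto
      then show ?thesis using G by simp
    qed
    show "\<bar>- \<phi>2 (r\<^sup>2)\<bar> * (4 * r\<^sup>2) + \<bar>- \<phi>1 (r\<^sup>2)\<bar> * 2 \<le>
        G"
    proof (cases "r \<ge> b")
      case True
      then have "r\<^sup>2 \<ge> b\<^sup>2" using a ab by (simp add: power_mono)
      then show ?thesis using \<phi>(5,6) G by simp
    next
      case False
      then have "\<bar>\<phi>2 (r\<^sup>2)\<bar> * (4 * r\<^sup>2) + \<bar>\<phi>1 (r\<^sup>2)\<bar> * 2
          \<le> B * (4 * b\<^sup>2) + B * 2"
        using r B by (intro add_mono mult_mono \<phi>(10,11)) (auto simp: power_mono)
      then show ?thesis using G by simp
    qed
  qed
  have sq: "y \<bullet> y = (norm y)\<^sup>2" for y :: "real ^ 'n" by (simp add: power2_norm_eq_inner)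
  show thesis
  proof (rule that[OF C])
    fix y v :: "real ^ 'n"
    show "1 - \<phi> (y \<bullet> y) = 1" "- \<phi>1 (y \<bullet> y) * (2 * (y \<bullet> v)) = 0" if
        "norm y \<le> a"
    proof -
      have "y \<bullet> y \<le> a\<^sup>2" unfolding sq using that by (simp add: power_mono)
      then show "1 - \<phi> (y \<bullet> y) = 1" "- \<phi>1 (y \<bullet> y) * (2 * (y \<bullet> v)) = 0" by
          (simp_all add: \<phi>)
    qed
    show "1 - \<phi> (y \<bullet> y) = 0" "- \<phi>1 (y \<bullet> y) * (2 * (y \<bullet> v)) = 0" if
        "norm y \<ge> b"
    proof -
      have "y \<bullet> y \<ge> b\<^sup>2" unfolding sq using that a ab by (simp add: power_mono)
      then show "1 - \<phi> (y \<bullet> y) = 0" "- \<phi>1 (y \<bullet> y) * (2 * (y \<bullet> v)) = 0" by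
          (simp_all add: \<phi>)
    qed
    show "0 \<le> 1 - \<phi> (y \<bullet> y)" "1 - \<phi> (y \<bullet> y) \<le> 1" using \<phi>(7,8) by
        simp_all
    assume y: "norm y \<ge> a"
    show "1 - (1 - \<phi> (y \<bullet> y)) \<le> \<rho> * ((norm y - a) / (b - a))"
    proof (cases "norm y \<ge> b")
      case True
      then have "1 \<le> (norm y - a) / (b - a)" using ab by simp
      then have "1 * 1 \<le> \<rho> * ((norm y - a) / (b - a))" using \<rho> by (intro mult_mono) auto
      then show ?thesis using \<phi>(8)[of "y \<bullet> y"] by simp
    next
      case False
      have "(norm y)\<^sup>2 \<ge> a\<^sup>2" using y a by (simp add: power_mono)
      from \<phi>(9)[OF this] have "\<phi> (y \<bullet> y) \<le> \<rho> * (((norm y)\<^sup>2 - a\<^sup>2) /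
          (b\<^sup>2 - a\<^sup>2))" by (simp only: sq)
      also have "\<dots> \<le> \<rho> * ((norm y - a) / (b - a))"
      proof (rule mult_left_mono)
        have "((norm y)\<^sup>2 - a\<^sup>2) / (b\<^sup>2 - a\<^sup>2) = ((norm y - a) / (b - a)) * ((norm y
            + a) / (b + a))"
          by (simp add: power2_eq_square algebra_simps)
        also have "\<dots> \<le> ((norm y - a) / (b - a)) * 1"
          using False y a ab by (intro mult_left_mono) auto
        finally show "((norm y)\<^sup>2 - a\<^sup>2) / (b\<^sup>2 - a\<^sup>2) \<le> (norm y - a) / (b - a)"
            by simp
      qed (use \<rho> in auto)
      finally show ?thesis by simp
    qed
  qed
  qed
qed

text \<open>The profile is \<kappa> (sqrt(1 + |y|^2) - 1), a smooth substitute for \<kappa> |y|,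
  times a step that switches it on between \<open>R1\<close> and \<open>R1 + 1\<close>. The upper
  bound keeps the contour in the cone where the symbol is holomorphic, the lower bound yields the
  exponential decay, and \<open>K\<close> collects the loss in the transition zone.\<close>

lemma C2_linear_growth:
  fixes R1 \<kappa> :: real
  assumes R1: "R1 > 0" and \<kappa>: "\<kappa> > 0"
  obtains g :: "real ^ 'n::finite \<Rightarrow> real" and g1 g2 G K where "C2_fun g g1 g2 G" "K \<ge> 0"
    "\<And>y. norm y \<le> R1 \<Longrightarrow> g y = 0" "\<And>y v. norm y \<le> R1 \<Longrightarrow> g1 y
        v = 0"
    "\<And>y. 0 \<le> g y" "\<And>y. g y \<le> \<kappa> * norm y" "\<And>y. g y \<ge> \<kappa> * norm y - K"
proof -
  define b where "b = R1 + 1"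
  have b: "b > 0" "R1\<^sup>2 < b\<^sup>2" using R1 by (auto simp: b_def power_strict_mono)
  have "(2::real) > 1" by simp
  show thesis
  proof (rule C2_step_real[OF b(2) \<open>2 > 1\<close>])
  fix \<phi> \<phi>1 \<phi>2 B
  assume \<phi>: "\<And>t. (\<phi> has_real_derivative \<phi>1 t) (at t)"
      "\<And>t. (\<phi>1 has_real_derivative \<phi>2 t) (at t)"
    "\<And>t. t \<le> R1\<^sup>2 \<Longrightarrow> \<phi> t = 0"
        "\<And>t. t \<ge> b\<^sup>2 \<Longrightarrow> \<phi> t = 1"
    "\<And>t. t \<le> R1\<^sup>2 \<or> t \<ge> b\<^sup>2 \<Longrightarrow> \<phi>1 t = 0"
        "\<And>t. t \<le> R1\<^sup>2 \<or> t \<ge> b\<^sup>2 \<Longrightarrow> \<phi>2 t = 0"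
    "\<And>t. 0 \<le> \<phi> t" "\<And>t. \<phi> t \<le> 1"
    "\<And>t. t \<ge> R1\<^sup>2 \<Longrightarrow> \<phi> t \<le> 2 * ((t - R1\<^sup>2) / (b\<^sup>2 -
        R1\<^sup>2))"
    "\<And>t. \<bar>\<phi>1 t\<bar> \<le> B" "\<And>t. \<bar>\<phi>2 t\<bar> \<le> B"

  have B: "B \<ge> 0" using \<phi>(10)[of 0] by linarith
  define s where "s t = sqrt (1 + t)" for t
  define \<gamma> where "\<gamma> t = \<kappa> * (\<phi> t * (s t - 1))" for t
  define \<gamma>1 where "\<gamma>1 t = \<kappa> * (\<phi>1 t * (s t - 1) + \<phi> t * (1 / (2 * s t)))" for
      t
  define \<gamma>2 where "\<gamma>2 t = \<kappa> * (\<phi>2 t * (s t - 1) + \<phi>1 t * (1 / s t) - \<phi> t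
      * (1 / (4 * (s t) ^ 3)))" for t
  have s1: "s t \<ge> 1" if "t \<ge> 0" for t using that by (simp add: s_def)
  have ds: "(s has_real_derivative 1 / (2 * s t)) (at t)" if "t \<ge> 0" for t
    unfolding s_def using that by (auto intro!: derivative_eq_intros simp: field_simps)
  have d: "(\<gamma> has_real_derivative \<gamma>1 t) (at t)" if "t \<ge> 0" for t
    unfolding \<gamma>_def \<gamma>1_def
    by (rule derivative_eq_intros \<phi>(1) ds[OF that] refl)+ (simp add: algebra_simps)
  have d1: "(\<gamma>1 has_real_derivative \<gamma>2 t) (at t)" if t: "t \<ge> 0" for t
  proof -
    have e1: "((\<lambda>t. 1 / (2 * s t)) has_real_derivative - (1 / (4 * (s t) ^ 3))) (at t)"
      using s1[OF t]
      by (auto intro!: derivative_eq_intros ds[OF t] simp: power2_eq_square power3_eq_cube)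
    have "(\<gamma>1 has_real_derivative \<kappa> * ((\<phi>2 t * (s t - 1) + (1 / (2 * s t) - 0) * \<phi>1
        t) +
        (\<phi>1 t * (1 / (2 * s t)) + - (1 / (4 * (s t) ^ 3)) * \<phi> t))) (at t)"
      unfolding \<gamma>1_def
      by (intro DERIV_cmult DERIV_add DERIV_mult DERIV_diff DERIV_const \<phi>(1,2) ds[OF t] e1)
    then show ?thesis
      by (rule DERIV_cong) (use s1[OF t] in \<open>simp add: \<gamma>2_def algebra_simps\<close>)
  qed
  have sr: "s (r\<^sup>2) \<ge> r" "s (r\<^sup>2) \<le> 1 + r" if "r \<ge> 0" for r
  proof -
    show "s (r\<^sup>2) \<ge> r" unfolding s_def by (rule real_le_rsqrt) simp
    show "s (r\<^sup>2) \<le> 1 + r" unfolding s_def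
      using that by (intro real_le_lsqrt) (auto simp: power2_sum)
  qed
  define G where "G = \<kappa> * (1 + (B * (2 * b * b) + 1) + ((B * b + B + 1) * (4 * b\<^sup>2) + 1) + ((B
      * b + 1) * 2))"
  have p: "B * (2 * b * b) \<ge> 0" "(B * b + B + 1) * (4 * b\<^sup>2) \<ge> 0" "(B * b + 1) * 2 \<ge> 0"
      using B b by auto
  have C: "C2_fun (\<lambda>y :: real ^ 'n. \<gamma> (y \<bullet> y)) (\<lambda>y v. \<gamma>1 (y \<bullet>
      y) * (2 * (y \<bullet> v)))
    (\<lambda>y v u. \<gamma>2 (y \<bullet> y) * (2 * (y \<bullet> u)) * (2 * (y \<bullet> v)) + \<gamma>1
        (y \<bullet> y) * (2 * (u \<bullet> v))) G"
  proof (rule C2_fun_radial[OF d d1])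
    fix r :: real assume r: "r \<ge> 0"
    let ?s = "s (r\<^sup>2)"
    have S: "?s \<ge> 1" "?s \<ge> r" "?s \<le> 1 + r" using s1[of "r\<^sup>2"] sr[OF r] by auto
    have \<phi>b: "0 \<le> \<phi> (r\<^sup>2)" "\<phi> (r\<^sup>2) \<le> 1" by (rule \<phi>)+
    have i1: "\<bar>\<phi> (r\<^sup>2) * (?s - 1)\<bar> \<le> 1 * r"
      unfolding abs_mult using \<phi>b S by (intro mult_mono) auto
    show "\<bar>\<gamma> (r\<^sup>2)\<bar> \<le> G * (1 + r)"
    proof -
      have "\<bar>\<gamma> (r\<^sup>2)\<bar> \<le> \<kappa> * (1 * r)" unfolding \<gamma>_def abs_mult[of
          \<kappa>] using i1 \<kappa> by simp
      also have "\<dots> \<le> (\<kappa> * 1) * (1 + r)" using \<kappa> by simp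
      also have "\<dots> \<le> G * (1 + r)" unfolding G_def using p \<kappa> r by (intro mult_right_mono
          mult_left_mono) linarith+
      finally show ?thesis .
    qed
    have zero: "\<phi>1 (r\<^sup>2) = 0 \<and> \<phi>2 (r\<^sup>2) = 0" if "r \<ge> b"
    proof -
      have "r\<^sup>2 \<ge> b\<^sup>2" using that b by (simp add: power_mono)
      then show ?thesis using \<phi>(5,6) by simp
    qed
    have j1: "\<bar>\<phi>1 (r\<^sup>2) * (?s - 1)\<bar> \<le> B * b"
        "\<bar>\<phi>2 (r\<^sup>2) * (?s - 1)\<bar> \<le> B * b"
      "\<bar>\<phi>1 (r\<^sup>2) * (?s - 1)\<bar> * (2 * r) \<le> B * (2 * b * b)"
      "\<bar>\<phi>2 (r\<^sup>2) * (?s - 1)\<bar> * (4 * r\<^sup>2) \<le> B * b * (4 * b\<^sup>2)"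
          "\<bar>\<phi>1 (r\<^sup>2)\<bar> * (4 * r\<^sup>2) \<le> B * (4 * b\<^sup>2)"
    proof -
      show *: "\<bar>\<phi>1 (r\<^sup>2) * (?s - 1)\<bar> \<le> B * b"
          "\<bar>\<phi>2 (r\<^sup>2) * (?s - 1)\<bar> \<le> B * b"
        using zero B b S r by (cases "r \<ge> b"; force simp: abs_mult intro!: mult_mono \<phi>(10,11))+
      show "\<bar>\<phi>1 (r\<^sup>2) * (?s - 1)\<bar> * (2 * r) \<le> B * (2 * b * b)"
      proof (cases "r \<ge> b")
        case False
        have "\<bar>\<phi>1 (r\<^sup>2) * (?s - 1)\<bar> * (2 * r) \<le> (B * b) * (2 * b)" using *(1) False
            r B b by (intro mult_mono) auto
        then show ?thesis by (simp add: mult_ac)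
      qed (use zero B b in auto)
      show "\<bar>\<phi>2 (r\<^sup>2) * (?s - 1)\<bar> * (4 * r\<^sup>2) \<le> B * b * (4 * b\<^sup>2)"
      proof (cases "r \<ge> b")
        case False
        then show ?thesis using *(2) r B b by (intro mult_mono) (auto simp: power_mono)
      qed (use zero B b in auto)
      show "\<bar>\<phi>1 (r\<^sup>2)\<bar> * (4 * r\<^sup>2) \<le> B * (4 * b\<^sup>2)"
      proof (cases "r \<ge> b")
        case False
        then show ?thesis using \<phi>(10) r B b by (intro mult_mono) (auto simp: power_mono)
      qed (use zero B b in auto)
    qed
    have k1: "\<bar>\<phi> (r\<^sup>2) * (1 / (2 * ?s))\<bar> \<le> 1 / (2 * ?s)"
      using mult_right_mono[of "\<bar>\<phi> (r\<^sup>2)\<bar>" 1 "\<bar>1 / (2 * ?s)\<bar>"] \<phi>b S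
          unfolding abs_mult by simp
    have k1a: "1 / (2 * ?s) * (2 * r) \<le> 1" "1 / (2 * ?s) \<le> 1" using S r by (auto simp: divide_le_eq)
    have t1: "\<bar>\<phi>1 (r\<^sup>2) * (?s - 1) + \<phi> (r\<^sup>2) * (1 / (2 * ?s))\<bar> \<le>
        \<bar>\<phi>1 (r\<^sup>2) * (?s - 1)\<bar> + 1 / (2 * ?s)"
      using k1 by linarith
    have "\<bar>\<phi>1 (r\<^sup>2) * (?s - 1) + \<phi> (r\<^sup>2) * (1 / (2 * ?s))\<bar> * (2 * r) \<le>
        (\<bar>\<phi>1 (r\<^sup>2) * (?s - 1)\<bar> + 1 / (2 * ?s)) * (2 * r)"
      using t1 r by (intro mult_right_mono) auto
    also have "\<dots> \<le> B * (2 * b * b) + 1" using j1(3) k1a(1) by (simp add: distrib_right)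
    finally have m1: "\<bar>\<phi>1 (r\<^sup>2) * (?s - 1) + \<phi> (r\<^sup>2) * (1 / (2 * ?s))\<bar> * (2
        * r) \<le> B * (2 * b * b) + 1" .
    have "\<bar>\<gamma>1 (r\<^sup>2)\<bar> * (2 * r) = \<kappa> * (\<bar>\<phi>1 (r\<^sup>2) * (?s - 1) +
        \<phi> (r\<^sup>2) * (1 / (2 * ?s))\<bar> * (2 * r))"
      unfolding \<gamma>1_def abs_mult[of \<kappa>] using \<kappa> by simp
    also have "\<dots> \<le> \<kappa> * (B * (2 * b * b) + 1)" using m1 \<kappa> by (intro mult_left_mono)
        auto
    also have "\<dots> \<le> G" unfolding G_def using p \<kappa> by (intro mult_left_mono) linarith+
    finally show "\<bar>\<gamma>1 (r\<^sup>2)\<bar> * (2 * r) \<le> G" .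
    have "\<bar>\<gamma>1 (r\<^sup>2)\<bar> \<le> \<kappa> * (B * b + 1)"
      unfolding \<gamma>1_def abs_mult[of \<kappa>] using t1 j1(1) k1a(2) \<kappa> by (simp add:
          mult_left_mono)
    then have g1b: "\<bar>\<gamma>1 (r\<^sup>2)\<bar> * 2 \<le> \<kappa> * ((B * b + 1) * 2)" by linarith
    have l2: "\<bar>\<phi>1 (r\<^sup>2) * (1 / ?s)\<bar> \<le> \<bar>\<phi>1 (r\<^sup>2)\<bar>"
      unfolding abs_mult using S by (intro mult_left_le) auto
    have "?s ^ 3 = ?s\<^sup>2 * ?s" by (simp add: power2_eq_square power3_eq_cube)
    moreover have "r\<^sup>2 * 1 \<le> ?s\<^sup>2 * ?s" using S r by (intro mult_mono power_mono) auto
    ultimately have "r\<^sup>2 * 1 \<le> ?s ^ 3" by simp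
    then have c3: "1 / (4 * ?s ^ 3) * (4 * r\<^sup>2) \<le> 1" using S by (simp add: divide_le_eq)
    have l3: "\<bar>\<phi> (r\<^sup>2) * (1 / (4 * ?s ^ 3))\<bar> * (4 * r\<^sup>2) \<le> 1"
    proof -
      have "\<bar>\<phi> (r\<^sup>2) * (1 / (4 * ?s ^ 3))\<bar> \<le> 1 / (4 * ?s ^ 3)"
        using mult_right_mono[of "\<bar>\<phi> (r\<^sup>2)\<bar>" 1 "\<bar>1 / (4 * ?s ^ 3)\<bar>"] \<phi>b
            S unfolding abs_mult by simp
      then have "\<bar>\<phi> (r\<^sup>2) * (1 / (4 * ?s ^ 3))\<bar> * (4 * r\<^sup>2) \<le> 1 / (4 * ?s ^
          3) * (4 * r\<^sup>2)" by (rule mult_right_mono) simp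
      with c3 show ?thesis by linarith
    qed
    have "\<bar>\<phi>2 (r\<^sup>2) * (?s - 1) + \<phi>1 (r\<^sup>2) * (1 / ?s) - \<phi> (r\<^sup>2) * (1 /
        (4 * ?s ^ 3))\<bar> * (4 * r\<^sup>2) \<le>
      (\<bar>\<phi>2 (r\<^sup>2) * (?s - 1)\<bar> + \<bar>\<phi>1 (r\<^sup>2)\<bar> + \<bar>\<phi>
          (r\<^sup>2) * (1 / (4 * ?s ^ 3))\<bar>) * (4 * r\<^sup>2)"
      using l2 by (intro mult_right_mono) (linarith, simp)
    also have "\<dots> \<le> B * b * (4 * b\<^sup>2) + B * (4 * b\<^sup>2) + 1"
      using j1(4,5) l3 by (simp add: distrib_right)
    also have "\<dots> \<le> (B * b + B + 1) * (4 * b\<^sup>2) + 1" by (simp add: algebra_simps)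
    finally have "\<bar>\<phi>2 (r\<^sup>2) * (?s - 1) + \<phi>1 (r\<^sup>2) * (1 / ?s) - \<phi> (r\<^sup>2)
        * (1 / (4 * ?s ^ 3))\<bar> * (4 * r\<^sup>2) \<le> (B * b + B + 1) * (4 * b\<^sup>2) + 1" .
    then have "\<bar>\<gamma>2 (r\<^sup>2)\<bar> * (4 * r\<^sup>2) \<le> \<kappa> * ((B * b + B + 1) * (4 *
        b\<^sup>2) + 1)"
      unfolding \<gamma>2_def abs_mult[of \<kappa>] using \<kappa> by (simp add: mult_left_mono)
    with g1b have "\<bar>\<gamma>2 (r\<^sup>2)\<bar> * (4 * r\<^sup>2) + \<bar>\<gamma>1 (r\<^sup>2)\<bar> *
        2 \<le> \<kappa> * (((B * b + B + 1) * (4 * b\<^sup>2) + 1) + (B * b + 1) * 2)"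
      by (simp only: distrib_left)
    also have "\<dots> \<le> G" unfolding G_def using p \<kappa> by (intro mult_left_mono) linarith+
    finally show "\<bar>\<gamma>2 (r\<^sup>2)\<bar> * (4 * r\<^sup>2) + \<bar>\<gamma>1 (r\<^sup>2)\<bar> *
        2 \<le> G" .
  qed
  have sq: "y \<bullet> y = (norm y)\<^sup>2" for y :: "real ^ 'n" by (simp add: power2_norm_eq_inner)
  show thesis
  proof (rule that[OF C, of "\<kappa> * (b + 1)"])
    show "0 \<le> \<kappa> * (b + 1)" using \<kappa> b by simp
    fix y v :: "real ^ 'n"
    have S: "s ((norm y)\<^sup>2) \<ge> 1" "s ((norm y)\<^sup>2) \<ge> norm y"
        "s ((norm y)\<^sup>2) \<le> 1 + norm y"
      using s1[of "(norm y)\<^sup>2"] sr[of "norm y"] by auto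
    show "\<gamma> (y \<bullet> y) = 0" "\<gamma>1 (y \<bullet> y) * (2 * (y \<bullet> v)) = 0" if
        "norm y \<le> R1"
    proof -
      have "y \<bullet> y \<le> R1\<^sup>2" unfolding sq using that by (simp add: power_mono)
      then show "\<gamma> (y \<bullet> y) = 0" "\<gamma>1 (y \<bullet> y) * (2 * (y \<bullet> v)) = 0" by
          (simp_all add: \<gamma>_def \<gamma>1_def \<phi>)
    qed
    show "0 \<le> \<gamma> (y \<bullet> y)" unfolding \<gamma>_def sq using \<kappa> \<phi>(7) S by simp
    have "\<phi> ((norm y)\<^sup>2) * (s ((norm y)\<^sup>2) - 1) \<le> 1 * norm y" using \<phi>(7,8) S by
        (intro mult_mono) auto
    then show "\<gamma> (y \<bullet> y) \<le> \<kappa> * norm y" unfolding \<gamma>_def sq using \<kappa> by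
        simp
    have "norm y - (b + 1) \<le> \<phi> ((norm y)\<^sup>2) * (s ((norm y)\<^sup>2) - 1)"
    proof (cases "norm y \<ge> b")
      case True
      then have "(norm y)\<^sup>2 \<ge> b\<^sup>2" using b by (simp add: power_mono)
      then show ?thesis using S b by (simp add: \<phi>(4))
    next
      case False
      moreover have "0 \<le> \<phi> ((norm y)\<^sup>2) * (s ((norm y)\<^sup>2) - 1)" using \<phi>(7) S by
          simp
      ultimately show ?thesis by linarith
    qed
    then have "\<kappa> * (norm y - (b + 1)) \<le> \<kappa> * (\<phi> ((norm y)\<^sup>2) * (s ((norm
        y)\<^sup>2) - 1))" using \<kappa> by simp
    then show "\<kappa> * norm y - \<kappa> * (b + 1) \<le> \<gamma> (y \<bullet> y)" unfolding \<gamma>_def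
        sq by (simp add: algebra_simps)
  qed
  qed
qed

text \<open>The third power is what makes the bump twice differentiable across the sphere of radius
  \<open>\<tau>\<close>. It is the height of the contour in the near part.\<close>

lemma C2_bump:
  fixes \<tau> \<mu> :: real
  assumes \<tau>: "\<tau> > 0" and \<mu>: "\<mu> > 0"
  obtains g1 :: "real ^ 'n::finite \<Rightarrow> real ^ 'n \<Rightarrow> real" and g2 G where
    "C2_fun (\<lambda>v. \<mu> * (max 0 (1 - (v \<bullet> v) / \<tau>\<^sup>2)) ^ 3) g1 g2 G"
        "\<And>y v. norm y \<ge> \<tau> \<Longrightarrow> g1 y v = 0"
proof -
  define m where "m t = max 0 (1 - t / \<tau>\<^sup>2)" for t
  define \<gamma> where "\<gamma> t = \<mu> * m t ^ 3" for t
  define \<gamma>1 where "\<gamma>1 t = \<mu> * (- 3 / \<tau>\<^sup>2) * m t ^ 2" for t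
  define \<gamma>2 where "\<gamma>2 t = \<mu> * (6 / \<tau> ^ 4) * m t" for t
  have dl: "((\<lambda>t. 1 - t / \<tau>\<^sup>2) has_real_derivative - 1 / \<tau>\<^sup>2) (at t)" for t
    by (rule DERIV_cong[OF DERIV_diff[OF DERIV_const DERIV_cdivide[OF DERIV_ident]]]) simp
  have d: "(\<gamma> has_real_derivative \<gamma>1 t) (at t)" for t
  proof -
    have "((\<lambda>t. \<mu> * m t ^ 3) has_real_derivative \<mu> * (3 * m t ^ 2 * (- 1 / \<tau>\<^sup>2)))
        (at t)"
      unfolding m_def by (rule DERIV_cmult[OF DERIV_chain2[OF DERIV_pos_part_cube dl]])
    then show ?thesis unfolding \<gamma>_def \<gamma>1_def by (rule DERIV_cong) simp
  qed
  have d1: "(\<gamma>1 has_real_derivative \<gamma>2 t) (at t)" for t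
  proof -
    have "((\<lambda>t. \<mu> * (- 3 / \<tau>\<^sup>2) * m t ^ 2) has_real_derivative \<mu> * (- 3 /
        \<tau>\<^sup>2) * (2 * m t * (- 1 / \<tau>\<^sup>2))) (at t)"
      unfolding m_def by (rule DERIV_cmult[OF DERIV_chain2[OF DERIV_pos_part_square dl]])
    then show ?thesis unfolding \<gamma>1_def \<gamma>2_def by (rule DERIV_cong) (simp add: power2_eq_square
        power4_eq_xxxx mult_ac)
  qed
  have m: "0 \<le> m t" for t by (simp add: m_def)
  have m1: "m t \<le> 1" if "t \<ge> 0" for t using that by (simp add: m_def)
  have mz: "m (r\<^sup>2) = 0" if "r \<ge> \<tau>" for r
  proof -
    have "r\<^sup>2 \<ge> \<tau>\<^sup>2" using that \<tau> by (simp add: power_mono)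
    then show ?thesis using \<tau> by (simp add: m_def)
  qed
  define G where "G = \<mu> * (1 + 3 / \<tau>\<^sup>2 * (2 * \<tau>) + (6 / \<tau> ^ 4 * (4 *
      \<tau>\<^sup>2) + 3 / \<tau>\<^sup>2 * 2))"
  have p: "0 \<le> 3 / \<tau>\<^sup>2 * (2 * \<tau>)" "0 \<le> 6 / \<tau> ^ 4 * (4 * \<tau>\<^sup>2)"
      "0 \<le> 3 / \<tau>\<^sup>2 * 2" using \<tau> by auto
  have C: "C2_fun (\<lambda>y :: real ^ 'n. \<gamma> (y \<bullet> y)) (\<lambda>y v. \<gamma>1 (y \<bullet>
      y) * (2 * (y \<bullet> v)))
    (\<lambda>y v u. \<gamma>2 (y \<bullet> y) * (2 * (y \<bullet> u)) * (2 * (y \<bullet> v)) + \<gamma>1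
        (y \<bullet> y) * (2 * (u \<bullet> v))) G"
  proof (rule C2_fun_radial[OF d d1])
    fix r :: real assume r: "r \<ge> 0"
    have M: "0 \<le> m (r\<^sup>2)" "m (r\<^sup>2) \<le> 1" using m m1 by auto
    have pw: "m (r\<^sup>2) ^ k \<le> 1" "0 \<le> m (r\<^sup>2) ^ k" for k using M by (auto simp:
        power_le_one)
    have g: "\<bar>\<gamma> (r\<^sup>2)\<bar> \<le> \<mu> * 1" unfolding \<gamma>_def abs_mult using \<mu>
        pw[of 3] abs_of_nonneg[OF pw(2)[of 3]] by simp
    have g1: "\<bar>\<gamma>1 (r\<^sup>2)\<bar> \<le> \<mu> * (3 / \<tau>\<^sup>2)"
      unfolding \<gamma>1_def abs_mult using \<mu> \<tau> pw[of 2] by (simp add: mult_left_le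
          divide_right_mono)
    have g2: "\<bar>\<gamma>2 (r\<^sup>2)\<bar> \<le> \<mu> * (6 / \<tau> ^ 4)"
      unfolding \<gamma>2_def abs_mult using \<mu> \<tau> M by (simp add: mult_left_le divide_right_mono)
    have "\<mu> * 1 \<le> G" unfolding G_def using p \<mu> by (intro mult_left_mono) linarith+
    also have "G = G * 1" by simp
    also have "\<dots> \<le> G * (1 + r)" using r \<mu> p unfolding G_def by (intro mult_left_mono) auto
    finally show "\<bar>\<gamma> (r\<^sup>2)\<bar> \<le> G * (1 + r)" using g by linarith
    have G0: "G \<ge> 0" unfolding G_def using p \<mu> by simp
    show "\<bar>\<gamma>1 (r\<^sup>2)\<bar> * (2 * r) \<le> G"
    proof (cases "r \<ge> \<tau>")
      case False
      have "\<bar>\<gamma>1 (r\<^sup>2)\<bar> * (2 * r) \<le> \<mu> * (3 / \<tau>\<^sup>2) * (2 * \<tau>)"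
          using g1 r False \<mu> by (intro mult_mono) auto
      also have "\<dots> = \<mu> * (3 / \<tau>\<^sup>2 * (2 * \<tau>))" by simp
      also have "\<dots> \<le> G" unfolding G_def using p \<mu> by (intro mult_left_mono) linarith+
      finally show ?thesis .
    qed (use mz G0 in \<open>simp add: \<gamma>1_def\<close>)
    show "\<bar>\<gamma>2 (r\<^sup>2)\<bar> * (4 * r\<^sup>2) + \<bar>\<gamma>1 (r\<^sup>2)\<bar> * 2 \<le>
        G"
    proof (cases "r \<ge> \<tau>")
      case False
      have "\<bar>\<gamma>2 (r\<^sup>2)\<bar> * (4 * r\<^sup>2) + \<bar>\<gamma>1 (r\<^sup>2)\<bar> * 2
          \<le> \<mu> * (6 / \<tau> ^ 4) * (4 * \<tau>\<^sup>2) + \<mu> * (3 / \<tau>\<^sup>2) * 2"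
        using g1 g2 r False \<mu> by (intro add_mono mult_mono) (auto simp: power_mono)
      also have "\<dots> = \<mu> * (6 / \<tau> ^ 4 * (4 * \<tau>\<^sup>2) + 3 / \<tau>\<^sup>2 * 2)" by
          (simp only: distrib_left mult.assoc)
      also have "\<dots> \<le> G" unfolding G_def using p \<mu> by (intro mult_left_mono) linarith+
      finally show ?thesis .
    qed (use mz G0 in \<open>simp add: \<gamma>1_def \<gamma>2_def\<close>)
  qed
  show thesis
  proof (rule that[OF C[unfolded \<gamma>_def m_def]])
    fix y v :: "real ^ 'n" assume "norm y \<ge> \<tau>"
    then have "m (y \<bullet> y) = 0" using mz by (simp add: power2_norm_eq_inner[symmetric])
    then show "\<gamma>1 (y \<bullet> y) * (2 * (y \<bullet> v)) = 0" by (simp add: \<gamma>1_def)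
  qed
qed

section \<open>The kernel of the operator\<close>

abbreviation hol_pair :: "((complex ^ 'n::finite) \<times> (complex ^ 'n) \<Rightarrow> complex)
    \<Rightarrow>
    ((complex ^ 'n) \<times> (complex ^ 'n)) set \<Rightarrow> bool" where
  "hol_pair \<equiv> holomorphic_wrt (\<lambda>c (z, w). (c *s z, c *s w))"

abbreviation hol_vec :: "(complex ^ 'n::finite \<Rightarrow> complex) \<Rightarrow> (complex ^ 'n) set
    \<Rightarrow> bool" where
  "hol_vec \<equiv> holomorphic_wrt (\<lambda>c z. c *s z)"

lemma holomorphic_wrt_linear:
  assumes "bounded_linear L" "\<And>c v. L (cs c v) = c * L v"
  shows "holomorphic_wrt cs L S"
  by (rule holomorphic_wrtI[OF bounded_linear_imp_has_derivative[OF assms(1)] assms(2)])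

lemma bounded_linear_cdot_left: "bounded_linear (\<lambda>w. cdot w z)"
  by (rule bounded_bilinear.bounded_linear_left[OF bounded_bilinear_cdot])

lemma bounded_linear_cdot_right: "bounded_linear (cdot w)"
  by (rule bounded_bilinear.bounded_linear_right[OF bounded_bilinear_cdot])

lemma hol_vec_cdot_left: "hol_vec (\<lambda>w. cdot w \<zeta>) S"
  by (rule holomorphic_wrt_linear[OF bounded_linear_cdot_left]) simp

lemma hol_vec_cdot_right: "hol_vec (cdot w) S"
  by (rule holomorphic_wrt_linear[OF bounded_linear_cdot_right]) simp

lemma holomorphic_wrt_exp: "holomorphic_wrt cs f S \<Longrightarrow> holomorphic_wrt cs (\<lambda>z. exp (f
    z)) S"
  by (rule holomorphic_wrt_compose_field[where g=exp and g'=exp]) (auto intro: DERIV_exp)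

lemma holomorphic_wrt_cmult: "holomorphic_wrt cs f S \<Longrightarrow> holomorphic_wrt cs (\<lambda>z. c * f
    z) S"
  by (rule holomorphic_wrt_mult[OF holomorphic_wrt_const])

lemma hol_vec_fst: "hol_vec f S \<Longrightarrow> hol_pair (\<lambda>x. f (fst x)) (S \<times> T)"
  by (rule holomorphic_wrt_affine[where g'=fst]) (auto intro!: derivative_eq_intros)

lemma hol_vec_snd: "hol_vec f T \<Longrightarrow> hol_pair (\<lambda>x. f (snd x)) (S \<times> T)"
  by (rule holomorphic_wrt_affine[where g'=snd]) (auto intro!: derivative_eq_intros)

lemma hol_pair_left:
  assumes "hol_pair f (S \<times> T)" "w \<in> T"
  shows "hol_vec (\<lambda>z. f (z, w)) S"
  by (rule holomorphic_wrt_affine[OF assms(1), where g="\<lambda>z. (z, w)" and g'="\<lambda>v. (v, 0)"])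
    (use assms(2) in \<open>auto intro!: derivative_eq_intros\<close>)

lemma hol_pair_right:
  assumes "hol_pair f (S \<times> T)" "z \<in> S"
  shows "hol_vec (\<lambda>w. f (z, w)) T"
  by (rule holomorphic_wrt_affine[OF assms(1), where g="\<lambda>w. (z, w)" and g'="\<lambda>v. (0, v)"])
    (use assms(2) in \<open>auto intro!: derivative_eq_intros\<close>)

lemma power_le_fact_exp:
  fixes x :: real
  assumes "x \<ge> 0"
  shows "x ^ j \<le> fact j * exp x"
proof -
  have s: "(\<lambda>n. x ^ n /\<^sub>R fact n) sums exp x" by (rule exp_converges)
  have "sum (\<lambda>n. x ^ n /\<^sub>R fact n) {j} \<le> exp x"
    using assms by (subst sums_unique[OF s]) (intro sum_le_suminf sums_summable[OF s]; simp)
  then show ?thesis by (simp add: field_simps)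
qed

text \<open>One term of the exponential series at s (1 + t). The negative power of the rate
  \<open>s\<close> is the source of the singularity of the kernel at w = 0.\<close>

lemma poly_exp_decay:
  fixes s t :: real
  assumes s: "s > 0" and t: "t \<ge> 0"
  shows "(1 + t) ^ j * exp (- s * t) \<le> fact j * exp s / s ^ j"
proof -
  have "(s * (1 + t)) ^ j \<le> fact j * exp (s * (1 + t))" using s t by (intro power_le_fact_exp) simp
  moreover have "exp (s * (1 + t)) = exp s * exp (s * t)" by (simp add: distrib_left exp_add)
  ultimately have "s ^ j * (1 + t) ^ j \<le> fact j * (exp s * exp (s * t))"
    by (simp only: power_mult_distrib)
  then have "s ^ j * (1 + t) ^ j * exp (- s * t) \<le> fact j * (exp s * exp (s * t)) * exp (- s * t)"
    by (intro mult_right_mono) auto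
  also have "\<dots> = fact j * exp s" by (simp add: exp_minus)
  finally show ?thesis using s by (simp add: field_simps)
qed

text \<open>\<open>N\<close> is a natural number that replaces |d|. The locally uniform bound covers
  \<open>W R \<epsilon>\<close> and all real frequencies at once, because the contours are real at
  low frequencies and enter \<open>W R \<epsilon>\<close> only beyond.\<close>

locale holo_symbol =
  fixes P :: "(complex ^ 'n::finite) \<times> (complex ^ 'n) \<Rightarrow> complex"
    and \<Omega> :: "(complex ^ 'n) set" and R \<epsilon> :: real and N :: nat
  assumes R_pos: "R > 0" and eps_pos: "\<epsilon> > 0" and open_\<Omega>: "open \<Omega>"
    and hol_P: "hol_pair P (\<Omega> \<times> W R \<epsilon>)"
    and hol_P_real: "\<And>\<xi>. hol_vec (\<lambda>z. P (z, cvec \<xi> 0)) \<Omega>"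
    and cont_P: "continuous_on (\<Omega> \<times> range (\<lambda>\<xi>. cvec \<xi> 0)) P"
    and bound_P: "\<And>z0. z0 \<in> \<Omega> \<Longrightarrow> \<exists>e>0. \<exists>C\<ge>0. ball z0 e
        \<subseteq> \<Omega> \<and>
      (\<forall>z\<in>ball z0 e. \<forall>\<zeta>\<in>W R \<epsilon> \<union> range (\<lambda>\<xi>. cvec
          \<xi> 0). norm (P (z, \<zeta>)) \<le> C * (1 + norm (Re_vec \<zeta>)) ^ N)"

text \<open>Since \<open>R < R1\<close>, the contour leaves the real space only at frequencies that
  are already well inside the domain of joint holomorphy.\<close>

locale symbol_contour = holo_symbol P \<Omega> R \<epsilon> N
  for P :: "(complex ^ 'n::finite) \<times> (complex ^ 'n) \<Rightarrow> complex" and \<Omega> R \<epsilon>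
      N +
  fixes \<kappa> R1 G K :: real and g :: "real ^ 'n \<Rightarrow> real" and g1 g2
  assumes kappa: "0 < \<kappa>" "\<kappa> < \<epsilon>" and R1: "R < R1"
    and C2_g: "C2_fun g g1 g2 G" and K: "K \<ge> 0"
    and g_zero: "\<And>y. norm y \<le> R1 \<Longrightarrow> g y = 0" and g1_zero:
        "\<And>y v. norm y \<le> R1 \<Longrightarrow> g1 y v = 0"
    and g_nonneg: "\<And>y. 0 \<le> g y" and g_le: "\<And>y. g y \<le> \<kappa> * norm y" and g_ge:
        "\<And>y. g y \<ge> \<kappa> * norm y - K"
begin

definition zeta :: "real ^ 'n \<Rightarrow> real ^ 'n \<Rightarrow> complex ^ 'n" where
  "zeta \<theta> \<xi> = cvec \<xi> (g \<xi> *\<^sub>R \<theta>)"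

text \<open>The determinant of the derivative of \<open>zeta \<theta>\<close>, a rank-one
  perturbation of the identity.\<close>

definition jac :: "real ^ 'n \<Rightarrow> real ^ 'n \<Rightarrow> complex" where
  "jac \<theta> \<xi> = 1 + \<i> * of_real (g1 \<xi> \<theta>)"

text \<open>Width of a collar around the part |\<xi>| > R1 of the contour that stays in
  \<open>W R \<epsilon>\<close>. The first entry preserves |Re \<zeta>| > R; the second is the
  solution c of \<kappa> R1 + c = \<epsilon> (R1 - c), the cone condition in the worst case |\<xi>|
  = R1.\<close>

definition c0 :: real where "c0 = min (R1 - R) ((\<epsilon> - \<kappa>) * R1 / (1 + \<epsilon>))"

lemma c0_pos: "c0 > 0"
  unfolding c0_def using R1 R_pos kappa eps_pos by auto

lemma g_facts:
  shows has_derivative_g: "(g has_derivative g1 y) (at y)"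
    and has_derivative_g1: "((\<lambda>y. g1 y v) has_derivative g2 y v) (at y)"
    and g1_bound: "\<bar>g1 y v\<bar> \<le> G * norm v"
  using C2_g unfolding C2_fun_def by blast+

lemma continuous_g: "continuous_on UNIV g" and continuous_g1: "continuous_on UNIV (\<lambda>y. g1 y v)"
  by (intro continuous_at_imp_continuous_on ballI has_derivative_continuous[OF has_derivative_g]
      has_derivative_continuous[OF has_derivative_g1])+

lemma G_nonneg: "G \<ge> 0"
proof -
  have "\<bar>g 0\<bar> \<le> G * (1 + norm (0 :: real ^ 'n))" using C2_g unfolding C2_fun_def by blast
  then show ?thesis by simp
qed

lemma norm_jac_le: "norm \<theta> \<le> 1 \<Longrightarrow> norm (jac \<theta> \<xi>) \<le> 1 + G"
proof -
  assume \<theta>: "norm \<theta> \<le> 1"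
  have "norm (jac \<theta> \<xi>) \<le> 1 + \<bar>g1 \<xi> \<theta>\<bar>"
    using norm_triangle_ineq[of 1 "\<i> * complex_of_real (g1 \<xi> \<theta>)"] by (simp add: norm_mult
        jac_def)
  also have "\<bar>g1 \<xi> \<theta>\<bar> \<le> G" using g1_bound[of \<xi> \<theta>] mult_left_mono[OF
      \<theta> G_nonneg] by simp
  finally show ?thesis by simp
qed

lemma norm_g_scaleR: "norm \<theta> \<le> 1 \<Longrightarrow> norm (g \<xi> *\<^sub>R \<theta>) \<le>
    \<kappa> * norm \<xi>"
  using mult_left_mono[OF _ g_nonneg, of "norm \<theta>" 1 \<xi>] g_le[of \<xi>] g_nonneg[of \<xi>] by simp

lemma ball_zeta_W:
  assumes \<xi>: "norm \<xi> > R1" and \<theta>: "norm \<theta> \<le> 1"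
  shows "ball (zeta \<theta> \<xi>) c0 \<subseteq> W R \<epsilon>"
proof
  fix \<zeta> assume "\<zeta> \<in> ball (zeta \<theta> \<xi>) c0"
  then have d: "norm (\<zeta> - zeta \<theta> \<xi>) < c0" by (simp add: dist_norm norm_minus_commute)
  have re: "norm (Re_vec \<zeta> - \<xi>) < c0" using norm_Re_vec_le[of "\<zeta> - zeta \<theta> \<xi>"] d
      by (simp add: zeta_def)
  have im: "norm (Im_vec \<zeta> - g \<xi> *\<^sub>R \<theta>) < c0" using norm_Im_vec_le[of
      "\<zeta> - zeta \<theta> \<xi>"] d by (simp add: zeta_def)
  have r: "norm (Re_vec \<zeta>) > norm \<xi> - c0" using re norm_triangle_ineq2[of \<xi> "Re_vec \<zeta>"]
      by (simp add: norm_minus_commute)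
  have "norm (g \<xi> *\<^sub>R \<theta>) \<le> \<kappa> * norm \<xi>" by (rule norm_g_scaleR[OF \<theta>])
  then have i: "norm (Im_vec \<zeta>) < \<kappa> * norm \<xi> + c0"
    using im norm_triangle_ineq2[of "Im_vec \<zeta>" "g \<xi> *\<^sub>R \<theta>"] by simp
  have "c0 \<le> R1 - R" "c0 \<le> (\<epsilon> - \<kappa>) * R1 / (1 + \<epsilon>)" by (simp_all add:
      c0_def)
  then have "c0 * (1 + \<epsilon>) \<le> (\<epsilon> - \<kappa>) * R1" using eps_pos by (simp add:
      field_simps)
  also have "\<dots> \<le> (\<epsilon> - \<kappa>) * norm \<xi>" using \<xi> kappa by (intro mult_left_mono)
      auto
  finally have "\<kappa> * norm \<xi> + c0 \<le> \<epsilon> * (norm \<xi> - c0)" by (simp add: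
      algebra_simps)
  also have "\<dots> \<le> \<epsilon> * norm (Re_vec \<zeta>)" using r eps_pos by (intro mult_left_mono)
      auto
  finally have "norm (Im_vec \<zeta>) < \<epsilon> * norm (Re_vec \<zeta>)" using i by linarith
  moreover have "norm (Re_vec \<zeta>) > R" using r \<xi> \<open>c0 \<le> R1 - R\<close> by linarith
  ultimately show "\<zeta> \<in> W R \<epsilon>" by (simp add: W_def)
qed

lemma zeta_W: "norm \<xi> > R \<Longrightarrow> norm \<theta> \<le> 1 \<Longrightarrow> zeta \<theta> \<xi>
    \<in> W R \<epsilon>"
proof -
  assume a: "norm \<xi> > R" "norm \<theta> \<le> 1"
  have "norm (g \<xi> *\<^sub>R \<theta>) \<le> \<kappa> * norm \<xi>" by (rule norm_g_scaleR[OF a(2)])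
  also have "\<dots> < \<epsilon> * norm \<xi>"
  proof (rule mult_strict_right_mono[OF kappa(2)])
    show "0 < norm \<xi>" using a R_pos by linarith
  qed
  finally show ?thesis using a by (simp add: W_def zeta_def)
qed

lemma zeta_low: "norm \<xi> \<le> R1 \<Longrightarrow> zeta \<theta> \<xi> = cvec \<xi> 0"
  by (simp add: zeta_def g_zero)

lemma zeta_mem: "norm \<theta> \<le> 1 \<Longrightarrow> zeta \<theta> \<xi> \<in> W R \<epsilon> \<union>
    range (\<lambda>\<xi>. cvec \<xi> 0)"
  using zeta_W[of \<xi> \<theta>] zeta_low[of \<xi> \<theta>] R1 by (cases "norm \<xi> > R") auto

lemma continuous_zeta: "continuous_on S (zeta \<theta>)"
  unfolding zeta_def
  by (intro continuous_intros continuous_on_subset[OF continuous_g]) auto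

text \<open>Two overlapping open sets cover all frequencies: for |\<xi>| < R1 the contour is real
  and \<open>cont_P\<close> applies, for |\<xi>| > R it lies in \<open>W R \<epsilon>\<close> and
  joint holomorphy applies.\<close>

lemma continuous_P_zeta:
  assumes z: "z \<in> \<Omega>" and \<theta>: "norm \<theta> \<le> 1"
  shows "continuous_on UNIV (\<lambda>\<xi>. P (z, zeta \<theta> \<xi>))"
proof -
  have 1: "continuous_on {\<xi>. norm \<xi> < R1} (\<lambda>\<xi>. P (z, zeta \<theta> \<xi>))"
  proof -
    have "continuous_on {\<xi>. norm \<xi> < R1} (\<lambda>\<xi>. P (z, cvec \<xi> 0))"
      by (rule continuous_on_compose2[OF cont_P]) (use z in \<open>auto intro!: continuous_intros\<close>)
    then show ?thesis by (rule continuous_on_eq) (auto simp: zeta_low)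
  qed
  have 2: "continuous_on {\<xi>. norm \<xi> > R} (\<lambda>\<xi>. P (z, zeta \<theta> \<xi>))"
    by (rule continuous_on_compose2[OF holomorphic_wrt_continuous_on[OF hol_P]])
      (use z zeta_W \<theta> in \<open>auto intro!: continuous_intros continuous_zeta\<close>)
  have "{\<xi>. norm \<xi> < R1} \<union> {\<xi>. norm \<xi> > R} = (UNIV :: (real ^ 'n) set)" using R1 by
      auto
  moreover have "open {\<xi> :: real ^ 'n. norm \<xi> < R1}" "open {\<xi> :: real ^ 'n. norm \<xi> > R}"
    by (intro open_Collect_less continuous_intros)+
  ultimately show ?thesis using continuous_on_open_Un[OF _ _ 1 2] by simp
qed

text \<open>The only estimate on \<open>h\<close> is on a uniform neighbourhood of the contour, so that
    Cauchy's
  inequality also controls its derivative there.\<close>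

lemma contour_shift:
  assumes z: "z \<in> \<Omega>" and h: "hol_vec h UNIV"
    and \<Theta>: "open \<Theta>" "convex \<Theta>" "\<And>\<theta>. \<theta> \<in> \<Theta>
        \<Longrightarrow> norm \<theta> \<le> 1"
    and bd: "\<And>\<theta> \<xi> \<zeta>. \<theta> \<in> \<Theta> \<Longrightarrow> norm (\<zeta> - zeta
        \<theta> \<xi>) < c0 \<Longrightarrow> norm (h \<zeta>) \<le> C / (1 + norm \<xi>) ^ (N + CARD('n) +
        3)"
    and \<theta>: "\<theta>0 \<in> \<Theta>" "\<theta>1 \<in> \<Theta>"
  shows "(\<integral>\<xi>. h (zeta \<theta>0 \<xi>) * P (z, zeta \<theta>0 \<xi>) * jac \<theta>0 \<xi>
      \<partial>lborel) =
    (\<integral>\<xi>. h (zeta \<theta>1 \<xi>) * P (z, zeta \<theta>1 \<xi>) * jac \<theta>1 \<xi>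
        \<partial>lborel)"
proof -
  obtain e CP where e: "e > 0" "CP \<ge> 0"
    and CP': "\<forall>z\<in>ball z e. \<forall>\<zeta>\<in>W R \<epsilon> \<union> range (\<lambda>\<xi>.
        cvec \<xi> 0). norm (P (z, \<zeta>)) \<le> CP * (1 + norm (Re_vec \<zeta>)) ^ N"
    using bound_P[OF z] by blast
  have CP: "norm (P (z, \<zeta>)) \<le> CP * (1 + norm (Re_vec \<zeta>)) ^ N" if
      "\<zeta> \<in> W R \<epsilon> \<union> range (\<lambda>\<xi>. cvec \<xi> 0)" for \<zeta>
    using CP' e(1) that by simp
  define f where "f \<zeta> = h \<zeta> * P (z, \<zeta>)" for \<zeta>
  \<comment> \<open>Off \<open>S\<close> the height and its derivative vanish, so a derivative of
    \<open>P\<close> in the frequency is called for only inside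
    \<open>W R \<epsilon>\<close>.\<close>
  define S where "S = {\<xi> :: real ^ 'n. norm \<xi> > R1}"
  let ?k = "CARD('n) + 3"
  have C: "C \<ge> 0"
    using order_trans[OF norm_ge_zero bd[OF \<theta>(1), of "zeta \<theta>0 0" 0]] c0_pos by simp
  have hol_f: "hol_vec f (W R \<epsilon>)" unfolding f_def
    by (intro holomorphic_wrt_mult holomorphic_wrt_subset[OF h] hol_pair_right[OF hol_P z]) auto
  \<comment> \<open>A point of the collar over \<xi> satisfies 1 + |Re \<zeta>| \<le> (1 + c0) (1 +
    |\<xi>|). The N powers of 1 + |\<xi>| lost to the symbol are the difference between the weights
    of \<open>h\<close> and of \<open>f\<close>.\<close>
  define C1 where "C1 = C * CP * (1 + c0) ^ N"
  have C1: "C1 \<ge> 0" using C e c0_pos by (simp add: C1_def)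
  have near: "norm (f \<zeta>) \<le> C1 / (1 + norm \<xi>) ^ ?k"
    if t: "\<theta> \<in> \<Theta>" and d: "norm (\<zeta> - zeta \<theta> \<xi>) < c0" and m:
        "\<zeta> \<in> W R \<epsilon> \<union> range (\<lambda>\<xi>. cvec \<xi> 0)" for \<theta> \<xi>
        \<zeta>
  proof -
    have "norm (Re_vec \<zeta> - \<xi>) < c0" using norm_Re_vec_le[of "\<zeta> - zeta \<theta> \<xi>"] d by
        (simp add: zeta_def)
    then have "norm (Re_vec \<zeta>) \<le> norm \<xi> + c0" using norm_triangle_ineq2[of "Re_vec \<zeta>"
        \<xi>] by linarith
    moreover have "0 \<le> c0 * norm \<xi>" using c0_pos by simp
    moreover have "(1 + c0) * (1 + norm \<xi>) = 1 + c0 + norm \<xi> + c0 * norm \<xi>" by (simp add: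
        algebra_simps)
    ultimately have "1 + norm (Re_vec \<zeta>) \<le> (1 + c0) * (1 + norm \<xi>)" by linarith
    then have "(1 + norm (Re_vec \<zeta>)) ^ N \<le> ((1 + c0) * (1 + norm \<xi>)) ^ N" by (intro
        power_mono) auto
    then have "norm (P (z, \<zeta>)) \<le> CP * ((1 + c0) ^ N * (1 + norm \<xi>) ^ N)"
      using order_trans[OF CP[OF m] mult_left_mono] e(2) by (simp add: power_mult_distrib)
    then have "norm (f \<zeta>) \<le> C / (1 + norm \<xi>) ^ (N + ?k) * (CP * ((1 + c0) ^ N * (1 + norm
        \<xi>) ^ N))"
      unfolding f_def norm_mult using bd[OF t d] C by (intro mult_mono) (auto simp: add.assoc)
    also have "\<dots> = C1 / (1 + norm \<xi>) ^ ?k"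
    proof -
      have "a / (x * y) * (b * (c * x)) = a * b * c / y" if "x \<noteq> 0" for a b c x y :: real using that
          by simp
      from this[of "(1 + norm \<xi>) ^ N"] show ?thesis
        unfolding C1_def power_add[of _ N] by (simp add: add_nonneg_eq_0_iff)
    qed
    finally show ?thesis .
  qed
  have onb: "norm (f (cvec \<xi> (g \<xi> *\<^sub>R \<theta>))) \<le> C1 / (1 + norm \<xi>) ^ ?k" if
      "\<theta> \<in> \<Theta>" for \<theta> \<xi>
    using near[OF that, of "zeta \<theta> \<xi>" \<xi>] zeta_mem[OF \<Theta>(3)[OF that]] c0_pos by (simp
        add: zeta_def)
  have inW: "cvec \<xi> (g \<xi> *\<^sub>R \<theta>) \<in> W R \<epsilon>" if "\<theta> \<in> \<Theta>"
      "\<xi> \<in> S" for \<theta> \<xi>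
    using zeta_W[of \<xi> \<theta>] \<Theta>(3)[OF that(1)] that(2) R1 by (simp add: zeta_def S_def)
  \<comment> \<open>Sum of the bound for the values and of Cauchy's bound at radius
    \<open>c0\<close>, so that one constant serves both.\<close>
  define C2 where "C2 = 2 * C1 / c0 + C1"
  have C2: "C1 \<le> C2" "2 * C1 / c0 \<le> C2" using C1 c0_pos by (auto simp: C2_def)
  let ?f' = "\<lambda>\<theta> \<xi>. frechet_derivative f (at (cvec \<xi> (g \<xi> *\<^sub>R \<theta>)))"
  have "(\<integral>\<xi>. f (cvec \<xi> (g \<xi> *\<^sub>R \<theta>0)) * (1 + \<i> * of_real (g1 \<xi>
      \<theta>0)) \<partial>lborel) =
    (\<integral>\<xi>. f (cvec \<xi> (g \<xi> *\<^sub>R \<theta>1)) * (1 + \<i> * of_real (g1 \<xi>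
        \<theta>1)) \<partial>lborel)"
  proof (rule integral_contour_direction[OF C2_g \<Theta>(1,2), where f'="?f'" and S=S and C=C2])
    show "norm \<theta> \<le> 2" if "\<theta> \<in> \<Theta>" for \<theta> using \<Theta>(3)[OF that] by
        simp
    show "(f has_derivative ?f' \<theta> \<xi>) (at (cvec \<xi> (g \<xi> *\<^sub>R \<theta>)))"
      "?f' \<theta> \<xi> (c *s v) = c * ?f' \<theta> \<xi> v" if "\<theta> \<in> \<Theta>" "\<xi> \<in> S"
          for \<theta> \<xi> c v
      by (rule holomorphic_wrtD(1)[OF hol_f inW[OF that]], rule holomorphic_wrtD(2)[OF hol_f inW[OF that]])
    show "norm (f (cvec \<xi> (g \<xi> *\<^sub>R \<theta>))) \<le> C2 / (1 + norm \<xi>) ^ ?k" if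
        "\<theta> \<in> \<Theta>" for \<theta> \<xi>
      by (rule order_trans[OF onb[OF that]]) (intro divide_right_mono C2; simp)
    show "norm (?f' \<theta> \<xi> v) \<le> C2 / (1 + norm \<xi>) ^ ?k * norm v" if t:
        "\<theta> \<in> \<Theta>" and x: "\<xi> \<in> S" for \<theta> \<xi> v
    proof -
      have sub: "ball (cvec \<xi> (g \<xi> *\<^sub>R \<theta>)) c0 \<subseteq> W R \<epsilon>"
        using ball_zeta_W[of \<xi> \<theta>] \<Theta>(3)[OF t] x by (simp add: zeta_def S_def)
      have "norm (?f' \<theta> \<xi> v) \<le> 2 * (C1 / (1 + norm \<xi>) ^ ?k) / c0 * norm v"
      proof (rule holomorphic_wrt_derivative_bound[OF complex_scaling_vec c0_pos holomorphic_wrt_subset[OF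
          hol_f sub]])
        show "norm (f \<zeta>) \<le> C1 / (1 + norm \<xi>) ^ ?k" if
            "\<zeta> \<in> ball (cvec \<xi> (g \<xi> *\<^sub>R \<theta>)) c0" for \<zeta>
          using that sub by (intro near[OF t]) (auto simp: zeta_def dist_norm norm_minus_commute)
      qed (rule holomorphic_wrtD(1)[OF hol_f inW[OF t x]])
      also have "\<dots> = (2 * C1 / c0) / (1 + norm \<xi>) ^ ?k * norm v" by simp
      also have "\<dots> \<le> C2 / (1 + norm \<xi>) ^ ?k * norm v"
        by (intro mult_right_mono divide_right_mono C2) auto
      finally show ?thesis .
    qed
    show "(\<lambda>\<xi>. f (cvec \<xi> (g \<xi> *\<^sub>R \<theta>))) \<in> borel_measurable borel" if
        "\<theta> \<in> \<Theta>" for \<theta>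
    proof (rule borel_measurable_continuous_onI)
      have "continuous_on UNIV (\<lambda>\<xi>. h (zeta \<theta> \<xi>))"
        by (rule continuous_on_compose2[OF holomorphic_wrt_continuous_on[OF h] continuous_zeta]) auto
      then show "continuous_on UNIV (\<lambda>\<xi>. f (cvec \<xi> (g \<xi> *\<^sub>R \<theta>)))"
        unfolding f_def using continuous_on_mult[OF _ continuous_P_zeta[OF z \<Theta>(3)[OF that]]] by (simp
            add: zeta_def)
    qed
  qed (use \<theta> g_zero g1_zero in \<open>auto simp: S_def\<close>)
  then show ?thesis by (simp add: f_def zeta_def jac_def)
qed

text \<open>Decay rate of exp(i w . \<zeta>) along the contour: the height gains at least (\<kappa>
  |\<xi>| - K) Re w . \<theta> in the exponent, and Im w loses at most |Im w| |\<xi>|.\<close>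

definition margin :: "real ^ 'n \<Rightarrow> complex ^ 'n \<Rightarrow> real" where
  "margin \<theta> w = \<kappa> * (Re_vec w \<bullet> \<theta>) - norm (Im_vec w)"

definition kern :: "real ^ 'n \<Rightarrow> (complex ^ 'n) \<times> (complex ^ 'n) \<Rightarrow> complex"
    where
  "kern \<theta> zw = (\<integral>\<xi>. exp (\<i> * cdot (snd zw) (zeta \<theta> \<xi>)) * P (fst zw, zeta
      \<theta> \<xi>) * jac \<theta> \<xi> \<partial>lborel)"

lemma norm_exp_zeta:
  assumes m: "margin \<theta> w \<ge> s" and s: "s \<ge> 0" and \<theta>: "norm \<theta> \<le> 1"
  shows "norm (exp (\<i> * cdot w (zeta \<theta> \<xi>))) \<le> exp (K * norm w) * exp (- s * norm \<xi>)"
proof -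
  have p: "Re_vec w \<bullet> \<theta> \<ge> 0"
  proof -
    have "\<kappa> * (Re_vec w \<bullet> \<theta>) \<ge> 0" using m s norm_ge_zero[of "Im_vec w"] unfolding
        margin_def by linarith
    then show ?thesis using kappa by (simp add: zero_le_mult_iff)
  qed
  have q: "Re_vec w \<bullet> \<theta> \<le> norm w"
    using norm_cauchy_schwarz[of "Re_vec w" \<theta>] mult_mono[OF norm_Re_vec_le[of w] \<theta>] by simp
  have "Re (\<i> * cdot w (zeta \<theta> \<xi>)) = - (Im_vec w \<bullet> \<xi>) - g \<xi> * (Re_vec w
      \<bullet> \<theta>)"
    by (simp add: Im_cdot zeta_def inner_commute)
  also have "\<dots> \<le> norm (Im_vec w) * norm \<xi> - (\<kappa> * norm \<xi> - K) * (Re_vec w \<bullet>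
      \<theta>)"
    using mult_right_mono[OF g_ge p, of \<xi>] norm_cauchy_schwarz[of "- Im_vec w" \<xi>] by simp
  also have "\<dots> = K * (Re_vec w \<bullet> \<theta>) - margin \<theta> w * norm \<xi>" by (simp add:
      margin_def algebra_simps)
  also have "\<dots> \<le> K * norm w - s * norm \<xi>"
    using mult_left_mono[OF q K] mult_right_mono[OF m, of "norm \<xi>"] by simp
  finally have "exp (Re (\<i> * cdot w (zeta \<theta> \<xi>))) \<le> exp (K * norm w - s * norm \<xi>)"
    by (simp only: exp_le_cancel_iff)
  then show ?thesis by (simp only: norm_exp_eq_Re exp_add[symmetric]) simp
qed

lemma exp_zeta_weight:
  assumes m: "margin \<theta> w \<ge> s" and s: "s > 0" and \<theta>: "norm \<theta> \<le> 1"
  shows "norm (exp (\<i> * cdot w (zeta \<theta> \<xi>))) \<le>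
    exp (K * norm w) * (fact (N + k) * exp s / s ^ (N + k)) / (1 + norm \<xi>) ^ (N + k)"
proof -
  have "norm (exp (\<i> * cdot w (zeta \<theta> \<xi>))) \<le> exp (K * norm w) * exp (- s * norm \<xi>)"
    using norm_exp_zeta[OF m _ \<theta>] s by simp
  also have "exp (- s * norm \<xi>) \<le> (fact (N + k) * exp s / s ^ (N + k)) / (1 + norm \<xi>) ^ (N + k)"
    using poly_exp_decay[OF s norm_ge_zero[of \<xi>], of "N + k"]
    by (subst pos_le_divide_eq) (auto intro!: zero_less_power add_pos_nonneg simp: mult.commute)
  finally show ?thesis by (simp add: mult_left_mono)
qed

text \<open>Bound for the Jacobian times the constant of \<open>poly_exp_decay\<close>; N of the
  powers compensate the growth of the symbol, the other n + 3 give integrability.\<close>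

definition Cs :: "real \<Rightarrow> real" where
  "Cs s = (1 + G) * (fact (N + (CARD('n) + 3)) * exp s / s ^ (N + (CARD('n) + 3)))"

lemma Cs_nonneg: "s > 0 \<Longrightarrow> Cs s \<ge> 0"
  using G_nonneg by (simp add: Cs_def)

lemma integrand_bound:
  assumes m: "margin \<theta> w \<ge> s" and s: "s > 0" and \<theta>: "norm \<theta> \<le> 1"
    and P: "norm (P (z, zeta \<theta> \<xi>)) \<le> C * (1 + norm \<xi>) ^ N" and C: "C \<ge> 0"
  shows "norm (exp (\<i> * cdot w (zeta \<theta> \<xi>)) * P (z, zeta \<theta> \<xi>) * jac \<theta> \<xi>)
      \<le>
    C * exp (K * norm w) * Cs s * (1 / (1 + norm \<xi>) ^ (CARD('n) + 3))"
proof -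
  define F where "F = fact (N + (CARD('n) + 3)) * exp s / s ^ (N + (CARD('n) + 3))"
  have F: "F \<ge> 0" using s by (simp add: F_def)
  have x: "1 + norm \<xi> > 0" by (auto intro: add_pos_nonneg)
  have "norm (exp (\<i> * cdot w (zeta \<theta> \<xi>)) * P (z, zeta \<theta> \<xi>) * jac \<theta> \<xi>)
      \<le>
      exp (K * norm w) * F / (1 + norm \<xi>) ^ (N + (CARD('n) + 3)) * (C * (1 + norm \<xi>) ^ N) * (1 + G)"
    unfolding norm_mult
    using exp_zeta_weight[OF m s \<theta>, of \<xi> "CARD('n) + 3"] P norm_jac_le[OF \<theta>, of \<xi>] F C
        x
    by (intro mult_mono) (auto simp: F_def[symmetric] intro!: mult_nonneg_nonneg divide_nonneg_nonneg)
  also have "\<dots> = C * exp (K * norm w) * ((1 + G) * F) * (1 / (1 + norm \<xi>) ^ (CARD('n) + 3))"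
    using x by (simp add: power_add)
  finally show ?thesis by (simp add: Cs_def F_def)
qed

lemma integrable_weight: "integrable lborel (\<lambda>\<xi> :: real ^ 'n. c * (1 / (1 + norm \<xi>) ^
    (CARD('n) + 3)))"
  using integrable_inverse_power_norm[of "CARD('n) + 3", where 'a="real ^ 'n"]
  by (intro integrable_mult_right) simp

lemma measurable_integrand:
  assumes "z \<in> \<Omega>" "norm \<theta> \<le> 1"
  shows "(\<lambda>\<xi>. exp (\<i> * cdot w (zeta \<theta> \<xi>)) * P (z, zeta \<theta> \<xi>) * jac
      \<theta> \<xi>) \<in> borel_measurable lborel"
proof -
  have "continuous_on UNIV (\<lambda>\<xi>. exp (\<i> * cdot w (zeta \<theta> \<xi>)) * P (z, zeta \<theta>
      \<xi>) * jac \<theta> \<xi>)"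
    unfolding jac_def
    by (intro continuous_intros continuous_P_zeta assms continuous_zeta continuous_g1
       bounded_linear.continuous_on[OF bounded_linear_cdot_right])
  then show ?thesis using borel_measurable_continuous_onI by simp
qed

lemma norm_kern_le:
  assumes m: "margin \<theta> w \<ge> s" and s: "s > 0" and \<theta>: "norm \<theta> \<le> 1" and z:
      "z \<in> \<Omega>"
    and P: "\<And>\<xi>. norm (P (z, zeta \<theta> \<xi>)) \<le> C * (1 + norm \<xi>) ^ N" and C:
        "C \<ge> 0"
  shows "norm (kern \<theta> (z, w)) \<le> C * exp (K * norm w) * Cs s * (\<integral>\<xi>. 1 / (1 + norm
      (\<xi> :: real ^ 'n)) ^ (CARD('n) + 3) \<partial>lborel)"
proof -
  have "norm (kern \<theta> (z, w)) \<le> (\<integral>\<xi>. norm (exp (\<i> * cdot w (zeta \<theta> \<xi>))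
      * P (z, zeta \<theta> \<xi>) * jac \<theta> \<xi>) \<partial>lborel)"
    unfolding kern_def by simp
  also have "\<dots> \<le> (\<integral>\<xi>. C * exp (K * norm w) * Cs s * (1 / (1 + norm (\<xi> :: real ^
      'n)) ^ (CARD('n) + 3)) \<partial>lborel)"
  proof (rule integral_mono)
    show "integrable lborel (\<lambda>\<xi>. norm (exp (\<i> * cdot w (zeta \<theta> \<xi>)) * P (z, zeta
        \<theta> \<xi>) * jac \<theta> \<xi>))"
    proof (rule integrable_norm, rule Bochner_Integration.integrable_bound[OF integrable_weight
        measurable_integrand[OF z \<theta>]])
      show "AE \<xi> in lborel. norm (exp (\<i> * cdot w (zeta \<theta> \<xi>)) * P (z, zeta \<theta> \<xi>)
          * jac \<theta> \<xi>) \<le>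
          norm (C * exp (K * norm w) * Cs s * (1 / (1 + norm \<xi>) ^ (CARD('n) + 3)))"
        unfolding real_norm_def
        by (intro AE_I2 order_trans[OF integrand_bound[OF m s \<theta> P C] abs_ge_self])
    qed
  qed (use integrand_bound[OF m s \<theta> P C] integrable_weight in auto)
  also have "\<dots> = C * exp (K * norm w) * Cs s * (\<integral>\<xi>. 1 / (1 + norm (\<xi> :: real ^ 'n))
      ^ (CARD('n) + 3) \<partial>lborel)"
    by (rule integral_mult_right_zero)
  finally show ?thesis .
qed

lemma continuous_margin: "continuous_on S (margin \<theta>)" and continuous_margin':
    "continuous_on T (\<lambda>\<theta>. margin \<theta> w)"
  unfolding margin_def by (intro continuous_intros)+

text \<open>The integrand is holomorphic for each \<xi>. Near a given point, half of its margin
  still serves as a common decay rate.\<close>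

lemma hol_kern:
  assumes \<theta>: "norm \<theta> \<le> 1"
  shows "hol_pair (kern \<theta>) (\<Omega> \<times> {w. margin \<theta> w > 0})"
proof -
  let ?M = "{w. margin \<theta> w > 0}"
  have openM: "open ?M" by (intro open_Collect_less continuous_intros continuous_margin)
  have "hol_pair (\<lambda>zw. \<integral>\<xi>. exp (\<i> * cdot (snd zw) (zeta \<theta> \<xi>)) * P (fst
      zw, zeta \<theta> \<xi>) * jac \<theta> \<xi> \<partial>lborel) (\<Omega> \<times> ?M)"
  proof (rule holomorphic_wrt_integral[OF complex_scaling_prod])
    show "(\<lambda>\<xi>. exp (\<i> * cdot (snd zw) (zeta \<theta> \<xi>)) * P (fst zw, zeta \<theta>
        \<xi>) * jac \<theta> \<xi>) \<in> borel_measurable lborel"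
      if "zw \<in> \<Omega> \<times> ?M" for zw
      using that \<theta> by (intro measurable_integrand) auto
    fix \<xi> :: "real ^ 'n"
    have "hol_vec (\<lambda>z. P (z, zeta \<theta> \<xi>)) \<Omega>"
      using zeta_mem[OF \<theta>, of \<xi>] hol_pair_left[OF hol_P] hol_P_real by auto
    from hol_vec_fst[OF this]
    show "hol_pair (\<lambda>zw. exp (\<i> * cdot (snd zw) (zeta \<theta> \<xi>)) * P (fst zw, zeta \<theta>
        \<xi>) * jac \<theta> \<xi>) (\<Omega> \<times> ?M)"
      by (intro holomorphic_wrt_mult holomorphic_wrt_exp holomorphic_wrt_const hol_vec_snd
          hol_vec_cdot_left)
  next
    fix zw0 assume zw0: "zw0 \<in> \<Omega> \<times> ?M"
    obtain z0 w0 where zw0_eq: "zw0 = (z0, w0)" by (cases zw0)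
    with zw0 have z0: "z0 \<in> \<Omega>" and w0: "margin \<theta> w0 > 0" by auto
    define s where "s = margin \<theta> w0 / 2"
    have s: "s > 0" using w0 by (simp add: s_def)
    obtain e1 C where e1: "e1 > 0" "C \<ge> 0" "ball z0 e1 \<subseteq> \<Omega>"
      and C': "\<forall>z\<in>ball z0 e1. \<forall>\<zeta>\<in>W R \<epsilon> \<union> range
          (\<lambda>\<xi>. cvec \<xi> 0). norm (P (z, \<zeta>)) \<le> C * (1 + norm (Re_vec \<zeta>)) ^ N"
      using bound_P[OF z0] by blast
    have C: "norm (P (z, \<zeta>)) \<le> C * (1 + norm (Re_vec \<zeta>)) ^ N"
      if "z \<in> ball z0 e1" "\<zeta> \<in> W R \<epsilon> \<union> range (\<lambda>\<xi>. cvec \<xi> 0)"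
          for z \<zeta> using C' that by simp
    have "open {w. margin \<theta> w > s}" by (intro open_Collect_less continuous_intros continuous_margin)
    moreover have "w0 \<in> {w. margin \<theta> w > s}" using w0 by (simp add: s_def)
    ultimately obtain e2 where e2: "e2 > 0" "ball w0 e2 \<subseteq> {w. margin \<theta> w > s}" using openE
        by blast
    \<comment> \<open>The entry 1 bounds \<open>norm w\<close> by \<open>norm w0 + 1\<close>, which
      controls the factor exp(K |w|).\<close>
    define e where "e = min 1 (min e1 e2)"
    have e: "e > 0" using e1 e2 by (simp add: e_def)
    have inb: "fst zw \<in> ball z0 e1" "snd zw \<in> ball w0 e2" "norm (snd zw) \<le> norm w0 + 1"
      if "zw \<in> ball zw0 e" for zw
    proof -
      have d: "dist (fst zw) z0 < e" "dist (snd zw) w0 < e"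
        using that dist_fst_le[of zw zw0] dist_snd_le[of zw zw0] by (auto simp: zw0_eq dist_commute)
      then show "fst zw \<in> ball z0 e1" "snd zw \<in> ball w0 e2" by (auto simp: e_def dist_commute)
      have "norm (snd zw - w0) \<le> 1" using d(2) by (simp add: e_def dist_norm)
      then show "norm (snd zw) \<le> norm w0 + 1" using norm_triangle_ineq2[of "snd zw" w0] by linarith
    qed
    let ?h = "\<lambda>\<xi>::real^'n. C * exp (K * (norm w0 + 1)) * Cs s * (1 / (1 + norm \<xi>) ^
        (CARD('n) + 3))"
    show "\<exists>e>0. \<exists>h. ball zw0 e \<subseteq> \<Omega> \<times> ?M \<and> integrable lborel h
        \<and>
       (\<forall>zw\<in>ball zw0 e. \<forall>\<xi>\<in>space lborel. norm (exp (\<i> * cdot (snd zw) (zeta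
           \<theta> \<xi>)) * P (fst zw, zeta \<theta> \<xi>) * jac \<theta> \<xi>) \<le> h \<xi>)"
    proof (intro exI[of _ e] exI[of _ ?h] conjI e ballI integrable_weight)
      show "ball zw0 e \<subseteq> \<Omega> \<times> ?M"
      proof
        fix zw assume b: "zw \<in> ball zw0 e"
        have "fst zw \<in> \<Omega>" using inb(1)[OF b] e1 by blast
        moreover have "margin \<theta> (snd zw) > s" using inb(2)[OF b] e2 by blast
        ultimately show "zw \<in> \<Omega> \<times> ?M" using s by (cases zw) auto
      qed
      fix zw and \<xi> :: "real ^ 'n" assume b: "zw \<in> ball zw0 e"
      have m: "margin \<theta> (snd zw) \<ge> s" using inb(2)[OF b] e2 by auto
      have "norm (P (fst zw, zeta \<theta> \<xi>)) \<le> C * (1 + norm \<xi>) ^ N"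
        using C[OF inb(1)[OF b] zeta_mem[OF \<theta>, of \<xi>]] by (simp add: zeta_def)
      from integrand_bound[OF m s \<theta> this e1(2)]
      have "norm (exp (\<i> * cdot (snd zw) (zeta \<theta> \<xi>)) * P (fst zw, zeta \<theta> \<xi>) * jac
          \<theta> \<xi>) \<le>
          C * exp (K * norm (snd zw)) * Cs s * (1 / (1 + norm \<xi>) ^ (CARD('n) + 3))" .
      also have "\<dots> \<le> ?h \<xi>"
        using inb(3)[OF b] K e1(2) Cs_nonneg[OF s]
        by (intro mult_right_mono mult_left_mono) (auto intro!: mult_left_mono)
      finally show "norm (exp (\<i> * cdot (snd zw) (zeta \<theta> \<xi>)) * P (fst zw, zeta \<theta> \<xi>)
          * jac \<theta> \<xi>) \<le> ?h \<xi>" .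
    qed
  qed
  then show ?thesis unfolding kern_def[abs_def] .
qed

text \<open>For fixed \<open>w\<close> the margin is affine in \<open>\<theta>\<close>, so the
  admissible directions form the intersection of a ball and a half-space. This set is open and
  convex, as \<open>contour_shift\<close> demands.\<close>

lemma kern_direction:
  assumes z: "z \<in> \<Omega>" and 0: "norm \<theta>0 < 1" "margin \<theta>0 w > 0" and 1:
      "norm \<theta>1 < 1" "margin \<theta>1 w > 0"
  shows "kern \<theta>0 (z, w) = kern \<theta>1 (z, w)"
proof -
  define s where "s = min (margin \<theta>0 w) (margin \<theta>1 w) / 2"
  have s: "s > 0" using 0 1 by (simp add: s_def)
  define \<Theta> where "\<Theta> = ball 0 1 \<inter> {\<theta>. margin \<theta> w > s}"
  have cv: "convex \<Theta>"
  proof -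
    have "{\<theta>. margin \<theta> w > s} = {\<theta>. (\<kappa> *\<^sub>R Re_vec w) \<bullet> \<theta> >
        s + norm (Im_vec w)}" by (auto simp: margin_def algebra_simps)
    then have "convex {\<theta>. margin \<theta> w > s}" by (simp only: convex_halfspace_gt)
    then show ?thesis unfolding \<Theta>_def by (intro convex_Int convex_ball)
  qed
  have op: "open \<Theta>" unfolding \<Theta>_def by (intro open_Int open_Collect_less continuous_intros
      continuous_margin') auto
  \<comment> \<open>The factor exp(4 |w| c0) is the price of moving by less than \<open>c0\<close>
    away from the contour; 4 is the constant of \<open>norm_cdot_le\<close>.\<close>
  define C where "C = exp (4 * norm w * c0) * (exp (K * norm w) * (fact (N + (CARD('n) + 3)) * exp s / s ^
      (N + (CARD('n) + 3))))"
  have "(\<integral>\<xi>. exp (\<i> * cdot w (zeta \<theta>0 \<xi>)) * P (z, zeta \<theta>0 \<xi>) * jac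
      \<theta>0 \<xi> \<partial>lborel) =
    (\<integral>\<xi>. exp (\<i> * cdot w (zeta \<theta>1 \<xi>)) * P (z, zeta \<theta>1 \<xi>) * jac
        \<theta>1 \<xi> \<partial>lborel)"
  proof (rule contour_shift[OF z _ op cv, where C=C])
    show "hol_vec (\<lambda>\<zeta>. exp (\<i> * cdot w \<zeta>)) UNIV"
      by (intro holomorphic_wrt_exp holomorphic_wrt_cmult hol_vec_cdot_right)
    show "norm \<theta> \<le> 1" if "\<theta> \<in> \<Theta>" for \<theta> using that by (simp add:
        \<Theta>_def)
    show "norm (exp (\<i> * cdot w \<zeta>)) \<le> C / (1 + norm \<xi>) ^ (N + CARD('n) + 3)"
      if t: "\<theta> \<in> \<Theta>" and d: "norm (\<zeta> - zeta \<theta> \<xi>) < c0" for \<theta> \<xi>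
          \<zeta>
    proof -
      have eq: "cdot w \<zeta> = cdot w (\<zeta> - zeta \<theta> \<xi>) + cdot w (zeta \<theta> \<xi>)"
        using linear_simps(2)[OF bounded_linear_cdot_right, of w \<zeta> "zeta \<theta> \<xi>"] by simp
      have "\<i> * cdot w \<zeta> = \<i> * cdot w (\<zeta> - zeta \<theta> \<xi>) + \<i> * cdot w (zeta
          \<theta> \<xi>)"
        by (simp only: eq distrib_left)
      then have "norm (exp (\<i> * cdot w \<zeta>)) = norm (exp (\<i> * cdot w (\<zeta> - zeta \<theta>
          \<xi>))) * norm (exp (\<i> * cdot w (zeta \<theta> \<xi>)))"
        by (simp add: exp_add norm_mult)
      also have "\<dots> \<le> exp (4 * norm w * c0) * (exp (K * norm w) * (fact (N + (CARD('n) + 3)) * exp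
          s / s ^ (N + (CARD('n) + 3))) / (1 + norm \<xi>) ^ (N + (CARD('n) + 3)))"
      proof (rule mult_mono)
        have "norm (exp (\<i> * cdot w (\<zeta> - zeta \<theta> \<xi>))) \<le> exp (norm (\<i> * cdot w
            (\<zeta> - zeta \<theta> \<xi>)))" by (rule norm_exp)
        also have "norm (\<i> * cdot w (\<zeta> - zeta \<theta> \<xi>)) \<le> norm w * norm (\<zeta> - zeta
            \<theta> \<xi>) * 4"
          using norm_cdot_le[of w "\<zeta> - zeta \<theta> \<xi>"] by (simp add: norm_mult)
        also have "\<dots> \<le> norm w * c0 * 4" using d by (intro mult_right_mono mult_left_mono) auto
        finally show "norm (exp (\<i> * cdot w (\<zeta> - zeta \<theta> \<xi>))) \<le> exp (4 * norm w *
            c0)" by (simp add: mult_ac)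
        show "norm (exp (\<i> * cdot w (zeta \<theta> \<xi>))) \<le> exp (K * norm w) * (fact (N + (CARD('n)
            + 3)) * exp s / s ^ (N + (CARD('n) + 3))) / (1 + norm \<xi>) ^ (N + (CARD('n) + 3))"
          by (rule exp_zeta_weight[OF _ s]) (use t in \<open>auto simp: \<Theta>_def\<close>)
      qed auto
      finally show ?thesis by (simp add: C_def add.assoc)
    qed
    show "\<theta>0 \<in> \<Theta>" "\<theta>1 \<in> \<Theta>" using 0 1 by (auto simp: \<Theta>_def s_def
        min_def)
  qed
  then show ?thesis by (simp add: kern_def)
qed

definition \<Gamma> :: "(complex ^ 'n) set" where "\<Gamma> = {w. norm (Im_vec w) < \<kappa> * norm (Re_vec
    w)}"

definition gap :: "complex ^ 'n \<Rightarrow> real" where "gap w = \<kappa> * norm (Re_vec w) - norm (Im_vec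
    w)"

text \<open>Along Re w the margin vanishes at length q = |Im w| / (\<kappa> |Re w|) and equals the
  gap at length 1. The midpoint (1 + q) / 2 keeps the norm strictly below 1 and still leaves half of
  the gap.\<close>

definition dir :: "complex ^ 'n \<Rightarrow> real ^ 'n" where
  "dir w = ((1 + norm (Im_vec w) / (\<kappa> * norm (Re_vec w))) / (2 * norm (Re_vec w))) *\<^sub>R Re_vec
      w"

definition kernel :: "(complex ^ 'n) \<times> (complex ^ 'n) \<Rightarrow> complex" where
  "kernel zw = kern (dir (snd zw)) zw"

lemma \<Gamma>_gap: "w \<in> \<Gamma> \<longleftrightarrow> gap w > 0"
  by (simp add: \<Gamma>_def gap_def)

lemma dir_facts:
  assumes "w \<in> \<Gamma>"
  shows norm_dir: "norm (dir w) < 1" and margin_dir: "margin (dir w) w = gap w / 2"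
proof -
  have lt: "norm (Im_vec w) < \<kappa> * norm (Re_vec w)" using assms by (simp add: \<Gamma>_def)
  then have "Re_vec w \<noteq> 0" using norm_ge_zero[of "Im_vec w"] by auto
  then have r: "norm (Re_vec w) > 0" by simp
  have kr: "\<kappa> * norm (Re_vec w) > 0" using r kappa by simp
  define q where "q = norm (Im_vec w) / (\<kappa> * norm (Re_vec w))"
  have q: "0 \<le> q" "q < 1" using lt kr by (auto simp: q_def)
  have d: "dir w = ((1 + q) / (2 * norm (Re_vec w))) *\<^sub>R Re_vec w" by (simp add: dir_def q_def)
  have "norm (dir w) = (1 + q) / 2" unfolding d using r q by simp
  then show "norm (dir w) < 1" using q by simp
  have "Re_vec w \<bullet> dir w = (1 + q) / 2 * norm (Re_vec w)"
    unfolding d using r by (simp add: power2_norm_eq_inner[symmetric] power2_eq_square)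
  then have "margin (dir w) w = (\<kappa> * norm (Re_vec w) + q * (\<kappa> * norm (Re_vec w))) / 2 - norm
      (Im_vec w)"
    by (simp add: margin_def algebra_simps add_divide_distrib)
  also have "q * (\<kappa> * norm (Re_vec w)) = norm (Im_vec w)"
  proof -
    have "x / y * y = x" if "y > 0" for x y :: real using that by simp
    from this[OF kr] show ?thesis unfolding q_def .
  qed
  finally show "margin (dir w) w = gap w / 2" by (simp add: gap_def)
qed

lemma kernel_eq_kern:
  assumes "z \<in> \<Omega>" "w \<in> \<Gamma>" "norm \<theta> < 1" "margin \<theta> w > 0"
  shows "kernel (z, w) = kern \<theta> (z, w)"
  unfolding kernel_def snd_conv
  by (rule kern_direction) (use assms dir_facts[OF assms(2)] \<Gamma>_gap in auto)

lemma open_\<Gamma>: "open \<Gamma>"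
  unfolding \<Gamma>_def by (intro open_Collect_less continuous_intros)

text \<open>\<open>dir\<close> does not depend holomorphically on \<open>w\<close>. Near a given
  point the direction may be frozen, because \<open>kern\<close> is the same for all admissible
  directions.\<close>

lemma hol_kernel: "hol_pair kernel (\<Omega> \<times> \<Gamma>)"
  unfolding holomorphic_wrt_def
proof
  fix zw0 assume zw0: "zw0 \<in> \<Omega> \<times> \<Gamma>"
  define \<theta> where "\<theta> = dir (snd zw0)"
  have w0: "snd zw0 \<in> \<Gamma>" using zw0 by auto
  have \<theta>: "norm \<theta> < 1" "margin \<theta> (snd zw0) > 0"
    using dir_facts[OF w0] w0 by (auto simp: \<theta>_def \<Gamma>_gap)
  define U where "U = \<Omega> \<times> (\<Gamma> \<inter> {w. margin \<theta> w > 0})"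
  have "open {w. margin \<theta> w > 0}" by (intro open_Collect_less continuous_intros continuous_margin)
  then have oU: "open U" unfolding U_def by (intro open_Times open_Int open_\<Omega> open_\<Gamma>)
  have mem: "zw0 \<in> U" using zw0 \<theta> by (cases zw0) (auto simp: U_def)
  have "hol_pair kernel U"
  proof (rule holomorphic_wrt_cong[OF oU])
    show "hol_pair (kern \<theta>) U"
      by (rule holomorphic_wrt_subset[OF hol_kern]) (use \<theta> in \<open>auto simp: U_def\<close>)
    show "kern \<theta> zw = kernel zw" if "zw \<in> U" for zw
      using that kernel_eq_kern[of "fst zw" "snd zw" \<theta>] \<theta> by (auto simp: U_def)
  qed
  then show "\<exists>f'. (kernel has_derivative f') (at zw0) \<and> (\<forall>c v. f' (case v of (z, w)
      \<Rightarrow> (c *s z, c *s w)) = c * f' v)"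
    using mem unfolding holomorphic_wrt_def by blast
qed

text \<open>The decay rate is half of the gap, and \<open>poly_exp_decay\<close> pays for it with
  the power N + n + 3. Its factor exp(s) is absorbed by exp(\<kappa> |w|), as s \<le> \<kappa>
  |w|.\<close>

lemma norm_kernel_le:
  assumes z0: "z0 \<in> \<Omega>"
  shows "\<exists>e>0. \<exists>C\<ge>0. ball z0 e \<subseteq> \<Omega> \<and> (\<forall>z\<in>ball z0 e.
      \<forall>w\<in>\<Gamma>.
    norm (kernel (z, w)) \<le> C * exp ((K + \<kappa>) * norm w) / gap w ^ (N + CARD('n) + 3))"
proof -
  obtain e C where e: "e > 0" "C \<ge> 0" "ball z0 e \<subseteq> \<Omega>"
      and C': "\<forall>z\<in>ball z0 e. \<forall>\<zeta>\<in>W R \<epsilon> \<union> range (\<lambda>\<xi>.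
          cvec \<xi> 0). norm (P (z, \<zeta>)) \<le> C * (1 + norm (Re_vec \<zeta>)) ^ N"
    using bound_P[OF z0] by blast
    have C: "norm (P (z, \<zeta>)) \<le> C * (1 + norm (Re_vec \<zeta>)) ^ N"
      if "z \<in> ball z0 e" "\<zeta> \<in> W R \<epsilon> \<union> range (\<lambda>\<xi>. cvec \<xi> 0)"
          for z \<zeta> using C' that by simp
  define I where "I = (\<integral>\<xi>. 1 / (1 + norm (\<xi> :: real ^ 'n)) ^ (CARD('n) + 3)
      \<partial>lborel)"
  have I: "I \<ge> 0" unfolding I_def by (intro Bochner_Integration.integral_nonneg) simp
  let ?j = "N + CARD('n) + 3"
  define D where "D = C * ((1 + G) * (fact ?j * 2 ^ ?j)) * I"
  have D: "D \<ge> 0" using e I G_nonneg by (simp add: D_def)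
  have "norm (kernel (z, w)) \<le> D * exp ((K + \<kappa>) * norm w) / gap w ^ ?j"
    if z: "z \<in> ball z0 e" and w: "w \<in> \<Gamma>" for z w
  proof -
    define s where "s = gap w / 2"
    have s: "s > 0" using w by (simp add: s_def \<Gamma>_gap)
    have m: "margin (dir w) w \<ge> s" using margin_dir[OF w] by (simp add: s_def)
    have nd: "norm (dir w) \<le> 1" using norm_dir[OF w] by simp
    have P: "norm (P (z, zeta (dir w) \<xi>)) \<le> C * (1 + norm \<xi>) ^ N" for \<xi>
      using C[OF z zeta_mem[OF nd, of \<xi>]] by (simp add: zeta_def)
    have zO: "z \<in> \<Omega>" using z e by blast
    have sk: "s \<le> \<kappa> * norm w"
    proof -
      have p: "0 \<le> \<kappa> * norm (Re_vec w)" using kappa by simp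
      have "s \<le> \<kappa> * norm (Re_vec w)"
      proof -
        have "(a - b) / 2 \<le> a" if "0 \<le> a" "0 \<le> b" for a b :: real using that by (simp add:
            field_simps)
        from this[OF p norm_ge_zero] show ?thesis unfolding s_def gap_def .
      qed
      also have "\<dots> \<le> \<kappa> * norm w" using kappa by (intro mult_left_mono norm_Re_vec_le) auto
      finally show ?thesis .
    qed
    have "norm (kernel (z, w)) \<le> C * exp (K * norm w) * Cs s * I"
      unfolding kernel_def snd_conv I_def by (rule norm_kern_le[OF m s nd zO P e(2)])
    also have "\<dots> \<le> C * exp (K * norm w) * ((1 + G) * (fact ?j * exp (\<kappa> * norm w) / s ^ ?j))
        * I"
      unfolding Cs_def using e I G_nonneg s sk
      by (intro mult_right_mono mult_left_mono divide_right_mono) (auto simp: add.assoc intro!: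
          mult_left_mono divide_right_mono)
    also have "\<dots> = D * exp ((K + \<kappa>) * norm w) / gap w ^ ?j"
    proof -
      have e: "exp ((K + \<kappa>) * norm w) = exp (K * norm w) * exp (\<kappa> * norm w)"
        by (simp add: distrib_right exp_add)
      have "C * a * (h * (f * b / (x / p))) * I = C * (h * (f * p)) * I * (a * b) / x" for a b f h p x ::
          real
        by simp
      then show ?thesis unfolding D_def s_def power_divide e .
    qed
    finally show ?thesis .
  qed
  then show ?thesis using e D by blast
qed

end

section \<open>The near part\<close>

lemma compact_nbhd_bound:
  fixes U :: "'a::euclidean_space \<Rightarrow> complex"
  assumes A: "compact A" "A \<subseteq> T" "open T" and U: "continuous_on T U"
  obtains \<rho> B where "\<rho> > 0" "B \<ge> 0" "\<And>a y. a \<in> A \<Longrightarrow> norm (y - a) \<le>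
      \<rho> \<Longrightarrow> y \<in> T \<and> norm (U y) \<le> B"
proof -
  obtain \<rho> where \<rho>: "\<rho> > 0" "(\<Union>x\<in>A. cball x \<rho>) \<subseteq> T"
    using compact_subset_open_imp_cball_epsilon_subset[OF A(1,3,2)] by blast
  have eq: "(\<Union>x\<in>A. cball x \<rho>) = {x + y |x y. x \<in> A \<and> y \<in> cball 0 \<rho>}"
  proof (intro equalityI subsetI)
    fix y assume "y \<in> (\<Union>x\<in>A. cball x \<rho>)"
    then obtain x where "x \<in> A" "dist x y \<le> \<rho>" by auto
    then have "y = x + (y - x) \<and> x \<in> A \<and> y - x \<in> cball 0 \<rho>" by (auto simp: dist_norm
        norm_minus_commute)
    then show "y \<in> {x + y |x y. x \<in> A \<and> y \<in> cball 0 \<rho>}" by blast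
  next
    fix z assume "z \<in> {x + y |x y. x \<in> A \<and> y \<in> cball 0 \<rho>}"
    then obtain x y where "z = x + y" "x \<in> A" "norm y \<le> \<rho>" by auto
    then show "z \<in> (\<Union>x\<in>A. cball x \<rho>)" by (intro UN_I[of x]) (auto simp: dist_norm)
  qed
  have "compact (\<Union>x\<in>A. cball x \<rho>)" unfolding eq by (intro compact_sums A compact_cball)
  then have "compact (U ` (\<Union>x\<in>A. cball x \<rho>))"
    by (intro compact_continuous_image continuous_on_subset[OF U \<rho>(2)])
  then have "bounded (U ` (\<Union>x\<in>A. cball x \<rho>))" by (rule compact_imp_bounded)
  then obtain B where B': "\<forall>w\<in>U ` (\<Union>x\<in>A. cball x \<rho>). norm w \<le> B"
    unfolding bounded_iff by (elim exE)
  have B: "norm (U y) \<le> B" if "y \<in> (\<Union>x\<in>A. cball x \<rho>)" for y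
    using B' imageI[OF that] by (rule bspec)
  show thesis
  proof (rule that[of \<rho> "max B 0"])
    fix a y assume "a \<in> A" "norm (y - a) \<le> \<rho>"
    then have "y \<in> (\<Union>x\<in>A. cball x \<rho>)" by (auto simp: dist_norm norm_minus_commute)
    then show "y \<in> T \<and> norm (U y) \<le> max B 0" using B \<rho>(2) by force
  qed (use \<rho> in auto)
qed

text \<open>With t = 1 - Y . Y / \<tau>^2 this is 1 - (1 - t^m)^M. It vanishes to order
  \<open>m\<close> where t = 0, the sphere of radius \<open>\<tau>\<close>, and differs from 1 to
  order \<open>2 * M\<close> at the origin. Being a polynomial in Y, it can follow a contour off the
  real points.\<close>

definition cutc :: "real \<Rightarrow> nat \<Rightarrow> nat \<Rightarrow> complex ^ 'n::finite
    \<Rightarrow> complex" where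
  "cutc \<tau> m M Y = 1 - (1 - (1 - cdot Y Y / of_real (\<tau>\<^sup>2)) ^ m) ^ M"

definition cutr :: "real \<Rightarrow> nat \<Rightarrow> nat \<Rightarrow> real ^ 'n::finite \<Rightarrow>
    real" where
  "cutr \<tau> m M v = (if norm v < \<tau> then 1 - (1 - (1 - (norm v)\<^sup>2 / \<tau>\<^sup>2) ^ m) ^ M
      else 0)"

definition near_ft :: "(complex ^ 'n::finite \<Rightarrow> complex) \<Rightarrow> real \<Rightarrow> nat
    \<Rightarrow> nat \<Rightarrow> complex ^ 'n \<Rightarrow> real ^ 'n \<Rightarrow> complex" where
  "near_ft U \<tau> m M z \<xi> = (\<integral>v. exp (\<i> * of_real (v \<bullet> \<xi>)) * of_real (cutr
      \<tau> m M v) * U (z - cvec v 0) \<partial>lborel)"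

lemma cdot_real: "cdot (cvec a 0) (cvec b 0) = of_real (a \<bullet> b)"
  by (simp add: complex_eq_iff Re_cdot Im_cdot)

lemma cutc_real: "norm v < \<tau> \<Longrightarrow> cutc \<tau> m M (cvec v 0) = of_real (cutr \<tau> m M
    v)"
  by (simp add: cutc_def cutr_def cdot_real power2_norm_eq_inner)

lemma cutr_bounds:
  assumes "\<tau> > 0"
  shows "0 \<le> cutr \<tau> m M v" "cutr \<tau> m M v \<le> 1"
proof -
  have "0 \<le> 1 - (1 - (1 - (norm v)\<^sup>2 / \<tau>\<^sup>2) ^ m) ^ M \<and> 1 - (1 - (1 - (norm
      v)\<^sup>2 / \<tau>\<^sup>2) ^ m) ^ M \<le> 1" if "norm v < \<tau>"
  proof -
    have "(norm v)\<^sup>2 \<le> \<tau>\<^sup>2" using that by (simp add: power_mono)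
    then have t: "0 \<le> 1 - (norm v)\<^sup>2 / \<tau>\<^sup>2"
        "1 - (norm v)\<^sup>2 / \<tau>\<^sup>2 \<le> 1" using assms by auto
    then have "0 \<le> (1 - (norm v)\<^sup>2 / \<tau>\<^sup>2) ^ m"
        "(1 - (norm v)\<^sup>2 / \<tau>\<^sup>2) ^ m \<le> 1" by (auto intro: power_le_one)
    then have "0 \<le> (1 - (1 - (norm v)\<^sup>2 / \<tau>\<^sup>2) ^ m) ^ M"
        "(1 - (1 - (norm v)\<^sup>2 / \<tau>\<^sup>2) ^ m) ^ M \<le> 1"
      by (auto intro: power_le_one)
    then show ?thesis by simp
  qed
  then show "0 \<le> cutr \<tau> m M v" "cutr \<tau> m M v \<le> 1" by (auto simp: cutr_def)
qed

text \<open>Bernoulli's inequality bounds 1 - (1 - x)^m by m x, with x = |v|^2 / \<tau>^2; then the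
  M-th power is taken.\<close>

lemma one_minus_cutr_le:
  assumes \<tau>: "\<tau> > 0" and v: "norm v < \<tau>"
  shows "1 - cutr \<tau> m M v \<le> (real m / \<tau>\<^sup>2) ^ M * (norm v) ^ (2 * M)"
proof -
  have "(norm v)\<^sup>2 \<le> \<tau>\<^sup>2" using v by (simp add: power_mono)
  then have t: "0 \<le> 1 - (norm v)\<^sup>2 / \<tau>\<^sup>2"
      "1 - (norm v)\<^sup>2 / \<tau>\<^sup>2 \<le> 1" using \<tau> by auto
  have "1 + real m * (- ((norm v)\<^sup>2 / \<tau>\<^sup>2)) \<le> (1 + - ((norm v)\<^sup>2 /
      \<tau>\<^sup>2)) ^ m"
    by (rule Bernoulli_inequality) (use t in auto)
  then have "1 - (1 - (norm v)\<^sup>2 / \<tau>\<^sup>2) ^ m \<le> real m * ((norm v)\<^sup>2 /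
      \<tau>\<^sup>2)" by simp
  moreover have "(1 - (norm v)\<^sup>2 / \<tau>\<^sup>2) ^ m \<le> 1" using t by (intro power_le_one)
  ultimately have "(1 - (1 - (norm v)\<^sup>2 / \<tau>\<^sup>2) ^ m) ^ M \<le> (real m * ((norm v)\<^sup>2 /
      \<tau>\<^sup>2)) ^ M"
    by (intro power_mono) auto
  also have "\<dots> = (real m / \<tau>\<^sup>2) ^ M * (norm v) ^ (2 * M)"
    by (simp add: power_mult_distrib power_divide power_mult)
  finally show ?thesis using v by (simp add: cutr_def)
qed

lemma measurable_cutr [measurable]: "cutr \<tau> m M \<in> borel_measurable borel"
  unfolding cutr_def[abs_def] by measurable

text \<open>The geometric sum splits off one factor \<open>X\<close>. With X a power of t this
  carries the vanishing at the sphere over to the cut-off at complex points.\<close>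

lemma norm_one_minus_power_le:
  fixes X :: complex
  shows "norm (1 - (1 - X) ^ M) \<le> norm X * (real M * (1 + norm X) ^ M)"
proof -
  have "1 - (1 - X) ^ M = X * (\<Sum>i<M. (1 - X) ^ i)"
    using one_diff_power_eq[of "1 - X" M] by simp
  moreover have "norm (\<Sum>i<M. (1 - X) ^ i) \<le> (\<Sum>i<M. (1 + norm X) ^ M)"
  proof (rule sum_norm_le)
    fix i assume "i \<in> {..<M}"
    have "norm ((1 - X) ^ i) \<le> (1 + norm X) ^ i"
      unfolding norm_power using norm_triangle_ineq4[of 1 X] by (intro power_mono) auto
    also have "\<dots> \<le> (1 + norm X) ^ M" using \<open>i \<in> {..<M}\<close> by (intro
        power_increasing) auto
    finally show "norm ((1 - X) ^ i) \<le> (1 + norm X) ^ M" .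
  qed
  ultimately show ?thesis by (simp add: norm_mult mult_left_mono)
qed

lemma hol_vec_cdot_self: "hol_vec (\<lambda>Y. cdot Y Y) S"
proof (rule holomorphic_wrtI)
  show "((\<lambda>Y. cdot Y Y) has_derivative (\<lambda>v. cdot Y v + cdot v Y)) (at Y)" for Y ::
      "complex ^ 'a"
    by (auto intro!: derivative_eq_intros)
qed (simp add: algebra_simps)

lemma holomorphic_wrt_diff:
  assumes "holomorphic_wrt cs f S" "holomorphic_wrt cs g S"
  shows "holomorphic_wrt cs (\<lambda>z. f z - g z) S"
  using holomorphic_wrt_add[OF assms(1) holomorphic_wrt_cmult[OF assms(2), of "-1"]] by simp

lemma holomorphic_wrt_power:
  assumes "holomorphic_wrt cs f S"
  shows "holomorphic_wrt cs (\<lambda>z. f z ^ k) S"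
  by (induction k) (auto intro: holomorphic_wrt_const holomorphic_wrt_mult[OF assms])

lemma hol_vec_cutc: "hol_vec (cutc \<tau> m M) S"
  unfolding cutc_def[abs_def] divide_inverse
  by (intro holomorphic_wrt_diff holomorphic_wrt_power holomorphic_wrt_mult holomorphic_wrt_const
      hol_vec_cdot_self)

lemma hol_vec_reflect:
  assumes "hol_vec U T" "\<And>Y. Y \<in> S \<Longrightarrow> z - Y \<in> T"
  shows "hol_vec (\<lambda>Y. U (z - Y)) S"
  by (rule holomorphic_wrt_affine[OF assms(1), where g="\<lambda>Y. z - Y" and g'="\<lambda>v. - v"])
    (use assms(2) in \<open>auto intro!: derivative_eq_intros simp: vec_eq_iff\<close>)

lemma hol_vec_translate:
  assumes "hol_vec U T" "\<And>z. z \<in> S \<Longrightarrow> z - a \<in> T"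
  shows "hol_vec (\<lambda>z. U (z - a)) S"
  by (rule holomorphic_wrt_affine[OF assms(1), where g="\<lambda>z. z - a" and g'="\<lambda>v. v"])
    (use assms(2) in \<open>auto intro!: derivative_eq_intros\<close>)

text \<open>The cut-off is analytic inside the ball of radius \<open>\<tau>\<close> and vanishes to high
    order at its
  boundary, so shifting \<open>v\<close> by \<open>i \<mu> t\<^sup>3 \<xi> / |\<xi>|\<close>, where \<open>t
      = 1 - |v|\<^sup>2 / \<tau>\<^sup>2\<close>, replaces repeated
  integration by parts.\<close>

lemma near_ft_decay:
  fixes U :: "complex ^ 'n::finite \<Rightarrow> complex"
  assumes T: "open T" and U: "hol_vec U T" and \<tau>: "\<tau> > 0"
    and z0: "\<And>v. norm v \<le> \<tau> \<Longrightarrow> z0 - cvec v 0 \<in> T"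
  shows "\<exists>e>0. \<exists>C\<ge>0. \<exists>B\<ge>0. \<forall>z\<in>ball z0 e. (\<forall>v. norm v
      \<le> \<tau> \<longrightarrow> z - cvec v 0 \<in> T \<and> norm (U (z - cvec v 0)) \<le> B) \<and>
    (\<forall>\<xi>. norm (near_ft U \<tau> (3 * j) M z \<xi>) \<le> C / (1 + norm \<xi>) ^ j)"
proof -
  define A where "A = (\<lambda>v. z0 - cvec v 0) ` cball 0 \<tau>"
  have "compact A" unfolding A_def by (intro compact_continuous_image continuous_intros compact_cball)
  moreover have "A \<subseteq> T" unfolding A_def using z0 by auto
  ultimately obtain \<rho> B where \<rho>: "\<rho> > 0" and B0: "B \<ge> 0"
    and B: "\<And>a y. a \<in> A \<Longrightarrow> norm (y - a) \<le> \<rho> \<Longrightarrow> y \<in> T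
        \<and> norm (U y) \<le> B"
    using compact_nbhd_bound[OF _ _ T holomorphic_wrt_continuous_on[OF U]] by blast
  \<comment> \<open>The collar \<open>\<rho>\<close> is shared in thirds: one for the motion of z,
    one for the height \<open>\<mu>\<close> times a direction of norm at most 2, one as the radius
    for Cauchy's inequality.\<close>
  define e where "e = \<rho> / 3"
  define \<mu> where "\<mu> = \<rho> / 6"
  have e: "e > 0" and \<mu>: "\<mu> > 0" using \<rho> by (auto simp: e_def \<mu>_def)
  obtain g1 :: "real ^ 'n \<Rightarrow> real ^ 'n \<Rightarrow> real" and g2 G where
    C2: "C2_fun (\<lambda>v. \<mu> * (max 0 (1 - (v \<bullet> v) / \<tau>\<^sup>2)) ^ 3) g1 g2 G" and g1z':
        "\<forall>y. \<tau> \<le> norm y \<longrightarrow> (\<forall>v. g1 y v = 0)"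
    by (rule C2_bump[OF \<tau> \<mu>]) blast
  have g1z: "g1 y v = 0" if "norm y \<ge> \<tau>" for y v using g1z' that by blast
  define t where "t v = max 0 (1 - (v \<bullet> v) / \<tau>\<^sup>2)" for v :: "real ^ 'n"
  define g where "g v = \<mu> * t v ^ 3" for v
  have C2g: "C2_fun g g1 g2 G" using C2 unfolding g_def[abs_def] t_def .
  have t0: "0 \<le> t v" and t1: "t v \<le> 1" for v unfolding t_def using \<tau> by auto
  have tz: "t v = 0" if "norm v \<ge> \<tau>" for v
  proof -
    have "v \<bullet> v \<ge> \<tau>\<^sup>2" using that \<tau> by (simp add:
        power2_norm_eq_inner[symmetric] power_mono)
    then show ?thesis using \<tau> by (simp add: t_def)
  qed
  have g0: "0 \<le> g v" and gle: "g v \<le> \<mu>" for v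
    using t0[of v] t1[of v] \<mu> by (auto simp: g_def intro!: mult_left_le power_le_one)
  have g1b: "\<bar>g1 y v\<bar> \<le> G * norm v" for y v using C2g unfolding C2_fun_def by blast
  have "\<bar>g 0\<bar> \<le> G * (1 + norm (0::real^'n))" using C2g unfolding C2_fun_def by blast
  then have G: "G \<ge> 0" by simp
  have inT: "z - Y' \<in> T \<and> norm (U (z - Y')) \<le> B"
    if z: "z \<in> ball z0 e" and Y: "norm (Y' - cvec v 0) \<le> 2 * \<rho> / 3" and v:
        "norm v \<le> \<tau>" for z Y' v
  proof (rule B)
    show "z0 - cvec v 0 \<in> A" using v by (auto simp: A_def)
    have "norm (z - Y' - (z0 - cvec v 0)) \<le> norm (z - z0) + norm (Y' - cvec v 0)"
      using norm_triangle_ineq4[of "z - z0" "Y' - cvec v 0"] by (simp add: algebra_simps)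
    also have "\<dots> \<le> \<rho> / 3 + 2 * \<rho> / 3" using z Y by (intro add_mono) (auto simp: e_def
        dist_norm norm_minus_commute)
    finally show "norm (z - Y' - (z0 - cvec v 0)) \<le> \<rho>" by simp
  qed
  \<comment> \<open>The height is at most \<mu> t, so moving v to v + i g \<theta> changes 1 - Y . Y
    / \<tau>^2 by at most (\<mu>^2 + 2 \<tau> \<mu>) t / \<tau>^2. It thus stays below L t, and the
    order of vanishing survives the shift.\<close>
  define L where "L = 1 + (\<mu>\<^sup>2 + 2 * \<tau> * \<mu>) / \<tau>\<^sup>2"
  have L: "L \<ge> 1" using \<mu> \<tau> by (simp add: L_def)
  \<comment> \<open>The shift gains exp(-\<mu> t^3 |\<xi>|), which bounds (1 + |\<xi>|)^j only up to
    t^(-3j). The order 3 j of the cut-off at the sphere cancels exactly this loss.\<close>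
  let ?m = "3 * j"
  define A1 where "A1 = L ^ ?m * (real M * (1 + L ^ ?m) ^ M)"
  have A1: "A1 \<ge> 0" using L by (simp add: A1_def)

  \<comment> \<open>Size of the cut-off on the shifted contour\<close>
  have cut_on: "norm (cutc \<tau> ?m M (cvec v (g v *\<^sub>R \<theta>))) \<le> A1 * t v ^ ?m"
    if v: "norm v < \<tau>" and \<theta>: "norm \<theta> \<le> 1" for v \<theta>
  proof -
    define X where "X = 1 - cdot (cvec v (g v *\<^sub>R \<theta>)) (cvec v (g v *\<^sub>R \<theta>)) /
        of_real (\<tau>\<^sup>2)"
    have vv: "v \<bullet> v \<le> \<tau>\<^sup>2" using v by (simp add: power2_norm_eq_inner[symmetric]
        power_mono)
    then have tv: "t v = 1 - (v \<bullet> v) / \<tau>\<^sup>2" using \<tau> by (simp add: t_def)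
    have gt: "g v \<le> \<mu> * t v"
      unfolding g_def using \<mu> t0[of v] t1[of v] power_decreasing[of 1 3 "t v"] by (intro mult_left_mono)
          auto
    have "cdot (cvec v (g v *\<^sub>R \<theta>)) (cvec v (g v *\<^sub>R \<theta>)) = of_real (v \<bullet> v)
        + (of_real (- ((g v)\<^sup>2 * (\<theta> \<bullet> \<theta>))) + \<i> * of_real (2 * g v * (v
        \<bullet> \<theta>)))"
      by (simp add: complex_eq_iff Re_cdot Im_cdot power2_eq_square inner_commute)
    then have "X = of_real (t v) - (of_real (- ((g v)\<^sup>2 * (\<theta> \<bullet> \<theta>))) + \<i> *
        of_real (2 * g v * (v \<bullet> \<theta>))) / of_real (\<tau>\<^sup>2)"
      by (simp add: X_def tv add_divide_distrib)
    also have "norm \<dots> \<le> t v + norm (of_real (- ((g v)\<^sup>2 * (\<theta> \<bullet> \<theta>))) +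
        \<i> * of_real (2 * g v * (v \<bullet> \<theta>))) / \<tau>\<^sup>2"
      using norm_triangle_ineq4[of "complex_of_real (t v)"] t0[of v] by (metis abs_of_nonneg norm_divide
          norm_of_real zero_le_power2)
    also have "norm (of_real (- ((g v)\<^sup>2 * (\<theta> \<bullet> \<theta>))) + \<i> * of_real (2 * g v *
        (v \<bullet> \<theta>))) \<le> (\<mu>\<^sup>2 + 2 * \<tau> * \<mu>) * t v"
    proof -
      have 1: "(g v)\<^sup>2 * (\<theta> \<bullet> \<theta>) \<le> \<mu> * (\<mu> * t v) * 1"
        unfolding power2_eq_square using g0 gle gt \<theta> \<mu> t0
        by (intro mult_mono) (auto simp: power2_norm_eq_inner[symmetric] power_le_one)
      have "\<bar>v \<bullet> \<theta>\<bar> \<le> \<tau> * 1" using Cauchy_Schwarz_ineq2[of v \<theta>] v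
          \<theta> mult_mono[of "norm v" \<tau> "norm \<theta>" 1] \<tau> by simp
      then have 2: "2 * g v * \<bar>v \<bullet> \<theta>\<bar> \<le> 2 * (\<mu> * t v) * (\<tau> * 1)" using
          g0 gt \<mu> t0 by (intro mult_mono) auto
      have "norm (of_real (- ((g v)\<^sup>2 * (\<theta> \<bullet> \<theta>))) + \<i> * complex_of_real (2 *
          g v * (v \<bullet> \<theta>))) \<le> \<bar>- ((g v)\<^sup>2 * (\<theta> \<bullet> \<theta>))\<bar>
          + \<bar>2 * g v * (v \<bullet> \<theta>)\<bar>"
        using norm_triangle_ineq[of "complex_of_real (- ((g v)\<^sup>2 * (\<theta> \<bullet> \<theta>)))"
            "\<i> * of_real (2 * g v * (v \<bullet> \<theta>))"]
        unfolding norm_mult norm_ii norm_of_real by simp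
      also have "\<dots> = (g v)\<^sup>2 * (\<theta> \<bullet> \<theta>) + 2 * g v * \<bar>v \<bullet>
          \<theta>\<bar>" using g0[of v] by (simp add: abs_mult)
      also have "\<dots> \<le> \<mu> * (\<mu> * t v) * 1 + 2 * (\<mu> * t v) * (\<tau> * 1)" using 1 2 by
          simp
      finally show ?thesis by (simp add: power2_eq_square algebra_simps)
    qed
    finally have X: "norm X \<le> L * t v" using \<tau> by (simp add: L_def divide_right_mono distrib_right)
    have Xm: "norm (X ^ ?m) \<le> L ^ ?m * t v ^ ?m"
      unfolding norm_power power_mult_distrib[symmetric] using X by (intro power_mono) auto
    moreover have "t v ^ ?m \<le> 1" using t0[of v] t1[of v] by (intro power_le_one)
    moreover have "0 \<le> L ^ ?m" using L by simp
    ultimately have Xm1: "norm (X ^ ?m) \<le> L ^ ?m"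
      using mult_left_le[of "t v ^ ?m" "L ^ ?m"] by linarith
    have "norm (cutc \<tau> ?m M (cvec v (g v *\<^sub>R \<theta>))) \<le> norm (X ^ ?m) * (real M * (1 +
        norm (X ^ ?m)) ^ M)"
      unfolding cutc_def X_def[symmetric] by (rule norm_one_minus_power_le)
    also have "\<dots> \<le> L ^ ?m * t v ^ ?m * (real M * (1 + L ^ ?m) ^ M)"
      using Xm Xm1 L t0[of v] by (intro mult_mono power_mono) auto
    finally show ?thesis by (simp add: A1_def mult_ac)
  qed
  define V where "V = (\<integral>v. indicat_real (ball (0::real^'n) \<tau>) v \<partial>lborel)"
  have V0: "V \<ge> 0" unfolding V_def by (intro Bochner_Integration.integral_nonneg) auto
  have intV: "integrable lborel (\<lambda>v. indicat_real (ball (0::real^'n) \<tau>) v)"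
    by (intro integrable_real_indicator emeasure_lborel_ball_finite) auto
  define C where "C = A1 * (fact j * exp \<mu> / \<mu> ^ j) * B * (1 + G) * V"
  have C: "C \<ge> 0" unfolding C_def using A1 \<mu> B0 G V0 by simp

  \<comment> \<open>Shift of the contour for fixed z and \<xi>\<close>
  have main: "norm (near_ft U \<tau> ?m M z \<xi>) \<le> C / (1 + norm \<xi>) ^ j" if z: "z \<in> ball z0 e"
      for z \<xi>
  proof -
    define f0 where "f0 Y = exp (\<i> * cdot (cvec \<xi> 0) Y) * (cutc \<tau> ?m M Y * U (z - Y))" for Y
    \<comment> \<open>\<open>f\<close> agrees with the holomorphic \<open>f0\<close> on the open set
      |Re Y| < \<tau>. Beyond it the height and its derivative vanish, so the truncation is
      compatible with the change of contour.\<close>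
    define f where "f Y = (if norm (Re_vec Y) < \<tau> then f0 Y else 0)" for Y
    define D where "D = {Y. z - Y \<in> T}"
    have hol0: "hol_vec f0 D"
      unfolding f0_def
      by (intro holomorphic_wrt_mult holomorphic_wrt_exp holomorphic_wrt_cmult hol_vec_cdot_right
          hol_vec_cutc hol_vec_reflect[OF U])
        (simp add: D_def)
    have "continuous_on (cball 0 (\<tau> + \<rho>)) (cutc \<tau> ?m M :: complex ^ 'n \<Rightarrow>
        complex)"
      by (rule holomorphic_wrt_continuous_on[OF hol_vec_cutc])
    then have "compact (cutc \<tau> ?m M ` cball (0::complex ^ 'n) (\<tau> + \<rho>))" by (intro
        compact_continuous_image compact_cball)
    then have "bounded (cutc \<tau> ?m M ` cball (0::complex ^ 'n) (\<tau> + \<rho>))" by (rule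
        compact_imp_bounded)
    then obtain A0 where A0': "\<forall>w\<in>cutc \<tau> ?m M ` cball (0::complex ^ 'n) (\<tau> + \<rho>).
        norm w \<le> A0"
      unfolding bounded_iff by (elim exE)
    have A0: "norm (cutc \<tau> ?m M Y) \<le> A0" if "norm (Y :: complex ^ 'n) \<le> \<tau> + \<rho>" for Y
      using A0' that by simp
    \<comment> \<open>This constant depends on \<xi>, which is harmless: it only licenses the shift.
      The decay in \<xi> is read off from the shifted integral afterwards.\<close>
    define C1 where "C1 = exp (norm \<xi> * (\<tau> + \<rho>) * 4) * (A0 * B)"
    have A00: "A0 \<ge> 0" using order_trans[OF norm_ge_zero A0[of 0]] \<tau> \<rho> by simp
    have near0: "Y' \<in> D \<and> norm (f0 Y') \<le> C1" if Y: "norm (Y' - cvec v 0) \<le> 2 * \<rho> / 3"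
        and v: "norm v \<le> \<tau>" for Y' v
    proof -
      have nY: "norm Y' \<le> \<tau> + \<rho>" using norm_triangle_ineq2[of Y' "cvec v 0"] Y v \<rho> by
          simp
      have "norm (exp (\<i> * cdot (cvec \<xi> 0) Y')) \<le> exp (norm (\<i> * cdot (cvec \<xi> 0) Y'))" by
          (rule norm_exp)
      also have "\<dots> \<le> exp (norm \<xi> * (\<tau> + \<rho>) * 4)"
        using norm_cdot_le[of "cvec \<xi> 0" Y'] mult_left_mono[OF nY, of "norm \<xi> * 4"] by (simp add:
            norm_mult mult_ac)
      finally have "norm (f0 Y') \<le> C1" unfolding f0_def norm_mult C1_def
        using A0[OF nY] inT[OF z Y v] A00 by (intro mult_mono) auto
      then show ?thesis using inT[OF z Y v] by (simp add: D_def)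
    qed
    have shift: "norm (cvec v (g v *\<^sub>R \<theta>) - cvec v 0) \<le> \<rho> / 3" if
        "norm \<theta> \<le> 2" for v \<theta>
    proof -
      have "cvec v (g v *\<^sub>R \<theta>) - cvec v 0 = cvec 0 (g v *\<^sub>R \<theta>)" by (rule
          complex_vec_eqI) simp_all
      then have "norm (cvec v (g v *\<^sub>R \<theta>) - cvec v 0) = g v * norm \<theta>" using g0[of v] by
          simp
      also have "\<dots> \<le> \<mu> * 2" using g0 gle that \<mu> by (intro mult_mono) auto
      finally show ?thesis by (simp add: \<mu>_def)
    qed
    let ?k = "CARD('n) + 3"
    define C2 where "C2 = (C1 + 6 * C1 / \<rho>) * (1 + \<tau>) ^ ?k"
    have C10: "C1 \<ge> 0" using A00 B0 by (simp add: C1_def)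
    have wt: "c \<le> C2 / (1 + norm v) ^ ?k" if "c \<le> C1 + 6 * C1 / \<rho>" "norm v < \<tau>" for c and
        v :: "real ^ 'n"
    proof -
      have x: "0 < (1 + norm v) ^ ?k" by (auto intro!: zero_less_power add_pos_nonneg)
      have "(1 + norm v) ^ ?k \<le> (1 + \<tau>) ^ ?k" using that(2) by (intro power_mono) auto
      then have "c * (1 + norm v) ^ ?k \<le> C2"
        unfolding C2_def using that(1) C10 \<rho> x by (intro mult_mono) auto
      then show ?thesis using x by (simp add: pos_le_divide_eq)
    qed
    have fon: "norm (f (cvec v (g v *\<^sub>R \<theta>))) \<le> C2 / (1 + norm v) ^ ?k" if
        "norm \<theta> \<le> 2" for v \<theta>
    proof (cases "norm v < \<tau>")
      case True
      have "norm (f0 (cvec v (g v *\<^sub>R \<theta>))) \<le> C1"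
        using near0[of "cvec v (g v *\<^sub>R \<theta>)" v] shift[OF that, of v] True \<rho> by simp
      then show ?thesis using True C10 \<rho> by (simp add: f_def wt add_increasing2)
    next
      case False
      then show ?thesis using C10 \<rho> \<tau> by (simp add: f_def C2_def)
    qed
    let ?f' = "\<lambda>\<theta> v. frechet_derivative f0 (at (cvec v (g v *\<^sub>R \<theta>)))"
    have inD: "cvec v (g v *\<^sub>R \<theta>) \<in> D" if "norm \<theta> \<le> 2" "norm v < \<tau>" for v
        \<theta>
      using near0[of "cvec v (g v *\<^sub>R \<theta>)" v] shift[OF that(1), of v] that \<rho> by simp
    have openRe: "open {Y :: complex ^ 'n. norm (Re_vec Y) < \<tau>}" by (intro open_Collect_less
        continuous_intros)
    have eq: "(\<integral>v. f (cvec v (g v *\<^sub>R 0)) * (1 + \<i> * of_real (g1 v 0)) \<partial>lborel)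
        =
        (\<integral>v. f (cvec v (g v *\<^sub>R sgn \<xi>)) * (1 + \<i> * of_real (g1 v (sgn \<xi>)))
            \<partial>lborel)"
    \<comment> \<open>Radius 2 provides an open convex set that contains both 0 and the unit vector
      \<open>sgn \<xi>\<close>.\<close>
    proof (rule integral_contour_direction[OF C2g, where \<Theta>="ball 0 2" and S="ball 0 \<tau>" and
        f'="?f'" and C=C2])
      fix \<theta> v :: "real ^ 'n" and c u assume \<theta>: "\<theta> \<in> ball 0 2" and v:
          "v \<in> ball 0 \<tau>"
      have \<theta>': "norm \<theta> \<le> 2" and v': "norm v < \<tau>" using \<theta> v by auto
      show "(f has_derivative ?f' \<theta> v) (at (cvec v (g v *\<^sub>R \<theta>)))"
        by (rule has_derivative_transform_within_open[OF holomorphic_wrtD(1)[OF hol0 inD[OF \<theta>' v']]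
            openRe])
          (use v' in \<open>auto simp: f_def\<close>)
      show "?f' \<theta> v (c *s u) = c * ?f' \<theta> v u" by (rule holomorphic_wrtD(2)[OF hol0 inD[OF
          \<theta>' v']])
      have nb: "Y' \<in> D \<and> norm (f0 Y') \<le> C1" if "Y' \<in> ball (cvec v (g v *\<^sub>R \<theta>))
          (\<rho> / 3)" for Y'
      proof (rule near0)
        have "norm (Y' - cvec v 0) \<le> norm (Y' - cvec v (g v *\<^sub>R \<theta>)) + norm (cvec v (g v
            *\<^sub>R \<theta>) - cvec v 0)"
          by (rule norm_diff_triangle_ineq[of Y' _ _ , simplified] | metis norm_triangle_sub
              norm_diff_triangle_le order_refl)
        also have "\<dots> \<le> \<rho> / 3 + \<rho> / 3" using that shift[OF \<theta>', of v] by (intro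
            add_mono) (auto simp: dist_norm norm_minus_commute)
        finally show "norm (Y' - cvec v 0) \<le> 2 * \<rho> / 3" by simp
      qed (use v' in simp)
      have "norm (?f' \<theta> v u) \<le> 2 * C1 / (\<rho> / 3) * norm u"
      proof (rule holomorphic_wrt_derivative_bound[OF complex_scaling_vec])
        show "hol_vec f0 (ball (cvec v (g v *\<^sub>R \<theta>)) (\<rho> / 3))" by (rule
            holomorphic_wrt_subset[OF hol0]) (use nb in blast)
        show "(f0 has_derivative ?f' \<theta> v) (at (cvec v (g v *\<^sub>R \<theta>)))" by (rule
            holomorphic_wrtD(1)[OF hol0 inD[OF \<theta>' v']])
      qed (use nb \<rho> in auto)
      also have "2 * C1 / (\<rho> / 3) \<le> C2 / (1 + norm v) ^ ?k"
        by (rule wt[OF _ v']) (use C10 \<rho> in simp)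
      finally show "norm (?f' \<theta> v u) \<le> C2 / (1 + norm v) ^ ?k * norm u" by (simp add:
          mult_right_mono)
    next
      fix \<theta> :: "real ^ 'n" assume \<theta>: "\<theta> \<in> ball 0 2"
      have "continuous_on (ball 0 \<tau>) (\<lambda>v. f0 (cvec v (g v *\<^sub>R \<theta>)))"
      proof (rule continuous_on_compose2[OF holomorphic_wrt_continuous_on[OF hol0]])
        have "continuous_on UNIV g"
          by (intro continuous_at_imp_continuous_on ballI has_derivative_continuous[where f'="g1 _"])
            (use C2g in \<open>auto simp: C2_fun_def\<close>)
        then show "continuous_on (ball 0 \<tau>) (\<lambda>v. cvec v (g v *\<^sub>R \<theta>))"
          by (intro continuous_intros) (auto intro: continuous_on_subset)
        show "(\<lambda>v. cvec v (g v *\<^sub>R \<theta>)) ` ball 0 \<tau> \<subseteq> D" using inD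
            \<theta> by auto
      qed
      then have "(\<lambda>v. indicator (ball 0 \<tau>) v *\<^sub>R f0 (cvec v (g v *\<^sub>R \<theta>)))
          \<in> borel_measurable borel"
        by (intro borel_measurable_continuous_on_indicator) auto
      moreover have "(\<lambda>v. f (cvec v (g v *\<^sub>R \<theta>))) = (\<lambda>v. indicator (ball 0
          \<tau>) v *\<^sub>R f0 (cvec v (g v *\<^sub>R \<theta>)))"
        by (auto simp: f_def fun_eq_iff indicator_def)
      ultimately show "(\<lambda>v. f (cvec v (g v *\<^sub>R \<theta>))) \<in> borel_measurable borel" by
          simp
    next
      show "norm (f (cvec y (g y *\<^sub>R \<theta>))) \<le> C2 / (1 + norm y) ^ ?k" if
          "\<theta> \<in> ball 0 2" for \<theta> y
        using that by (intro fon) auto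
    qed (use tz g1z in \<open>auto simp: g_def norm_sgn\<close>)
    have lhs: "f (cvec v (g v *\<^sub>R 0)) * (1 + \<i> * of_real (g1 v 0)) =
        exp (\<i> * of_real (v \<bullet> \<xi>)) * of_real (cutr \<tau> ?m M v) * U (z - cvec v 0)" for v
    proof -
      have "\<bar>g1 v 0\<bar> \<le> 0" using g1b[of v 0] by simp
      then show ?thesis
        by (cases "norm v < \<tau>") (auto simp: f_def f0_def cutc_real cdot_real inner_commute cutr_def)
    qed
    have int_eq: "near_ft U \<tau> ?m M z \<xi> = (\<integral>v. f (cvec v (g v *\<^sub>R sgn \<xi>)) * (1 +
        \<i> * of_real (g1 v (sgn \<xi>))) \<partial>lborel)"
      unfolding near_ft_def eq[symmetric] lhs ..

    \<comment> \<open>Decay read off from the shifted integral\<close>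
    define H where "H = A1 * (fact j * exp \<mu> / \<mu> ^ j) * B * (1 + G) / (1 + norm \<xi>) ^ j"
    have H0: "H \<ge> 0" unfolding H_def using A1 B0 G \<mu> by simp
    have pt: "norm (f (cvec v (g v *\<^sub>R sgn \<xi>)) * (1 + \<i> * of_real (g1 v (sgn \<xi>)))) \<le> H
        * indicat_real (ball 0 \<tau>) v" for v
    proof (cases "norm v < \<tau>")
      case True
      have ns: "norm (sgn \<xi>) \<le> 1" by (simp add: norm_sgn)
      have tp: "t v > 0"
      proof -
        have "v \<bullet> v < \<tau>\<^sup>2" using True by (simp add: power2_norm_eq_inner[symmetric]
            power_strict_mono)
        then show ?thesis using \<tau> by (simp add: t_def)
      qed
      have s: "\<mu> * t v ^ 3 > 0" using tp \<mu> by simp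
      have sg: "sgn \<xi> \<bullet> \<xi> = norm \<xi>"
        by (cases "\<xi> = 0") (simp_all add: sgn_div_norm power2_norm_eq_inner[symmetric] power2_eq_square)
      \<comment> \<open>The direction \<open>sgn \<xi>\<close> aligns the imaginary shift with the
        frequency, so the whole height times |\<xi>| enters the exponent.\<close>
      have ex: "norm (exp (\<i> * cdot (cvec \<xi> 0) (cvec v (g v *\<^sub>R sgn \<xi>)))) = exp (- (\<mu> *
          t v ^ 3) * norm \<xi>)"
        using sg by (simp add: norm_exp_eq_Re Im_cdot g_def inner_commute)
      have "exp (- (\<mu> * t v ^ 3) * norm \<xi>) * (1 + norm \<xi>) ^ j \<le> fact j * exp (\<mu> * t v ^
          3) / (\<mu> * t v ^ 3) ^ j"
        using poly_exp_decay[OF s norm_ge_zero[of \<xi>], of j] by (simp only: mult.commute)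
      also have "\<dots> \<le> fact j * exp \<mu> / (\<mu> * t v ^ 3) ^ j"
        using gle[of v] s by (intro divide_right_mono) (auto simp: g_def)
      also have "\<dots> = (fact j * exp \<mu> / \<mu> ^ j) / t v ^ ?m" by (simp add: power_mult_distrib
          power_mult)
      finally have d0: "exp (- (\<mu> * t v ^ 3) * norm \<xi>) * (1 + norm \<xi>) ^ j \<le> (fact j * exp
          \<mu> / \<mu> ^ j) / t v ^ ?m" .
      have "a * d \<le> c / b" if "a * b \<le> c / d" "b > 0" "d > 0" for a b c d :: real
        using that by (simp add: field_simps)
      from this[OF d0] have d: "exp (- (\<mu> * t v ^ 3) * norm \<xi>) * t v ^ ?m \<le> (fact j * exp \<mu>
          / \<mu> ^ j) / (1 + norm \<xi>) ^ j"
        using tp by (simp add: add_pos_nonneg)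
      have J: "norm (1 + \<i> * complex_of_real (g1 v (sgn \<xi>))) \<le> 1 + G"
      proof -
        have "norm (1 + \<i> * complex_of_real (g1 v (sgn \<xi>))) \<le> 1 + \<bar>g1 v (sgn \<xi>)\<bar>"
          using norm_triangle_ineq[of 1 "\<i> * complex_of_real (g1 v (sgn \<xi>))"] by (simp add:
              norm_mult)
        also have "\<bar>g1 v (sgn \<xi>)\<bar> \<le> G" using g1b[of v "sgn \<xi>"] mult_left_mono[OF ns G]
            by simp
        finally show ?thesis by simp
      qed
      have Ub: "norm (U (z - cvec v (g v *\<^sub>R sgn \<xi>))) \<le> B"
        using inT[OF z, of "cvec v (g v *\<^sub>R sgn \<xi>)" v] shift[of "sgn \<xi>" v] ns True \<rho> by
            simp
      have "norm (f (cvec v (g v *\<^sub>R sgn \<xi>)) * (1 + \<i> * of_real (g1 v (sgn \<xi>)))) =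
          exp (- (\<mu> * t v ^ 3) * norm \<xi>) * (norm (cutc \<tau> ?m M (cvec v (g v *\<^sub>R sgn
              \<xi>))) * norm (U (z - cvec v (g v *\<^sub>R sgn \<xi>))))
          * norm (1 + \<i> * complex_of_real (g1 v (sgn \<xi>)))"
        using True by (simp add: f_def f0_def norm_mult ex del: norm_exp_eq_Re)
      also have "\<dots> \<le> exp (- (\<mu> * t v ^ 3) * norm \<xi>) * ((A1 * t v ^ ?m) * B) * (1 + G)"
        using cut_on[OF True ns] Ub J B0 A1 tp G by (intro mult_mono mult_left_mono) auto
      also have "\<dots> = (exp (- (\<mu> * t v ^ 3) * norm \<xi>) * t v ^ ?m) * (A1 * B * (1 + G))" by
          (simp add: mult_ac)
      also have "\<dots> \<le> (fact j * exp \<mu> / \<mu> ^ j) / (1 + norm \<xi>) ^ j * (A1 * B * (1 + G))"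
        using d A1 B0 G by (intro mult_right_mono) auto
      also have "\<dots> = H * indicat_real (ball 0 \<tau>) v" using True by (simp add: H_def mult_ac)
      finally show ?thesis .
    next
      case False
      then show ?thesis using H0 by (simp add: f_def)
    qed
    have "norm (near_ft U \<tau> ?m M z \<xi>) \<le> (\<integral>v. norm (f (cvec v (g v *\<^sub>R sgn
        \<xi>)) * (1 + \<i> * of_real (g1 v (sgn \<xi>)))) \<partial>lborel)"
      unfolding int_eq by (rule integral_norm_bound)
    also have "\<dots> \<le> (\<integral>v. H * indicat_real (ball (0::real^'n) \<tau>) v \<partial>lborel)"
      by (rule integral_mono_AE') (use pt intV H0 in \<open>auto intro!: AE_I2\<close>)
    also have "\<dots> = H * V" by (simp add: V_def)
    also have "\<dots> = C / (1 + norm \<xi>) ^ j" by (simp add: H_def C_def)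
    finally show ?thesis .
  qed
  have "z - cvec v 0 \<in> T \<and> norm (U (z - cvec v 0)) \<le> B" if "z \<in> ball z0 e"
      "norm v \<le> \<tau>" for z v
    using inT[OF that(1), of "cvec v 0" v] that(2) \<rho> by simp
  then show ?thesis using e C B0 main by blast
qed

lemma borel_measurable_near_ft:
  fixes H :: "real ^ 'n::finite \<Rightarrow> complex"
  assumes [measurable]: "H \<in> borel_measurable borel"
  shows "(\<lambda>\<xi>. \<integral>v. exp (\<i> * of_real (v \<bullet> \<xi>)) * H v \<partial>lborel)
      \<in> borel_measurable borel"
proof -
  have "(\<lambda>\<xi>. \<integral>v. exp (\<i> * of_real (v \<bullet> \<xi>)) * H v \<partial>lborel)
      \<in> borel_measurable lborel"
    by (rule sigma_finite_measure.borel_measurable_lebesgue_integral[OF sigma_finite_lborel]) measurable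
  then show ?thesis by simp
qed

lemma measurable_cutr_U:
  fixes U :: "complex ^ 'n::finite \<Rightarrow> complex"
  assumes U: "continuous_on T U" and z: "\<And>v. norm v \<le> \<tau> \<Longrightarrow> z - cvec v 0 \<in>
      T"
  shows "(\<lambda>v. of_real (cutr \<tau> m M v) * U (z - cvec v 0)) \<in> borel_measurable borel"
proof -
  have "continuous_on (ball 0 \<tau>) (\<lambda>v. U (z - cvec v 0))"
    by (rule continuous_on_compose2[OF U]) (use z in \<open>auto intro!: continuous_intros\<close>)
  then have [measurable]: "(\<lambda>v. indicator (ball 0 \<tau>) v *\<^sub>R U (z - cvec v 0)) \<in>
      borel_measurable borel"
    by (intro borel_measurable_continuous_on_indicator) auto
  have "(\<lambda>v. of_real (cutr \<tau> m M v) * (indicator (ball 0 \<tau>) v *\<^sub>R U (z - cvec v 0)))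
      \<in> borel_measurable borel"
    by measurable
  moreover have "(\<lambda>v. of_real (cutr \<tau> m M v) * (indicator (ball 0 \<tau>) v *\<^sub>R U (z -
      cvec v 0))) = (\<lambda>v. of_real (cutr \<tau> m M v) * U (z - cvec v 0))"
    by (auto simp: cutr_def fun_eq_iff indicator_def)
  ultimately show ?thesis by simp
qed

lemma hol_near_ft:
  fixes U :: "complex ^ 'n::finite \<Rightarrow> complex"
  assumes T: "open T" and U: "hol_vec U T" and \<tau>: "\<tau> > 0" and Z: "open Z"
    and zT: "\<And>z v. z \<in> Z \<Longrightarrow> norm v \<le> \<tau> \<Longrightarrow> z - cvec v 0 \<in>
        T"
  shows "hol_vec (\<lambda>z. near_ft U \<tau> m M z \<xi>) Z"
  unfolding near_ft_def
proof (rule holomorphic_wrt_integral[OF complex_scaling_vec])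
  fix z assume z: "z \<in> Z"
  have [measurable]: "(\<lambda>v. of_real (cutr \<tau> m M v) * U (z - cvec v 0)) \<in> borel_measurable
      borel"
    by (rule measurable_cutr_U[OF holomorphic_wrt_continuous_on[OF U]]) (use zT[OF z] in auto)
  show "(\<lambda>v. exp (\<i> * of_real (v \<bullet> \<xi>)) * of_real (cutr \<tau> m M v) * U (z - cvec v
      0)) \<in> borel_measurable lborel"
    unfolding mult.assoc by measurable
next
  fix v
  show "hol_vec (\<lambda>z. exp (\<i> * of_real (v \<bullet> \<xi>)) * of_real (cutr \<tau> m M v) * U (z -
      cvec v 0)) Z"
  proof (cases "norm v < \<tau>")
    case True
    then show ?thesis by (intro holomorphic_wrt_cmult hol_vec_translate[OF U]) (use zT in auto)
  next
    case False
    then show ?thesis using holomorphic_wrt_const[of _ 0] by (simp add: cutr_def)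
  qed
next
  fix z0 assume z0: "z0 \<in> Z"
  obtain e1 B where e1: "e1 > 0" "B \<ge> 0" and B: "\<forall>z\<in>ball z0 e1. \<forall>v. norm v \<le>
      \<tau> \<longrightarrow> norm (U (z - cvec v 0)) \<le> B"
    \<comment> \<open>Only the locally uniform bound on \<open>U\<close> is taken from this lemma,
      hence the exponent 0.\<close>
    using near_ft_decay[OF T U \<tau> zT[OF z0], of 0 0] by blast
  obtain e2 where e2: "e2 > 0" "ball z0 e2 \<subseteq> Z" using Z z0 openE by blast
  show "\<exists>e>0. \<exists>h. ball z0 e \<subseteq> Z \<and> integrable lborel h \<and>
      (\<forall>z\<in>ball z0 e. \<forall>v\<in>space lborel.
      norm (exp (\<i> * of_real (v \<bullet> \<xi>)) * of_real (cutr \<tau> m M v) * U (z - cvec v 0)) \<le>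
          h v)"
  proof (intro exI[of _ "min e1 e2"] exI[of _ "\<lambda>v. B * indicat_real (ball 0 \<tau>) v"] conjI ballI)
    show "integrable lborel (\<lambda>v. B * indicat_real (ball (0::real^'n) \<tau>) v)"
      by (intro integrable_mult_right integrable_real_indicator emeasure_lborel_ball_finite) auto
    fix z and v :: "real ^ 'n" assume z: "z \<in> ball z0 (min e1 e2)"
    show "norm (exp (\<i> * of_real (v \<bullet> \<xi>)) * of_real (cutr \<tau> m M v) * U (z - cvec v 0))
        \<le> B * indicat_real (ball 0 \<tau>) v"
    proof (cases "norm v < \<tau>")
      case True
      have "norm (U (z - cvec v 0)) \<le> B" using B z True by auto
      moreover have "\<bar>cutr \<tau> m M v\<bar> \<le> 1" using cutr_bounds[OF \<tau>, of m M v] by simp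
      ultimately have "\<bar>cutr \<tau> m M v\<bar> * norm (U (z - cvec v 0)) \<le> 1 * B" by (intro
          mult_mono) auto
      then show ?thesis using True by (simp add: norm_mult norm_exp_eq_Re)
    qed (simp add: cutr_def)
  qed (use e1 e2 in auto)
qed

context holo_symbol
begin

text \<open>The transform decays to order N + n + 2: N powers compensate the symbol and n + 2 make
  the integral converge. The factor 3 in the order of the cut-off is the one required by
  \<open>near_ft_decay\<close>.\<close>

lemma hol_near:
  assumes T: "open T" and U: "hol_vec U T" and \<tau>: "\<tau> > 0" and Z: "open Z" "Z \<subseteq> \<Omega>"
    and zT: "\<And>z v. z \<in> Z \<Longrightarrow> norm v \<le> \<tau> \<Longrightarrow> z - cvec v 0 \<in>
        T"
  shows "hol_vec (\<lambda>z. \<integral>\<xi>. P (z, cvec \<xi> 0) * near_ft U \<tau> (3 * (N + CARD('n) +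
      2)) M z \<xi> \<partial>lborel) Z"
proof (rule holomorphic_wrt_integral[OF complex_scaling_vec])
  let ?j = "N + CARD('n) + 2"
  fix z assume z: "z \<in> Z"
  have 1: "(\<lambda>\<xi>. near_ft U \<tau> (3 * ?j) M z \<xi>) \<in> borel_measurable borel"
    unfolding near_ft_def mult.assoc
    by (rule borel_measurable_near_ft[OF measurable_cutr_U[OF holomorphic_wrt_continuous_on[OF U]]])
      (use zT[OF z] in auto)
  have "continuous_on UNIV (\<lambda>\<xi>. P (z, cvec \<xi> 0))"
    by (rule continuous_on_compose2[OF cont_P]) (use z Z in \<open>auto intro!: continuous_intros\<close>)
  then have 2: "(\<lambda>\<xi>. P (z, cvec \<xi> 0)) \<in> borel_measurable borel" by (rule
      borel_measurable_continuous_onI)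
  show "(\<lambda>\<xi>. P (z, cvec \<xi> 0) * near_ft U \<tau> (3 * ?j) M z \<xi>) \<in> borel_measurable
      lborel"
    using 1 2 by measurable
next
  fix \<xi>
  show "hol_vec (\<lambda>z. P (z, cvec \<xi> 0) * near_ft U \<tau> (3 * (N + CARD('n) + 2)) M z \<xi>) Z"
    by (intro holomorphic_wrt_mult holomorphic_wrt_subset[OF hol_P_real Z(2)] hol_near_ft[OF T U \<tau> Z(1)
        zT])
next
  let ?j = "N + CARD('n) + 2"
  fix z0 assume z0: "z0 \<in> Z"
  obtain e1 C1 where e1: "e1 > 0" "C1 \<ge> 0"
    and C1: "\<forall>z\<in>ball z0 e1. \<forall>\<xi>. norm (near_ft U \<tau> (3 * ?j) M z \<xi>) \<le> C1
        / (1 + norm \<xi>) ^ ?j"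
    using near_ft_decay[OF T U \<tau> zT[OF z0], of ?j M] by blast
  have "z0 \<in> \<Omega>" using z0 Z by blast
  then obtain e2 C2 where e2: "e2 > 0" "C2 \<ge> 0"
    and C2: "\<forall>z\<in>ball z0 e2. \<forall>\<zeta>\<in>W R \<epsilon> \<union> range (\<lambda>\<xi>.
        cvec \<xi> 0). norm (P (z, \<zeta>)) \<le> C2 * (1 + norm (Re_vec \<zeta>)) ^ N"
    using bound_P by blast
  obtain e3 where e3: "e3 > 0" "ball z0 e3 \<subseteq> Z" using Z z0 openE by blast
  define e where "e = min e1 (min e2 e3)"
  show "\<exists>e>0. \<exists>h. ball z0 e \<subseteq> Z \<and> integrable lborel h \<and>
      (\<forall>z\<in>ball z0 e. \<forall>\<xi>\<in>space lborel.
      norm (P (z, cvec \<xi> 0) * near_ft U \<tau> (3 * ?j) M z \<xi>) \<le> h \<xi>)"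
  proof (intro exI[of _ e] exI[of _ "\<lambda>\<xi>. C2 * C1 * (1 / (1 + norm \<xi>) ^ (CARD('n) + 2))"]
      conjI ballI)
    show "integrable lborel (\<lambda>\<xi> :: real ^ 'n. C2 * C1 * (1 / (1 + norm \<xi>) ^ (CARD('n) +
        2)))"
      using integrable_inverse_power_norm[of "CARD('n) + 2", where 'a="real ^ 'n"] by (intro
          integrable_mult_right) simp
    fix z and \<xi> :: "real ^ 'n" assume z: "z \<in> ball z0 e"
    have x: "(1 + norm \<xi>) > 0" by (auto intro: add_pos_nonneg)
    have "norm (P (z, cvec \<xi> 0)) \<le> C2 * (1 + norm (Re_vec (cvec \<xi> 0))) ^ N"
      using z by (intro C2[rule_format]) (auto simp: e_def)
    then have "norm (P (z, cvec \<xi> 0) * near_ft U \<tau> (3 * ?j) M z \<xi>) \<le> (C2 * (1 + norm \<xi>)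
        ^ N) * (C1 / (1 + norm \<xi>) ^ ?j)"
      unfolding norm_mult using C1 z e2 by (intro mult_mono) (auto simp: e_def)
    also have "\<dots> = C2 * C1 * (1 / (1 + norm \<xi>) ^ (CARD('n) + 2))"
      using x by (simp add: power_add)
    finally show "norm (P (z, cvec \<xi> 0) * near_ft U \<tau> (3 * ?j) M z \<xi>) \<le> C2 * C1 * (1 / (1 +
        norm \<xi>) ^ (CARD('n) + 2))" .
  qed (use e1 e2 e3 in \<open>auto simp: e_def\<close>)
qed

end

section \<open>The middle and far parts\<close>

lemma C2_fun_mono: "C2_fun g g1 g2 G \<Longrightarrow> G \<le> G' \<Longrightarrow> C2_fun g g1 g2 G'"
proof -
  assume g: "C2_fun g g1 g2 G" and le: "G \<le> G'"
  have 1: "G * (1 + norm y) \<le> G' * (1 + norm y)" for y :: "real ^ 'a"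
    using le by (intro mult_right_mono) auto
  have 2: "G * norm v \<le> G' * norm v" for v :: "real ^ 'a"
    using le by (intro mult_right_mono) auto
  have 3: "G * norm u * norm v \<le> G' * norm u * norm v" for u v :: "real ^ 'a"
    using le by (intro mult_right_mono) auto
  show ?thesis
    using g unfolding C2_fun_def by (meson 1 2 3 order_trans)
qed

text \<open>The Cauchy-Riemann equations: a real linear map is complex linear as soon as it commutes
  with multiplication by i on real vectors.\<close>

lemma hol_vec_of_real_imag:
  assumes bl: "bounded_linear (f' :: complex ^ 'n::finite \<Rightarrow> complex)"
    and im: "\<And>a. f' (cvec 0 a) = \<i> * f' (cvec a 0)"
  shows "f' (c *s v) = c * f' v"
proof -
  note lin = linear_simps[OF bl]
  have split: "f' (cvec a b) = f' (cvec a 0) + \<i> * f' (cvec b 0)" for a b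
    using lin(1)[of "cvec a 0" "cvec 0 b"] im[of b] cvec_add[of a 0 0 b] by simp
  have addr: "f' (cvec (a + b) 0) = f' (cvec a 0) + f' (cvec b 0)" for a b
    using lin(1)[of "cvec a 0" "cvec b 0"] cvec_add[of a b 0 0] by simp
  have scl: "f' (cvec (r *\<^sub>R a) 0) = of_real r * f' (cvec a 0)" for r a
    using lin(5)[of r "cvec a 0"] cvec_scaleR[of r a 0] by (simp add: scaleR_conv_of_real)
  obtain a b where v: "v = cvec a b" using cvec_Re_Im[of v] by metis
  have "c *s v = cvec (Re c *\<^sub>R a + (- Im c) *\<^sub>R b) (Re c *\<^sub>R b + Im c *\<^sub>R a)"
    unfolding v by (rule complex_vec_eqI) simp_all
  then have "f' (c *s v) = of_real (Re c) * f' (cvec a 0) - of_real (Im c) * f' (cvec b 0)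
     + \<i> * (of_real (Re c) * f' (cvec b 0) + of_real (Im c) * f' (cvec a 0))"
    using split[of "Re c *\<^sub>R a + (- Im c) *\<^sub>R b" "Re c *\<^sub>R b + Im c *\<^sub>R a"] by (simp
        only: addr scl) simp
  also have "\<dots> = (of_real (Re c) + \<i> * of_real (Im c)) * (f' (cvec a 0) + \<i> * f' (cvec b 0))"
    by (simp add: algebra_simps)
  also have "of_real (Re c) + \<i> * of_real (Im c) = c" by (simp add: complex_eq_iff)
  finally show ?thesis unfolding v split[of a b] .
qed

text \<open>\<open>\<tau>\<close> is the radius of the inner cut-off \<open>cutr\<close>, while
  \<open>a\<close> descends from 1 to 0 between \<open>\<tau>\<close> and \<open>\<tau>2\<close>;
  \<open>c\<close> scales the height of the space contour. By \<open>Z_c\<close> the contour has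
  full height wherever \<open>a\<close> matters, so z - Y is real there and the derivatives of
  \<open>a\<close> and \<open>c\<close> never meet. \<open>Z_gap\<close> is the form in which the
  slope of \<open>c\<close> is used: away from the singularity z - Y stays in the cone with a
  uniform gap.\<close>

locale deformation = symbol_contour P \<Omega> R \<epsilon> N \<kappa> R1 G K g g1 g2
  for P :: "(complex ^ 'n::finite) \<times> (complex ^ 'n) \<Rightarrow> complex" and \<Omega> R \<epsilon>
      N \<kappa> R1 G K g g1 g2 +
  fixes U :: "complex ^ 'n \<Rightarrow> complex" and T :: "(complex ^ 'n) set" and u ::
      "real ^ 'n \<Rightarrow> complex"
    and c :: "real ^ 'n \<Rightarrow> real" and c1 c2 Gc
    and a :: "real ^ 'n \<Rightarrow> real" and a1 a2 Ga
    and \<tau> \<tau>2 \<rho>1 Rad :: real and Z :: "(complex ^ 'n) set"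
  assumes open_T: "open T" and hol_U: "hol_vec U T"
    and cont_u: "continuous_on UNIV u" and u_zero: "\<And>y. norm y \<ge> Rad \<Longrightarrow> u y = 0" and
        \<rho>1_le: "\<rho>1 \<le> Rad"
    and C2_c: "C2_fun c c1 c2 Gc" and c_range: "\<And>y. 0 \<le> c y" "\<And>y. c y \<le> 1"
    and c_zero: "\<And>y. norm y \<ge> \<rho>1 \<Longrightarrow> c y = 0" and c1_zero:
        "\<And>y v. norm y \<ge> \<rho>1 \<Longrightarrow> c1 y v = 0"
    and C2_a: "C2_fun a a1 a2 Ga" and a_range: "\<And>y. 0 \<le> a y" "\<And>y. a y \<le> 1"
    and \<tau>_pos: "0 < \<tau>" and \<tau>2: "\<tau> < \<tau>2"
    and a_one: "\<And>v. norm v \<le> \<tau> \<Longrightarrow> a v = 1" and a1_zero: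
        "\<And>v w. norm v \<le> \<tau> \<Longrightarrow> a1 v w = 0"
    and a_far: "\<And>v. norm v \<ge> \<tau>2 \<Longrightarrow> a v = 0" and a1_far:
        "\<And>v w. norm v \<ge> \<tau>2 \<Longrightarrow> a1 v w = 0"
    and open_Z: "open Z" and Z_\<Omega>: "Z \<subseteq> \<Omega>"
    and Z_c: "\<And>z y v. z \<in> Z \<Longrightarrow> norm (Re_vec z - y) < \<tau>2 \<Longrightarrow> c y =
        1 \<and> c1 y v = 0"
    and Z_gap: "\<And>z0. z0 \<in> Z \<Longrightarrow> \<exists>e>0. \<exists>m>0. \<forall>z\<in>ball z0 e.
        \<forall>y. norm (Re_vec z - y) \<ge> \<tau> \<longrightarrow>
       gap (z - cvec y (c y *\<^sub>R Im_vec z)) \<ge> m"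
    and Z_T: "\<And>z0. z0 \<in> Z \<Longrightarrow> \<exists>e>0. \<exists>Q. compact Q \<and> Q
        \<subseteq> T \<and> (\<forall>z\<in>ball z0 e. \<forall>y. norm y < \<rho>1 \<longrightarrow> cvec
        y (c y *\<^sub>R Im_vec z) \<in> Q)"
    and Z_T': "\<And>z v. z \<in> Z \<Longrightarrow> norm v \<le> \<tau>2 \<Longrightarrow> z - cvec v 0
        \<in> T"
begin

lemma gap_real: "gap (cvec v 0) = \<kappa> * norm v"
  by (simp add: gap_def)

lemma \<Gamma>_real: "v \<noteq> 0 \<Longrightarrow> cvec v 0 \<in> \<Gamma>"
  using kappa by (simp add: \<Gamma>_gap gap_real)

definition middle :: "nat \<Rightarrow> complex ^ 'n \<Rightarrow> complex" where
  "middle m z = (\<integral>v. of_real ((1 - cutr \<tau> m (N + CARD('n) + 3) v) * a v) * (kernel (z, cvec v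
      0) * U (z - cvec v 0)) \<partial>lborel)"

lemma continuous_a: "continuous_on S a"
  by (intro continuous_at_imp_continuous_on ballI has_derivative_continuous[where f'="a1 _"])
    (use C2_a in \<open>auto simp: C2_fun_def\<close>)

text \<open>With \<open>m + 1\<close> in place of \<open>m\<close> the right-hand side is at least 1
  outside the ball, even for \<open>m = 0\<close>, so one bound holds everywhere.\<close>

lemma one_minus_cutr_le': "\<bar>1 - cutr \<tau> m M v\<bar> \<le> ((real m + 1) / \<tau>\<^sup>2) ^ M *
    norm v ^ (2 * M)"
proof (cases "norm v < \<tau>")
  case True
  have "\<bar>1 - cutr \<tau> m M v\<bar> \<le> (real m / \<tau>\<^sup>2) ^ M * norm v ^ (2 * M)"
    using one_minus_cutr_le[OF \<tau>_pos True] cutr_bounds[OF \<tau>_pos, of m M v] by simp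
  also have "\<dots> \<le> ((real m + 1) / \<tau>\<^sup>2) ^ M * norm v ^ (2 * M)"
    by (intro mult_right_mono power_mono divide_right_mono) auto
  finally show ?thesis .
next
  case False
  then have "\<tau>\<^sup>2 \<le> (norm v)\<^sup>2" using \<tau>_pos by (simp add: power_mono)
  then have "1 \<le> (norm v)\<^sup>2 / \<tau>\<^sup>2" using \<tau>_pos by simp
  also have "\<dots> \<le> (real m + 1) / \<tau>\<^sup>2 * (norm v)\<^sup>2"
    using \<tau>_pos by (simp add: divide_right_mono distrib_right)
  finally have "1 \<le> ((real m + 1) / \<tau>\<^sup>2 * (norm v)\<^sup>2) ^ M" by (rule one_le_power)
  then have "1 \<le> ((real m + 1) / \<tau>\<^sup>2) ^ M * norm v ^ (2 * M)"
    by (simp only: power_mult_distrib power_mult)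
  then show ?thesis using False by (simp add: cutr_def)
qed

lemma continuous_kernel_real:
  assumes "z \<in> \<Omega>" shows "continuous_on (- {0}) (\<lambda>v. kernel (z, cvec v 0))"
  by (rule continuous_on_compose2[OF holomorphic_wrt_continuous_on[OF hol_kernel]])
    (use assms \<Gamma>_real in \<open>auto intro!: continuous_intros\<close>)

lemma measurable_kernel_real:
  assumes "z \<in> \<Omega>" shows "(\<lambda>v. indicator (- {0}) v *\<^sub>R kernel (z, cvec v 0)) \<in>
      borel_measurable borel"
  by (intro borel_measurable_continuous_on_indicator continuous_kernel_real assms) auto

text \<open>The variable v = z - Y is real here, so z enters only through the symbol and through U(z
  - v), both holomorphically. With J = N + n + 3 the kernel is at most of order |v|^(-J), while the
  cut-off factor is of order |v|^(2 J); the integrand is bounded.\<close>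

lemma hol_middle: "hol_vec (middle m) Z"
proof -
  have "hol_vec (\<lambda>z. \<integral>v. of_real ((1 - cutr \<tau> m (N + CARD('n) + 3) v) * a v) *
      (kernel (z, cvec v 0) * U (z - cvec v 0)) \<partial>lborel) Z"
  proof (rule holomorphic_wrt_integral[OF complex_scaling_vec])
    fix z assume z: "z \<in> Z"
    have zO: "z \<in> \<Omega>" using z Z_\<Omega> by blast
    have "continuous_on (cball 0 \<tau>2) (\<lambda>v. U (z - cvec v 0))"
      by (rule continuous_on_compose2[OF holomorphic_wrt_continuous_on[OF hol_U]])
        (use Z_T'[OF z] in \<open>auto intro!: continuous_intros\<close>)
    then have [measurable]: "(\<lambda>v. indicator (cball 0 \<tau>2) v *\<^sub>R U (z - cvec v 0)) \<in>
        borel_measurable borel"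
      by (intro borel_measurable_continuous_on_indicator) auto
    note [measurable] = measurable_kernel_real[OF zO]
    have [measurable]: "a \<in> borel_measurable borel" by (intro borel_measurable_continuous_onI
        continuous_a)
    have "(\<lambda>v. of_real ((1 - cutr \<tau> m (N + CARD('n) + 3) v) * a v) * ((indicator (- {0}) v
        *\<^sub>R kernel (z, cvec v 0)) * (indicator (cball 0 \<tau>2) v *\<^sub>R U (z - cvec v 0)))) \<in>
        borel_measurable borel"
      by measurable
    moreover have "of_real ((1 - cutr \<tau> m (N + CARD('n) + 3) v) * a v) * ((indicator (- {0}) v
        *\<^sub>R kernel (z, cvec v 0)) * (indicator (cball 0 \<tau>2) v *\<^sub>R U (z - cvec v 0)))
        = of_real ((1 - cutr \<tau> m (N + CARD('n) + 3) v) * a v) * (kernel (z, cvec v 0) * U (z - cvec v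
            0))" for v
    \<comment> \<open>At v = 0 the factor \<open>1 - cutr\<close> is exactly 0, because the outer
      exponent is positive; the product is therefore 0 whatever the total function
      \<open>kernel\<close> returns outside the cone.\<close>
    proof (cases "v = 0 \<or> norm v > \<tau>2")
      case True
      then have "(1 - cutr \<tau> m (N + CARD('n) + 3) v) * a v = 0" using a_far[of v] \<tau>_pos by (auto
          simp: cutr_def)
      then show ?thesis by (simp only: of_real_0 mult_zero_left)
    qed (auto simp: indicator_def)
    ultimately show "(\<lambda>v. of_real ((1 - cutr \<tau> m (N + CARD('n) + 3) v) * a v) * (kernel (z,
        cvec v 0) * U (z - cvec v 0))) \<in> borel_measurable lborel"
      by simp
  next
    fix v :: "real ^ 'n"
    show "hol_vec (\<lambda>z. of_real ((1 - cutr \<tau> m (N + CARD('n) + 3) v) * a v) * (kernel (z, cvec v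
        0) * U (z - cvec v 0))) Z"
    proof (cases "v = 0 \<or> norm v > \<tau>2")
      case True
      then have 0: "(1 - cutr \<tau> m (N + CARD('n) + 3) v) * a v = 0" using a_far[of v] \<tau>_pos by
          (auto simp: cutr_def)
      show ?thesis unfolding 0 using holomorphic_wrt_const[of _ 0] by simp
    next
      case False
      have "hol_vec (\<lambda>z. kernel (z, cvec v 0)) Z"
        by (rule holomorphic_wrt_subset[OF hol_pair_left[OF hol_kernel] Z_\<Omega>]) (use False
            \<Gamma>_real in auto)
      then show ?thesis
        by (intro holomorphic_wrt_cmult holomorphic_wrt_mult hol_vec_translate[OF hol_U]) (use Z_T' False in
            auto)
    qed
  next
    fix z0 assume z0: "z0 \<in> Z"
    have \<tau>2p: "\<tau>2 > 0" using \<tau>_pos \<tau>2 by simp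
    obtain e1 B where e1: "e1 > 0" "B \<ge> 0" and B: "\<forall>z\<in>ball z0 e1. \<forall>v. norm v \<le>
        \<tau>2 \<longrightarrow> norm (U (z - cvec v 0)) \<le> B"
      using near_ft_decay[OF open_T hol_U \<tau>2p Z_T'[OF z0], of 0 0] by blast
    have "z0 \<in> \<Omega>" using z0 Z_\<Omega> by blast
    then obtain e2 C where e2: "e2 > 0" "C \<ge> 0"
      and C: "\<forall>z\<in>ball z0 e2. \<forall>w\<in>\<Gamma>. norm (kernel (z, w)) \<le> C * exp ((K +
          \<kappa>) * norm w) / gap w ^ (N + CARD('n) + 3)"
      using norm_kernel_le by blast
    obtain e3 where e3: "e3 > 0" "ball z0 e3 \<subseteq> Z" using open_Z z0 openE by blast
    define e where "e = min e1 (min e2 e3)"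
    define D where "D = ((real m + 1) / \<tau>\<^sup>2) ^ (N + CARD('n) + 3) * \<tau>2 ^ (N + CARD('n) + 3)
        * (C * exp ((K + \<kappa>) * \<tau>2) / \<kappa> ^ (N + CARD('n) + 3)) * B"
    have D0: "D \<ge> 0" unfolding D_def using e1 e2 \<tau>2p kappa by simp
    show "\<exists>e>0. \<exists>h. ball z0 e \<subseteq> Z \<and> integrable lborel h \<and>
        (\<forall>z\<in>ball z0 e. \<forall>v\<in>space lborel.
       norm (of_real ((1 - cutr \<tau> m (N + CARD('n) + 3) v) * a v) * (kernel (z, cvec v 0) * U (z - cvec
           v 0))) \<le> h v)"
    proof (intro exI[of _ e] exI[of _ "\<lambda>v. D * indicat_real (cball 0 \<tau>2) v"] conjI ballI)
      show "integrable lborel (\<lambda>v. D * indicat_real (cball (0::real^'n) \<tau>2) v)"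
        by (intro integrable_mult_right integrable_real_indicator emeasure_lborel_cball_finite) auto
      fix z and v :: "real ^ 'n" assume z: "z \<in> ball z0 e"
      show "norm (of_real ((1 - cutr \<tau> m (N + CARD('n) + 3) v) * a v) * (kernel (z, cvec v 0) * U (z -
          cvec v 0))) \<le> D * indicat_real (cball 0 \<tau>2) v"
      proof (cases "v = 0 \<or> norm v > \<tau>2")
        case True
        then have 0: "(1 - cutr \<tau> m (N + CARD('n) + 3) v) * a v = 0" using a_far[of v] \<tau>_pos by
            (auto simp: cutr_def)
        show ?thesis unfolding 0 using D0 by simp
      next
        case False
        then have v: "norm v > 0" "norm v \<le> \<tau>2" by auto
        have k: "norm (kernel (z, cvec v 0)) \<le> C * exp ((K + \<kappa>) * norm v) / (\<kappa> * norm v) ^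
            (N + CARD('n) + 3)"
          using C[rule_format, of z "cvec v 0"] z False \<Gamma>_real gap_real by (auto simp: e_def)
        also have "\<dots> \<le> C * exp ((K + \<kappa>) * \<tau>2) / (\<kappa> * norm v) ^ (N + CARD('n) +
            3)"
          using v K kappa e2 by (intro divide_right_mono mult_left_mono) auto
        finally have k: "norm (kernel (z, cvec v 0)) \<le> (C * exp ((K + \<kappa>) * \<tau>2) / \<kappa> ^
            (N + CARD('n) + 3)) / norm v ^ (N + CARD('n) + 3)"
          by (simp add: power_mult_distrib)
        have cut: "\<bar>1 - cutr \<tau> m (N + CARD('n) + 3) v\<bar> * \<bar>a v\<bar> \<le> (((real m + 1)
            / \<tau>\<^sup>2) ^ (N + CARD('n) + 3) * norm v ^ (2 * (N + CARD('n) + 3))) * 1"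
          using a_range[of v] by (intro mult_mono one_minus_cutr_le') auto
        have Ub: "norm (U (z - cvec v 0)) \<le> B" using B z v by (auto simp: e_def)
        have pw: "norm v ^ (N + CARD('n) + 3) \<le> \<tau>2 ^ (N + CARD('n) + 3)" using v by (intro
            power_mono) auto
        define M1 where "M1 = C * exp ((K + \<kappa>) * \<tau>2) / \<kappa> ^ (N + CARD('n) + 3)"
        have M1: "M1 \<ge> 0" using e2 kappa by (simp add: M1_def)
        have "norm (of_real ((1 - cutr \<tau> m (N + CARD('n) + 3) v) * a v) * (kernel (z, cvec v 0) * U (z
            - cvec v 0))) \<le>
            ((((real m + 1) / \<tau>\<^sup>2) ^ (N + CARD('n) + 3) * norm v ^ (2 * (N + CARD('n) + 3))) * 1)
                * (M1 / norm v ^ (N + CARD('n) + 3) * B)"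
          unfolding norm_mult norm_of_real abs_mult
          by (intro mult_mono cut k[folded M1_def] Ub mult_nonneg_nonneg divide_nonneg_nonneg M1) auto
        also have "\<dots> = ((real m + 1) / \<tau>\<^sup>2) ^ (N + CARD('n) + 3) * norm v ^ (N + CARD('n) +
            3) * M1 * B"
        proof -
          have "(x * p ^ (2 * j) * 1) * (y / p ^ j * b) = x * p ^ j * y * b" if "p > 0" for x y b p :: real
              and j
            using that by (simp add: mult_2 power_add)
          from this[OF v(1)] show ?thesis .
        qed
        also have "\<dots> \<le> ((real m + 1) / \<tau>\<^sup>2) ^ (N + CARD('n) + 3) * \<tau>2 ^ (N +
            CARD('n) + 3) * M1 * B"
          using M1 e1 pw by (intro mult_right_mono mult_left_mono) auto
        also have "\<dots> = D * indicat_real (cball 0 \<tau>2) v" using v by (simp add: D_def M1_def)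
        finally show ?thesis .
      qed
    qed (use e1 e2 e3 in \<open>auto simp: e_def\<close>)
  qed
  then show ?thesis unfolding middle_def[abs_def] .
qed

definition Yc :: "real ^ 'n \<Rightarrow> complex ^ 'n \<Rightarrow> complex ^ 'n" where
  "Yc y z = cvec y (c y *\<^sub>R Im_vec z)"

text \<open>For \<open>norm y \<ge> \<rho>1\<close> the contour is real, and only the smooth function
    \<open>u\<close> is available there.\<close>

definition Gy :: "real ^ 'n \<Rightarrow> complex ^ 'n \<Rightarrow> complex" where
  "Gy y Y = (if norm y < \<rho>1 then U Y else u y)"

text \<open>Here z and Y are independent variables, and \<open>y\<close> merely selects the branch
  of \<open>Gy\<close>. For fixed \<open>y\<close> this is holomorphic in the pair; the dependence
  on z through the contour is added by the chain rule.\<close>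

definition \<Phi> :: "real ^ 'n \<Rightarrow> (complex ^ 'n) \<times> (complex ^ 'n) \<Rightarrow> complex"
    where
  "\<Phi> y p = Gy y (snd p) * kernel (fst p, fst p - snd p)"

text \<open>The last factor is the Jacobian determinant of y -> \<open>Yc y z\<close>.\<close>

definition q :: "complex ^ 'n \<Rightarrow> real ^ 'n \<Rightarrow> complex" where
  "q z y = of_real (1 - a (Re_vec z - y)) * \<Phi> y (z, Yc y z) * (1 + \<i> * of_real (c1 y (Im_vec z)))"

text \<open>Product rule in z. The contour follows z only through its imaginary part, so its
  increment \<open>cvec 0 (c y *\<^sub>R Im_vec h)\<close> is not complex linear in
  \<open>h\<close>: the integrand is not holomorphic in z point by point.\<close>

definition q' :: "complex ^ 'n \<Rightarrow> real ^ 'n \<Rightarrow> complex ^ 'n \<Rightarrow> complex"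
    where
  "q' z y h = of_real (- a1 (Re_vec z - y) (Re_vec h)) * \<Phi> y (z, Yc y z) * (1 + \<i> * of_real (c1 y
      (Im_vec z)))
     + of_real (1 - a (Re_vec z - y)) * frechet_derivative (\<Phi> y) (at (z, Yc y z)) (h, cvec 0 (c y
         *\<^sub>R Im_vec h)) * (1 + \<i> * of_real (c1 y (Im_vec z)))
     + of_real (1 - a (Re_vec z - y)) * \<Phi> y (z, Yc y z) * (\<i> * of_real (c1 y (Im_vec h)))"

definition far :: "complex ^ 'n \<Rightarrow> complex" where
  "far z = (\<integral>y. q z y \<partial>lborel)"

lemma c_facts:
  shows has_derivative_c: "(c has_derivative c1 y) (at y)"
    and has_derivative_c1: "((\<lambda>y. c1 y v) has_derivative c2 y v) (at y)"
    and c1_bound: "\<bar>c1 y v\<bar> \<le> Gc * norm v"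
  using C2_c unfolding C2_fun_def by blast+

lemma a_facts:
  shows has_derivative_a: "(a has_derivative a1 y) (at y)"
    and a1_bound: "\<bar>a1 y v\<bar> \<le> Ga * norm v"
  using C2_a unfolding C2_fun_def by blast+

lemma Gc_nonneg: "Gc \<ge> 0" and Ga_nonneg: "Ga \<ge> 0"
proof -
  have "\<bar>c 0\<bar> \<le> Gc * (1 + norm (0 :: real ^ 'n))"
      "\<bar>a 0\<bar> \<le> Ga * (1 + norm (0 :: real ^ 'n))"
    using C2_c C2_a unfolding C2_fun_def by blast+
  then show "Gc \<ge> 0" "Ga \<ge> 0" by simp_all
qed

lemma gap_lipschitz: "gap w' \<ge> gap w - (\<kappa> + 1) * norm (w' - w)"
proof -
  have 1: "norm (Re_vec w) - norm (Re_vec w') \<le> norm (w' - w)"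
    using norm_triangle_ineq2[of "Re_vec w" "Re_vec w'"] norm_Re_vec_le[of "w - w'"] by (simp add:
        norm_minus_commute)
  have 2: "norm (Im_vec w') - norm (Im_vec w) \<le> norm (w' - w)"
    using norm_triangle_ineq2[of "Im_vec w'" "Im_vec w"] norm_Im_vec_le[of "w' - w"] by simp
  have "\<kappa> * (norm (Re_vec w) - norm (Re_vec w')) \<le> \<kappa> * norm (w' - w)" using 1 kappa by
      (intro mult_left_mono) auto
  then show ?thesis using 2 by (simp add: gap_def algebra_simps)
qed

text \<open>One radius and one bound serve for all \<open>y\<close> away from the singularity, so
  Cauchy's inequality later bounds the derivatives of \<open>\<Phi> y\<close> uniformly in
  \<open>y\<close>.\<close>

lemma \<Phi>_local:
  assumes z0: "z0 \<in> Z"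
  shows "\<exists>s>0. \<exists>C\<ge>0. ball z0 s \<subseteq> Z \<and> (\<forall>z\<in>ball z0 s.
      \<forall>y. norm y \<le> Rad \<longrightarrow> norm (Re_vec z - y) \<ge> \<tau> \<longrightarrow>
     hol_pair (\<Phi> y) (ball (z, Yc y z) s) \<and> (\<forall>p\<in>ball (z, Yc y z) s. norm (\<Phi> y p)
         \<le> C))"
proof -
  obtain e1 m where e1: "e1 > 0" "m > 0" and gp: "\<forall>z\<in>ball z0 e1. \<forall>y. norm (Re_vec z - y)
      \<ge> \<tau> \<longrightarrow> gap (z - Yc y z) \<ge> m"
    using Z_gap[OF z0] unfolding Yc_def by blast
  obtain e2 Q where e2: "e2 > 0" "compact Q" "Q \<subseteq> T" and Q:
      "\<forall>z\<in>ball z0 e2. \<forall>y. norm y < \<rho>1 \<longrightarrow> Yc y z \<in> Q"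
    using Z_T[OF z0] unfolding Yc_def by blast
  obtain \<rho> B where \<rho>: "\<rho> > 0" "B \<ge> 0" and B:
      "\<And>a y. a \<in> Q \<Longrightarrow> norm (y - a) \<le> \<rho> \<Longrightarrow> y \<in> T \<and>
      norm (U y) \<le> B"
    using compact_nbhd_bound[OF e2(2,3) open_T holomorphic_wrt_continuous_on[OF hol_U]] by blast
  have "compact (u ` cball 0 Rad)" by (intro compact_continuous_image continuous_on_subset[OF cont_u]) auto
  then have "bounded (u ` cball 0 Rad)" by (rule compact_imp_bounded)
  then obtain Bu where Bu': "\<forall>w\<in>u ` cball 0 Rad. norm w \<le> Bu" unfolding bounded_iff by (elim
      exE)
  have "z0 \<in> \<Omega>" using z0 Z_\<Omega> by blast
  then obtain e3 C where e3: "e3 > 0" "C \<ge> 0" "ball z0 e3 \<subseteq> \<Omega>"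
    and C: "\<forall>z\<in>ball z0 e3. \<forall>w\<in>\<Gamma>. norm (kernel (z, w)) \<le> C * exp ((K +
        \<kappa>) * norm w) / gap w ^ (N + CARD('n) + 3)"
    using norm_kernel_le by blast
  obtain e4 where e4: "e4 > 0" "ball z0 e4 \<subseteq> Z" using open_Z z0 openE by blast
  \<comment> \<open>Half of \<open>e3\<close>, as p is within \<open>s\<close> of a point that is
    itself within \<open>s\<close> of \<open>z0\<close>. The last entry: z - Y moves by at most 2 s,
    which by \<open>gap_lipschitz\<close> lowers the gap by at most m / 2.\<close>
  define s where "s = min (min 1 e1) (min (min e2 (e3 / 2)) (min e4 (min \<rho> (m / (4 * (\<kappa> +
      1))))))"
  have s: "s > 0" using e1 e2 e3 e4 \<rho> kappa by (simp add: s_def)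
  have sle: "s \<le> 1" "s \<le> e1" "s \<le> e2" "s \<le> e3 / 2" "s \<le> e4" "s \<le> \<rho>"
      "s \<le> m / (4 * (\<kappa> + 1))"
    unfolding s_def by linarith+
  define B' where "B' = max B (max Bu 0)"
  define Bw where "Bw = norm z0 + 1 + (Rad + (norm z0 + 1)) + 2"
  define C' where "C' = B' * (C * exp ((K + \<kappa>) * Bw) / (m / 2) ^ (N + CARD('n) + 3))"
  have C'0: "C' \<ge> 0" using e1 e3 by (simp add: C'_def B'_def)
  have main: "hol_pair (\<Phi> y) (ball (z, Yc y z) s) \<and> (\<forall>p\<in>ball (z, Yc y z) s. norm
      (\<Phi> y p) \<le> C')"
    if z: "z \<in> ball z0 s" and y: "norm y \<le> Rad" and far: "norm (Re_vec z - y) \<ge> \<tau>" for z y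
  proof -
    let ?D = "ball (z, Yc y z) s"
    have zn: "norm (z - z0) < s" using z by (simp add: dist_norm norm_minus_commute)
    have nz: "norm z \<le> norm z0 + 1" using zn sle(1) norm_triangle_ineq2[of z z0] by linarith
    have nY: "norm (Yc y z) \<le> Rad + (norm z0 + 1)"
    proof -
      have "norm (Yc y z) \<le> norm y + c y * norm (Im_vec z)"
        using norm_complex_vec_le[of "Yc y z"] c_range(1)[of y] by (simp add: Yc_def)
      also have "c y * norm (Im_vec z) \<le> 1 * norm z" using c_range by (intro mult_mono norm_Im_vec_le)
          auto
      finally show ?thesis using y nz by simp
    qed
    have pt: "fst p \<in> ball z0 e3 \<and> fst p - snd p \<in> \<Gamma> \<and> gap (fst p - snd p) \<ge> m
        / 2 \<and> norm (fst p - snd p) \<le> Bw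
        \<and> (norm y < \<rho>1 \<longrightarrow> snd p \<in> T) \<and> norm (Gy y (snd p)) \<le>
            B'" if p: "p \<in> ?D" for p
    proof -
      have d: "norm (fst p - z) < s" "norm (snd p - Yc y z) < s"
        using p dist_fst_le[of p "(z, Yc y z)"] dist_snd_le[of p "(z, Yc y z)"]
        by (auto simp: dist_commute dist_norm norm_minus_commute intro: le_less_trans)
      have "norm (fst p - z0) \<le> norm (fst p - z) + norm (z - z0)"
        using norm_triangle_ineq[of "fst p - z" "z - z0"] by simp
      then have 1: "fst p \<in> ball z0 e3" using d(1) zn sle(4) by (simp add: dist_norm norm_minus_commute)
      have dw_eq: "(fst p - snd p) - (z - Yc y z) = (fst p - z) - (snd p - Yc y z)" by simp
      have dw: "norm ((fst p - snd p) - (z - Yc y z)) \<le> 2 * s"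
        unfolding dw_eq using norm_triangle_ineq4[of "fst p - z" "snd p - Yc y z"] d by linarith
      have "(\<kappa> + 1) * norm ((fst p - snd p) - (z - Yc y z)) \<le> (\<kappa> + 1) * (2 * (m / (4 *
          (\<kappa> + 1))))"
        using dw sle(7) kappa by (intro mult_left_mono) auto
      also have "\<dots> = m / 2" using kappa by (simp add: field_simps)
      finally have gp': "gap (fst p - snd p) \<ge> m / 2"
        using gap_lipschitz[of "z - Yc y z" "fst p - snd p"] gp[rule_format, of z y] z sle(2) far by auto
      then have G: "fst p - snd p \<in> \<Gamma>" using e1 by (simp add: \<Gamma>_gap)
      have "norm (fst p - snd p) \<le> norm (z - Yc y z) + norm ((fst p - snd p) - (z - Yc y z))"
        using norm_triangle_ineq[of "z - Yc y z" "(fst p - snd p) - (z - Yc y z)"] by simp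
      also have "norm (z - Yc y z) \<le> norm z + norm (Yc y z)" by (rule norm_triangle_ineq4)
      finally have nw: "norm (fst p - snd p) \<le> Bw" using nz nY dw sle(1) by (simp add: Bw_def)
      have 3: "(norm y < \<rho>1 \<longrightarrow> snd p \<in> T) \<and> norm (Gy y (snd p)) \<le> B'"
      proof (cases "norm y < \<rho>1")
        case True
        have "Yc y z \<in> Q" using Q z sle(3) True by auto
        from B[OF this, of "snd p"] d(2) sle(6) show ?thesis using True by (auto simp: Gy_def B'_def)
      next
        case False
        have "norm (u y) \<le> Bu" using Bu' y by simp
        then show ?thesis using False by (simp add: Gy_def B'_def)
      qed
      show ?thesis using 1 G gp' nw 3 by blast
    qed
    have h1: "hol_pair (\<lambda>p. Gy y (snd p)) ?D"
    proof (cases "norm y < \<rho>1")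
      case True
      have "hol_pair (\<lambda>p. U (snd p)) (UNIV \<times> T)" by (rule hol_vec_snd[OF hol_U])
      moreover have "?D \<subseteq> UNIV \<times> T" using pt True by (force simp: mem_Times_iff)
      ultimately show ?thesis using True by (simp add: Gy_def holomorphic_wrt_subset)
    next
      case False
      then show ?thesis by (simp add: Gy_def holomorphic_wrt_const)
    qed
    have h2: "hol_pair (\<lambda>p. kernel (fst p, fst p - snd p)) ?D"
    proof (rule holomorphic_wrt_affine[OF hol_kernel, where g'="\<lambda>p. (fst p, fst p - snd p)"])
      show "((\<lambda>p. (fst p, fst p - snd p)) has_derivative (\<lambda>p. (fst p, fst p - snd p))) (at
          p)" for p :: "(complex^'n) \<times> (complex^'n)"
        by (auto intro!: derivative_eq_intros)
      show "(fst p, fst p - snd p) \<in> \<Omega> \<times> \<Gamma>" if "p \<in> ?D" for p using pt[OF that]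
          e3(3) by auto
    qed (auto simp: vec_eq_iff algebra_simps)
    have "norm (\<Phi> y p) \<le> C'" if p: "p \<in> ?D" for p
    proof -
      note F = pt[OF p]
      have "norm (kernel (fst p, fst p - snd p)) \<le> C * exp ((K + \<kappa>) * norm (fst p - snd p)) / gap
          (fst p - snd p) ^ (N + CARD('n) + 3)"
        using C F by blast
      also have "\<dots> \<le> C * exp ((K + \<kappa>) * Bw) / (m / 2) ^ (N + CARD('n) + 3)"
        using F e1 e3 K kappa by (intro frac_le mult_left_mono power_mono) auto
      finally show ?thesis unfolding \<Phi>_def norm_mult C'_def using F by (intro mult_mono) (auto simp:
          B'_def)
    qed
    then show ?thesis using holomorphic_wrt_mult[OF h1 h2] unfolding \<Phi>_def[abs_def] by blast
  qed
  have "ball z0 s \<subseteq> Z" using e4 sle(5) by auto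
  then show ?thesis using s C'0 main by blast
qed

lemma Yc_affine: "((\<lambda>z. (z, Yc y z)) has_derivative (\<lambda>h. (h, cvec 0 (c y *\<^sub>R Im_vec
    h)))) (at z)"
  unfolding Yc_def by (auto intro!: derivative_eq_intros)

lemma \<Phi>_zero: "norm y > Rad \<Longrightarrow> \<Phi> y = (\<lambda>p. 0)"
  using u_zero[of y] \<rho>1_le by (auto simp: \<Phi>_def Gy_def fun_eq_iff)

lemma bounded_linear_c1: "bounded_linear (c1 y)"
  by (rule has_derivative_bounded_linear[OF has_derivative_c])

text \<open>Off the open ball of radius \<open>\<tau>\<close> around Re z the chain rule applies.
  Inside it \<open>a = 1\<close> on a neighbourhood, so the integrand vanishes identically
  there.\<close>

lemma has_derivative_q:
  assumes z: "z \<in> Z"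
  shows "((\<lambda>z. q z y) has_derivative q' z y) (at z)"
proof (cases "norm (Re_vec z - y) \<ge> \<tau>")
  case True
  have d\<Phi>: "(\<Phi> y has_derivative frechet_derivative (\<Phi> y) (at (z, Yc y z))) (at (z, Yc y z))"
  proof (cases "norm y \<le> Rad")
    case y: True
    obtain s C where s: "s > 0" and *: "\<forall>z'\<in>ball z s. \<forall>y. norm y \<le> Rad
        \<longrightarrow> norm (Re_vec z' - y) \<ge> \<tau> \<longrightarrow>
     hol_pair (\<Phi> y) (ball (z', Yc y z') s) \<and> (\<forall>p\<in>ball (z', Yc y z') s. norm (\<Phi> y
         p) \<le> C)"
      using \<Phi>_local[OF z] by blast
    have "z \<in> ball z s" using s by simp
    then have "hol_pair (\<Phi> y) (ball (z, Yc y z) s)" using * y True by blast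
    then show ?thesis using s by (intro holomorphic_wrtD(1)) auto
  next
    case False
    then show ?thesis by (simp add: \<Phi>_zero)
  qed
  have d1: "((\<lambda>z. \<Phi> y (z, Yc y z)) has_derivative (\<lambda>h. frechet_derivative (\<Phi> y)
      (at (z, Yc y z)) (h, cvec 0 (c y *\<^sub>R Im_vec h)))) (at z)"
    by (rule has_derivative_compose[where g="\<Phi> y", OF Yc_affine d\<Phi>])
  have d2: "((\<lambda>z. complex_of_real (1 - a (Re_vec z - y))) has_derivative (\<lambda>h. of_real (- a1
      (Re_vec z - y) (Re_vec h)))) (at z)"
  proof -
    have "((\<lambda>z. a (Re_vec z - y)) has_derivative (\<lambda>h. a1 (Re_vec z - y) (Re_vec h))) (at z)"
      by (rule has_derivative_compose[where g=a, OF _ has_derivative_a]) (auto intro!: derivative_eq_intros)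
    then show ?thesis by (auto intro!: derivative_eq_intros)
  qed
  have d3: "((\<lambda>z. 1 + \<i> * complex_of_real (c1 y (Im_vec z))) has_derivative (\<lambda>h. \<i> *
      of_real (c1 y (Im_vec h)))) (at z)"
    by (auto intro!: derivative_eq_intros bounded_linear.has_derivative[OF bounded_linear_c1])
  show ?thesis
    unfolding q_def
    by (rule has_derivative_eq_rhs[OF has_derivative_mult[OF has_derivative_mult[OF d2 d1] d3]])
      (simp add: q'_def fun_eq_iff algebra_simps)
next
  case False
  define S where "S = {z' :: complex ^ 'n. norm (Re_vec z' - y) < \<tau>}"
  have "open S" unfolding S_def by (intro open_Collect_less continuous_intros)
  moreover have "z \<in> S" using False by (simp add: S_def)
  ultimately have "((\<lambda>z. q z y) has_derivative (\<lambda>h. 0)) (at z)"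
    by (rule has_derivative_transform_within_open[OF has_derivative_const[of 0]]) (simp add: q_def S_def
        a_one)
  moreover have "q' z y = (\<lambda>h. 0)" using False by (simp add: q'_def fun_eq_iff a_one a1_zero)
  ultimately show ?thesis by simp
qed

lemma norm_J_le: "norm (1 + \<i> * complex_of_real (c1 y v)) \<le> 1 + Gc * norm v"
proof -
  have "norm (1 + \<i> * complex_of_real (c1 y v)) \<le> 1 + \<bar>c1 y v\<bar>"
    using norm_triangle_ineq[of 1 "\<i> * complex_of_real (c1 y v)"] by (simp add: norm_mult)
  then show ?thesis using c1_bound[of y v] by simp
qed

lemma continuous_c: "continuous_on S c" and continuous_c1: "continuous_on S (\<lambda>y. c1 y v)"
  by (intro continuous_at_imp_continuous_on ballI has_derivative_continuous[OF has_derivative_c]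
      has_derivative_continuous[OF has_derivative_c1])+

lemma contour_facts:
  assumes z: "z \<in> Z"
  shows "norm (Re_vec z - y) \<ge> \<tau> \<Longrightarrow> z - Yc y z \<in> \<Gamma>" and
      "norm y < \<rho>1 \<Longrightarrow> Yc y z \<in> T"
proof -
  obtain e m where e: "e > 0" "m > 0" and gp: "\<forall>z'\<in>ball z e. \<forall>y. norm (Re_vec z' - y)
      \<ge> \<tau> \<longrightarrow> gap (z' - Yc y z') \<ge> m"
    using Z_gap[OF z] unfolding Yc_def by blast
  have "z \<in> ball z e" using e by simp
  then have "gap (z - Yc y z) \<ge> m" if "norm (Re_vec z - y) \<ge> \<tau>" using gp that by blast
  then show "norm (Re_vec z - y) \<ge> \<tau> \<Longrightarrow> z - Yc y z \<in> \<Gamma>" using e by (simp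
      add: \<Gamma>_gap)
  obtain e' Q where e': "e' > 0" "Q \<subseteq> T" and Q: "\<forall>z'\<in>ball z e'. \<forall>y. norm y <
      \<rho>1 \<longrightarrow> Yc y z' \<in> Q"
    using Z_T[OF z] unfolding Yc_def by blast
  have "z \<in> ball z e'" using e' by simp
  then show "norm y < \<rho>1 \<Longrightarrow> Yc y z \<in> T" using Q e' by blast
qed

text \<open>On each of the two pieces all factors are continuous; on the rest, where z - Y may leave
  the cone, the factor \<open>1 - a\<close> is zero.\<close>

lemma measurable_q:
  assumes z: "z \<in> Z"
  shows "q z \<in> borel_measurable borel"
proof -
  define S1 where "S1 = {y :: real ^ 'n. norm (Re_vec z - y) \<ge> \<tau>} \<inter> {y. norm y < \<rho>1}"
  define S2 where "S2 = {y :: real ^ 'n. norm (Re_vec z - y) \<ge> \<tau>} \<inter> {y. norm y \<ge>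
      \<rho>1}"
  have cl: "closed {y :: real ^ 'n. norm (Re_vec z - y) \<ge> \<tau>}"
      "closed {y :: real ^ 'n. norm y \<ge> \<rho>1}"
    by (intro closed_Collect_le continuous_intros)+
  have op: "open {y :: real ^ 'n. norm y < \<rho>1}" by (intro open_Collect_less continuous_intros)
  have S: "S1 \<in> sets borel" "S2 \<in> sets borel" unfolding S1_def S2_def using cl op by auto
  have zO: "z \<in> \<Omega>" using z Z_\<Omega> by blast
  have cY: "continuous_on A (\<lambda>y. Yc y z)" for A unfolding Yc_def by (intro continuous_intros
      continuous_c)
  have cK: "continuous_on A (\<lambda>y. kernel (z, z - Yc y z))" if
      "A \<subseteq> {y. norm (Re_vec z - y) \<ge> \<tau>}" for A
    by (rule continuous_on_compose2[OF holomorphic_wrt_continuous_on[OF hol_kernel]])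
      (use that zO contour_facts(1)[OF z] in \<open>auto intro!: continuous_intros cY\<close>)
  have ca: "continuous_on A (\<lambda>y. complex_of_real (1 - a (Re_vec z - y)))" for A
    by (intro continuous_intros continuous_on_compose2[OF continuous_a[of UNIV]]) auto
  have cU: "continuous_on S1 (\<lambda>y. U (Yc y z))"
    by (rule continuous_on_compose2[OF holomorphic_wrt_continuous_on[OF hol_U] cY])
      (use contour_facts(2)[OF z] in \<open>auto simp: S1_def\<close>)
  have "continuous_on S1 (\<lambda>y. of_real (1 - a (Re_vec z - y)) * (U (Yc y z) * kernel (z, z - Yc y z))
      * (1 + \<i> * of_real (c1 y (Im_vec z))))"
    by (intro continuous_intros ca cU cK continuous_c1) (auto simp: S1_def)
  then have 1: "(\<lambda>y. indicator S1 y *\<^sub>R (of_real (1 - a (Re_vec z - y)) * (U (Yc y z) * kernel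
      (z, z - Yc y z)) * (1 + \<i> * of_real (c1 y (Im_vec z))))) \<in> borel_measurable borel"
    by (rule borel_measurable_continuous_on_indicator[OF S(1)])
  have "continuous_on S2 (\<lambda>y. of_real (1 - a (Re_vec z - y)) * (u y * kernel (z, z - Yc y z)) * (1 +
      \<i> * of_real (c1 y (Im_vec z))))"
    by (intro continuous_intros ca cK continuous_c1 continuous_on_subset[OF cont_u]) (auto simp: S2_def)
  then have 2: "(\<lambda>y. indicator S2 y *\<^sub>R (of_real (1 - a (Re_vec z - y)) * (u y * kernel (z, z
      - Yc y z)) * (1 + \<i> * of_real (c1 y (Im_vec z))))) \<in> borel_measurable borel"
    by (rule borel_measurable_continuous_on_indicator[OF S(2)])
  have eq: "q z = (\<lambda>y. indicator S1 y *\<^sub>R (of_real (1 - a (Re_vec z - y)) * (U (Yc y z) *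
      kernel (z, z - Yc y z)) * (1 + \<i> * of_real (c1 y (Im_vec z))))
     + indicator S2 y *\<^sub>R (of_real (1 - a (Re_vec z - y)) * (u y * kernel (z, z - Yc y z)) * (1 + \<i>
         * of_real (c1 y (Im_vec z)))))"
  proof
    fix y
    show "q z y = indicator S1 y *\<^sub>R (of_real (1 - a (Re_vec z - y)) * (U (Yc y z) * kernel (z, z - Yc
        y z)) * (1 + \<i> * of_real (c1 y (Im_vec z))))
     + indicator S2 y *\<^sub>R (of_real (1 - a (Re_vec z - y)) * (u y * kernel (z, z - Yc y z)) * (1 + \<i>
         * of_real (c1 y (Im_vec z))))"
      by (cases "\<tau> \<le> norm (Re_vec z - y)"; cases "norm y < \<rho>1")
        (simp_all add: q_def \<Phi>_def Gy_def S1_def S2_def a_one indicator_def)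
  qed
  show ?thesis unfolding eq by (rule borel_measurable_add[OF 1 2])
qed

text \<open>Differentiation under the integral gives only a real derivative. Its failure to be
  complex linear is the integral treated in \<open>integral_contour_variation\<close>, with weight 1
  - a(Re z0 - y), height \<open>c\<close> and direction Im z0.\<close>

lemma hol_far: "hol_vec far Z"
  unfolding holomorphic_wrt_def
proof
  fix z0 assume z0: "z0 \<in> Z"
  obtain s C where s: "s > 0" and C0: "C \<ge> 0" and sZ: "ball z0 s \<subseteq> Z"
    and loc: "\<forall>z\<in>ball z0 s. \<forall>y. norm y \<le> Rad \<longrightarrow> norm (Re_vec z - y)
        \<ge> \<tau> \<longrightarrow>
     hol_pair (\<Phi> y) (ball (z, Yc y z) s) \<and> (\<forall>p\<in>ball (z, Yc y z) s. norm (\<Phi> y p)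
         \<le> C)"
    using \<Phi>_local[OF z0] by blast
  define B where "B = norm z0 + s"
  have nz: "norm (Im_vec z) \<le> B" if "z \<in> ball z0 s" for z
  proof -
    have "norm z \<le> norm z0 + s"
      using norm_triangle_ineq2[of z z0] that by (simp add: dist_norm norm_minus_commute)
    then show ?thesis using norm_Im_vec_le[of z] by (simp add: B_def)
  qed
  have B0: "B \<ge> 0" using s by (simp add: B_def)

  \<comment> \<open>Uniform bounds for the integrand and its derivative\<close>
  have val: "norm (\<Phi> y (z, Yc y z)) \<le> C" if "z \<in> ball z0 s" "norm (Re_vec z - y) \<ge> \<tau>"
      for z y
  proof (cases "norm y \<le> Rad")
    case True
    moreover have "(z, Yc y z) \<in> ball (z, Yc y z) s" using s by simp
    ultimately show ?thesis using loc that by blast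
  next
    case False
    then show ?thesis using C0 by (simp add: \<Phi>_zero)
  qed
  have Dval: "norm (frechet_derivative (\<Phi> y) (at (z, Yc y z)) v) \<le> 2 * C / s * norm v"
    if "z \<in> ball z0 s" "norm (Re_vec z - y) \<ge> \<tau>" for z y v
  proof (cases "norm y \<le> Rad")
    case True
    have hol: "hol_pair (\<Phi> y) (ball (z, Yc y z) s)" and bd:
        "\<And>p. p \<in> ball (z, Yc y z) s \<Longrightarrow> norm (\<Phi> y p) \<le> C"
      using loc that True by blast+
    show ?thesis
      by (rule holomorphic_wrt_derivative_bound[OF complex_scaling_prod s hol bd])
        (use s in \<open>auto intro!: holomorphic_wrtD(1)[OF hol]\<close>)
  next
    case False
    then show ?thesis using C0 s by (simp add: \<Phi>_zero)
  qed
  define JB where "JB = 1 + Gc * B"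
  have JB: "norm (1 + \<i> * complex_of_real (c1 y (Im_vec z))) \<le> JB" if "z \<in> ball z0 s" for z y
    using norm_J_le[of y "Im_vec z"] mult_left_mono[OF nz[OF that] Gc_nonneg] by (simp add: JB_def)
  have JB0: "JB \<ge> 0" using Gc_nonneg B0 by (simp add: JB_def)
  have ab: "\<bar>1 - a v\<bar> \<le> 1" for v using a_range[of v] by simp
  have qb: "norm (q z y) \<le> C * JB * indicat_real (cball 0 Rad) y" if z: "z \<in> ball z0 s" for z y
  proof (cases "norm (Re_vec z - y) \<ge> \<tau> \<and> norm y \<le> Rad")
    case True
    have "norm (q z y) \<le> 1 * C * JB"
      unfolding q_def norm_mult norm_of_real using C0 JB[OF z] val[OF z] True ab by (intro mult_mono) auto
    then show ?thesis using True by simp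
  next
    case False
    then have "q z y = 0" using \<Phi>_zero[of y] by (auto simp: q_def a_one)
    then show ?thesis using C0 JB0 by simp
  qed
  \<comment> \<open>One summand for each term of the product rule; the extra factor 2 bounds the
    increment of the pair (z, Y) by that of z.\<close>
  define M where "M = Ga * C * JB + 2 * C / s * 2 * JB + C * Gc"
  have M0: "M \<ge> 0" unfolding M_def using Ga_nonneg Gc_nonneg C0 JB0 s by simp
  have q'b: "norm (q' z y h) \<le> M * indicat_real (cball 0 Rad) y * norm h" if z: "z \<in> ball z0 s" for
      z y h
  proof (cases "norm (Re_vec z - y) \<ge> \<tau> \<and> norm y \<le> Rad")
    case True
    have nh: "norm (h, cvec 0 (c y *\<^sub>R Im_vec h)) \<le> 2 * norm h"
    proof -
      have "norm (h, cvec 0 (c y *\<^sub>R Im_vec h)) \<le> norm h + norm (cvec 0 (c y *\<^sub>R Im_vec h))"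
          by (rule norm_Pair_le)
      also have "norm (cvec 0 (c y *\<^sub>R Im_vec h)) = c y * norm (Im_vec h)" using c_range(1)[of y] by
          simp
      also have "\<dots> \<le> 1 * norm h" using c_range by (intro mult_mono norm_Im_vec_le) auto
      finally show ?thesis by simp
    qed
    have Dv: "norm (frechet_derivative (\<Phi> y) (at (z, Yc y z)) (h, cvec 0 (c y *\<^sub>R Im_vec h)))
        \<le> 2 * C / s * (2 * norm h)"
      using order_trans[OF Dval[OF z] mult_left_mono[OF nh]] True C0 s by simp
    have "\<bar>- a1 (Re_vec z - y) (Re_vec h)\<bar> \<le> Ga * norm (Re_vec h)" using a1_bound by simp
    also have "\<dots> \<le> Ga * norm h" using Ga_nonneg by (intro mult_left_mono norm_Re_vec_le)
    finally have a1b: "\<bar>- a1 (Re_vec z - y) (Re_vec h)\<bar> \<le> Ga * norm h" .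
    have "\<bar>c1 y (Im_vec h)\<bar> \<le> Gc * norm (Im_vec h)" by (rule c1_bound)
    also have "\<dots> \<le> Gc * norm h" using Gc_nonneg by (intro mult_left_mono norm_Im_vec_le)
    finally have c1b: "\<bar>c1 y (Im_vec h)\<bar> \<le> Gc * norm h" .
    have "norm (q' z y h) \<le> (Ga * norm h) * C * JB + 1 * (2 * C / s * (2 * norm h)) * JB + 1 * C * (1 *
        (Gc * norm h))"
      unfolding q'_def
    proof (intro order_trans[OF norm_triangle_ineq] add_mono)
      show "norm (of_real (- a1 (Re_vec z - y) (Re_vec h)) * \<Phi> y (z, Yc y z) * (1 + \<i> * of_real (c1
          y (Im_vec z)))) \<le> (Ga * norm h) * C * JB"
        unfolding norm_mult norm_of_real using a1b val[OF z] True JB[OF z] C0 Ga_nonneg by (intro mult_mono)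
            auto
      show "norm (of_real (1 - a (Re_vec z - y)) * frechet_derivative (\<Phi> y) (at (z, Yc y z)) (h, cvec 0
          (c y *\<^sub>R Im_vec h)) * (1 + \<i> * of_real (c1 y (Im_vec z)))) \<le> 1 * (2 * C / s * (2 *
          norm h)) * JB"
        unfolding norm_mult norm_of_real using ab Dv JB[OF z] C0 s by (intro mult_mono) auto
      show "norm (of_real (1 - a (Re_vec z - y)) * \<Phi> y (z, Yc y z) * (\<i> * of_real (c1 y (Im_vec
          h)))) \<le> 1 * C * (1 * (Gc * norm h))"
        unfolding norm_mult norm_of_real norm_ii using ab c1b val[OF z] True C0 by (intro mult_mono) auto
    qed
    also have "\<dots> = M * norm h" by (simp add: M_def algebra_simps)
    finally show ?thesis using True by simp
  next
    case False
    then have "q' z y h = 0" using \<Phi>_zero[of y] by (auto simp: q'_def a_one a1_zero)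
    then show ?thesis using M0 by simp
  qed
  have intI: "integrable lborel (\<lambda>y. D * indicat_real (cball (0::real^'n) Rad) y)" for D
    by (intro integrable_mult_right integrable_real_indicator emeasure_lborel_cball_finite) auto
  have intq: "integrable lborel (q z)" if z: "z \<in> ball z0 s" for z
  proof (rule Bochner_Integration.integrable_bound[OF intI])
    show "q z \<in> borel_measurable lborel" using measurable_q sZ z by auto
    show "AE y in lborel. norm (q z y) \<le> norm (C * JB * indicat_real (cball 0 Rad) y)"
      unfolding real_norm_def by (intro AE_I2 order_trans[OF qb[OF z] abs_ge_self])
  qed
  have derq: "((\<lambda>z. q z y) has_derivative q' z y) (at z)" if "z \<in> ball z0 s" for z y
    using has_derivative_q sZ that by blast
  have D: "(far has_derivative (\<lambda>h. \<integral>y. q' z0 y h \<partial>lborel)) (at z0)"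
    unfolding far_def[abs_def] by (rule has_derivative_integral(2)[OF s intq derq q'b intI])
  have intq': "integrable lborel (\<lambda>y. q' z0 y h)" for h
    by (rule has_derivative_integral(1)[OF s intq derq q'b intI])
  have z0s: "z0 \<in> ball z0 s" using s by simp

  \<comment> \<open>The Cauchy-Riemann equations\<close>
  have im: "(\<integral>y. q' z0 y (cvec 0 e) \<partial>lborel) = \<i> * (\<integral>y. q' z0 y (cvec e 0)
      \<partial>lborel)" for e
  proof -
    define f where "f Y = U Y * kernel (z0, z0 - Y)" for Y
    define S where "S = {y :: real ^ 'n. norm y < \<rho>1 \<and> norm (Re_vec z0 - y) \<ge> \<tau>}"
    define \<eta> where "\<eta> = Im_vec z0"
    have Y: "Yc y z0 = cvec y (c y *\<^sub>R \<eta>)" for y by (simp add: Yc_def \<eta>_def)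
    have f\<Phi>: "f = (\<lambda>Y. \<Phi> y (z0, Y))" if "norm y < \<rho>1" for y
      using that by (simp add: f_def[abs_def] \<Phi>_def Gy_def)
    let ?f' = "\<lambda>y v. frechet_derivative (\<Phi> y) (at (z0, Yc y z0)) (0, v)"
    define G' where "G' = max Ga Gc"
    let ?k = "CARD('n) + 3"
    define Cf where "Cf = (C + 2 * C / s) * (1 + \<rho>1) ^ ?k"
    have wt: "x \<le> Cf / (1 + norm y) ^ ?k" if "x \<le> C + 2 * C / s" "norm y < \<rho>1" for x and y ::
        "real ^ 'n"
    proof -
      have x: "0 < (1 + norm y) ^ ?k" by (auto intro!: zero_less_power add_pos_nonneg)
      have "(1 + norm y) ^ ?k \<le> (1 + \<rho>1) ^ ?k" using that(2) by (intro power_mono) auto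
      then have "x * (1 + norm y) ^ ?k \<le> Cf"
        unfolding Cf_def using that(1) C0 s x by (intro mult_mono) auto
      then show ?thesis using x by (simp add: pos_le_divide_eq)
    qed
    let ?A = "\<lambda>y. 1 - a (Re_vec z0 - y)" let ?A1 = "\<lambda>y v. a1 (Re_vec z0 - y) v"
    \<comment> \<open>Where \<open>a\<close> varies, the contour already has full height and
      \<open>c\<close> is stationary. This provides the orthogonality hypothesis of the variation
      formula, and it allows a factor \<open>c y = 1\<close> to be inserted in the term with
      \<open>a1\<close>.\<close>
    have nearc: "c y = 1" "c1 y v = 0" if "?A1 y w \<noteq> 0" for y v w
    proof -
      have "norm (Re_vec z0 - y) < \<tau>2" using that a1_far[of "Re_vec z0 - y" w] by (meson not_le)
      then show "c y = 1" "c1 y v = 0" using Z_c[OF z0, of y v] by auto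
    qed
    have holS: "hol_pair (\<Phi> y) (ball (z0, Yc y z0) s)" if "y \<in> S" for y
      using loc z0s that \<rho>1_le by (simp add: S_def)
    have dS: "(\<Phi> y has_derivative frechet_derivative (\<Phi> y) (at (z0, Yc y z0))) (at (z0, Yc y z0))"
      and lS: "frechet_derivative (\<Phi> y) (at (z0, Yc y z0)) (k *s v, k *s w) = k * frechet_derivative
          (\<Phi> y) (at (z0, Yc y z0)) (v, w)"
      if "y \<in> S" for y k v w
      using holomorphic_wrtD(1)[OF holS[OF that], of "(z0, Yc y z0)"]
        holomorphic_wrtD(2)[OF holS[OF that], of "(z0, Yc y z0)" k "(v, w)"] s by auto
    have "(\<integral>y. of_real (?A y) * (\<i> * of_real (c y) * ?f' y (cvec e 0) * (1 + \<i> * of_real (c1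
        y \<eta>))
          + \<i> * of_real (c1 y e) * f (cvec y (c y *\<^sub>R \<eta>)))
        + \<i> * of_real (?A1 y e * c y) * f (cvec y (c y *\<^sub>R \<eta>)) \<partial>lborel) = 0"
    proof (rule integral_contour_variation(2)[where A="?A" and ?A1.0="?A1" and S=S and C=Cf])
      show "C2_fun c c1 c2 G'" by (rule C2_fun_mono[OF C2_c]) (simp add: G'_def)
      fix y v w :: "real ^ 'n" and k :: complex and V :: "complex ^ 'n"
      show "(?A has_derivative ?A1 y) (at y)"
      proof -
        have "((\<lambda>y. a (Re_vec z0 - y)) has_derivative (\<lambda>v. a1 (Re_vec z0 - y) (- v))) (at
            y)"
          by (rule has_derivative_compose[where g=a, OF _ has_derivative_a]) (auto intro!:
              derivative_eq_intros)
        then show ?thesis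
          using linear_simps(4)[OF has_derivative_bounded_linear[OF has_derivative_a]]
          by (auto intro!: derivative_eq_intros)
      qed
      show "\<bar>?A y\<bar> \<le> 1" by (rule ab)
      have "Ga * norm v \<le> G' * norm v" by (intro mult_right_mono) (auto simp: G'_def)
      then show "\<bar>?A1 y v\<bar> \<le> G' * norm v" using a1_bound[of "Re_vec z0 - y" v] by linarith
      show "?A1 y v * c1 y w = 0" using nearc(2)[of y v w] by (cases "?A1 y v = 0") auto
      show "?A y * c y = 0" "?A y * c1 y v + ?A1 y v * c y = 0" if "y \<notin> S"
        using that c_zero[of y] c1_zero[of y v] by (auto simp: S_def a_one a1_zero not_le not_less)
      assume y: "y \<in> S"
      have y1: "norm y < \<rho>1" "norm (Re_vec z0 - y) \<ge> \<tau>" using y by (auto simp: S_def)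
      show "(f has_derivative ?f' y) (at (cvec y (c y *\<^sub>R \<eta>)))"
        unfolding f\<Phi>[OF y1(1)]
        unfolding Y
        by (rule has_derivative_compose[where g="\<Phi> y" and f="\<lambda>Y. (z0, Y)" and
            f'="\<lambda>v. (0, v)", OF _ dS[OF y, unfolded Y]])
          (auto intro!: derivative_eq_intros)
      show "?f' y (k *s V) = k * ?f' y V" using lS[OF y, of k 0 V] by simp
      have "norm (f (cvec y (c y *\<^sub>R \<eta>))) \<le> C"
        using val[OF z0s y1(2)] unfolding f\<Phi>[OF y1(1)] Y .
      moreover have "C \<le> C + 2 * C / s" using C0 s by simp
      ultimately show "norm (f (cvec y (c y *\<^sub>R \<eta>))) \<le> Cf / (1 + norm y) ^ ?k"
        by (intro wt y1) linarith
      have "norm (?f' y V) \<le> 2 * C / s * norm V" using Dval[OF z0s y1(2), of "(0, V)"] by simp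
      also have "2 * C / s \<le> Cf / (1 + norm y) ^ ?k" by (rule wt[OF _ y1(1)]) (use C0 in simp)
      finally show "norm (?f' y V) \<le> Cf / (1 + norm y) ^ ?k * norm V" by (simp add: mult_right_mono)
    qed
    \<comment> \<open>The derivative through the first argument of \<open>\<Phi>\<close> is complex
      linear and cancels. What is left comes from the cut-off, from the contour point and from the
      Jacobian.\<close>
    moreover have "q' z0 y (cvec 0 e) - \<i> * q' z0 y (cvec e 0) =
        of_real (?A y) * (\<i> * of_real (c y) * ?f' y (cvec e 0) * (1 + \<i> * of_real (c1 y \<eta>))
          + \<i> * of_real (c1 y e) * f (cvec y (c y *\<^sub>R \<eta>)))
        + \<i> * of_real (?A1 y e * c y) * f (cvec y (c y *\<^sub>R \<eta>))" for y
    proof (cases "norm (Re_vec z0 - y) \<ge> \<tau>")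
      case True
      let ?D = "frechet_derivative (\<Phi> y) (at (z0, Yc y z0))"
      have bl: "bounded_linear ?D" and lin: "?D (k *s v, k *s w) = k * ?D (v, w)" for k v w
      proof -
        have "(\<Phi> y has_derivative ?D) (at (z0, Yc y z0)) \<and> ?D (k *s v, k *s w) = k * ?D (v, w)"
        proof (cases "norm y \<le> Rad")
          case y: True
          have hol: "hol_pair (\<Phi> y) (ball (z0, Yc y z0) s)" using loc z0s True y by blast
          show ?thesis
            using holomorphic_wrtD(1)[OF hol, of "(z0, Yc y z0)"] holomorphic_wrtD(2)[OF hol, of
                "(z0, Yc y z0)" k "(v, w)"] s by auto
        qed (simp add: \<Phi>_zero)
        then show "bounded_linear ?D" "?D (k *s v, k *s w) = k * ?D (v, w)"
          using has_derivative_bounded_linear by blast+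
      qed
      define F where "F = f (cvec y (c y *\<^sub>R \<eta>))"
      define ph where "ph = \<Phi> y (z0, Yc y z0)"
      define jc where "jc = 1 + \<i> * complex_of_real (c1 y \<eta>)"
      \<comment> \<open>\<open>F\<close> uses \<open>U\<close> everywhere, \<open>ph\<close>
        switches to \<open>u\<close> for |y| \<ge> \<rho>1. The two may differ there, but every term
        in which they are exchanged carries a factor that vanishes for such
        \<open>y\<close>.\<close>
      have Fph: "F = ph" if "norm y < \<rho>1" unfolding F_def ph_def Y f\<Phi>[OF that] ..
      have e1: "of_real (c1 y e) * F = of_real (c1 y e) * ph"
        using Fph c1_zero[of y e] by (cases "norm y < \<rho>1") (auto simp: not_less)
      have e2: "of_real (?A1 y e * c y) * F = of_real (?A1 y e) * ph * jc"
      proof (cases "?A1 y e = 0")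
        case False
        have "norm y < \<rho>1" using nearc(1)[OF False] c_zero[of y] by (metis not_less zero_neq_one)
        then show ?thesis using Fph nearc[OF False] by (simp add: jc_def)
      qed simp
      have "(cvec 0 e, cvec 0 (c y *\<^sub>R e)) = (\<i> *s cvec e 0, \<i> *s (of_real (c y) *s cvec e 0))"
        by (auto intro!: complex_vec_eqI)
      then have D1: "?D (cvec 0 e, cvec 0 (c y *\<^sub>R e)) = \<i> * ?D (cvec e 0, of_real (c y) *s cvec e
          0)"
        by (simp only: lin)
      have "?D (cvec e 0, of_real (c y) *s cvec e 0) = ?D (cvec e 0, 0) + ?D (of_real (c y) *s 0, of_real (c
          y) *s cvec e 0)"
        using linear_simps(1)[OF bl, of "(cvec e 0, 0)" "(0, of_real (c y) *s cvec e 0)"] by simp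
      then have D2: "?D (cvec e 0, of_real (c y) *s cvec e 0) = ?D (cvec e 0, 0) + of_real (c y) * ?D (0,
          cvec e 0)"
        by (simp only: lin)
      have z0': "a1 (Re_vec z0 - y) 0 = 0" "c1 y 0 = 0"
        using linear_simps(3)[OF has_derivative_bounded_linear[OF has_derivative_a]] linear_simps(3)[OF
            bounded_linear_c1] by auto
      have L: "q' z0 y (cvec 0 e) = of_real (?A y) * (\<i> * (?D (cvec e 0, 0) + of_real (c y) * ?D (0, cvec
          e 0))) * jc
          + of_real (?A y) * ph * (\<i> * of_real (c1 y e))"
        unfolding q'_def by (simp add: z0' D1[unfolded D2] ph_def jc_def \<eta>_def)
      have Rr: "q' z0 y (cvec e 0) = of_real (- ?A1 y e) * ph * jc + of_real (?A y) * ?D (cvec e 0, 0) * jc"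
        unfolding q'_def by (simp add: z0' ph_def jc_def \<eta>_def)
      have "q' z0 y (cvec 0 e) - \<i> * q' z0 y (cvec e 0) =
          of_real (?A y) * (\<i> * of_real (c y) * ?D (0, cvec e 0) * jc + \<i> * (of_real (c1 y e) * ph)) +
              \<i> * (of_real (?A1 y e) * ph * jc)"
        unfolding L Rr by (simp add: algebra_simps)
      also have "\<dots> = of_real (?A y) * (\<i> * of_real (c y) * ?D (0, cvec e 0) * jc + \<i> * (of_real
          (c1 y e) * F)) + \<i> * (of_real (?A1 y e * c y) * F)"
        by (simp only: e1 e2)
      finally show ?thesis unfolding F_def jc_def by (simp only: mult.assoc)
    next
      case False
      then show ?thesis by (simp add: q'_def a_one a1_zero)
    qed
    ultimately have "(\<integral>y. q' z0 y (cvec 0 e) - \<i> * q' z0 y (cvec e 0) \<partial>lborel) = 0" by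
        simp
    then show ?thesis using intq' by simp
  qed
  show "\<exists>f'. (far has_derivative f') (at z0) \<and> (\<forall>c v. f' (c *s v) = c * f' v)"
    using D hol_vec_of_real_imag[OF has_derivative_bounded_linear[OF D] im] by blast
qed

end

section \<open>Regularisation at real points\<close>

lemma C_k_continuous: "C_k k f \<Longrightarrow> continuous_on UNIV f"
proof (cases k)
  case (Suc j)
  assume "C_k k f"
  then have "f differentiable (at z)" for z using Suc by simp
  then show ?thesis by (intro continuous_at_imp_continuous_on ballI differentiable_imp_continuous_within)
qed simp

lemma bounded_compact_support:
  fixes f :: "real ^ 'n::finite \<Rightarrow> complex"
  assumes f: "continuous_on UNIV f" and z: "\<And>y. norm y > r \<Longrightarrow> f y = 0" and r: "r > 0"
  shows "\<exists>B\<ge>0. \<forall>y. norm (f y) \<le> B * indicat_real (cball 0 r) y"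
proof -
  have "compact (f ` cball 0 r)" by (intro compact_continuous_image continuous_on_subset[OF f]) auto
  then have "bounded (f ` cball 0 r)" by (rule compact_imp_bounded)
  then obtain B where B: "\<forall>w\<in>f ` cball 0 r. norm w \<le> B" unfolding bounded_iff by (elim exE)
  have "norm (f y) \<le> max B 0 * indicat_real (cball 0 r) y" for y
  proof (cases "norm y \<le> r")
    case True
    then have "norm (f y) \<le> B" using B by simp
    then show ?thesis using True by (simp add: le_max_iff_disj)
  qed (use z in simp)
  then show ?thesis by (intro exI[of _ "max B 0"]) auto
qed

lemma integrable_compact_support:
  fixes f :: "real ^ 'n::finite \<Rightarrow> complex"
  assumes f: "f \<in> borel_measurable borel" and b: "\<And>y. norm (f y) \<le> B * indicat_real (cball 0 r)
      y"
  shows "integrable lborel f"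
proof (rule Bochner_Integration.integrable_bound)
  show "integrable lborel (\<lambda>y. B * indicat_real (cball (0::real^'n) r) y)"
    by (intro integrable_mult_right integrable_real_indicator emeasure_lborel_cball_finite) auto
  show "AE y in lborel. norm (f y) \<le> norm (B * indicat_real (cball 0 r) y)"
    unfolding real_norm_def by (intro AE_I2 order_trans[OF b abs_ge_self])
qed (use f in simp)

lemma weight_compact_support:
  fixes y :: "'a::real_normed_vector"
  assumes "B \<ge> 0" "r > 0"
  shows "B * indicat_real (cball 0 r) y \<le> B * (1 + r) ^ k / (1 + norm y) ^ k"
proof (cases "norm y \<le> r")
  case True
  have "(1 + norm y) ^ k \<le> (1 + r) ^ k" using True by (intro power_mono) auto
  moreover have "0 < (1 + norm y) ^ k" by (auto intro!: zero_less_power add_pos_nonneg)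
  ultimately have "1 \<le> (1 + r) ^ k / (1 + norm y) ^ k" by simp
  from mult_left_mono[OF this assms(1)] show ?thesis using True by simp
qed (use assms in simp)

lemma dir_deriv_zero_outside:
  fixes f :: "real ^ 'n::finite \<Rightarrow> complex"
  assumes "\<And>y. norm y > r \<Longrightarrow> f y = 0" "norm y > r"
  shows "dir_deriv v f y = 0"
proof -
  have "open {y :: real ^ 'n. norm y > r}" by (intro open_Collect_less continuous_intros)
  then have "(f has_derivative (\<lambda>h. 0)) (at y)"
    by (rule has_derivative_transform_within_open[OF has_derivative_const[of 0]]) (use assms in auto)
  then show ?thesis unfolding dir_deriv_def by (simp add: frechet_derivative_at[symmetric])
qed

text \<open>Integration by parts through \<open>integral_directional_derivative\<close>, applied to
  the product of the exponential and \<open>f\<close>; compact support supplies the weight.\<close>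

lemma fourier_dir_deriv:
  fixes f :: "real ^ 'n::finite \<Rightarrow> complex"
  assumes f: "C_k (Suc k) f" and z: "\<And>y. norm y > r \<Longrightarrow> f y = 0" and r: "r > 0"
  shows "fourier (dir_deriv v f) \<xi> = \<i> * of_real (v \<bullet> \<xi>) * fourier f \<xi>"
proof -
  have cf: "continuous_on UNIV f" by (rule C_k_continuous[OF f])
  have cd: "continuous_on UNIV (dir_deriv v f)" by (rule C_k_continuous[of k]) (use f in simp)
  obtain B1 where B1: "B1 \<ge> 0" "\<forall>y. norm (f y) \<le> B1 * indicat_real (cball 0 r) y"
    using bounded_compact_support[OF cf z r] by blast
  have zd: "dir_deriv v f y = 0" if "norm y > r" for y by (rule dir_deriv_zero_outside[OF z that])
  obtain B2 where B2: "B2 \<ge> 0" "\<forall>y. norm (dir_deriv v f y) \<le> B2 * indicat_real (cball 0 r)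
      y"
    using bounded_compact_support[OF cd zd r] by blast
  have df: "(f has_derivative frechet_derivative f (at y)) (at y)" for y
    using f by (simp add: frechet_derivative_works[symmetric])
  define E where "E y = exp (- \<i> * complex_of_real (y \<bullet> \<xi>))" for y
  define X where "X y = E y * f y" for y
  define X' where "X' y w = E y * frechet_derivative f (at y) w + (E y * (- \<i> * of_real (w \<bullet>
      \<xi>))) * f y" for y w
  have nE: "norm (E y) = 1" for y by (simp add: E_def norm_exp_eq_Re)
  have dX: "(X has_derivative X' y) (at y)" for y
  proof -
    have "((\<lambda>y. - \<i> * complex_of_real (y \<bullet> \<xi>)) has_derivative (\<lambda>w. - \<i> *
        of_real (w \<bullet> \<xi>))) (at y)"
      by (auto intro!: derivative_eq_intros)
    from has_derivative_compose[OF this DERIV_exp[unfolded has_field_derivative_def]]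
    have "(E has_derivative (\<lambda>w. E y * (- \<i> * of_real (w \<bullet> \<xi>)))) (at y)"
      by (simp add: E_def[abs_def] mult_ac)
    from has_derivative_mult[OF this df] show ?thesis unfolding X_def[abs_def] X'_def[abs_def] .
  qed
  let ?B = "B2 + \<bar>v \<bullet> \<xi>\<bar> * B1 + B1"
  let ?C = "?B * (1 + r) ^ (CARD('n) + 2)"
  have B: "?B \<ge> 0" using B1 B2 by simp
  have X'v: "X' y v = E y * dir_deriv v f y + (- \<i> * of_real (v \<bullet> \<xi>)) * (E y * f y)" for y
    by (simp add: X'_def dir_deriv_def)
  have 1: "norm (X y) \<le> ?C / (1 + norm y) ^ (CARD('n) + 2)" for y
  proof -
    have "norm (X y) \<le> B1 * indicat_real (cball 0 r) y" using B1 by (simp add: X_def norm_mult nE)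
    also have "\<dots> \<le> ?B * indicat_real (cball 0 r) y" using B1 B2 by (intro mult_right_mono) auto
    also have "\<dots> \<le> ?C / (1 + norm y) ^ (CARD('n) + 2)" by (rule weight_compact_support[OF B r])
    finally show ?thesis .
  qed
  have 2: "norm (X' y v) \<le> ?C / (1 + norm y) ^ (CARD('n) + 2)" for y
  proof -
    have "norm (X' y v) \<le> norm (dir_deriv v f y) + \<bar>v \<bullet> \<xi>\<bar> * norm (f y)"
      unfolding X'v using norm_triangle_ineq[of "E y * dir_deriv v f y"
          "(- \<i> * of_real (v \<bullet> \<xi>)) * (E y * f y)"]
      by (simp add: norm_mult nE)
    also have "\<dots> \<le> B2 * indicat_real (cball 0 r) y + \<bar>v \<bullet> \<xi>\<bar> * (B1 *
        indicat_real (cball 0 r) y)"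
      using B1 B2 by (intro add_mono mult_left_mono) auto
    also have "\<dots> \<le> ?B * indicat_real (cball 0 r) y" using B1 by (simp add: distrib_right
        mult.assoc)
    also have "\<dots> \<le> ?C / (1 + norm y) ^ (CARD('n) + 2)" by (rule weight_compact_support[OF B r])
    finally show ?thesis .
  qed
  have D: "DIM(real ^ 'n) = CARD('n)" by simp
  have "(\<integral>y. X' y v \<partial>lborel) = 0"
    using integral_directional_derivative(2)[of X X' ?C v] dX 1 2 unfolding D by blast
  moreover have "(\<integral>y. X' y v \<partial>lborel) = fourier (dir_deriv v f) \<xi> - \<i> * of_real (v
      \<bullet> \<xi>) * fourier f \<xi>"
  proof -
    have cE: "continuous_on UNIV E" unfolding E_def by (intro continuous_intros)
    have "integrable lborel (\<lambda>y. E y * dir_deriv v f y)"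
      by (rule integrable_compact_support[where B=B2 and r=r])
        (use B2 in \<open>auto intro!: borel_measurable_continuous_onI continuous_intros cE cd simp:
            norm_mult nE\<close>)
    moreover have "integrable lborel (\<lambda>y. E y * f y)"
      by (rule integrable_compact_support[where B=B1 and r=r])
        (use B1 in \<open>auto intro!: borel_measurable_continuous_onI continuous_intros cE cf simp:
            norm_mult nE\<close>)
    ultimately show ?thesis unfolding X'v by (simp add: fourier_def E_def)
  qed
  ultimately show ?thesis by simp
qed

lemma fourier_power_dir_deriv:
  fixes f :: "real ^ 'n::finite \<Rightarrow> complex"
  assumes "C_k k f" "\<And>y. norm y > r \<Longrightarrow> f y = 0" "r > 0"
  shows "\<exists>B\<ge>0. \<forall>\<xi>. norm (fourier f \<xi>) * \<bar>v \<bullet> \<xi>\<bar> ^ k \<le>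
      B"
  using assms
proof (induction k arbitrary: f)
  case 0
  obtain B1 where B1: "B1 \<ge> 0" "\<forall>y. norm (f y) \<le> B1 * indicat_real (cball 0 r) y"
    using bounded_compact_support[OF C_k_continuous[OF 0(1)] 0(2,3)] by blast
  have "norm (fourier f \<xi>) \<le> (\<integral>y. B1 * indicat_real (cball (0::real^'n) r) y
      \<partial>lborel)" for \<xi>
  proof -
    have "norm (fourier f \<xi>) \<le> (\<integral>y. norm (exp (- \<i> * complex_of_real (y \<bullet>
        \<xi>)) * f y) \<partial>lborel)"
      unfolding fourier_def by (rule integral_norm_bound)
    also have "\<dots> \<le> (\<integral>y. B1 * indicat_real (cball (0::real^'n) r) y \<partial>lborel)"
      by (rule integral_mono_AE')
        (use B1 in \<open>auto intro!: AE_I2 integrable_mult_right integrable_real_indicator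
            emeasure_lborel_cball_finite
          simp: norm_mult norm_exp_eq_Re\<close>)
    finally show ?thesis .
  qed
  moreover have "0 \<le> (\<integral>y. B1 * indicat_real (cball (0::real^'n) r) y \<partial>lborel)"
    using B1 by (intro Bochner_Integration.integral_nonneg) auto
  ultimately show ?case by auto
next
  case (Suc k)
  have "C_k k (dir_deriv v f)" using Suc.prems(1) by simp
  moreover have "dir_deriv v f y = 0" if "norm y > r" for y
    by (rule dir_deriv_zero_outside[OF Suc.prems(2) that])
  ultimately have "\<exists>B\<ge>0. \<forall>\<xi>. norm (fourier (dir_deriv v f) \<xi>) * \<bar>v
      \<bullet> \<xi>\<bar> ^ k \<le> B"
    using Suc.prems(3) by (rule Suc.IH)
  then obtain B where B: "B \<ge> 0" "\<forall>\<xi>. norm (fourier (dir_deriv v f) \<xi>) * \<bar>v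
      \<bullet> \<xi>\<bar> ^ k \<le> B" by (elim exE conjE)
  have eq: "norm (fourier f \<xi>) * \<bar>v \<bullet> \<xi>\<bar> ^ Suc k = norm (fourier (dir_deriv v f)
      \<xi>) * \<bar>v \<bullet> \<xi>\<bar> ^ k" for \<xi>
    using fourier_dir_deriv[OF Suc.prems, of v \<xi>] by (simp add: norm_mult)
  show ?case unfolding eq using B by blast
qed

text \<open>Only pure powers of single coordinates are controlled by
  \<open>fourier_power_dir_deriv\<close>; the largest coordinate controls the norm.\<close>

lemma fourier_decay:
  fixes u :: "real ^ 'n::finite \<Rightarrow> complex"
  assumes u: "smooth u" "\<And>y. norm y > r \<Longrightarrow> u y = 0" "r > 0"
  shows "\<exists>C\<ge>0. \<forall>\<xi>. norm (fourier u \<xi>) \<le> C / (1 + norm \<xi>) ^ j"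
proof -
  have ck: "C_k k u" for k using u(1) by (simp add: smooth_def)
  have "\<exists>B. \<forall>i. B i \<ge> 0 \<and> (\<forall>\<xi>. norm (fourier u \<xi>) * \<bar>axis i 1
      \<bullet> \<xi>\<bar> ^ j \<le> B i)"
    using fourier_power_dir_deriv[OF ck u(2,3)] by (intro choice allI) blast
  then obtain B where B: "\<And>i. B i \<ge> 0" "\<And>i \<xi>. norm (fourier u \<xi>) * \<bar>\<xi> $
      i\<bar> ^ j \<le> B i"
    by (auto simp: inner_axis inner_commute)
  obtain B0 where B0: "B0 \<ge> 0" "\<And>\<xi>. norm (fourier u \<xi>) \<le> B0"
    using fourier_power_dir_deriv[OF ck u(2,3), where k=0] by auto
  define C where "C = (real CARD('n) + 1) ^ j * (B0 + (\<Sum>i\<in>UNIV. B i))"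
  have "norm (fourier u \<xi>) \<le> C / (1 + norm \<xi>) ^ j" for \<xi>
  proof -
    \<comment> \<open>Including 1 makes 1 + |\<xi>| \<le> (n + 1) m hold near the origin too. The
      maximum is attained, so one of the coordinate bounds, or the bound for exponent 0,
      applies.\<close>
    define m where "m = Max (insert 1 (range (\<lambda>i. \<bar>\<xi> $ i\<bar>)))"
    have mi: "\<bar>\<xi> $ i\<bar> \<le> m" "1 \<le> m" for i unfolding m_def by (rule Max_ge; simp)+
    have "norm \<xi> \<le> (\<Sum>i\<in>UNIV. \<bar>\<xi> $ i\<bar>)" by (rule norm_le_l1_cart)
    also have "\<dots> \<le> (\<Sum>i\<in>(UNIV :: 'n set). m)" by (intro sum_mono mi)
    finally have "1 + norm \<xi> \<le> (real CARD('n) + 1) * m" using mi(2) by (simp add: algebra_simps)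
    then have "(1 + norm \<xi>) ^ j \<le> ((real CARD('n) + 1) * m) ^ j" by (intro power_mono) auto
    then have 1: "(1 + norm \<xi>) ^ j \<le> (real CARD('n) + 1) ^ j * m ^ j" by (simp only:
        power_mult_distrib)
    have "m \<in> insert 1 (range (\<lambda>i. \<bar>\<xi> $ i\<bar>))" unfolding m_def by (rule Max_in)
        auto
    then have 2: "norm (fourier u \<xi>) * m ^ j \<le> B0 + (\<Sum>i\<in>UNIV. B i)"
    proof
      assume "m = 1"
      then show ?thesis using B0(2)[of \<xi>] sum_nonneg[of UNIV B] B(1) by simp
    next
      assume "m \<in> range (\<lambda>i. \<bar>\<xi> $ i\<bar>)"
      then obtain i where "m = \<bar>\<xi> $ i\<bar>" by auto
      then have "norm (fourier u \<xi>) * m ^ j \<le> B i" using B(2) by simp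
      also have "\<dots> \<le> (\<Sum>i\<in>UNIV. B i)" using B(1) by (intro member_le_sum) auto
      finally show ?thesis using B0(1) by simp
    qed
    have "norm (fourier u \<xi>) * (1 + norm \<xi>) ^ j \<le> norm (fourier u \<xi>) * ((real CARD('n) + 1)
        ^ j * m ^ j)"
      by (intro mult_left_mono 1) auto
    also have "\<dots> = (real CARD('n) + 1) ^ j * (norm (fourier u \<xi>) * m ^ j)" by (simp add: mult_ac)
    also have "\<dots> \<le> C" unfolding C_def using 2 by (intro mult_left_mono) auto
    finally show ?thesis by (subst pos_le_divide_eq) (auto intro!: zero_less_power add_pos_nonneg)
  qed
  moreover have "C \<ge> 0" unfolding C_def using B0 B by (intro mult_nonneg_nonneg add_nonneg_nonneg
      sum_nonneg) auto
  ultimately show ?thesis by blast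
qed

lemma lborel_integral_reflect:
  fixes f :: "'a::euclidean_space \<Rightarrow> complex"
  assumes f: "f \<in> borel_measurable borel"
  shows "(\<integral>v. f (x - v) \<partial>lborel) = (\<integral>y. f y \<partial>lborel)"
proof -
  have "lborel = distr lborel borel (\<lambda>v. x - v)"
    using lborel_affine[of "-1" x] by (simp add: density_1 one_ennreal_def[symmetric])
  then have "(\<integral>y. f y \<partial>lborel) = (\<integral>y. f y \<partial>(distr lborel borel
      (\<lambda>v. x - v)))" by simp
  also have "\<dots> = (\<integral>v. f (x - v) \<partial>lborel)" using f by (intro integral_distr) auto
  finally show ?thesis by simp
qed

context symbol_contour
begin

text \<open>On a contour of opening at most 1/2, |Re \<zeta>| \<ge> |\<xi>| - c0 and |Im \<zeta>|
  \<le> |\<xi>| / 2 + c0. Hence Re(\<zeta> . \<zeta>) is at least 3/4 |\<xi>|^2 up to terms of lower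
  order, and the Gaussian dominates exp(i v . \<zeta>).\<close>

lemma gaussian_exponent:
  fixes v \<xi> :: "real ^ 'n"
  assumes \<theta>: "norm \<theta> \<le> 1" "\<kappa> * norm \<theta> \<le> 1 / 2" and d:
      "norm (\<zeta> - zeta \<theta> \<xi>) < c0" and \<rho>: "\<rho> > 0"
  shows "Re (\<i> * cdot (cvec v 0) \<zeta> - of_real \<rho> * cdot \<zeta> \<zeta>) \<le>
    norm v * c0 + 3 * \<rho> * c0\<^sup>2 + (norm v / 2 + 3 * \<rho> * c0 + 1)\<^sup>2 / (3 * \<rho>) - norm
        \<xi>"
proof -
  define t where "t = norm \<xi>"
  define A where "A = norm (Re_vec \<zeta>)"
  define B where "B = norm (Im_vec \<zeta>)"
  have t0: "t \<ge> 0" "A \<ge> 0" "B \<ge> 0" by (simp_all add: t_def A_def B_def)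
  have "norm (Re_vec \<zeta> - \<xi>) < c0" using norm_Re_vec_le[of "\<zeta> - zeta \<theta> \<xi>"] d by
      (simp add: zeta_def)
  then have A: "A \<ge> t - c0" using norm_triangle_ineq2[of \<xi> "Re_vec \<zeta>"] by (simp add:
      norm_minus_commute t_def A_def)
  have "norm (Im_vec \<zeta> - g \<xi> *\<^sub>R \<theta>) < c0" using norm_Im_vec_le[of
      "\<zeta> - zeta \<theta> \<xi>"] d by (simp add: zeta_def)
  moreover have "norm (g \<xi> *\<^sub>R \<theta>) \<le> t / 2"
  proof -
    have "norm (g \<xi> *\<^sub>R \<theta>) \<le> \<kappa> * t * norm \<theta>" using g_nonneg[of \<xi>]
        g_le[of \<xi>] by (simp add: mult_right_mono t_def)
    also have "\<dots> = (\<kappa> * norm \<theta>) * t" by simp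
    also have "\<dots> \<le> 1 / 2 * t" using \<theta>(2) t0 by (intro mult_right_mono) auto
    finally show ?thesis by simp
  qed
  ultimately have B: "B \<le> t / 2 + c0" using norm_triangle_ineq2[of "Im_vec \<zeta>"
      "g \<xi> *\<^sub>R \<theta>"] by (simp add: B_def)
  have sq: "A\<^sup>2 - B\<^sup>2 \<ge> 3/4 * t\<^sup>2 - 3 * t * c0 - 3 * c0\<^sup>2"
  proof -
    have B2: "B\<^sup>2 \<le> (t / 2 + c0)\<^sup>2" using B t0 by (intro power_mono) auto
    show ?thesis
    proof (cases "t \<ge> c0")
      case True
      then have "A\<^sup>2 \<ge> (t - c0)\<^sup>2" using A by (intro power_mono) auto
      moreover have "(t - c0)\<^sup>2 - (t / 2 + c0)\<^sup>2 = 3/4 * t\<^sup>2 - 3 * t * c0" by (simp add: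
          power2_eq_square field_simps)
      ultimately show ?thesis using B2 zero_le_power2[of c0] by linarith
    next
      case False
      have "(t / 2 + c0)\<^sup>2 = t\<^sup>2 / 4 + t * c0 + c0\<^sup>2" by (simp add: power2_eq_square
          field_simps)
      moreover have "t\<^sup>2 \<le> c0\<^sup>2" using False t0 by (intro power_mono) auto
      moreover have "0 \<le> t * c0" using t0 c0_pos by simp
      ultimately show ?thesis using B2 zero_le_power2[of A] zero_le_power2[of c0] by linarith
    qed
  qed
  have e1: "Re (\<i> * cdot (cvec v 0) \<zeta>) \<le> norm v * (t / 2 + c0)"
  proof -
    have "Re (\<i> * cdot (cvec v 0) \<zeta>) = - (v \<bullet> Im_vec \<zeta>)" by (simp add: Im_cdot)
    also have "\<dots> \<le> norm v * B" using norm_cauchy_schwarz[of "- v" "Im_vec \<zeta>"] by (simp add: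
        B_def)
    also have "\<dots> \<le> norm v * (t / 2 + c0)" using B by (intro mult_left_mono) auto
    finally show ?thesis .
  qed
  have e2: "Re (of_real \<rho> * cdot \<zeta> \<zeta>) = \<rho> * (A\<^sup>2 - B\<^sup>2)"
    by (simp add: Re_cdot A_def B_def power2_norm_eq_inner)
  have e3: "\<rho> * (A\<^sup>2 - B\<^sup>2) \<ge> \<rho> * (3/4 * t\<^sup>2 - 3 * t * c0 - 3 * c0\<^sup>2)"
    using sq \<rho> by (intro mult_left_mono) auto
  \<comment> \<open>The coefficient of t from all linear terms, plus 1; completing the square then
    leaves the surplus -t in the exponent.\<close>
  define \<beta> where "\<beta> = norm v / 2 + 3 * \<rho> * c0 + 1"
  have "0 \<le> (3 * \<rho> * t - 2 * \<beta>)\<^sup>2 / (12 * \<rho>)" using \<rho> by simp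
  also have "\<dots> = 3/4 * \<rho> * t\<^sup>2 - \<beta> * t + \<beta>\<^sup>2 / (3 * \<rho>)" using \<rho>
      by (simp add: power2_eq_square field_simps)
  finally have q: "\<beta> * t - 3/4 * \<rho> * t\<^sup>2 \<le> \<beta>\<^sup>2 / (3 * \<rho>)" by simp
  have "Re (\<i> * cdot (cvec v 0) \<zeta> - of_real \<rho> * cdot \<zeta> \<zeta>) \<le> norm v * (t / 2 +
      c0) - \<rho> * (3/4 * t\<^sup>2 - 3 * t * c0 - 3 * c0\<^sup>2)"
    unfolding minus_complex.sel using e1 e2 e3 by linarith
  also have "\<dots> = norm v * c0 + 3 * \<rho> * c0\<^sup>2 + (\<beta> * t - 3/4 * \<rho> * t\<^sup>2) - t"
    by (simp add: \<beta>_def algebra_simps)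
  finally show ?thesis using q unfolding \<beta>_def t_def by linarith
qed

lemma poly_gaussian_bound:
  assumes \<rho>: "\<rho> > 0"
  shows "\<exists>C\<ge>0. \<forall>\<xi> :: real ^ 'n. exp (- \<rho> * (norm \<xi>)\<^sup>2) * (1 + norm
      \<xi>) ^ j \<le> C"
proof -
  have "exp (- \<rho> * (norm \<xi>)\<^sup>2) * (1 + norm \<xi>) ^ j \<le> exp \<rho> * (fact j * exp (2 *
      \<rho>) / (2 * \<rho>) ^ j)" for \<xi> :: "real ^ 'n"
  proof -
    \<comment> \<open>The tangent of the parabola at 1 replaces the Gaussian by an exponential, to
      which \<open>poly_exp_decay\<close> applies.\<close>
    have "0 \<le> \<rho> * (norm \<xi> - 1)\<^sup>2" using \<rho> by simp
    then have "- \<rho> * (norm \<xi>)\<^sup>2 \<le> \<rho> + - (2 * \<rho>) * norm \<xi>" by (simp add: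
        power2_eq_square algebra_simps)
    then have "exp (- \<rho> * (norm \<xi>)\<^sup>2) \<le> exp \<rho> * exp (- (2 * \<rho>) * norm \<xi>)"
        by (simp only: exp_add[symmetric] exp_le_cancel_iff)
    then have "exp (- \<rho> * (norm \<xi>)\<^sup>2) * (1 + norm \<xi>) ^ j \<le> exp \<rho> * exp (- (2 *
        \<rho>) * norm \<xi>) * (1 + norm \<xi>) ^ j"
      by (rule mult_right_mono) auto
    also have "\<dots> = exp \<rho> * ((1 + norm \<xi>) ^ j * exp (- (2 * \<rho>) * norm \<xi>))" by (simp
        add: mult_ac)
    also have "\<dots> \<le> exp \<rho> * (fact j * exp (2 * \<rho>) / (2 * \<rho>) ^ j)"
      by (intro mult_left_mono poly_exp_decay) (use \<rho> in auto)
    finally show ?thesis .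
  qed
  then show ?thesis using \<rho> by (intro exI[of _ "exp \<rho> * (fact j * exp (2 * \<rho>) / (2 * \<rho>)
      ^ j)"]) auto
qed

text \<open>The opening \<open>tt\<close> of the contour is kept small, so that
  the Gaussian stays bounded by one on it.\<close>

definition tt :: real where "tt = min 1 (1 / (2 * \<kappa>)) / 2"

definition dirr :: "real ^ 'n \<Rightarrow> real ^ 'n" where "dirr v = tt *\<^sub>R sgn v"

lemma tt: "0 < tt" "tt < 1" "\<kappa> * (2 * tt) \<le> 1 / 2"
proof -
  show "0 < tt" using kappa by (simp add: tt_def)
  have "x / 2 < 1" if "x \<le> 1" for x :: real using that by simp
  from this[OF min.cobounded1] show "tt < 1" unfolding tt_def .
  have "\<kappa> * (2 * tt) = \<kappa> * min 1 (1 / (2 * \<kappa>))" by (simp add: tt_def)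
  also have "\<dots> \<le> \<kappa> * (1 / (2 * \<kappa>))" using kappa by (intro mult_left_mono) auto
  also have "\<dots> = 1 / 2" using kappa by simp
  finally show "\<kappa> * (2 * tt) \<le> 1 / 2" .
qed

lemma tt_half: "2 * tt \<le> 1"
proof -
  have "2 * (x / 2) \<le> 1" if "x \<le> 1" for x :: real using that by simp
  from this[OF min.cobounded1] show ?thesis unfolding tt_def .
qed

text \<open>The left side is the integral over the real contour, which converges thanks to the
  Gaussian; \<open>contour_shift\<close> moves it to the direction of \<open>v\<close>, where it
  converges without the Gaussian.\<close>

lemma gaussian_kernel:
  assumes z: "z \<in> \<Omega>" and v: "v \<noteq> 0" and \<rho>: "\<rho> > 0"
  shows "(\<integral>\<xi>. exp (- of_real (\<rho> * (norm \<xi>)\<^sup>2)) * P (z, cvec \<xi> 0) * exp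
      (\<i> * of_real (v \<bullet> \<xi>)) \<partial>lborel) =
    (\<integral>\<xi>. exp (- of_real \<rho> * cdot (zeta (dirr v) \<xi>) (zeta (dirr v) \<xi>)) *
       (exp (\<i> * cdot (cvec v 0) (zeta (dirr v) \<xi>)) * P (z, zeta (dirr v) \<xi>) * jac (dirr v)
           \<xi>) \<partial>lborel)"
proof -
  define h where "h \<zeta> = exp (\<i> * cdot (cvec v 0) \<zeta> - of_real \<rho> * cdot \<zeta> \<zeta>)"
      for \<zeta>
  define \<gamma> where "\<gamma> = norm v * c0 + 3 * \<rho> * c0\<^sup>2 + (norm v / 2 + 3 * \<rho> * c0 +
      1)\<^sup>2 / (3 * \<rho>)"
  let ?k = "N + CARD('n) + 3"
  have "(\<integral>\<xi>. h (zeta 0 \<xi>) * P (z, zeta 0 \<xi>) * jac 0 \<xi> \<partial>lborel) =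
    (\<integral>\<xi>. h (zeta (dirr v) \<xi>) * P (z, zeta (dirr v) \<xi>) * jac (dirr v) \<xi>
        \<partial>lborel)"
  \<comment> \<open>The radius \<open>2 * tt\<close> gives an open ball that contains 0 and
    \<open>dirr v\<close>, of norm \<open>tt\<close>, while all its directions keep the opening at
    most 1/2.\<close>
  proof (rule contour_shift[OF z, where \<Theta>="ball 0 (2 * tt)" and
      C="exp \<gamma> * (fact ?k * exp 1)"])
    show "hol_vec h UNIV" unfolding h_def
      by (intro holomorphic_wrt_exp holomorphic_wrt_diff holomorphic_wrt_cmult hol_vec_cdot_right
          hol_vec_cdot_self)
    show "norm \<theta> \<le> 1" if "\<theta> \<in> ball 0 (2 * tt)" for \<theta> using that tt_half by simp
    show "norm (h \<zeta>) \<le> exp \<gamma> * (fact ?k * exp 1) / (1 + norm \<xi>) ^ ?k"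
      if \<theta>: "\<theta> \<in> ball 0 (2 * tt)" and d: "norm (\<zeta> - zeta \<theta> \<xi>) < c0" for
          \<theta> \<xi> \<zeta>
    proof -
      have "norm \<theta> \<le> 1" using \<theta> tt_half by simp
      moreover have "\<kappa> * norm \<theta> \<le> \<kappa> * (2 * tt)" using \<theta> kappa by (intro
          mult_left_mono) auto
      ultimately have "Re (\<i> * cdot (cvec v 0) \<zeta> - of_real \<rho> * cdot \<zeta> \<zeta>) \<le>
          \<gamma> + - 1 * norm \<xi>"
        using gaussian_exponent[OF _ _ d \<rho>, of v] tt(3) by (simp add: \<gamma>_def)
      then have "norm (h \<zeta>) \<le> exp \<gamma> * exp (- 1 * norm \<xi>)"
        unfolding h_def norm_exp_eq_Re exp_add[symmetric] by (simp only: exp_le_cancel_iff)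
      also have "exp (- 1 * norm \<xi>) \<le> (fact ?k * exp 1) / (1 + norm \<xi>) ^ ?k"
        using poly_exp_decay[of 1 "norm \<xi>" ?k]
        by (subst pos_le_divide_eq) (auto intro!: zero_less_power add_pos_nonneg simp: mult.commute)
      finally show ?thesis by (simp add: mult_left_mono)
    qed
    show "0 \<in> ball 0 (2 * tt)" "dirr v \<in> ball 0 (2 * tt)" using tt by (auto simp: dirr_def norm_sgn)
  qed auto
  moreover have "h (zeta 0 \<xi>) * P (z, zeta 0 \<xi>) * jac 0 \<xi> =
      exp (- of_real (\<rho> * (norm \<xi>)\<^sup>2)) * P (z, cvec \<xi> 0) * exp (\<i> * of_real (v
          \<bullet> \<xi>))" for \<xi>
  proof -
    have "g1 \<xi> 0 = 0" using g1_bound[of \<xi> 0] by simp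
    then show ?thesis
      by (simp add: h_def zeta_def jac_def cdot_real power2_norm_eq_inner exp_diff exp_minus divide_inverse
          mult_ac)
  qed
  moreover have "h (zeta (dirr v) \<xi>) * P (z, zeta (dirr v) \<xi>) * jac (dirr v) \<xi> =
      exp (- of_real \<rho> * cdot (zeta (dirr v) \<xi>) (zeta (dirr v) \<xi>)) *
       (exp (\<i> * cdot (cvec v 0) (zeta (dirr v) \<xi>)) * P (z, zeta (dirr v) \<xi>) * jac (dirr v)
           \<xi>)" for \<xi>
    by (simp add: h_def exp_diff exp_minus divide_inverse mult_ac)
  ultimately show ?thesis by simp
qed

lemma dirr_facts:
  assumes "v \<noteq> 0"
  shows "norm (dirr v) < 1" "margin (dirr v) (cvec v 0) = \<kappa> * tt * norm v"
proof -
  show "norm (dirr v) < 1" using assms tt by (simp add: dirr_def norm_sgn)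
  have "v \<bullet> sgn v = norm v" using assms by (simp add: sgn_div_norm power2_norm_eq_inner[symmetric]
      power2_eq_square)
  then show "margin (dirr v) (cvec v 0) = \<kappa> * tt * norm v" by (simp add: margin_def dirr_def)
qed

text \<open>The imaginary part of the contour is no longer than the real part, so Re(\<zeta> .
  \<zeta>) \<ge> 0. Being uniform in \<open>\<rho>\<close>, this is the majorant for letting the
  Gaussian tend to 1.\<close>

lemma norm_gaussian_zeta_le:
  assumes \<rho>: "\<rho> \<ge> 0"
  shows "norm (exp (- of_real \<rho> * cdot (zeta (dirr v) \<xi>) (zeta (dirr v) \<xi>))) \<le> 1"
proof -
  have "norm (g \<xi> *\<^sub>R dirr v) \<le> norm \<xi>"
  proof -
    have "norm (dirr v) \<le> 2 * tt" using tt by (simp add: dirr_def norm_sgn)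
    then have "norm (g \<xi> *\<^sub>R dirr v) \<le> (\<kappa> * norm \<xi>) * (2 * tt)"
      using g_nonneg[of \<xi>] g_le[of \<xi>] kappa by (simp only: norm_scaleR abs_of_nonneg) (intro
          mult_mono; simp)
    also have "\<dots> = (\<kappa> * (2 * tt)) * norm \<xi>" by simp
    also have "\<dots> \<le> 1 * norm \<xi>" using tt(3) by (intro mult_right_mono) auto
    finally show ?thesis by simp
  qed
  then have "(norm (g \<xi> *\<^sub>R dirr v))\<^sup>2 \<le> (norm \<xi>)\<^sup>2" by (intro power_mono)
      auto
  then have "Re (cdot (zeta (dirr v) \<xi>) (zeta (dirr v) \<xi>)) \<ge> 0"
    by (simp only: Re_cdot zeta_def Re_vec_cvec Im_vec_cvec power2_norm_eq_inner[symmetric])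
  then show ?thesis using \<rho> by (simp add: norm_exp_eq_Re)
qed

end

context deformation
begin

text \<open>The translate u(x - v) is split by \<open>cutr\<close>. The inner part is
  \<open>near_ft\<close>, by definition. For the outer part both orders of integration, regularised
  by a Gaussian, agree by Fubini; their limits as the Gaussian disappears are the frequency integral
  and the integral against \<open>kernel\<close>.\<close>

lemma real_identity:
  assumes z: "cvec x 0 \<in> Z"
    and Uu: "\<And>y. norm y < r \<Longrightarrow> U (cvec y 0) = u y"
    and r: "\<rho>1 \<le> r" "\<And>v. norm v \<le> \<tau>2 \<Longrightarrow> norm (x - v) < r"
    and fu: "\<And>\<xi>. norm (fourier u \<xi>) \<le> Cu / (1 + norm \<xi>) ^ (N + CARD('n) + 2)"
  defines "m \<equiv> 3 * (N + CARD('n) + 2)" and "J \<equiv> N + CARD('n) + 3"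
  shows "(\<integral>\<xi>. exp (\<i> * of_real (x \<bullet> \<xi>)) * P (cvec x 0, cvec \<xi> 0) * fourier
      u \<xi> \<partial>lborel) =
    (\<integral>\<xi>. P (cvec x 0, cvec \<xi> 0) * near_ft U \<tau> m J (cvec x 0) \<xi> \<partial>lborel)
        + middle m (cvec x 0) + far (cvec x 0)"
proof -
  define z where "z = cvec x (0 :: real ^ 'n)"
  have zZ: "z \<in> Z" using z by (simp add: z_def)
  have zO: "z \<in> \<Omega>" using zZ Z_\<Omega> by blast
  let ?k = "CARD('n) + 2"
  \<comment> \<open>The outer part: bounded with compact support, and of order |v|^(2 J) at 0, which
    will absorb the singularity of the kernel.\<close>
  define b where "b v = of_real (1 - cutr \<tau> m J v) * u (x - v)" for v
  define Rb where "Rb = \<bar>Rad\<bar> + norm x + 1"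
  have Rb: "Rb > 0" by (simp add: Rb_def add_nonneg_pos)
  have uz: "u y = 0" if "norm y > \<bar>Rad\<bar> + 1" for y using u_zero[of y] that by simp
  have "0 < \<bar>Rad\<bar> + 1" by (rule add_nonneg_pos) auto
  then obtain Bu where Bu0: "Bu \<ge> 0" and Bu': "\<forall>y. norm (u y) \<le> Bu * indicat_real (cball 0
      (\<bar>Rad\<bar> + 1)) y"
    using bounded_compact_support[OF cont_u uz] by blast
  have Bu: "norm (u y) \<le> Bu" for y
  proof -
    have "Bu * indicat_real (cball 0 (\<bar>Rad\<bar> + 1)) y \<le> Bu * 1" using Bu0 by (intro
        mult_left_mono) (auto simp: indicator_def)
    then show ?thesis using Bu' order_trans by (metis mult.right_neutral)
  qed
  have b_out: "b v = 0" if "norm v > Rb" for v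
  proof -
    have "norm (x - v) \<ge> Rad" using norm_triangle_ineq2[of v x] that by (simp add: Rb_def
        norm_minus_commute)
    then show ?thesis using u_zero by (simp add: b_def)
  qed
  define D where "D = ((real m + 1) / \<tau>\<^sup>2) ^ J"
  have D0: "D \<ge> 0" by (simp add: D_def)
  have b1: "norm (b v) \<le> D * norm v ^ (2 * J) * Bu" for v
    unfolding b_def norm_mult norm_of_real D_def
    using one_minus_cutr_le'[of m J v] Bu[of "x - v"] by (intro mult_mono) auto
  have b2: "norm (b v) \<le> Bu * indicat_real (cball 0 Rb) v" for v
  proof (cases "norm v \<le> Rb")
    case True
    have "\<bar>1 - cutr \<tau> m J v\<bar> * norm (u (x - v)) \<le> 1 * Bu"
      using cutr_bounds[OF \<tau>_pos, of m J v] Bu by (intro mult_mono) auto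
    then have "norm (b v) \<le> Bu" unfolding b_def norm_mult norm_of_real by simp
    then show ?thesis using True by simp
  qed (use b_out in simp)
  have [measurable]: "u \<in> borel_measurable borel" by (rule borel_measurable_continuous_onI[OF cont_u])
  have [measurable]: "a \<in> borel_measurable borel" by (rule borel_measurable_continuous_onI[OF
      continuous_a])
  have mb [measurable]: "b \<in> borel_measurable borel" unfolding b_def by measurable
  have intb: "integrable lborel b" by (rule integrable_compact_support[OF mb b2])
  obtain e CP where e: "e > 0" "CP \<ge> 0"
    and CP': "\<forall>z'\<in>ball z e. \<forall>\<zeta>\<in>W R \<epsilon> \<union> range (\<lambda>\<xi>.
        cvec \<xi> 0). norm (P (z', \<zeta>)) \<le> CP * (1 + norm (Re_vec \<zeta>)) ^ N"
    using bound_P[OF zO] by blast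
  have CP: "norm (P (z, \<zeta>)) \<le> CP * (1 + norm (Re_vec \<zeta>)) ^ N" if
      "\<zeta> \<in> W R \<epsilon> \<union> range (\<lambda>\<xi>. cvec \<xi> 0)" for \<zeta>
    using CP' e(1) that by simp
  have CPr: "norm (P (z, cvec \<xi> 0)) \<le> CP * (1 + norm \<xi>) ^ N" for \<xi> using CP[of
      "cvec \<xi> 0"] by simp
  have CPz: "norm (P (z, zeta (dirr v) \<xi>)) \<le> CP * (1 + norm \<xi>) ^ N" for v \<xi>
  proof -
    have "norm (dirr v) \<le> 1" using tt by (simp add: dirr_def norm_sgn)
    then show ?thesis using CP[OF zeta_mem, of "dirr v" \<xi>] by (simp add: zeta_def)
  qed
  have cP: "continuous_on UNIV (\<lambda>\<xi>. P (z, cvec \<xi> 0))"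
    by (rule continuous_on_compose2[OF cont_P]) (use zO in \<open>auto intro!: continuous_intros\<close>)
  have [measurable]: "(\<lambda>\<xi>. P (z, cvec \<xi> 0)) \<in> borel_measurable borel"
    by (rule borel_measurable_continuous_onI[OF cP])

  \<comment> \<open>The regularised kernel and its limit\<close>
  define kr where "kr \<rho> v = (\<integral>\<xi>. exp (- of_real (\<rho> * (norm \<xi>)\<^sup>2)) * P (z,
      cvec \<xi> 0) * exp (\<i> * of_real (v \<bullet> \<xi>)) \<partial>lborel)" for \<rho> v
  define S where "S v \<xi> = exp (\<i> * cdot (cvec v 0) (zeta (dirr v) \<xi>)) * P (z, zeta (dirr v)
      \<xi>) * jac (dirr v) \<xi>" for v \<xi>
  define E where "E \<rho> v \<xi> = exp (- of_real \<rho> * cdot (zeta (dirr v) \<xi>) (zeta (dirr v)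
      \<xi>))" for \<rho> v \<xi>
  define I where "I = (\<integral>\<xi>. 1 / (1 + norm (\<xi> :: real ^ 'n)) ^ (CARD('n) + 3)
      \<partial>lborel)"
  define Q where "Q v = CP * exp (K * norm v) * Cs (\<kappa> * tt * norm v)" for v :: "real ^ 'n"
  have kr_eq: "kr \<rho> v = (\<integral>\<xi>. E \<rho> v \<xi> * S v \<xi> \<partial>lborel)" if
      "v \<noteq> 0" "\<rho> > 0" for \<rho> v
    unfolding kr_def E_def S_def by (rule gaussian_kernel[OF zO that])
  have sp: "\<kappa> * tt * norm v > 0" if "v \<noteq> 0" for v :: "real ^ 'n" using that kappa tt by simp
  have S_le: "norm (S v \<xi>) \<le> Q v * (1 / (1 + norm \<xi>) ^ (CARD('n) + 3))" if "v \<noteq> 0" for v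
      \<xi>
  proof -
    have "margin (dirr v) (cvec v 0) \<ge> \<kappa> * tt * norm v" "norm (dirr v) \<le> 1" using
        dirr_facts[OF that] by simp_all
    from integrand_bound[OF this(1) sp[OF that] this(2) CPz e(2)] show ?thesis by (simp add: S_def Q_def)
  qed
  have mS: "S v \<in> borel_measurable lborel" if "v \<noteq> 0" for v
    unfolding S_def using measurable_integrand[OF zO, of "dirr v" "cvec v 0"] dirr_facts(1)[OF that] by simp
  have mE: "E \<rho> v \<in> borel_measurable lborel" for \<rho> v
  proof -
    have "continuous_on UNIV (E \<rho> v)" unfolding E_def by (intro continuous_intros continuous_zeta)
    then show ?thesis using borel_measurable_continuous_onI by simp
  qed
  have ES: "norm (E \<rho> v \<xi> * S v \<xi>) \<le> Q v * (1 / (1 + norm \<xi>) ^ (CARD('n) + 3))" if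
      "v \<noteq> 0" "\<rho> \<ge> 0" for \<rho> v \<xi>
  proof -
    have "norm (E \<rho> v \<xi>) * norm (S v \<xi>) \<le> 1 * (Q v * (1 / (1 + norm \<xi>) ^ (CARD('n) +
        3)))"
      using norm_gaussian_zeta_le[OF that(2), of v \<xi>] unfolding E_def[symmetric] by (intro mult_mono
          S_le that) auto
    then show ?thesis by (simp add: norm_mult)
  qed
  have kr_le: "norm (kr \<rho> v) \<le> Q v * I" if "v \<noteq> 0" "\<rho> > 0" for \<rho> v
  proof -
    have "norm (kr \<rho> v) \<le> (\<integral>\<xi>. norm (E \<rho> v \<xi> * S v \<xi>) \<partial>lborel)"
      unfolding kr_eq[OF that] by (rule integral_norm_bound)
    also have "\<dots> \<le> (\<integral>\<xi>. Q v * (1 / (1 + norm (\<xi> :: real ^ 'n)) ^ (CARD('n) + 3))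
        \<partial>lborel)"
    proof (rule integral_mono_AE'[OF integrable_weight])
      show "AE \<xi> in lborel. norm (E \<rho> v \<xi> * S v \<xi>) \<le> Q v * (1 / (1 + norm \<xi>) ^
          (CARD('n) + 3))"
        using ES[OF that(1)] that(2) by (intro AE_I2) auto
    qed (rule AE_I2, rule order_trans[OF norm_ge_zero ES[OF that(1) less_imp_le[OF that(2)]]])
    also have "\<dots> = Q v * I" unfolding I_def by (rule integral_mult_right_zero)
    finally show ?thesis .
  qed
  define \<rho> where "\<rho> i = 1 / real (Suc i)" for i
  have \<rho>: "\<rho> i > 0" for i by (simp add: \<rho>_def)
  have \<rho>lim: "\<rho> \<longlonglongrightarrow> 0" unfolding \<rho>_def by (rule LIMSEQ_Suc[OF
      lim_1_over_n])
  have kr_lim: "(\<lambda>i. kr (\<rho> i) v) \<longlonglongrightarrow> kernel (z, cvec v 0)" if v: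
      "v \<noteq> 0" for v
  proof -
    have "(\<lambda>i. \<integral>\<xi>. E (\<rho> i) v \<xi> * S v \<xi> \<partial>lborel)
        \<longlonglongrightarrow> (\<integral>\<xi>. S v \<xi> \<partial>lborel)"
    proof (rule integral_dominated_convergence[where w="\<lambda>\<xi>. Q v * (1 / (1 + norm \<xi>) ^
        (CARD('n) + 3))"])
      show "AE \<xi> in lborel. (\<lambda>i. E (\<rho> i) v \<xi> * S v \<xi>) \<longlonglongrightarrow> S v
          \<xi>"
      proof (rule AE_I2)
        fix \<xi>
        have "(\<lambda>i. E (\<rho> i) v \<xi> * S v \<xi>) \<longlonglongrightarrow> exp (- of_real 0 *
            cdot (zeta (dirr v) \<xi>) (zeta (dirr v) \<xi>)) * S v \<xi>"
          unfolding E_def by (intro tendsto_intros \<rho>lim)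
        then show "(\<lambda>i. E (\<rho> i) v \<xi> * S v \<xi>) \<longlonglongrightarrow> S v \<xi>" by
            simp
      qed
      show "AE \<xi> in lborel. norm (E (\<rho> i) v \<xi> * S v \<xi>) \<le> Q v * (1 / (1 + norm \<xi>) ^
          (CARD('n) + 3))" for i
        using ES[OF v] \<rho>[of i] by (intro AE_I2) auto
    qed (use mS[OF v] mE integrable_weight in \<open>auto intro: borel_measurable_times\<close>)
    moreover have "(\<integral>\<xi>. S v \<xi> \<partial>lborel) = kernel (z, cvec v 0)"
      using kernel_eq_kern[OF zO \<Gamma>_real[OF v] dirr_facts(1)[OF v]] dirr_facts(2)[OF v] sp[OF v]
      by (simp add: kern_def S_def)
    ultimately show ?thesis using kr_eq[OF v \<rho>] by simp
  qed
  \<comment> \<open>\<open>b\<close> supplies |v|^(2 J) and \<open>Q\<close> costs |v|^(-J); the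
    surplus |v|^J is bounded by \<open>Rb ^ J\<close> on the support of \<open>b\<close>.\<close>
  define H where "H = D * Rb ^ J * Bu * (CP * exp (K * Rb) * ((1 + G) * (fact J * exp (\<kappa> * tt * Rb) /
      (\<kappa> * tt) ^ J)) * I)"
  have I0: "I \<ge> 0" unfolding I_def by (intro Bochner_Integration.integral_nonneg) simp
  have bQ: "norm (b v) * (Q v * I) \<le> H * indicat_real (cball 0 Rb) v" if v: "v \<noteq> 0" for v
  proof (cases "norm v \<le> Rb")
    case True
    have nv: "norm v > 0" using v by simp
    have "Q v \<le> CP * exp (K * Rb) * ((1 + G) * (fact J * exp (\<kappa> * tt * Rb) / (\<kappa> * tt *
        norm v) ^ J))"
      unfolding Q_def Cs_def J_def
      using e(2) K kappa tt True nv G_nonneg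
      by (intro mult_mono divide_right_mono mult_left_mono) (auto simp: add.assoc intro!: mult_left_mono
          divide_right_mono)
    also have "\<dots> = CP * exp (K * Rb) * ((1 + G) * (fact J * exp (\<kappa> * tt * Rb) / (\<kappa> * tt)
        ^ J)) / norm v ^ J"
      by (simp add: power_mult_distrib)
    finally have Qb: "Q v \<le> CP * exp (K * Rb) * ((1 + G) * (fact J * exp (\<kappa> * tt * Rb) /
        (\<kappa> * tt) ^ J)) / norm v ^ J" .
    define X where "X = CP * exp (K * Rb) * ((1 + G) * (fact J * exp (\<kappa> * tt * Rb) / (\<kappa> * tt)
        ^ J))"
    have X0: "X \<ge> 0" unfolding X_def using e kappa tt G_nonneg by simp
    have Q0: "Q v \<ge> 0" unfolding Q_def using e Cs_nonneg[OF sp[OF v]] by simp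
    have "norm (b v) * (Q v * I) \<le> (D * norm v ^ (2 * J) * Bu) * (X / norm v ^ J * I)"
      using b1 Qb I0 D0 Bu0 X0 Q0 unfolding X_def[symmetric] by (intro mult_mono) auto
    also have "\<dots> = D * norm v ^ J * Bu * (X * I)"
    proof -
      have "(x * p ^ (2 * j) * c) * (y / p ^ j * d) = x * p ^ j * c * (y * d)" if "p > 0" for x y c d p ::
          real and j
        using that by (simp add: mult_2 power_add)
      from this[OF nv] show ?thesis .
    qed
    also have "\<dots> \<le> D * Rb ^ J * Bu * (X * I)"
      using True D0 Bu0 X0 I0 by (intro mult_right_mono mult_left_mono power_mono) auto
    finally show ?thesis using True by (simp add: H_def X_def)
  qed (use b_out in simp)
  have intH: "integrable lborel (\<lambda>v. H * indicat_real (cball (0::real^'n) Rb) v)"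
    by (intro integrable_mult_right integrable_real_indicator emeasure_lborel_cball_finite) auto
  \<comment> \<open>The kernel is controlled for v \<noteq> 0 only, and one point is a null
    set.\<close>
  have AE0: "AE v in lborel. v \<noteq> (0 :: real ^ 'n)" by (rule AE_lborel_singleton)
  note [measurable] = measurable_kernel_real[OF zO]
  have mk: "(\<lambda>v. b v * kernel (z, cvec v 0)) \<in> borel_measurable borel"
  proof -
    have "(\<lambda>v. b v * (indicator (- {0}) v *\<^sub>R kernel (z, cvec v 0))) \<in> borel_measurable
        borel" by measurable
    moreover have "b v * (indicator (- {0}) v *\<^sub>R kernel (z, cvec v 0)) = b v * kernel (z, cvec v 0)"
        for v
    proof (cases "v = 0")
      case True
      have "b v = 0" using True \<tau>_pos by (simp add: b_def cutr_def J_def)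
      then show ?thesis by simp
    qed simp
    ultimately show ?thesis by simp
  qed
  have mkr: "kr \<rho>' \<in> borel_measurable borel" for \<rho>'
  proof -
    have "(\<lambda>v. \<integral>\<xi>. exp (- of_real (\<rho>' * (norm \<xi>)\<^sup>2)) * P (z, cvec \<xi>
        0) * exp (\<i> * of_real (v \<bullet> \<xi>)) \<partial>lborel) \<in> borel_measurable lborel"
      by (rule sigma_finite_measure.borel_measurable_lebesgue_integral[OF sigma_finite_lborel]) measurable
    then show ?thesis unfolding kr_def[abs_def] by simp
  qed
  have lim_v: "(\<lambda>i. \<integral>v. b v * kr (\<rho> i) v \<partial>lborel) \<longlonglongrightarrow>
      (\<integral>v. b v * kernel (z, cvec v 0) \<partial>lborel)"
  proof (rule integral_dominated_convergence[OF _ _ intH])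
    show "(\<lambda>v. b v * kernel (z, cvec v 0)) \<in> borel_measurable lborel" using mk by simp
    show "(\<lambda>v. b v * kr (\<rho> i) v) \<in> borel_measurable lborel" for i using mb mkr by
        measurable
    show "AE v in lborel. (\<lambda>i. b v * kr (\<rho> i) v) \<longlonglongrightarrow> b v * kernel (z,
        cvec v 0)"
      using AE0 by eventually_elim (intro tendsto_intros kr_lim)
    show "AE v in lborel. norm (b v * kr (\<rho> i) v) \<le> H * indicat_real (cball 0 Rb) v" for i
      using AE0
    proof eventually_elim
      fix v :: "real ^ 'n" assume v: "v \<noteq> 0"
      have "norm (b v * kr (\<rho> i) v) \<le> norm (b v) * (Q v * I)"
        unfolding norm_mult by (intro mult_left_mono kr_le[OF v \<rho>]) auto
      then show "norm (b v * kr (\<rho> i) v) \<le> H * indicat_real (cball 0 Rb) v" using bQ[OF v] by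
          linarith
    qed
  qed
  have int_bk: "integrable lborel (\<lambda>v. b v * kernel (z, cvec v 0))"
  proof (rule Bochner_Integration.integrable_bound[OF intH])
    show "(\<lambda>v. b v * kernel (z, cvec v 0)) \<in> borel_measurable lborel" using mk by simp
    show "AE v in lborel. norm (b v * kernel (z, cvec v 0)) \<le> norm (H * indicat_real (cball 0 Rb) v)"
      using AE0
    proof eventually_elim
      fix v :: "real ^ 'n" assume v: "v \<noteq> 0"
      have "norm (kernel (z, cvec v 0)) \<le> Q v * I"
        by (rule LIMSEQ_le_const2[OF tendsto_norm[OF kr_lim[OF v]]]) (use kr_le[OF v \<rho>] in auto)
      then have "norm (b v * kernel (z, cvec v 0)) \<le> norm (b v) * (Q v * I)"
        unfolding norm_mult by (intro mult_left_mono) auto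
      then show "norm (b v * kernel (z, cvec v 0)) \<le> norm (H * indicat_real (cball 0 Rb) v)"
        using bQ[OF v] unfolding real_norm_def by linarith
    qed
  qed

  \<comment> \<open>The frequency side and the exchange of integrals\<close>
  define Bf where "Bf \<xi> = (\<integral>v. exp (\<i> * of_real (v \<bullet> \<xi>)) * b v
      \<partial>lborel)" for \<xi>
  define nf where "nf \<xi> = near_ft U \<tau> m J z \<xi>" for \<xi>
  \<comment> \<open>The Gaussian is what gives absolute integrability in both variables; the symbol
    alone may grow like |\<xi>|^N.\<close>
  have fub: "(\<integral>\<xi>. exp (- of_real (\<rho> i * (norm \<xi>)\<^sup>2)) * (P (z, cvec \<xi> 0) *
      Bf \<xi>) \<partial>lborel) = (\<integral>v. b v * kr (\<rho> i) v \<partial>lborel)" for i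
  proof -
    define F where "F \<xi> v = exp (- of_real (\<rho> i * (norm \<xi>)\<^sup>2)) * P (z, cvec \<xi> 0) *
        exp (\<i> * of_real (v \<bullet> \<xi>)) * b v" for \<xi> v
    obtain CG where CG: "CG \<ge> 0" "\<forall>\<xi> :: real ^ 'n. exp (- \<rho> i * (norm \<xi>)\<^sup>2) *
        (1 + norm \<xi>) ^ (N + (CARD('n) + 3)) \<le> CG"
      using poly_gaussian_bound[OF \<rho>] by blast
    have nF: "norm (F \<xi> v) = exp (- \<rho> i * (norm \<xi>)\<^sup>2) * norm (P (z, cvec \<xi> 0)) * norm
        (b v)" for \<xi> v
      by (simp add: F_def norm_mult norm_exp_eq_Re)
    have Gb: "exp (- \<rho> i * (norm \<xi>)\<^sup>2) * norm (P (z, cvec \<xi> 0)) \<le> CP * CG * (1 / (1 +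
        norm \<xi>) ^ (CARD('n) + 3))" for \<xi>
    proof -
      have "exp (- \<rho> i * (norm \<xi>)\<^sup>2) * norm (P (z, cvec \<xi> 0)) \<le> exp (- \<rho> i *
          (norm \<xi>)\<^sup>2) * (CP * (1 + norm \<xi>) ^ N)"
        by (intro mult_left_mono CPr) auto
      also have "\<dots> = CP * (exp (- \<rho> i * (norm \<xi>)\<^sup>2) * (1 + norm \<xi>) ^ N)" by simp
      also have "exp (- \<rho> i * (norm \<xi>)\<^sup>2) * (1 + norm \<xi>) ^ N \<le> CG / (1 + norm \<xi>)
          ^ (CARD('n) + 3)"
      proof -
        have x: "0 < (1 + norm \<xi>) ^ (CARD('n) + 3)" by (auto intro!: zero_less_power add_pos_nonneg)
        show ?thesis
          unfolding pos_le_divide_eq[OF x] mult.assoc power_add[symmetric] by (rule CG(2)[rule_format])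
      qed
      finally show ?thesis using e(2) by (simp add: mult_left_mono)
    qed
    have "integrable (lborel \<Otimes>\<^sub>M lborel) (\<lambda>(\<xi>, v). F \<xi> v)"
    proof (rule lborel_pair.Fubini_integrable)
      show "(\<lambda>(\<xi>, v). F \<xi> v) \<in> borel_measurable (lborel \<Otimes>\<^sub>M lborel)"
          unfolding F_def by measurable
      have nb: "integrable lborel (\<lambda>v. norm (b v))" using intb by simp
      have "(\<integral>v. norm (F \<xi> v) \<partial>lborel) = exp (- \<rho> i * (norm \<xi>)\<^sup>2) *
          norm (P (z, cvec \<xi> 0)) * (\<integral>v. norm (b v) \<partial>lborel)" for \<xi>
        unfolding nF by (rule integral_mult_right_zero)
      moreover have "integrable lborel (\<lambda>\<xi>. exp (- \<rho> i * (norm \<xi>)\<^sup>2) * norm (P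
          (z, cvec \<xi> 0)))"
      proof (rule Bochner_Integration.integrable_bound[OF integrable_weight[of "CP * CG"]])
        show "AE \<xi> in lborel. norm (exp (- \<rho> i * (norm \<xi>)\<^sup>2) * norm (P (z, cvec \<xi>
            0))) \<le> norm (CP * CG * (1 / (1 + norm \<xi>) ^ (CARD('n) + 3)))"
        proof (rule AE_I2)
          fix \<xi> :: "real ^ 'n"
          have "norm (exp (- \<rho> i * (norm \<xi>)\<^sup>2) * norm (P (z, cvec \<xi> 0))) = exp (- \<rho>
              i * (norm \<xi>)\<^sup>2) * norm (P (z, cvec \<xi> 0))" by simp
          also note Gb
          also have "CP * CG * (1 / (1 + norm \<xi>) ^ (CARD('n) + 3)) \<le> norm (CP * CG * (1 / (1 + norm
              \<xi>) ^ (CARD('n) + 3)))"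
            unfolding real_norm_def by (rule abs_ge_self)
          finally show "norm (exp (- \<rho> i * (norm \<xi>)\<^sup>2) * norm (P (z, cvec \<xi> 0))) \<le>
              norm (CP * CG * (1 / (1 + norm \<xi>) ^ (CARD('n) + 3)))" .
        qed
      qed measurable
      ultimately show "integrable lborel (\<lambda>\<xi>. \<integral>v. norm (case (\<xi>, v) of (\<xi>, v)
          \<Rightarrow> F \<xi> v) \<partial>lborel)" by simp
      have "integrable lborel (F \<xi>)" for \<xi>
      proof (rule Bochner_Integration.integrable_bound[OF integrable_mult_right[OF nb]])
        show "F \<xi> \<in> borel_measurable lborel" unfolding F_def by measurable
        show "AE v in lborel. norm (F \<xi> v) \<le> norm (exp (- \<rho> i * (norm \<xi>)\<^sup>2) * norm (P
            (z, cvec \<xi> 0)) * norm (b v))"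
          unfolding nF by simp
      qed
      then show "AE \<xi> in lborel. integrable lborel (\<lambda>v. case (\<xi>, v) of (\<xi>, v)
          \<Rightarrow> F \<xi> v)" by simp
    qed
    from lborel_pair.Fubini_integral[OF this]
    have "(\<integral>v. (\<integral>\<xi>. F \<xi> v \<partial>lborel) \<partial>lborel) =
        (\<integral>\<xi>. (\<integral>v. F \<xi> v \<partial>lborel) \<partial>lborel)" .
    moreover have "(\<integral>\<xi>. F \<xi> v \<partial>lborel) = b v * kr (\<rho> i) v" for v
      unfolding F_def kr_def by simp
    moreover have "(\<integral>v. F \<xi> v \<partial>lborel) = exp (- of_real (\<rho> i * (norm
        \<xi>)\<^sup>2)) * (P (z, cvec \<xi> 0) * Bf \<xi>)" for \<xi>
      unfolding F_def Bf_def mult.assoc by simp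
    ultimately show ?thesis by simp
  qed
  have shift: "(\<integral>v. exp (\<i> * of_real (v \<bullet> \<xi>)) * u (x - v) \<partial>lborel) = exp
      (\<i> * of_real (x \<bullet> \<xi>)) * fourier u \<xi>" for \<xi>
  proof -
    define f where "f y = exp (\<i> * of_real ((x - y) \<bullet> \<xi>)) * u y" for y
    have "f \<in> borel_measurable borel" unfolding f_def by measurable
    from lborel_integral_reflect[OF this, of x]
    have "(\<integral>v. exp (\<i> * of_real (v \<bullet> \<xi>)) * u (x - v) \<partial>lborel) =
        (\<integral>y. f y \<partial>lborel)" by (simp add: f_def)
    also have "\<dots> = (\<integral>y. exp (\<i> * of_real (x \<bullet> \<xi>)) * (exp (- \<i> * of_real (y
        \<bullet> \<xi>)) * u y) \<partial>lborel)"
      by (simp add: f_def inner_diff_left right_diff_distrib exp_diff exp_minus divide_inverse mult_ac)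
    also have "\<dots> = exp (\<i> * of_real (x \<bullet> \<xi>)) * fourier u \<xi>" unfolding fourier_def
        by (rule integral_mult_right_zero)
    finally show ?thesis .
  qed
  have zv: "z - cvec v 0 = cvec (x - v) 0" for v
    using cvec_diff[of x v 0 0] by (simp add: z_def)
  have Uv: "U (z - cvec v 0) = u (x - v)" if "norm v \<le> \<tau>2" for v
    unfolding zv by (rule Uu[OF r(2)[OF that]])
  have nf_eq: "nf \<xi> = (\<integral>v. exp (\<i> * of_real (v \<bullet> \<xi>)) * (of_real (cutr \<tau> m
      J v) * u (x - v)) \<partial>lborel)" for \<xi>
    unfolding nf_def near_ft_def
  proof (rule Bochner_Integration.integral_cong[OF refl])
    fix v :: "real ^ 'n"
    show "exp (\<i> * of_real (v \<bullet> \<xi>)) * of_real (cutr \<tau> m J v) * U (z - cvec v 0) =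
        exp (\<i> * of_real (v \<bullet> \<xi>)) * (of_real (cutr \<tau> m J v) * u (x - v))"
      using Uv[of v] \<tau>2 by (cases "norm v < \<tau>") (auto simp: cutr_def)
  qed
  have Bf_eq: "exp (\<i> * of_real (x \<bullet> \<xi>)) * fourier u \<xi> = Bf \<xi> + nf \<xi>" for \<xi>
  proof -
    have "integrable lborel (\<lambda>v. exp (\<i> * of_real (v \<bullet> \<xi>)) * b v)"
      by (rule integrable_compact_support[where B=Bu and r=Rb]) (use b2 in \<open>auto simp: norm_mult
          norm_exp_eq_Re\<close>)
    moreover have "integrable lborel (\<lambda>v. exp (\<i> * of_real (v \<bullet> \<xi>)) * (of_real (cutr
        \<tau> m J v) * u (x - v)))"
    proof (rule integrable_compact_support[where B=Bu and r=\<tau>])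
      fix v :: "real ^ 'n"
      have "\<bar>cutr \<tau> m J v\<bar> * norm (u (x - v)) \<le> 1 * Bu"
        using cutr_bounds[OF \<tau>_pos, of m J v] Bu by (intro mult_mono) auto
      then show "norm (exp (\<i> * of_real (v \<bullet> \<xi>)) * (of_real (cutr \<tau> m J v) * u (x - v)))
          \<le> Bu * indicat_real (cball 0 \<tau>) v"
      proof (cases "norm v < \<tau>")
        case True
        assume "\<bar>cutr \<tau> m J v\<bar> * norm (u (x - v)) \<le> 1 * Bu"
        then show ?thesis using True by (simp add: norm_mult norm_exp_eq_Re)
      qed (use Bu0 in \<open>simp add: cutr_def\<close>)
    qed measurable
    ultimately have "Bf \<xi> + nf \<xi> = (\<integral>v. exp (\<i> * of_real (v \<bullet> \<xi>)) * b v +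
        exp (\<i> * of_real (v \<bullet> \<xi>)) * (of_real (cutr \<tau> m J v) * u (x - v))
        \<partial>lborel)"
      unfolding Bf_def nf_eq by simp
    also have "\<dots> = (\<integral>v. exp (\<i> * of_real (v \<bullet> \<xi>)) * u (x - v)
        \<partial>lborel)"
      by (simp add: b_def algebra_simps)
    finally show ?thesis using shift by simp
  qed

  \<comment> \<open>Decay in frequency and removal of the Gaussian\<close>
  obtain Cn where Cn: "Cn \<ge> 0" "\<forall>\<xi>. norm (nf \<xi>) \<le> Cn / (1 + norm \<xi>) ^ (N +
      CARD('n) + 2)"
  proof -
    have "z - cvec v 0 \<in> T" if "norm v \<le> \<tau>" for v using Z_T'[OF zZ, of v] that \<tau>2 by simp
    from near_ft_decay[OF open_T hol_U \<tau>_pos this, of "N + CARD('n) + 2" J]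
    obtain e C where "e > 0" "C \<ge> 0" and *: "\<forall>z'\<in>ball z e. \<forall>\<xi>. norm (near_ft U
        \<tau> m J z' \<xi>) \<le> C / (1 + norm \<xi>) ^ (N + CARD('n) + 2)"
      unfolding m_def by blast
    have "z \<in> ball z e" using \<open>e > 0\<close> by simp
    with * \<open>C \<ge> 0\<close> show thesis using that unfolding nf_def by blast
  qed
  have mnf [measurable]: "nf \<in> borel_measurable borel"
    unfolding nf_eq[abs_def] by (rule borel_measurable_near_ft) measurable
  have mBf [measurable]: "Bf \<in> borel_measurable borel"
    unfolding Bf_def[abs_def] by (rule borel_measurable_near_ft) measurable
  have Cu0: "Cu \<ge> 0" using order_trans[OF norm_ge_zero fu[of 0]] by simp
  \<comment> \<open>\<open>b\<close> inherits only finite smoothness from the cut-off. Its transform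
    is estimated as a difference instead: the transform of \<open>u\<close> and the near part both
    decay to the order wanted.\<close>
  have Bf_le: "norm (Bf \<xi>) \<le> (Cu + Cn) / (1 + norm \<xi>) ^ (N + CARD('n) + 2)" for \<xi>
  proof -
    have "Bf \<xi> = exp (\<i> * of_real (x \<bullet> \<xi>)) * fourier u \<xi> - nf \<xi>" using Bf_eq[of
        \<xi>] by simp
    then have "norm (Bf \<xi>) \<le> norm (exp (\<i> * of_real (x \<bullet> \<xi>)) * fourier u \<xi>) +
        norm (nf \<xi>)"
      by (simp only: norm_triangle_ineq4)
    also have "norm (exp (\<i> * of_real (x \<bullet> \<xi>)) * fourier u \<xi>) = norm (fourier u \<xi>)"
        by (simp add: norm_mult norm_exp_eq_Re)
    finally show ?thesis using fu[of \<xi>] Cn(2)[rule_format, of \<xi>] by (simp add: add_divide_distrib)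
  qed
  have Pw: "norm (P (z, cvec \<xi> 0) * X) \<le> CP * C * (1 / (1 + norm \<xi>) ^ ?k)"
    if "norm X \<le> C / (1 + norm \<xi>) ^ (N + CARD('n) + 2)" for X C \<xi>
  proof -
    have x: "(1 + norm \<xi>) > 0" by (auto intro: add_pos_nonneg)
    have "norm (P (z, cvec \<xi> 0) * X) \<le> CP * (1 + norm \<xi>) ^ N * (C / (1 + norm \<xi>) ^ (N +
        CARD('n) + 2))"
      unfolding norm_mult using CPr that e(2) by (intro mult_mono) auto
    also have "\<dots> = CP * C * (1 / (1 + norm \<xi>) ^ ?k)" using x by (simp add: power_add)
    finally show ?thesis .
  qed
  have intw: "integrable lborel (\<lambda>\<xi> :: real ^ 'n. c * (1 / (1 + norm \<xi>) ^ ?k))" for c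
    using integrable_inverse_power_norm[of ?k, where 'a="real ^ 'n"] by (intro integrable_mult_right) simp
  have intP: "integrable lborel (\<lambda>\<xi>. P (z, cvec \<xi> 0) * X \<xi>)"
    if [measurable]: "X \<in> borel_measurable borel" and "\<And>\<xi>. norm (X \<xi>) \<le> C / (1 + norm
        \<xi>) ^ (N + CARD('n) + 2)" for X C
  proof (rule Bochner_Integration.integrable_bound[OF intw])
    show "AE \<xi> in lborel. norm (P (z, cvec \<xi> 0) * X \<xi>) \<le> norm (CP * C * (1 / (1 + norm
        \<xi>) ^ ?k))"
      unfolding real_norm_def by (intro AE_I2 order_trans[OF Pw[OF that(2)] abs_ge_self])
  qed measurable
  have lim_xi: "(\<lambda>i. \<integral>\<xi>. exp (- of_real (\<rho> i * (norm \<xi>)\<^sup>2)) * (P (z,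
      cvec \<xi> 0) * Bf \<xi>) \<partial>lborel) \<longlonglongrightarrow> (\<integral>\<xi>. P (z, cvec
      \<xi> 0) * Bf \<xi> \<partial>lborel)"
  proof (rule integral_dominated_convergence[OF _ _ intw[of "CP * (Cu + Cn)"]])
    show "(\<lambda>\<xi>. P (z, cvec \<xi> 0) * Bf \<xi>) \<in> borel_measurable lborel" by measurable
    show "(\<lambda>\<xi>. exp (- of_real (\<rho> i * (norm \<xi>)\<^sup>2)) * (P (z, cvec \<xi> 0) * Bf
        \<xi>)) \<in> borel_measurable lborel" for i by measurable
    show "AE \<xi> in lborel. (\<lambda>i. exp (- of_real (\<rho> i * (norm \<xi>)\<^sup>2)) * (P (z, cvec
        \<xi> 0) * Bf \<xi>)) \<longlonglongrightarrow> P (z, cvec \<xi> 0) * Bf \<xi>"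
    proof (rule AE_I2)
      fix \<xi> :: "real ^ 'n"
      have "(\<lambda>i. exp (- of_real (\<rho> i * (norm \<xi>)\<^sup>2)) * (P (z, cvec \<xi> 0) * Bf
          \<xi>)) \<longlonglongrightarrow> exp (- of_real (0 * (norm \<xi>)\<^sup>2)) * (P (z, cvec \<xi>
          0) * Bf \<xi>)"
        by (intro tendsto_intros \<rho>lim)
      then show "(\<lambda>i. exp (- of_real (\<rho> i * (norm \<xi>)\<^sup>2)) * (P (z, cvec \<xi> 0) * Bf
          \<xi>)) \<longlonglongrightarrow> P (z, cvec \<xi> 0) * Bf \<xi>" by simp
    qed
    show "AE \<xi> in lborel. norm (exp (- of_real (\<rho> i * (norm \<xi>)\<^sup>2)) * (P (z, cvec \<xi> 0)
        * Bf \<xi>)) \<le> CP * (Cu + Cn) * (1 / (1 + norm \<xi>) ^ ?k)" for i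
    proof (rule AE_I2)
      fix \<xi> :: "real ^ 'n"
      have "norm (exp (- complex_of_real (\<rho> i * (norm \<xi>)\<^sup>2))) \<le> 1"
        unfolding norm_exp_eq_Re using \<rho>[of i] by simp
      then have "norm (exp (- complex_of_real (\<rho> i * (norm \<xi>)\<^sup>2))) * norm (P (z, cvec \<xi>
          0) * Bf \<xi>) \<le> 1 * (CP * (Cu + Cn) * (1 / (1 + norm \<xi>) ^ ?k))"
        by (intro mult_mono Pw Bf_le) auto
      then show "norm (exp (- of_real (\<rho> i * (norm \<xi>)\<^sup>2)) * (P (z, cvec \<xi> 0) * Bf \<xi>))
          \<le> CP * (Cu + Cn) * (1 / (1 + norm \<xi>) ^ ?k)"
        by (simp only: norm_mult mult_1_left)
    qed
  qed
  have main: "(\<integral>\<xi>. P (z, cvec \<xi> 0) * Bf \<xi> \<partial>lborel) = (\<integral>v. b v *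
      kernel (z, cvec v 0) \<partial>lborel)"
    using LIMSEQ_unique[OF lim_xi] lim_v unfolding fub by blast

  \<comment> \<open>Reassembling the middle and far parts\<close>
  have mid: "middle m z = (\<integral>v. of_real (a v) * (b v * kernel (z, cvec v 0)) \<partial>lborel)"
    unfolding middle_def J_def[symmetric]
  proof (rule Bochner_Integration.integral_cong[OF refl])
    fix v :: "real ^ 'n"
    show "of_real ((1 - cutr \<tau> m J v) * a v) * (kernel (z, cvec v 0) * U (z - cvec v 0)) = of_real (a
        v) * (b v * kernel (z, cvec v 0))"
      using Uv[of v] a_far[of v] by (cases "norm v \<le> \<tau>2") (auto simp: b_def)
  qed
  \<comment> \<open>At a real point Im z = 0, so the contour is real, its Jacobian is 1 and Y = x -
    v after reflection.\<close>
  have fr: "far z = (\<integral>v. of_real (1 - a v) * (b v * kernel (z, cvec v 0)) \<partial>lborel)"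
  proof -
    have "far z = (\<integral>v. q z (x - v) \<partial>lborel)"
      unfolding far_def by (rule lborel_integral_reflect[OF measurable_q[OF zZ], symmetric])
    also have "\<dots> = (\<integral>v. of_real (1 - a v) * (b v * kernel (z, cvec v 0)) \<partial>lborel)"
    proof (rule Bochner_Integration.integral_cong[OF refl])
      fix v :: "real ^ 'n"
      have Im: "Im_vec z = 0" "Re_vec z = x" by (simp_all add: z_def)
      have c10: "c1 (x - v) 0 = 0" using c1_bound[of "x - v" 0] by simp
      have Y: "Yc (x - v) z = cvec (x - v) 0" by (simp add: Yc_def Im)
      have Gv: "Gy (x - v) (cvec (x - v) 0) = u (x - v)" using Uu[of "x - v"] r(1) by (auto simp: Gy_def)
      have zz: "z - cvec (x - v) 0 = cvec v 0" using cvec_diff[of x "x - v" 0 0] by (simp add: z_def)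
      have "q z (x - v) = of_real (1 - a v) * (u (x - v) * kernel (z, cvec v 0))"
        unfolding q_def \<Phi>_def Y Im fst_conv snd_conv Gv zz c10 by simp
      \<comment> \<open>Inside the ball of radius \<open>\<tau>\<close> both sides vanish since
        \<open>a = 1\<close>; outside it \<open>cutr\<close> is 0 and \<open>b v\<close> is just u(x
        - v).\<close>
      also have "\<dots> = of_real (1 - a v) * (b v * kernel (z, cvec v 0))"
        using a_one[of v] by (cases "norm v < \<tau>") (auto simp: b_def cutr_def)
      finally show "q z (x - v) = of_real (1 - a v) * (b v * kernel (z, cvec v 0))" .
    qed
    finally show ?thesis .
  qed
  have ia: "integrable lborel (\<lambda>v. of_real (w v) * (b v * kernel (z, cvec v 0)))"
    if [measurable]: "w \<in> borel_measurable borel" and "\<And>v. \<bar>w v\<bar> \<le> 1" for w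
  proof (rule Bochner_Integration.integrable_bound[OF int_bk])
    show "(\<lambda>v. of_real (w v) * (b v * kernel (z, cvec v 0))) \<in> borel_measurable lborel" using mk
        by measurable
    show "AE v in lborel. norm (of_real (w v) * (b v * kernel (z, cvec v 0))) \<le> norm (b v * kernel (z,
        cvec v 0))"
      using that(2) by (intro AE_I2) (simp only: norm_mult[of "of_real _"] norm_of_real mult_left_le_one_le
          norm_ge_zero abs_ge_zero)
  qed
  have "middle m z + far z = (\<integral>v. b v * kernel (z, cvec v 0) \<partial>lborel)"
  proof -
    have "integrable lborel (\<lambda>v. of_real (a v) * (b v * kernel (z, cvec v 0)))"
      by (rule ia) (use a_range in auto)
    moreover have "integrable lborel (\<lambda>v. of_real (1 - a v) * (b v * kernel (z, cvec v 0)))"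
      by (rule ia) (use a_range in auto)
    ultimately have "middle m z + far z = (\<integral>v. of_real (a v) * (b v * kernel (z, cvec v 0)) +
        of_real (1 - a v) * (b v * kernel (z, cvec v 0)) \<partial>lborel)"
      unfolding mid fr by simp
    also have "\<dots> = (\<integral>v. b v * kernel (z, cvec v 0) \<partial>lborel)"
      by (rule Bochner_Integration.integral_cong[OF refl]) (simp add: algebra_simps)
    finally show ?thesis .
  qed
  then have "(\<integral>\<xi>. P (z, cvec \<xi> 0) * Bf \<xi> \<partial>lborel) = middle m z + far z" using
      main by simp
  moreover have "(\<integral>\<xi>. exp (\<i> * of_real (x \<bullet> \<xi>)) * P (z, cvec \<xi> 0) * fourier
      u \<xi> \<partial>lborel) =
      (\<integral>\<xi>. P (z, cvec \<xi> 0) * Bf \<xi> \<partial>lborel) + (\<integral>\<xi>. P (z, cvec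
          \<xi> 0) * nf \<xi> \<partial>lborel)"
  proof -
    have "exp (\<i> * of_real (x \<bullet> \<xi>)) * P (z, cvec \<xi> 0) * fourier u \<xi> = P (z, cvec
        \<xi> 0) * Bf \<xi> + P (z, cvec \<xi> 0) * nf \<xi>" for \<xi>
    proof -
      have "exp (\<i> * of_real (x \<bullet> \<xi>)) * P (z, cvec \<xi> 0) * fourier u \<xi> = P (z, cvec
          \<xi> 0) * (exp (\<i> * of_real (x \<bullet> \<xi>)) * fourier u \<xi>)"
        by (simp add: mult_ac)
      then show ?thesis unfolding Bf_eq by (simp add: distrib_left)
    qed
    then show ?thesis using intP[OF mBf Bf_le] intP[OF mnf Cn(2)[rule_format]] by simp
  qed
  ultimately show ?thesis unfolding nf_def z_def by simp
qed

end

section \<open>The extension\<close>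

lemma japanese_bracket_bounds: "1 \<le> japanese_bracket \<xi>"
    "japanese_bracket \<xi> \<le> 1 + norm \<xi>"
proof -
  show "1 \<le> japanese_bracket \<xi>" by (simp add: japanese_bracket_def)
  show "japanese_bracket \<xi> \<le> 1 + norm \<xi>"
    unfolding japanese_bracket_def by (rule real_le_lsqrt) (auto simp: power2_sum)
qed

lemma le_of_bracket_bound:
  assumes "japanese_bracket \<xi> powr (- d) * x \<le> B" and x: "x \<ge> 0" and N:
      "\<bar>d\<bar> \<le> real N"
  shows "x \<le> max B 0 * (1 + norm \<xi>) ^ N"
proof -
  let ?j = "japanese_bracket \<xi>"
  have j: "1 \<le> ?j" "?j \<le> 1 + norm \<xi>" by (rule japanese_bracket_bounds)+
  have "?j powr d \<le> ?j powr real N" using j N by (intro powr_mono) auto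
  also have "\<dots> = ?j ^ N" using j by (simp add: powr_realpow)
  also have "\<dots> \<le> (1 + norm \<xi>) ^ N" using j by (intro power_mono) auto
  finally have p: "?j powr d \<le> (1 + norm \<xi>) ^ N" .
  have "?j powr d * ?j powr (- d) = 1" using j by (simp add: powr_add[symmetric])
  then have "x = ?j powr d * (?j powr (- d) * x)" by (simp add: mult.assoc[symmetric])
  also have "\<dots> \<le> ?j powr d * max B 0" using assms(1) by (intro mult_left_mono) auto
  also have "\<dots> \<le> (1 + norm \<xi>) ^ N * max B 0" using p by (intro mult_right_mono) auto
  finally show ?thesis by (simp add: mult.commute)
qed

text \<open>On \<open>W R \<epsilon>\<close> the growth hypothesis is used for a closed ball of
  points z. The real frequencies outside \<open>W R \<epsilon>\<close> have norm at most
  \<open>R\<close>; there joint continuity on a compact set bounds the symbol.\<close>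

lemma holo_symbol_intro:
  fixes P :: "(complex ^ 'n::finite) \<times> (complex ^ 'n) \<Rightarrow> complex"
  assumes "R > 0" "\<epsilon> > 0" and \<Omega>: "open \<Omega>" and N: "\<bar>d\<bar> \<le> real N"
    and h2: "holo2 P (\<Omega> \<times> W R \<epsilon>)" and h1:
        "\<And>\<xi>. holo (\<lambda>z. P (z, cvec \<xi> 0)) \<Omega>"
    and ct: "continuous_on (\<Omega> \<times> range (\<lambda>\<xi>. cvec \<xi> 0)) P"
    and bd: "\<And>K. relatively_compact_in K \<Omega> \<Longrightarrow>
      bdd_above ((\<lambda>(x, \<zeta>). japanese_bracket (Re_vec \<zeta>) powr (- d) * norm (P (x,
          \<zeta>))) ` (K \<times> W R \<epsilon>))"
  shows "holo_symbol P \<Omega> R \<epsilon> N"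
proof
  show "hol_pair P (\<Omega> \<times> W R \<epsilon>)" using h2 by (simp add: holo2_def)
  show "hol_vec (\<lambda>z. P (z, cvec \<xi> 0)) \<Omega>" for \<xi> using h1 by (simp add: holo_def)
  fix z0 assume "z0 \<in> \<Omega>"
  with \<Omega> obtain e where e: "e > 0" "cball z0 e \<subseteq> \<Omega>" using open_contains_cball by
      blast
  define K where "K = cball z0 e"
  have "relatively_compact_in K \<Omega>" using e by (simp add: relatively_compact_in_def K_def)
  from bd[OF this] obtain B where B: "\<forall>t\<in>(\<lambda>(x, \<zeta>). japanese_bracket (Re_vec
      \<zeta>) powr (- d) * norm (P (x, \<zeta>))) ` (K \<times> W R \<epsilon>). t \<le> B"
    unfolding bdd_above_def by (elim exE)
  have BW: "norm (P (z, \<zeta>)) \<le> max B 0 * (1 + norm (Re_vec \<zeta>)) ^ N" if "z \<in> K"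
      "\<zeta> \<in> W R \<epsilon>" for z \<zeta>
  proof (rule le_of_bracket_bound[OF _ norm_ge_zero N])
    have "(z, \<zeta>) \<in> K \<times> W R \<epsilon>" using that by simp
    from bspec[OF B imageI[OF this]]
    show "japanese_bracket (Re_vec \<zeta>) powr (- d) * norm (P (z, \<zeta>)) \<le> B" by simp
  qed
  define L where "L = K \<times> (\<lambda>\<xi>. cvec \<xi> 0) ` cball (0 :: real ^ 'n) R"
  have "compact L" unfolding L_def K_def
    by (intro compact_Times compact_cball compact_continuous_image continuous_intros)
  moreover have "continuous_on L P"
    by (rule continuous_on_subset[OF ct]) (use e in \<open>auto simp: L_def K_def\<close>)
  ultimately have "bounded (P ` L)" by (intro compact_imp_bounded compact_continuous_image)
  then obtain B' where B': "\<forall>t\<in>P ` L. norm t \<le> B'" unfolding bounded_iff by (elim exE)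
  define C where "C = max B 0 + max B' 0"
  have "norm (P (z, \<zeta>)) \<le> C * (1 + norm (Re_vec \<zeta>)) ^ N" if z: "z \<in> K" and m:
      "\<zeta> \<in> W R \<epsilon> \<union> range (\<lambda>\<xi>. cvec \<xi> 0)" for z \<zeta>
  proof -
    have pw: "1 \<le> (1 + norm (Re_vec \<zeta>)) ^ N" by (rule one_le_power) simp
    show ?thesis
    proof (cases "\<zeta> \<in> W R \<epsilon>")
      case True
      have "max B 0 * (1 + norm (Re_vec \<zeta>)) ^ N \<le> C * (1 + norm (Re_vec \<zeta>)) ^ N"
        by (intro mult_right_mono) (auto simp: C_def)
      then show ?thesis using BW[OF z True] by linarith
    next
      case False
      then obtain \<xi> where \<xi>: "\<zeta> = cvec \<xi> 0" using m by auto
      have "norm \<xi> \<le> R"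
      proof (rule ccontr)
        assume "\<not> norm \<xi> \<le> R"
        then have "0 < norm \<xi>" using \<open>R > 0\<close> by linarith
        then have "cvec \<xi> 0 \<in> W R \<epsilon>" using \<open>\<not> norm \<xi> \<le> R\<close>
            \<open>\<epsilon> > 0\<close> by (simp add: W_def)
        then show False using False \<xi> by simp
      qed
      then have "(z, \<zeta>) \<in> L" using z \<xi> by (auto simp: L_def)
      then have "norm (P (z, \<zeta>)) \<le> B'" using B' by blast
      also have "\<dots> \<le> C * 1" by (simp add: C_def)
      also have "\<dots> \<le> C * (1 + norm (Re_vec \<zeta>)) ^ N" using pw by (intro mult_left_mono) (auto
          simp: C_def)
      finally show ?thesis .
    qed
  qed
  moreover have "ball z0 e \<subseteq> K" "ball z0 e \<subseteq> \<Omega>" using e by (auto simp: K_def)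
  moreover have "C \<ge> 0" by (simp add: C_def)
  ultimately show "\<exists>e>0. \<exists>C\<ge>0. ball z0 e \<subseteq> \<Omega> \<and>
      (\<forall>z\<in>ball z0 e. \<forall>\<zeta>\<in>W R \<epsilon> \<union> range (\<lambda>\<xi>. cvec
          \<xi> 0). norm (P (z, \<zeta>)) \<le> C * (1 + norm (Re_vec \<zeta>)) ^ N)"
    using e(1) by blast
qed (use assms in auto)

theorem theorem3p1:
  fixes p :: "(real ^ 'n::finite) \<times> (real ^ 'n) \<Rightarrow> complex"
    and P :: "(complex ^ 'n) \<times> (complex ^ 'n) \<Rightarrow> complex"
    and u :: "real ^ 'n \<Rightarrow> complex"
    and d R \<epsilon> r0 \<delta>0 r \<delta> r' \<delta>' :: real
  assumes "R > 0" and "\<epsilon> > 0" and "r0 > 0" and "\<delta>0 > 0" and "r > 0" and "\<delta> > 0"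
    and "p \<in> symbol_class d"
    and "extends_symbol_holomorphically P p (ball 0 r0) (tube (ball 0 r0) (ball 0 \<delta>0)) (W R \<epsilon>)"
    and "\<And>K. relatively_compact_in K (tube (ball 0 r0) (ball 0 \<delta>0)) \<Longrightarrow>
           bdd_above ((\<lambda>(x, \<zeta>). japanese_bracket (Re_vec \<zeta>) powr (- d) * norm (P (x, \<zeta>)))
                        ` (K \<times> W R \<epsilon>))"
    and "smooth_compact_support u"
    and "extends_holomorphically u (ball 0 r) (tube (ball 0 r) (ball 0 \<delta>))"
    and "r > r'" and "r' > 0" and "\<delta> \<ge> \<delta>'" and "\<delta>' > 0"
    and "\<delta>' / (r - r') < \<epsilon>"
  shows "extends_holomorphically (Op p u) (ball 0 (min r' r0))
           (tube (ball 0 (min r' r0)) (ball 0 (min \<delta>' \<delta>0)))"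
proof -
  define \<Omega> where "\<Omega> = tube (ball 0 r0) (ball (0 :: real ^ 'n) \<delta>0)"
  define T where "T = tube (ball 0 r) (ball (0 :: real ^ 'n) \<delta>)"
  define Z where "Z = tube (ball 0 (min r' r0)) (ball (0 :: real ^ 'n) (min \<delta>' \<delta>0))"
  have open_\<Omega>: "open \<Omega>" and open_T: "open T" and open_Z: "open Z"
    unfolding \<Omega>_def T_def Z_def by (intro open_tube open_ball)+
  note ext = assms(8)[unfolded extends_symbol_holomorphically_def, folded \<Omega>_def]
  obtain N where N: "\<bar>d\<bar> \<le> real N" using real_arch_simple by blast
  interpret holo_symbol P \<Omega> R \<epsilon> N
    by (rule holo_symbol_intro[OF assms(1,2) open_\<Omega> N]) (use ext assms(9)[folded \<Omega>_def] in auto)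
  obtain U where U: "holo U T" and Uu: "\<And>y. y \<in> ball 0 r \<Longrightarrow> U (cvec y 0) = u y"
    using assms(11) unfolding extends_holomorphically_def T_def by blast
  have hol_U: "hol_vec U T" using U by (simp add: holo_def)
  have su: "smooth u" and cu: "compact (closure {x. u x \<noteq> 0})"
    using assms(10) by (auto simp: smooth_compact_support_def)
  have "bounded {x. u x \<noteq> 0}" using compact_imp_bounded[OF cu] bounded_subset closure_subset by blast
  then obtain Rad0 where Rad0: "\<forall>x\<in>{x. u x \<noteq> 0}. norm x \<le> Rad0" unfolding bounded_iff by (elim exE)
  \<comment> \<open>The added 1 makes \<open>u\<close> vanish on the sphere of radius
    \<open>Rad\<close> as well; the maximum with \<open>r\<close> places the complex part of the
    contour inside this ball.\<close>
  define Rad where "Rad = max r (Rad0 + 1)"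
  have Rad: "r \<le> Rad" "Rad > 0" using assms(5) by (auto simp: Rad_def)
  have u_zero: "u y = 0" if "norm y \<ge> Rad" for y
  proof (rule ccontr)
    assume "u y \<noteq> 0"
    then have "norm y \<le> Rad0" using Rad0 by blast
    then show False using that by (simp add: Rad_def)
  qed
  have cont_u: "continuous_on UNIV u" using su C_k_continuous[of 0 u] by (simp add: smooth_def)

  define s where "s = \<delta>' / (r - r')"
  have s: "0 < s" "s < \<epsilon>" using assms by (auto simp: s_def)
  \<comment> \<open>The midpoint: above the slope \<open>s\<close>, so that the space contour can
    come down in time, and below \<open>\<epsilon>\<close>, so that the frequency contour stays in
    the domain of the symbol.\<close>
  define \<kappa> where "\<kappa> = (s + \<epsilon>) / 2"
  have \<kappa>: "s < \<kappa>" "\<kappa> < \<epsilon>" "0 < \<kappa>" using s by (auto simp: \<kappa>_def)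
  have "\<delta>' < \<kappa> * (r - r')" using \<kappa>(1) assms(12) by (simp add: s_def pos_divide_less_eq)
  then have gp: "\<delta>' / \<kappa> < r - r'" using \<kappa>(3) by (simp add: pos_divide_less_eq mult.commute)
  \<comment> \<open>A quarter of the slack in r - r' > \<delta>' / \<kappa>. One \<open>h\<close> is
    left between r' and the start of the descent, one between its end and \<open>r\<close>; the
    descent still has length \<delta>' / \<kappa> + 2 h.\<close>
  define h where "h = (r - r' - \<delta>' / \<kappa>) / 4"
  have h: "h > 0" using gp by (simp add: h_def)
  define \<alpha> where "\<alpha> = r' + h"
  define \<rho>1 where "\<rho>1 = r - h"
  have dk: "0 < \<delta>' / \<kappa>" using assms(15) \<kappa>(3) by simp
  have eq4: "4 * h = r - r' - \<delta>' / \<kappa>" by (simp add: h_def)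
  have \<alpha>: "0 < \<alpha>" using h assms(13) by (simp add: \<alpha>_def)
  have len: "\<rho>1 - \<alpha> > \<delta>' / \<kappa>" using h eq4 by (simp add: \<rho>1_def \<alpha>_def)
  have \<alpha>\<rho>: "\<alpha> < \<rho>1" using len dk by linarith
  \<comment> \<open>The steepness that turns the chord slope of the cut-off into exactly \<kappa> /
    \<delta>'. It exceeds 1 because the descent is longer than \<delta>' / \<kappa>, so a spline of
    this steepness exists.\<close>
  define L where "L = (\<rho>1 - \<alpha>) * \<kappa> / \<delta>'"
  have L: "L > 1"
    using len \<kappa>(3) assms(15) by (simp add: L_def pos_divide_less_eq pos_less_divide_eq mult.commute)
  have Ld: "L * ((t - \<alpha>) / (\<rho>1 - \<alpha>)) = \<kappa> / \<delta>' * (t - \<alpha>)" for t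
    using \<alpha>\<rho> by (simp add: L_def)
  have hr: "r' + h < r" using h eq4 dk by linarith
  have \<rho>1r: "\<rho>1 < r" using h by (simp add: \<rho>1_def)
  have R1: "R + 1 > 0" using assms(1) by simp
  have h2: "0 < h / 2" "h / 2 < h" using h by auto
  show ?thesis
  \<comment> \<open>Three profiles: the height in frequency, the space contour with the critical
    steepness \<open>L\<close>, and the outer cut-off \<open>a\<close> between h / 2 and h, where
    the factor 2 is an arbitrary number above 1.\<close>
  proof (rule C2_linear_growth[OF R1 \<kappa>(3)], rule C2_cutoff[OF \<alpha> \<alpha>\<rho> L], rule C2_cutoff[OF h2, of 2])
    show "(1::real) < 2" by simp
    fix g :: "real ^ 'n \<Rightarrow> real" and g1 g2 G K
    fix c :: "real ^ 'n \<Rightarrow> real" and c1 c2 Gc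
    fix a :: "real ^ 'n \<Rightarrow> real" and a1 a2 Ga
    assume g: "C2_fun g g1 g2 G" "K \<ge> 0"
      "\<And>y. norm y \<le> R + 1 \<Longrightarrow> g y = 0" "\<And>y v. norm y \<le> R + 1 \<Longrightarrow> g1 y v = 0"
      "\<And>y. 0 \<le> g y" "\<And>y. g y \<le> \<kappa> * norm y" "\<And>y. g y \<ge> \<kappa> * norm y - K"
    assume c: "C2_fun c c1 c2 Gc"
      "\<And>y. norm y \<le> \<alpha> \<Longrightarrow> c y = 1" "\<And>y v. norm y \<le> \<alpha> \<Longrightarrow> c1 y v = 0"
      "\<And>y. norm y \<ge> \<rho>1 \<Longrightarrow> c y = 0" "\<And>y v. norm y \<ge> \<rho>1 \<Longrightarrow> c1 y v = 0"
      "\<And>y. 0 \<le> c y" "\<And>y. c y \<le> 1"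
      "\<And>y. norm y \<ge> \<alpha> \<Longrightarrow> 1 - c y \<le> L * ((norm y - \<alpha>) / (\<rho>1 - \<alpha>))"
    assume a: "C2_fun a a1 a2 Ga"
      "\<And>y. norm y \<le> h / 2 \<Longrightarrow> a y = 1" "\<And>y v. norm y \<le> h / 2 \<Longrightarrow> a1 y v = 0"
      "\<And>y. norm y \<ge> h \<Longrightarrow> a y = 0" "\<And>y v. norm y \<ge> h \<Longrightarrow> a1 y v = 0"
      "\<And>y. 0 \<le> a y" "\<And>y. a y \<le> 1"
    interpret symbol_contour P \<Omega> R \<epsilon> N \<kappa> "R + 1" G K g g1 g2
      by unfold_locales (use \<kappa> g in auto)
    have Zx: "norm (Re_vec z) < r'" "norm (Re_vec z) < r0" "norm (Im_vec z) < \<delta>'" "norm (Im_vec z) < \<delta>0" if "z \<in> Z" for z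
      using that by (auto simp: Z_def mem_tube)
    interpret deformation P \<Omega> R \<epsilon> N \<kappa> "R + 1" G K g g1 g2 U T u c c1 c2 Gc a a1 a2 Ga "h / 2" h \<rho>1 Rad Z
    proof
      show "\<rho>1 \<le> Rad" using \<rho>1r Rad by linarith
      show "Z \<subseteq> \<Omega>" by (auto simp: Z_def \<Omega>_def mem_tube)
      show "c y = 1 \<and> c1 y v = 0" if "z \<in> Z" "norm (Re_vec z - y) < h" for z y v
      proof -
        have "norm y \<le> norm (Re_vec z) + norm (Re_vec z - y)"
          using norm_triangle_ineq2[of y "Re_vec z"] by (simp add: norm_minus_commute)
        then have "norm y \<le> \<alpha>" using Zx(1)[OF that(1)] that(2) by (simp add: \<alpha>_def)
        then show ?thesis using c(2,3) by blast
      qed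
      show "z - cvec v 0 \<in> T" if "z \<in> Z" "norm v \<le> h" for z v
      proof -
        have "norm (Re_vec z - v) \<le> norm (Re_vec z) + norm v" by (rule norm_triangle_ineq4)
        then have "norm (Re_vec z - v) < r" using Zx(1)[OF that(1)] that(2) hr by linarith
        then show ?thesis using Zx(3)[OF that(1)] assms(14) by (simp add: T_def mem_tube)
      qed
      have gap_ge: "gap (z - cvec y (c y *\<^sub>R Im_vec z)) \<ge> \<kappa> * (h / 2)"
        if z: "z \<in> Z" and y: "norm (Re_vec z - y) \<ge> h / 2" for z y
      proof -
        have "norm (Im_vec z - c y *\<^sub>R Im_vec z) = (1 - c y) * norm (Im_vec z)"
        proof -
          have "Im_vec z - c y *\<^sub>R Im_vec z = (1 - c y) *\<^sub>R Im_vec z" by (simp add: scaleR_diff_left)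
          then show ?thesis using c(7)[of y] by simp
        qed
        then have gz: "gap (z - cvec y (c y *\<^sub>R Im_vec z)) = \<kappa> * norm (Re_vec z - y) - (1 - c y) * norm (Im_vec z)"
          by (simp add: gap_def)
        show ?thesis
        proof (cases "norm y \<le> \<alpha>")
          case True
          then show ?thesis using gz c(2)[OF True] y \<kappa>(3) by (simp add: mult_left_mono)
        next
          case False
          \<comment> \<open>The slope \<kappa> / \<delta>' times |Im z| < \<delta>' gives the slope
            \<kappa>: the imaginary part of z - Y grows no faster than the cone opens.\<close>
          have "(1 - c y) * norm (Im_vec z) \<le> \<kappa> / \<delta>' * (norm y - \<alpha>) * \<delta>'"
            using c(8)[of y] c(7)[of y] False Zx(3)[OF z] \<kappa>(3) assms(15) unfolding Ld by (intro mult_mono) auto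
          also have "\<dots> = \<kappa> * (norm y - \<alpha>)" using assms(15) by simp
          finally have 1: "(1 - c y) * norm (Im_vec z) \<le> \<kappa> * (norm y - \<alpha>)" .
          have "norm y \<le> norm (Re_vec z) + norm (Re_vec z - y)"
            using norm_triangle_ineq2[of y "Re_vec z"] by (simp add: norm_minus_commute)
          \<comment> \<open>As |Re z| < r' = \<alpha> - h, the distance from Re z to y exceeds |y| -
            \<alpha> by at least \<open>h\<close>; half of it is kept as the uniform gap.\<close>
          then have "norm y - \<alpha> + h / 2 \<le> norm (Re_vec z - y)" using Zx(1)[OF z] h by (simp add: \<alpha>_def)
          then have "\<kappa> * (norm y - \<alpha> + h / 2) \<le> \<kappa> * norm (Re_vec z - y)" using \<kappa>(3) by (intro mult_left_mono) auto
          then show ?thesis using 1 gz by (simp add: distrib_left)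
        qed
      qed
      show "\<exists>e>0. \<exists>m>0. \<forall>z\<in>ball z0 e. \<forall>y. h / 2 \<le> norm (Re_vec z - y) \<longrightarrow> m \<le> gap (z - cvec y (c y *\<^sub>R Im_vec z))"
        if z0: "z0 \<in> Z" for z0
      proof -
        obtain e where e: "e > 0" "ball z0 e \<subseteq> Z" using open_Z z0 openE by blast
        have "\<kappa> * (h / 2) > 0" using \<kappa>(3) h by simp
        then show ?thesis using e gap_ge by blast
      qed
      show "\<exists>e>0. \<exists>Q. compact Q \<and> Q \<subseteq> T \<and> (\<forall>z\<in>ball z0 e. \<forall>y. norm y < \<rho>1 \<longrightarrow> cvec y (c y *\<^sub>R Im_vec z) \<in> Q)"
        if z0: "z0 \<in> Z" for z0
      proof -
        \<comment> \<open>Strictly between |Im z0| and \<delta>': points near \<open>z0\<close> keep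
          their imaginary parts below it, and the closed ball of this radius fits into the open
          domain of \<open>U\<close>.\<close>
        define \<delta>1 where "\<delta>1 = (norm (Im_vec z0) + \<delta>') / 2"
        have \<delta>1: "norm (Im_vec z0) < \<delta>1" "\<delta>1 < \<delta>'" using Zx(3)[OF z0] by (auto simp: \<delta>1_def)
        define Q where "Q = (\<lambda>(y, w). cvec y w) ` (cball 0 \<rho>1 \<times> cball (0 :: real ^ 'n) \<delta>1)"
        have "compact Q" unfolding Q_def
          by (intro compact_continuous_image compact_Times compact_cball bounded_linear.continuous_on[OF bounded_linear_cvec] continuous_on_id)
        moreover have "Q \<subseteq> T" using \<rho>1r \<delta>1 assms(14) by (auto simp: Q_def T_def mem_tube)
        moreover have "cvec y (c y *\<^sub>R Im_vec z) \<in> Q"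
          if "z \<in> ball z0 (\<delta>1 - norm (Im_vec z0))" "norm y < \<rho>1" for z y
        proof -
          have "norm (Im_vec z) - norm (Im_vec z0) \<le> norm (z - z0)"
            using norm_triangle_ineq2[of "Im_vec z" "Im_vec z0"] norm_Im_vec_le[of "z - z0"] by simp
          then have "norm (Im_vec z) \<le> \<delta>1" using that(1) by (simp add: dist_norm norm_minus_commute)
          moreover have "c y * norm (Im_vec z) \<le> 1 * norm (Im_vec z)" using c(7) by (intro mult_right_mono) auto
          ultimately have "norm (c y *\<^sub>R Im_vec z) \<le> \<delta>1" using c(6)[of y] by simp
          then show ?thesis using that(2) by (auto simp: Q_def intro!: image_eqI[of _ _ "(y, c y *\<^sub>R Im_vec z)"])
        qed
        ultimately show ?thesis using \<delta>1 by (intro exI[of _ "\<delta>1 - norm (Im_vec z0)"]) auto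
      qed
    qed (use open_T hol_U cont_u u_zero c a h2 h open_Z in auto)
    let ?m = "3 * (N + CARD('n) + 2)" and ?J = "N + CARD('n) + 3"
    define near where "near z = (\<integral>\<xi>. P (z, cvec \<xi> 0) * near_ft U (h / 2) ?m ?J z \<xi> \<partial>lborel)" for z
    define F where "F z = complex_of_real (1 / (2 * pi) ^ CARD('n)) * (near z + middle ?m z + far z)" for z
    have "hol_vec near Z"
      unfolding near_def
      by (rule hol_near[OF open_T hol_U h2(1) open_Z Z_\<Omega>]) (use Z_T' h2 in auto)
    then have "hol_vec F Z"
      unfolding F_def by (intro holomorphic_wrt_cmult holomorphic_wrt_add hol_middle hol_far)
    moreover have "F (cvec x 0) = Op p u x" if x: "x \<in> ball 0 (min r' r0)" for x
    proof -
      have xZ: "cvec x 0 \<in> Z" using x assms by (simp add: Z_def mem_tube)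
      have uz: "u y = 0" if "norm y > Rad" for y using u_zero that by simp
      obtain Cu where Cu: "\<forall>\<xi>. norm (fourier u \<xi>) \<le> Cu / (1 + norm \<xi>) ^ (N + CARD('n) + 2)"
        using fourier_decay[OF su uz Rad(2)] by blast
      have "(\<integral>\<xi>. exp (\<i> * of_real (x \<bullet> \<xi>)) * P (cvec x 0, cvec \<xi> 0) * fourier u \<xi> \<partial>lborel) =
          near (cvec x 0) + middle ?m (cvec x 0) + far (cvec x 0)"
        unfolding near_def
      proof (rule real_identity[OF xZ, where r=r and Cu=Cu])
        show "norm (x - v) < r" if "norm v \<le> h" for v
          using norm_triangle_ineq4[of x v] that x hr by simp
      qed (use Uu Cu \<rho>1r in auto)
      moreover have "P (cvec x 0, cvec \<xi> 0) = p (x, \<xi>)" for \<xi> using ext x by simp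
      ultimately show ?thesis by (simp add: F_def Op_def)
    qed
    ultimately show ?thesis
      unfolding extends_holomorphically_def Z_def[symmetric] holo_def by blast
  qed
qed

end
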